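(* Let $G$ be any infinite rooted tree of uniformly bounded degree each of whose vertices has at least two offspring. Then there exists $T_0 \in (0,\infty)$ such that if $T \geq T_0$ then the random stirring model with parameter $T$ on $G$ contains infinite cycles almost surely.
   Context: The random stirring model on a graph $G$ is the process $(\sigma_t)_{t\ge 0}$ of permutations of $V(G)$ which starts at the identity at time $0$ and in which, independently for each edge $e\in E(G)$, the transposition of the two endpoints of $e$ is performed (composed) at each point of a rate-one Poisson process on $[0,\infty)$. The random stirring model with parameter $T$ is the random permutation $\sigma_T$. An infinite cycle is a cycle of the permutation containing infinitely many vertices. In a rooted tree, the offspring of a vertex $v$ are its neighbours that are farther from the root than $v$. *)

theory Defs
  imports "HOL-Probability.Probability"
begin

section \<open>Graphs and rooted trees\<close>

text \<open>A simple graph is given by a vertex set V and an adjacency predicate E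
(only its restriction to V matters).\<close>

definition adj :: "'a set \<Rightarrow> ('a \<Rightarrow> 'a \<Rightarrow> bool) \<Rightarrow> ('a \<times> 'a) set" where
  "adj V E = {(u, w). u \<in> V \<and> w \<in> V \<and> E u w}"

definition simple_graph :: "'a set \<Rightarrow> ('a \<Rightarrow> 'a \<Rightarrow> bool) \<Rightarrow> bool" where
  "simple_graph V E \<longleftrightarrow> (\<forall>u\<in>V. \<forall>w\<in>V. E u w \<longrightarrow> E w u) \<and> (\<forall>u\<in>V. \<not> E u u)"

definition connected_graph :: "'a set \<Rightarrow> ('a \<Rightarrow> 'a \<Rightarrow> bool) \<Rightarrow> bool" where
  "connected_graph V E \<longleftrightarrow> (\<forall>u\<in>V. \<forall>w\<in>V. (u, w) \<in> (adj V E)\<^sup>*)"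

text \<open>A cycle: at least three distinct vertices, consecutive ones adjacent,
and the last adjacent to the first.\<close>
definition has_cycle :: "'a set \<Rightarrow> ('a \<Rightarrow> 'a \<Rightarrow> bool) \<Rightarrow> bool" where
  "has_cycle V E \<longleftrightarrow> (\<exists>xs. length xs \<ge> 3 \<and> distinct xs \<and> set xs \<subseteq> V \<and>
      (\<forall>i. Suc i < length xs \<longrightarrow> E (xs ! i) (xs ! Suc i)) \<and> E (last xs) (hd xs))"

definition rooted_tree :: "'a set \<Rightarrow> ('a \<Rightarrow> 'a \<Rightarrow> bool) \<Rightarrow> 'a \<Rightarrow> bool" where
  "rooted_tree V E r \<longleftrightarrow> simple_graph V E \<and> connected_graph V E \<and> \<not> has_cycle V E \<and> r \<in> V"

definition neighbours :: "'a set \<Rightarrow> ('a \<Rightarrow> 'a \<Rightarrow> bool) \<Rightarrow> 'a \<Rightarrow> 'a set" where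
  "neighbours V E v = {w \<in> V. E v w}"

definition uniformly_bounded_degree :: "'a set \<Rightarrow> ('a \<Rightarrow> 'a \<Rightarrow> bool) \<Rightarrow> bool" where
  "uniformly_bounded_degree V E \<longleftrightarrow>
     (\<exists>D::nat. \<forall>v\<in>V. finite (neighbours V E v) \<and> card (neighbours V E v) \<le> D)"

text \<open>Graph distance (length of a shortest walk).\<close>
definition gdist :: "'a set \<Rightarrow> ('a \<Rightarrow> 'a \<Rightarrow> bool) \<Rightarrow> 'a \<Rightarrow> 'a \<Rightarrow> nat" where
  "gdist V E u w = (LEAST n. (u, w) \<in> (adj V E) ^^ n)"

text \<open>Offspring of v: neighbours farther from the root than v.\<close>
definition offspring :: "'a set \<Rightarrow> ('a \<Rightarrow> 'a \<Rightarrow> bool) \<Rightarrow> 'a \<Rightarrow> 'a \<Rightarrow> 'a set" where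
  "offspring V E r v = {w \<in> neighbours V E v. gdist V E r v < gdist V E r w}"

definition graph_edges :: "'a set \<Rightarrow> ('a \<Rightarrow> 'a \<Rightarrow> bool) \<Rightarrow> 'a set set" where
  "graph_edges V E = {{u, w} | u w. u \<in> V \<and> w \<in> V \<and> E u w}"

section \<open>Random stirring model\<close>

text \<open>Sample space: for every edge e and every k, an independent Exp(1) variable
\<open>\<omega> (e, k)\<close>; the points of the rate-one Poisson process on edge e are the
partial sums \<open>\<omega>(e,0) + ... + \<omega>(e,k)\<close>.\<close>
definition stirring_space :: "'a set \<Rightarrow> ('a \<Rightarrow> 'a \<Rightarrow> bool) \<Rightarrow> ('a set \<times> nat \<Rightarrow> real) measure" where
  "stirring_space V E =
     (\<Pi>\<^sub>M i \<in> graph_edges V E \<times> (UNIV :: nat set). density lborel (exponential_density 1))"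

definition ring_time :: "('a set \<times> nat \<Rightarrow> real) \<Rightarrow> 'a set \<Rightarrow> nat \<Rightarrow> real" where
  "ring_time \<omega> e k = (\<Sum>j\<le>k. \<omega> (e, j))"

text \<open>Possible next jumps of a particle at u at time t: rings in (t, T] of edges at u.\<close>
definition next_jumps ::
  "'a set \<Rightarrow> ('a \<Rightarrow> 'a \<Rightarrow> bool) \<Rightarrow> ('a set \<times> nat \<Rightarrow> real) \<Rightarrow> real \<Rightarrow> 'a \<times> real \<Rightarrow> (real \<times> 'a) set" where
  "next_jumps V E \<omega> T p = (case p of (u, t) \<Rightarrow>
     {(s, w). u \<in> V \<and> w \<in> V \<and> E u w \<and> (\<exists>k. s = ring_time \<omega> {u, w} k) \<and> t < s \<and> s \<le> T})"

text \<open>One step: jump across the edge with the earliest ring in (t, T] (if any).\<close>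
definition stir_step ::
  "'a set \<Rightarrow> ('a \<Rightarrow> 'a \<Rightarrow> bool) \<Rightarrow> ('a set \<times> nat \<Rightarrow> real) \<Rightarrow> real \<Rightarrow> 'a \<times> real \<Rightarrow> 'a \<times> real" where
  "stir_step V E \<omega> T p =
     (let J = next_jumps V E \<omega> T p in
      if J = {} then p
      else (let q = (SOME q. q \<in> J \<and> (\<forall>q'\<in>J. fst q \<le> fst q')) in (snd q, fst q)))"

definition stir_traj ::
  "'a set \<Rightarrow> ('a \<Rightarrow> 'a \<Rightarrow> bool) \<Rightarrow> ('a set \<times> nat \<Rightarrow> real) \<Rightarrow> real \<Rightarrow> 'a \<Rightarrow> nat \<Rightarrow> 'a \<times> real" where
  "stir_traj V E \<omega> T v n = (stir_step V E \<omega> T ^^ n) (v, 0)"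

text \<open>\<open>\<sigma>_T(v)\<close>: the position at time T of the particle started at v; i.e. the
composition, in time order, of the transpositions of the Poisson points in [0,T].
(On the null event where the trajectory is not eventually constant, v is fixed.)\<close>
definition stirring_perm ::
  "'a set \<Rightarrow> ('a \<Rightarrow> 'a \<Rightarrow> bool) \<Rightarrow> ('a set \<times> nat \<Rightarrow> real) \<Rightarrow> real \<Rightarrow> 'a \<Rightarrow> 'a" where
  "stirring_perm V E \<omega> T v =
     (if \<exists>N. \<forall>n\<ge>N. stir_traj V E \<omega> T v n = stir_traj V E \<omega> T v N
      then fst (stir_traj V E \<omega> T v (LEAST N. \<forall>n\<ge>N. stir_traj V E \<omega> T v n = stir_traj V E \<omega> T v N))
      else v)"

text \<open>An infinite cycle: the cycle (orbit) of some vertex contains infinitely many vertices.\<close>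
definition has_infinite_cycle :: "'a set \<Rightarrow> ('a \<Rightarrow> 'a) \<Rightarrow> bool" where
  "has_infinite_cycle V \<sigma> \<longleftrightarrow> (\<exists>v\<in>V. infinite {(\<sigma> ^^ n) v | n. True})"

end

(*
Split [0,T] into M slots. The events "edge e rings in slot i" are independent with probability
p = 1 - exp(-T/M), and for M large the particle, as long as it stays above a fixed depth n, follows a
deterministic walk through these bits: slot i is refined into D+1 steps, one for each colour of a
proper edge colouring, and at each step the walk may cross the one edge of the current colour.
Letting the walk run periodically in time iterates the permutation, so a finite cycle is a periodic
walk whose depth stays bounded.

The heart is a lower bound, uniform in n, for the probability that the periodic walk from v reaches
depth n inside the subtree of v. Into unexplored environment the walk is a transient random walk (each
vertex has two children, so it drifts down): a supermartingale shows that from any x it reaches the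
next K levels with probability at least 1/20, even while avoiding the subtree of the first child z of x.
Let x be the first vertex visited on some level, and continue the walk from x with the edge above x
and the edge to z closed (the "virtual walk"). Either it goes to depth n having asked only a few times for the edge to z,
in which case it coincides with the real walk at a cost bounded below; or it asks for this edge about 1/p times
(this includes the case where it would close up into a cycle, since it must then spend the last 1/p slots
before its hitting time at x), and each of these requests lets it enter the fresh subtree of z, with
probability p, and escape there by induction. The latter events are disjoint for different levels of x, because
the first paths to depth dep v + K and to depth n then separate exactly at x; summing over K levels makes the
recursion self-improving.

Infinitely many disjoint subtrees along a ray, each cut off from the rest by a silent edge with probability
exp(-T), give independent attempts, so almost surely one of them succeeds. Independence of the bits is
derived from the exponential increments by a renewal identity for the void probabilities.
*)

theory Submission
  imports Defs
begin

section \<open>Conditioning and independence for product Bernoulli weights on a finite cube\<close>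

section \<open>Finite families of independent bits\<close>

text \<open>The obstacle is memory. The environment has period \<open>L\<close>, so a walk that
  outlives one period reads bits it has read before, and one-step independence is lost. Long runs
  are therefore handled by comparing weights of cylinders: all bits away from the edge above
  \<open>x\<close> and from the subtree of its first child \<open>z\<close> are frozen, and only
  those bits of the edges above \<open>x\<close> and \<open>z\<close> that are read have to be paid
  for. The edge above \<open>z\<close> comes one colour after the edge above \<open>x\<close>, so
  every request for the latter is followed by one for the former, and the requests for
  \<open>z\<close> control both costs. The subtree of \<open>z\<close> stays unread until it is
  entered, which lets the induction hypothesis apply there.

  The natural unit of time is \<open>1/p\<close> rounds: over it, keeping an edge closed costs a
  bounded factor, while an opening has probability of order one. A period must have room for two
  downward runs of \<open>N\<close> steps and one quiet window; this fixes \<open>esc_time\<close>.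
  The bounds are uniform in the number \<open>M\<close> of slots and in the depth \<open>n\<close>.
  The limit in \<open>M\<close> is taken first, with \<open>n\<close> fixed, since slots separate
  the rings of finitely many edges only.\<close>

definition wt :: "'i set \<Rightarrow> ('i \<Rightarrow> real) \<Rightarrow> 'i set \<Rightarrow> real" where
  "wt I \<pi> S = (\<Prod>i\<in>I. if i \<in> S then \<pi> i else 1 - \<pi> i)"

text \<open>A plain sum over a finite cube, so events need no measurability. Conditioning on a bit
  means replacing its parameter by 0 or 1, hence a conditional probability is again
  \<open>Pr\<close> with other parameters.\<close>

definition Pr :: "'i set \<Rightarrow> ('i \<Rightarrow> real) \<Rightarrow> ('i set \<Rightarrow> bool) \<Rightarrow> real" where
  "Pr I \<pi> A = (\<Sum>S\<in>Pow I. if A S then wt I \<pi> S else 0)"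

definition prob_on :: "'i set \<Rightarrow> ('i \<Rightarrow> real) \<Rightarrow> bool" where
  "prob_on I \<pi> \<longleftrightarrow> (\<forall>i\<in>I. 0 \<le> \<pi> i \<and> \<pi> i \<le> 1)"

definition depends :: "('i set \<Rightarrow> bool) \<Rightarrow> 'i set \<Rightarrow> bool" where
  "depends A J \<longleftrightarrow> (\<forall>S S'. S \<inter> J = S' \<inter> J \<longrightarrow> A S = A S')"

lemma dependsD: "depends A J \<Longrightarrow> S \<inter> J = S' \<inter> J \<Longrightarrow> A S = A S'"
  unfolding depends_def by blast

lemma depends_mono: "depends A J \<Longrightarrow> J \<subseteq> J' \<Longrightarrow> depends A J'"
  unfolding depends_def by (metis inf.absorb_iff2 inf_assoc)

lemma depends_conj: "depends A J \<Longrightarrow> depends B J \<Longrightarrow> depends (\<lambda>S. A S \<and> B S) J"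
  unfolding depends_def by blast

lemma wt_nonneg: "prob_on I \<pi> \<Longrightarrow> 0 \<le> wt I \<pi> S"
  unfolding wt_def prob_on_def by (intro prod_nonneg) auto

lemma Pr_nonneg: "prob_on I \<pi> \<Longrightarrow> 0 \<le> Pr I \<pi> A"
  unfolding Pr_def by (intro sum_nonneg) (auto intro: wt_nonneg)

lemma Pr_mono:
  assumes "prob_on I \<pi>" "\<And>S. S \<subseteq> I \<Longrightarrow> A S \<Longrightarrow> B S"
  shows "Pr I \<pi> A \<le> Pr I \<pi> B"
  unfolding Pr_def using assms by (intro sum_mono) (auto intro: wt_nonneg)

lemma Pr_cong: "(\<And>S. S \<subseteq> I \<Longrightarrow> A S = B S) \<Longrightarrow> Pr I \<pi> A = Pr I \<pi> B"
  unfolding Pr_def by (intro sum.cong) auto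

lemma Pr_cong_prob: "(\<And>i. i \<in> I \<Longrightarrow> \<pi> i = \<pi>' i) \<Longrightarrow> Pr I \<pi> A = Pr I \<pi>' A"
  unfolding Pr_def wt_def by (intro sum.cong if_cong prod.cong) auto

lemma Pr_False [simp]: "Pr I \<pi> (\<lambda>_. False) = 0"
  unfolding Pr_def by simp

lemma Pr_True [simp]: "finite I \<Longrightarrow> Pr I \<pi> (\<lambda>_. True) = 1"
proof -
  assume fin: "finite I"
  have "(1::real) = (\<Prod>i\<in>I. \<pi> i + (1 - \<pi> i))" by simp
  also have "\<dots> = (\<Sum>S\<in>Pow I. (\<Prod>i\<in>S. \<pi> i) * (\<Prod>i\<in>I-S. 1 - \<pi> i))"
    using prod_add[OF fin, of \<pi> "\<lambda>i. 1 - \<pi> i"] .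
  also have "\<dots> = (\<Sum>S\<in>Pow I. wt I \<pi> S)"
  proof (rule sum.cong)
    fix S assume S: "S \<in> Pow I"
    have "wt I \<pi> S = (\<Prod>i\<in>I \<inter> {i. i \<in> S}. \<pi> i) * (\<Prod>i\<in>I \<inter> - {i. i \<in> S}. 1 - \<pi> i)"
      unfolding wt_def by (rule prod.If_cases[OF fin])
    moreover have "I \<inter> {i. i \<in> S} = S" "I \<inter> - {i. i \<in> S} = I - S" using S by auto
    ultimately show "(\<Prod>i\<in>S. \<pi> i) * (\<Prod>i\<in>I-S. 1 - \<pi> i) = wt I \<pi> S" by simp
  qed simp
  finally show "Pr I \<pi> (\<lambda>_. True) = 1" by (simp add: Pr_def)
qed

lemma Pr_le_1: "finite I \<Longrightarrow> prob_on I \<pi> \<Longrightarrow> Pr I \<pi> A \<le> 1"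
  using Pr_mono[of I \<pi> A "\<lambda>_. True"] by simp

lemma Pr_not: "finite I \<Longrightarrow> Pr I \<pi> (\<lambda>S. \<not> A S) = 1 - Pr I \<pi> A"
proof -
  assume fin: "finite I"
  have "Pr I \<pi> (\<lambda>S. \<not> A S) + Pr I \<pi> A = Pr I \<pi> (\<lambda>_. True)"
    unfolding Pr_def sum.distrib[symmetric] by (intro sum.cong) auto
  then show ?thesis using fin by simp
qed

lemma Pr_UN_disjoint:
  assumes "finite X" "\<And>S x y. x \<in> X \<Longrightarrow> y \<in> X \<Longrightarrow> A x S \<Longrightarrow> A y S \<Longrightarrow> x = y"
  shows "Pr I \<pi> (\<lambda>S. \<exists>x\<in>X. A x S) = (\<Sum>x\<in>X. Pr I \<pi> (A x))"
proof -
  have "(if \<exists>x\<in>X. A x S then wt I \<pi> S else 0) = (\<Sum>x\<in>X. if A x S then wt I \<pi> S else 0)" for S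
  proof (cases "\<exists>x\<in>X. A x S")
    case True
    then obtain x where x: "x \<in> X" "A x S" by blast
    have "(\<Sum>y\<in>X. if A y S then wt I \<pi> S else 0) = (\<Sum>y\<in>X. if y = x then wt I \<pi> S else 0)"
      using assms(2) x by (intro sum.cong) auto
    then show ?thesis using x assms(1) by auto
  next
    case False
    then show ?thesis by (auto intro: sum.neutral[symmetric])
  qed
  then show ?thesis
    unfolding Pr_def by (subst sum.swap) simp
qed

lemma Pr_sum_le:
  assumes "prob_on I \<pi>" "finite X"
    "\<And>S x y. x \<in> X \<Longrightarrow> y \<in> X \<Longrightarrow> A x S \<Longrightarrow> A y S \<Longrightarrow> x = y"
    "\<And>S x. S \<subseteq> I \<Longrightarrow> x \<in> X \<Longrightarrow> A x S \<Longrightarrow> B S"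
  shows "(\<Sum>x\<in>X. Pr I \<pi> (A x)) \<le> Pr I \<pi> B"
proof -
  have "Pr I \<pi> (\<lambda>S. \<exists>x\<in>X. A x S) \<le> Pr I \<pi> B"
    using assms by (intro Pr_mono) auto
  then show ?thesis using Pr_UN_disjoint[of X A I \<pi>] assms by simp
qed

lemma wt_pivot:
  assumes "finite I" "i \<in> I"
  shows "wt I \<pi> S = \<pi> i * wt I (\<pi>(i := 1)) S + (1 - \<pi> i) * wt I (\<pi>(i := 0)) S"
proof -
  have "wt I \<rho> S = (if i \<in> S then \<rho> i else 1 - \<rho> i) * wt (I - {i}) \<rho> S" for \<rho>
    unfolding wt_def by (rule prod.remove[OF assms])
  moreover have "wt (I - {i}) (\<pi>(i := x)) S = wt (I - {i}) \<pi> S" for x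
    unfolding wt_def by (intro prod.cong) auto
  ultimately show ?thesis by (simp add: algebra_simps)
qed

lemma Pr_pivot:
  assumes "finite I" "i \<in> I"
  shows "Pr I \<pi> A = \<pi> i * Pr I (\<pi>(i := 1)) A + (1 - \<pi> i) * Pr I (\<pi>(i := 0)) A"
  unfolding Pr_def sum_distrib_left sum.distrib[symmetric]
  by (intro sum.cong) (auto simp: wt_pivot[OF assms, of \<pi>])

lemma Pr_known:
  assumes "finite I" "i \<in> I" "\<pi> i = (if b then 1 else 0)"
  shows "Pr I \<pi> A = Pr I \<pi> (\<lambda>S. A S \<and> (i \<in> S \<longleftrightarrow> b))"
proof -
  have "wt I \<pi> S = 0" if "(i \<in> S) \<noteq> b" for S
    unfolding wt_def using assms that by (intro prod_zero) (auto split: if_splits)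
  then show ?thesis unfolding Pr_def by (intro sum.cong) auto
qed

lemma Pr_known_set:
  assumes "finite I" "J \<subseteq> I" "\<And>i. i \<in> J \<Longrightarrow> \<pi> i = (if i \<in> b then 1 else 0)"
  shows "Pr I \<pi> A = Pr I \<pi> (\<lambda>S. A S \<and> S \<inter> J = b \<inter> J)"
proof -
  have "wt I \<pi> S = 0" if "S \<inter> J \<noteq> b \<inter> J" for S
  proof -
    have "\<exists>i\<in>J. (i \<in> S) \<noteq> (i \<in> b)"
    proof (rule ccontr)
      assume "\<not> ?thesis"
      then have "S \<inter> J = b \<inter> J" by auto
      with that show False by simp
    qed
    then obtain i where "i \<in> J" "(i \<in> S) \<noteq> (i \<in> b)" by blast
    moreover have "\<pi> i = (if i \<in> b then 1 else 0)" "i \<in> I" using \<open>i \<in> J\<close> assms by auto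
    ultimately show ?thesis
      unfolding wt_def using assms(1) by (intro prod_zero bexI[of _ i]) auto
  qed
  then show ?thesis unfolding Pr_def by (intro sum.cong) auto
qed

lemma prob_on_upd: "prob_on I \<pi> \<Longrightarrow> 0 \<le> x \<Longrightarrow> x \<le> 1 \<Longrightarrow> prob_on I (\<pi>(i := x))"
  unfolding prob_on_def by auto

text \<open>\<open>Pr\<close> is affine in each parameter, so a linear inequality that holds for
  every 0/1 assignment on \<open>J\<close> holds for the original parameters. The bits are averaged
  out one at a time; \<open>K\<close> contains those still undetermined.\<close>

lemma Pr_reveal:
  assumes fin: "finite I" and J: "J \<subseteq> I" and pr: "prob_on I \<pi>"
    and main: "\<And>\<rho> b. prob_on I \<rho> \<Longrightarrow> (\<And>i. i \<notin> J \<Longrightarrow> \<rho> i = \<pi> i) \<Longrightarrow>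
        (\<And>i. i \<in> J \<Longrightarrow> \<rho> i = (if i \<in> b then 1 else 0)) \<Longrightarrow> c * Pr I \<rho> B \<le> Pr I \<rho> A"
  shows "c * Pr I \<pi> B \<le> Pr I \<pi> A"
proof -
  have "c * Pr I \<rho> B \<le> Pr I \<rho> A"
    if "K \<subseteq> J" "prob_on I \<rho>" "\<And>i. i \<notin> J \<Longrightarrow> \<rho> i = \<pi> i"
       "\<And>i. i \<in> J - K \<Longrightarrow> \<rho> i = (if i \<in> b then 1 else 0)" for K \<rho> b
  proof -
    have "finite K" using that J fin by (meson finite_subset)
    then show ?thesis using that
    proof (induction K arbitrary: \<rho> b)
      case empty
      then show ?case by (intro main) auto
    next
      case (insert i K)
      have i: "i \<in> I" "i \<in> J" using insert.prems J by auto
      have 1: "c * Pr I (\<rho>(i := 1)) B \<le> Pr I (\<rho>(i := 1)) A"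
        by (rule insert.IH[where b = "insert i b"])
          (use insert.prems i in \<open>auto intro: prob_on_upd[unfolded fun_upd_def]\<close>)
      have 0: "c * Pr I (\<rho>(i := 0)) B \<le> Pr I (\<rho>(i := 0)) A"
        by (rule insert.IH[where b = "b - {i}"])
          (use insert.prems i in \<open>auto intro: prob_on_upd[unfolded fun_upd_def]\<close>)
      have pi: "0 \<le> \<rho> i" "\<rho> i \<le> 1" using insert.prems i by (auto simp: prob_on_def)
      have "c * Pr I \<rho> B = \<rho> i * (c * Pr I (\<rho>(i := 1)) B) + (1 - \<rho> i) * (c * Pr I (\<rho>(i := 0)) B)"
        by (subst Pr_pivot[OF fin i(1)]) (simp add: algebra_simps)
      also have "\<dots> \<le> \<rho> i * Pr I (\<rho>(i := 1)) A + (1 - \<rho> i) * Pr I (\<rho>(i := 0)) A"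
        using 1 0 pi by (intro add_mono mult_left_mono) auto
      also have "\<dots> = Pr I \<rho> A" by (rule Pr_pivot[OF fin i(1), symmetric])
      finally show ?case .
    qed
  qed
  from this[of J \<pi>] pr show ?thesis by auto
qed

text \<open>Toggling bit \<open>i\<close> carries the weights for parameter 1 to those for parameter
  0 and leaves \<open>A\<close> unchanged.\<close>

lemma Pr_flip:
  assumes fin: "finite I" and i: "i \<in> I" and dep: "depends A (- {i})"
  shows "Pr I (\<pi>(i := x)) A = Pr I (\<pi>(i := y)) A"
proof -
  have *: "Pr I (\<pi>(i := 1)) A = Pr I (\<pi>(i := 0)) A" 
  proof -
    have "(\<Sum>S\<in>Pow I. if A S then wt I (\<pi>(i := 1)) S else 0) =
        (\<Sum>S\<in>Pow I. if A S then wt I (\<pi>(i := 0)) S else 0)"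
    proof (rule sum.reindex_bij_witness[where i = "\<lambda>S. if i \<in> S then S - {i} else insert i S"
          and j = "\<lambda>S. if i \<in> S then S - {i} else insert i S"])
      fix S assume "S \<in> Pow I"
      let ?S = "if i \<in> S then S - {i} else insert i S"
      have "A ?S = A S" by (rule dependsD[OF dep]) auto
      moreover have "wt I (\<pi>(i := 0)) ?S = wt I (\<pi>(i := 1)) S"
        unfolding wt_def by (intro prod.cong) auto
      ultimately show "(if A ?S then wt I (\<pi>(i := 0)) ?S else 0) = (if A S then wt I (\<pi>(i := 1)) S else 0)"
        by simp
    qed (use i in auto)
    then show ?thesis unfolding Pr_def .
  qed
  have "Pr I (\<pi>(i := z)) A = Pr I (\<pi>(i := 0)) A" for z
    by (subst Pr_pivot[OF fin i]) (simp add: * algebra_simps)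
  then show ?thesis by metis
qed

lemma Pr_depends:
  assumes fin: "finite I" and dep: "depends A J" and eq: "\<And>i. i \<in> I \<Longrightarrow> i \<in> J \<Longrightarrow> \<pi> i = \<rho> i"
  shows "Pr I \<pi> A = Pr I \<rho> A"
proof -
  have "Pr I \<pi> A = Pr I (\<lambda>i. if i \<in> K then \<rho> i else \<pi> i) A" if "K \<subseteq> I - J" for K
  proof -
    have "finite K" using that fin by (meson finite_Diff finite_subset)
    then show ?thesis using that
    proof (induction K)
      case empty
      then show ?case by simp
    next
      case (insert i K)
      let ?\<pi> = "\<lambda>j. if j \<in> K then \<rho> j else \<pi> j"
      have "depends A (- {i})" by (rule depends_mono[OF dep]) (use insert.prems in auto)
      then have "Pr I (?\<pi>(i := \<pi> i)) A = Pr I (?\<pi>(i := \<rho> i)) A"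
        using insert.prems by (intro Pr_flip[OF fin]) auto
      moreover have "?\<pi>(i := \<pi> i) = ?\<pi>" using insert.hyps by auto
      moreover have "?\<pi>(i := \<rho> i) = (\<lambda>j. if j \<in> insert i K then \<rho> j else \<pi> j)" by auto
      ultimately show ?case using insert by simp
    qed
  qed
  from this[of "I - J"] have "Pr I \<pi> A = Pr I (\<lambda>i. if i \<in> I - J then \<rho> i else \<pi> i) A" by simp
  also have "\<dots> = Pr I \<rho> A" by (rule Pr_cong_prob) (use eq in auto)
  finally show ?thesis .
qed

text \<open>The defect \<open>F\<close> of the product formula is affine in every parameter of
  \<open>J\<close>, so it suffices that it vanishes once these bits are deterministic. Then
  \<open>A\<close> is constant, and \<open>B\<close> does not see the change of parameters.\<close>

lemma Pr_indep:
  assumes fin: "finite I" and pr: "prob_on I \<pi>" and A: "depends A J" and B: "depends B J'"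
    and disj: "I \<inter> J \<inter> J' = {}"
  shows "Pr I \<pi> (\<lambda>S. A S \<and> B S) = Pr I \<pi> A * Pr I \<pi> B"
proof -
  define F where "F \<rho> = Pr I \<rho> (\<lambda>S. A S \<and> B S) - Pr I \<rho> A * Pr I \<pi> B" for \<rho>
  have "F \<rho> = 0"
    if "K \<subseteq> I \<inter> J" "\<And>i. i \<notin> I \<inter> J \<Longrightarrow> \<rho> i = \<pi> i"
       "\<And>i. i \<in> I \<inter> J - K \<Longrightarrow> \<rho> i = (if i \<in> b then 1 else 0)" for K \<rho> b
  proof -
    have "finite K" using that fin by (meson finite_Int finite_subset)
    then show ?thesis using that
    proof (induction K arbitrary: \<rho> b)
      case empty
      have eqB: "Pr I \<rho> B = Pr I \<pi> B"
        by (rule Pr_depends[OF fin B]) (use disj empty.prems in auto)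
      have AS: "A S = A (b \<inter> I)" if "S \<subseteq> I" "S \<inter> (I \<inter> J) = b \<inter> (I \<inter> J)" for S
        by (rule dependsD[OF A]) (use that in auto)
      have known: "Pr I \<rho> Q = Pr I \<rho> (\<lambda>S. Q S \<and> S \<inter> (I \<inter> J) = b \<inter> (I \<inter> J))" for Q
        using empty.prems by (intro Pr_known_set[OF fin]) auto
      have "Pr I \<rho> (\<lambda>S. A S \<and> B S) = Pr I \<rho> (\<lambda>S. A (b \<inter> I) \<and> B S)"
        by (subst (1 2) known, rule Pr_cong) (use AS in auto)
      moreover have "Pr I \<rho> A = Pr I \<rho> (\<lambda>S. A (b \<inter> I))"
        by (subst (1 2) known, rule Pr_cong) (use AS in auto)
      ultimately show ?case
        unfolding F_def using fin eqB by (cases "A (b \<inter> I)") auto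
    next
      case (insert i K)
      have i: "i \<in> I" using insert.prems by auto
      have "F (\<rho>(i := 1)) = 0"
        by (rule insert.IH[where b = "insert i b"]) (use insert.prems in auto)
      moreover have "F (\<rho>(i := 0)) = 0"
        by (rule insert.IH[where b = "b - {i}"]) (use insert.prems in auto)
      moreover have "F \<rho> = \<rho> i * F (\<rho>(i := 1)) + (1 - \<rho> i) * F (\<rho>(i := 0))"
        unfolding F_def by (subst (1 2) Pr_pivot[OF fin i]) (simp add: algebra_simps)
      ultimately show ?case by simp
    qed
  qed
  from this[of "I \<inter> J" \<pi>] show ?thesis unfolding F_def by auto
qed

text \<open>Factorisation over a cylinder: prescribing the bits of \<open>Q\<close> costs their
  weight and leaves the same model with these bits frozen. Every later comparison of a real with a
  virtual walk is a comparison of such weights.\<close>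

lemma Pr_constrain:
  assumes fin: "finite I" and Q: "Q \<subseteq> I"
  shows "Pr I \<pi> (\<lambda>S. S \<inter> Q = b \<inter> Q \<and> A S)
    = wt Q \<pi> b * Pr I (\<lambda>i. if i \<in> Q then (if i \<in> b then 1 else 0) else \<pi> i) A"
proof -
  have "finite Q" using Q fin by (rule finite_subset)
  then show ?thesis using Q
  proof (induction Q arbitrary: \<pi>)
    case empty
    then show ?case by (simp add: wt_def)
  next
    case (insert i Q)
    have i: "i \<in> I" "Q \<subseteq> I" using insert.prems by auto
    let ?x = "if i \<in> b then 1 else 0 :: real"
    let ?B = "\<lambda>S. S \<inter> insert i Q = b \<inter> insert i Q \<and> A S"
    let ?B' = "\<lambda>S. S \<inter> Q = b \<inter> Q \<and> A S"
    have *: "Pr I (\<pi>(i := y)) ?B = (if y = ?x then Pr I (\<pi>(i := y)) ?B' else 0)"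
      if "y = 0 \<or> y = 1" for y :: real
    proof -
      have "Pr I (\<pi>(i := y)) ?B = Pr I (\<pi>(i := y)) (\<lambda>S. ?B S \<and> (i \<in> S \<longleftrightarrow> y = 1))"
        by (rule Pr_known[OF fin i(1)]) (use that in auto)
      also have "\<dots> = (if y = ?x then Pr I (\<pi>(i := y)) (\<lambda>S. ?B' S \<and> (i \<in> S \<longleftrightarrow> y = 1)) else 0)"
      proof (cases "y = ?x")
        case True
        then show ?thesis by (auto intro!: Pr_cong)
      next
        case False
        then have "Pr I (\<pi>(i := y)) (\<lambda>S. ?B S \<and> (i \<in> S \<longleftrightarrow> y = 1)) = Pr I (\<pi>(i := y)) (\<lambda>_. False)"
          using that by (intro Pr_cong) (auto split: if_splits)
        then show ?thesis using False by simp
      qed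
      also have "Pr I (\<pi>(i := y)) (\<lambda>S. ?B' S \<and> (i \<in> S \<longleftrightarrow> y = 1)) = Pr I (\<pi>(i := y)) ?B'"
        by (rule Pr_known[OF fin i(1), symmetric]) (use that in auto)
      finally show ?thesis .
    qed
    have "Pr I \<pi> ?B = (if i \<in> b then \<pi> i else 1 - \<pi> i) * Pr I (\<pi>(i := ?x)) ?B'"
      by (subst Pr_pivot[OF fin i(1)]) (simp add: *)
    also have "Pr I (\<pi>(i := ?x)) ?B' = wt Q (\<pi>(i := ?x)) b *
        Pr I (\<lambda>j. if j \<in> Q then (if j \<in> b then 1 else 0) else (\<pi>(i := ?x)) j) A"
      by (rule insert.IH[OF i(2)])
    also have "wt Q (\<pi>(i := ?x)) b = wt Q \<pi> b"
      unfolding wt_def using insert.hyps by (intro prod.cong) auto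
    also have "(\<lambda>j. if j \<in> Q then (if j \<in> b then 1 else 0) else (\<pi>(i := ?x)) j) =
       (\<lambda>j. if j \<in> insert i Q then (if j \<in> b then 1 else 0) else \<pi> j)" by auto
    finally show ?case using insert.hyps by (simp add: wt_def mult.assoc)
  qed
qed

section \<open>Reversible periodic dynamics on a tree, driven by bits\<close>

section \<open>The discretised walk on a rooted tree\<close>

text \<open>An edge is named by its endpoint farther from the root. Time is discrete, and at time \<open>t\<close> only
edges of colour \<open>t mod C\<close> may be crossed; as the colouring is proper, at most one edge is
available to the walker. The edge to the child with index \<open>i\<close> is available \<open>i + 1\<close> steps after the edge to the
parent. A round consists of \<open>C\<close> steps and the environment has period \<open>L\<close>.\<close>

locale coloured_tree =
  fixes V :: "'a set" and r :: 'a and par :: "'a \<Rightarrow> 'a" and dep idx :: "'a \<Rightarrow> nat" and D M :: nat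
  assumes rV: "r \<in> V" and dep_r: "dep r = 0" and par_r: "par r = r"
    and par_V: "\<And>v. v \<in> V \<Longrightarrow> par v \<in> V"
    and dep_par: "\<And>v. v \<in> V \<Longrightarrow> v \<noteq> r \<Longrightarrow> dep v = Suc (dep (par v))"
    and idx_less: "\<And>v. v \<in> V \<Longrightarrow> v \<noteq> r \<Longrightarrow> idx v < D"
    and idx_inj: "\<And>v w. v \<in> V \<Longrightarrow> w \<in> V \<Longrightarrow> v \<noteq> r \<Longrightarrow> w \<noteq> r \<Longrightarrow> par v = par w \<Longrightarrow> idx v = idx w \<Longrightarrow> v = w"
    and kid_ex: "\<And>v k. v \<in> V \<Longrightarrow> k < 2 \<Longrightarrow> \<exists>w\<in>V. w \<noteq> r \<and> par w = v \<and> idx w = k"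
    and M_pos: "0 < M"
begin

definition C :: nat where "C = Suc D"
definition L :: nat where "L = M * C"

text \<open>The depth serves as recursion fuel. Colours accumulate along the path from the root;
  since \<open>idx < D\<close> and \<open>C = Suc D\<close>, the shifts \<open>1 + idx\<close> stay
  strictly between 0 and \<open>C\<close>, which makes the colouring proper.\<close>

primrec colk :: "nat \<Rightarrow> 'a \<Rightarrow> nat" where
  "colk 0 w = 0"
| "colk (Suc n) w = (colk n (par w) + 1 + idx w) mod C"

definition col :: "'a \<Rightarrow> nat" where "col w = colk (dep w) w"

definition kid :: "'a \<Rightarrow> nat \<Rightarrow> 'a" where
  "kid v k = (SOME w. w \<in> V \<and> w \<noteq> r \<and> par w = v \<and> idx w = k)"

definition edge_at :: "'a \<Rightarrow> 'a \<Rightarrow> nat \<Rightarrow> bool" where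
  "edge_at e x t \<longleftrightarrow> e \<in> V \<and> e \<noteq> r \<and> (x = e \<or> x = par e) \<and> col e = t mod C"

definition opp :: "'a \<Rightarrow> 'a \<Rightarrow> 'a" where "opp e x = (if x = e then par e else e)"

definition mv :: "('a \<times> nat) set \<Rightarrow> nat \<Rightarrow> 'a \<Rightarrow> 'a" where
  "mv \<omega> t x = (if \<exists>e. edge_at e x t \<and> (e, t mod L) \<in> \<omega> then opp (THE e. edge_at e x t) x else x)"

primrec wlk :: "('a \<times> nat) set \<Rightarrow> nat \<Rightarrow> 'a \<Rightarrow> nat \<Rightarrow> 'a" where
  "wlk \<omega> t x 0 = x"
| "wlk \<omega> t x (Suc n) = mv \<omega> (t + n) (wlk \<omega> t x n)"

text \<open>When \<open>d\<close> is at least \<open>dep w\<close> the subtraction truncates and the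
  value is \<open>w\<close> itself.\<close>

definition anc :: "nat \<Rightarrow> 'a \<Rightarrow> 'a" where "anc d w = (par ^^ (dep w - d)) w"

definition sub :: "'a \<Rightarrow> 'a set" where "sub v = {w \<in> V. \<exists>k. (par ^^ k) w = v}"

definition bits :: "nat \<Rightarrow> ('a \<times> nat) set" where
  "bits n = {(e, j). e \<in> V \<and> e \<noteq> r \<and> dep e \<le> n \<and> j < L \<and> j mod C = col e}"

lemma C_pos: "0 < C" by (simp add: C_def)
lemma L_pos: "0 < L" using C_pos M_pos by (simp add: L_def)
lemma mod_L_mod_C: "t mod L mod C = t mod C"
  unfolding L_def by (rule mod_mod_cancel) simp

lemma D_ge_2: "2 \<le> D"
proof -
  obtain w where "w \<in> V" "w \<noteq> r" "idx w = 1" using kid_ex[OF rV, of 1] by auto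
  then show ?thesis using idx_less[of w] by simp
qed

lemma C_ge_3: "3 \<le> C" using D_ge_2 by (simp add: C_def)

lemma col_less: "col w < C"
  unfolding col_def by (cases "dep w") (auto simp: C_pos)

lemma col_par: "w \<in> V \<Longrightarrow> w \<noteq> r \<Longrightarrow> col w = (col (par w) + 1 + idx w) mod C"
  unfolding col_def using dep_par[of w] by simp

lemma kid_props:
  assumes "v \<in> V" "k < 2"
  shows "kid v k \<in> V" "kid v k \<noteq> r" "par (kid v k) = v" "idx (kid v k) = k"
proof -
  define P where "P w \<longleftrightarrow> w \<in> V \<and> w \<noteq> r \<and> par w = v \<and> idx w = k" for w
  have "\<exists>w. P w" using kid_ex[OF assms] unfolding P_def by blast
  then have "P (kid v k)" unfolding kid_def P_def[symmetric] by (rule someI_ex)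
  then show "kid v k \<in> V" "kid v k \<noteq> r" "par (kid v k) = v" "idx (kid v k) = k"
    unfolding P_def by simp_all
qed

lemma dep_kid:
  assumes "v \<in> V" "k < 2"
  shows "dep (kid v k) = Suc (dep v)"
proof -
  have "dep (kid v k) = Suc (dep (par (kid v k)))" by (rule dep_par[OF kid_props(1,2)[OF assms]])
  then show ?thesis unfolding kid_props(3)[OF assms] .
qed

lemma kid_neq:
  assumes "v \<in> V"
  shows "kid v 0 \<noteq> kid v 1"
proof
  assume "kid v 0 = kid v 1"
  then have "idx (kid v 0) = idx (kid v 1)" by (rule arg_cong)
  then show False using kid_props(4)[OF assms, of 0] kid_props(4)[OF assms, of 1] by simp
qed

lemma dep_0:
  assumes "v \<in> V"
  shows "dep v = 0 \<longleftrightarrow> v = r"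
proof (cases "v = r")
  case False
  then show ?thesis using dep_par[OF assms False] by linarith
qed (simp add: dep_r)

lemma par_neq:
  assumes "v \<in> V" "v \<noteq> r"
  shows "par v \<noteq> v"
proof
  assume "par v = v"
  then have "dep (par v) = dep v" by (rule arg_cong)
  then show False using dep_par[OF assms] by linarith
qed

lemma add_mod_cancel:
  assumes "(a + j) mod m = (a + k) mod m" "j < m" "k < m"
  shows "j = (k::nat)"
proof -
  have *: "j = k" if "(a + j) mod m = (a + k) mod m" "k < m" "j \<le> k" for j k
  proof -
    have "m dvd (a + k) - (a + j)" using that by (subst mod_eq_dvd_iff_nat[symmetric]) auto
    then have "m dvd k - j" by simp
    then show ?thesis using that dvd_imp_le[of m "k - j"] by (cases "k - j = 0") auto
  qed
  show ?thesis using *[of j k] *[of k j] assms by (cases "j \<le> k") auto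
qed

text \<open>Two edges of equal colour at a common endpoint would have congruent shifts, either 0
  against \<open>1 + idx\<close> or two child shifts, all below \<open>C\<close>. This is what gives
  the \<open>THE\<close> in \<open>mv\<close> its meaning.\<close>

lemma edge_at_unique:
  assumes "edge_at e x t" "edge_at f x t"
  shows "e = f"
proof -
  have *: False if "e \<in> V" "e \<noteq> r" "par e = f" "col e = col f" for e f
  proof -
    have "(col f + (1 + idx e)) mod C = (col f + 0) mod C"
      using col_par[OF that(1,2)] that col_less[of f] by (simp add: add.assoc)
    then have "1 + idx e = 0"
      by (rule add_mod_cancel) (use idx_less[OF that(1,2)] C_pos in \<open>auto simp: C_def\<close>)
    then show False by simp
  qed
  have **: "e = f" if "e \<in> V" "e \<noteq> r" "f \<in> V" "f \<noteq> r" "par e = par f" "col e = col f"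
  proof -
    have "(col (par f) + 1 + idx e) mod C = (col (par f) + 1 + idx f) mod C"
      using col_par[OF that(1,2)] col_par[OF that(3,4)] that by simp
    then have "idx e = idx f"
      by (rule add_mod_cancel) (use idx_less that in \<open>auto simp: C_def less_Suc_eq\<close>)
    then show ?thesis using idx_inj that by blast
  qed
  have e: "e \<in> V" "e \<noteq> r" "f \<in> V" "f \<noteq> r" "col e = col f" "x = e \<or> x = par e" "x = f \<or> x = par f"
    using assms unfolding edge_at_def by auto
  show ?thesis
  proof (cases "x = e")
    case True
    then show ?thesis using *[OF e(3,4)] e by auto
  next
    case False
    then show ?thesis using *[OF e(1,2)] **[OF e(1-4)] e by auto
  qed
qed

lemma edge_at_mod: "t mod L = t' mod L \<Longrightarrow> edge_at e x t = edge_at e x t'"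
  unfolding edge_at_def by (metis mod_L_mod_C)

lemma edge_at_opp: "edge_at e x t \<Longrightarrow> edge_at e (opp e x) t"
  unfolding edge_at_def opp_def by auto

lemma opp_opp: "edge_at e x t \<Longrightarrow> opp e (opp e x) = x"
  using par_neq unfolding edge_at_def opp_def by auto

lemma mv_on: "edge_at e x t \<Longrightarrow> (e, t mod L) \<in> \<omega> \<Longrightarrow> mv \<omega> t x = opp e x"
proof -
  assume "edge_at e x t" "(e, t mod L) \<in> \<omega>"
  moreover have "(THE f. edge_at f x t) = e" using \<open>edge_at e x t\<close> edge_at_unique by blast
  ultimately show ?thesis unfolding mv_def by auto
qed

lemma mv_off: "edge_at e x t \<Longrightarrow> (e, t mod L) \<notin> \<omega> \<Longrightarrow> mv \<omega> t x = x"
proof -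
  assume "edge_at e x t" "(e, t mod L) \<notin> \<omega>"
  then have "\<not> (\<exists>f. edge_at f x t \<and> (f, t mod L) \<in> \<omega>)" using edge_at_unique by blast
  then show ?thesis unfolding mv_def by (rule if_not_P)
qed

lemma mv_none: "(\<And>e. edge_at e x t \<Longrightarrow> (e, t mod L) \<notin> \<omega>) \<Longrightarrow> mv \<omega> t x = x"
proof -
  assume "\<And>e. edge_at e x t \<Longrightarrow> (e, t mod L) \<notin> \<omega>"
  then have "\<not> (\<exists>f. edge_at f x t \<and> (f, t mod L) \<in> \<omega>)" by blast
  then show ?thesis unfolding mv_def by (rule if_not_P)
qed

lemma mv_cases:
  obtains "mv \<omega> t x = x" "\<And>e. edge_at e x t \<Longrightarrow> (e, t mod L) \<notin> \<omega>"
  | e where "edge_at e x t" "(e, t mod L) \<in> \<omega>" "mv \<omega> t x = opp e x"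
proof (cases "\<exists>e. edge_at e x t \<and> (e, t mod L) \<in> \<omega>")
  case True
  then show thesis using mv_on that(2) by blast
next
  case False
  then show thesis using mv_none that(1) by blast
qed

lemma mv_invol: "mv \<omega> t (mv \<omega> t x) = x"
proof (cases rule: mv_cases[of \<omega> t x])
  case (2 e)
  then show ?thesis using mv_on[OF edge_at_opp[OF 2(1)] 2(2)] opp_opp[OF 2(1)] by simp
qed simp

lemma mv_V: "x \<in> V \<Longrightarrow> mv \<omega> t x \<in> V"
proof (cases rule: mv_cases[of \<omega> t x])
  case (2 e)
  then show ?thesis by (auto simp: opp_def edge_at_def par_V)
qed simp

lemma mv_mod: "t mod L = t' mod L \<Longrightarrow> mv \<omega> t x = mv \<omega> t' x"
  unfolding mv_def using edge_at_mod[of t t'] by auto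

lemma mv_cong:
  assumes "\<And>e. edge_at e x t \<Longrightarrow> (e, t mod L) \<in> \<omega> \<longleftrightarrow> (e, t mod L) \<in> \<omega>'"
  shows "mv \<omega> t x = mv \<omega>' t x"
proof -
  have "(\<exists>e. edge_at e x t \<and> (e, t mod L) \<in> \<omega>) = (\<exists>e. edge_at e x t \<and> (e, t mod L) \<in> \<omega>')"
    using assms by blast
  then show ?thesis unfolding mv_def by presburger
qed

lemma wlk_V: "x \<in> V \<Longrightarrow> wlk \<omega> t x n \<in> V"
  by (induction n) (auto intro: mv_V)

lemma wlk_add: "wlk \<omega> t x (m + n) = wlk \<omega> (t + m) (wlk \<omega> t x m) n"
  by (induction n) (auto simp: add.assoc)

lemma wlk_Suc_left: "wlk \<omega> t x (Suc n) = wlk \<omega> (Suc t) (mv \<omega> t x) n"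
  using wlk_add[of \<omega> t x 1 n] by simp

lemma wlk_mod: "t mod L = t' mod L \<Longrightarrow> wlk \<omega> t x n = wlk \<omega> t' x n"
proof (induction n)
  case (Suc n)
  then have "(t + n) mod L = (t' + n) mod L" by (metis mod_add_left_eq)
  then show ?case using Suc by (simp add: mv_mod[of "t + n" "t' + n"])
qed simp

lemma wlk_inj: "wlk \<omega> t x n = wlk \<omega> t y n \<Longrightarrow> x = y"
proof (induction n)
  case (Suc n)
  then have "mv \<omega> (t + n) (mv \<omega> (t + n) (wlk \<omega> t x n)) = mv \<omega> (t + n) (mv \<omega> (t + n) (wlk \<omega> t y n))" by simp
  then show ?case using Suc.IH by (simp add: mv_invol)
qed simp

text \<open>Shifting time by a multiple of \<open>L\<close> leaves the environment unchanged, so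
  both sides are \<open>a\<close>-step walks in the same environment, from \<open>x\<close> and from
  \<open>wlk \<omega> t x m\<close>. As each step is an involution, equal endpoints force equal
  starting points.\<close>

lemma wlk_closes:
  assumes "wlk \<omega> t x a = wlk \<omega> t x (a + m)" "L dvd m"
  shows "wlk \<omega> t x m = x"
proof -
  have "wlk \<omega> t x (a + m) = wlk \<omega> (t + m) (wlk \<omega> t x m) a"
    using wlk_add[of \<omega> t x m a] add.commute[of m a] by argo
  also have "\<dots> = wlk \<omega> t (wlk \<omega> t x m) a"
    by (rule wlk_mod) (use assms(2) in auto)
  finally show ?thesis using assms(1) wlk_inj by metis
qed

text \<open>Only bits of edges that are actually offered matter; this transfers a path from one
  configuration to another.\<close>

lemma wlk_cong:
  assumes "\<And>l e. l < n \<Longrightarrow> edge_at e (wlk \<omega> t x l) (t + l) \<Longrightarrow>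
      (e, (t + l) mod L) \<in> \<omega> \<longleftrightarrow> (e, (t + l) mod L) \<in> \<omega>'"
  shows "l \<le> n \<Longrightarrow> wlk \<omega>' t x l = wlk \<omega> t x l"
proof (induction l)
  case (Suc l)
  then have "wlk \<omega>' t x l = wlk \<omega> t x l" by simp
  moreover have "mv \<omega> (t + l) (wlk \<omega> t x l) = mv \<omega>' (t + l) (wlk \<omega> t x l)"
    by (rule mv_cong) (use assms[of l] Suc.prems in auto)
  ultimately show ?case by simp
qed simp

lemma wlk_const:
  assumes "\<And>l e. l < n \<Longrightarrow> edge_at e x (t + l) \<Longrightarrow> (e, (t + l) mod L) \<notin> \<omega>"
  shows "l \<le> n \<Longrightarrow> wlk \<omega> t x l = x"
proof (induction l)
  case (Suc l)
  then have "mv \<omega> (t + l) x = x" by (intro mv_none) (use assms[of l] in auto)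
  then show ?case using Suc by simp
qed simp

lemma dep_par_diff: "u \<in> V \<Longrightarrow> dep (par u) = dep u - 1"
  by (cases "u = r") (simp_all add: par_r dep_r dep_par)

lemma dep_funpow_par:
  assumes "w \<in> V"
  shows "dep ((par ^^ k) w) = dep w - k \<and> (par ^^ k) w \<in> V"
proof (induction k)
  case (Suc k)
  then show ?case using dep_par_diff[of "(par ^^ k) w"] par_V[of "(par ^^ k) w"] by simp
qed (simp add: assms)

lemma sub_iff: "w \<in> sub v \<longleftrightarrow> w \<in> V \<and> dep v \<le> dep w \<and> anc (dep v) w = v"
proof
  assume "w \<in> sub v"
  then obtain k where w: "w \<in> V" and k: "(par ^^ k) w = v" unfolding sub_def by blast
  then have d: "dep v = dep w - k" "v \<in> V" using dep_funpow_par[OF w, of k] by simp_all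
  have "anc (dep v) w = v"
  proof (cases "k \<le> dep w")
    case True
    then show ?thesis using d k by (simp add: anc_def)
  next
    case False
    then have "v = r" using d dep_0[of v] by simp
    moreover have "(par ^^ dep w) w = r"
      using dep_funpow_par[OF w, of "dep w"] dep_0[of "(par ^^ dep w) w"] by simp
    ultimately show ?thesis by (simp add: anc_def dep_r)
  qed
  then show "w \<in> V \<and> dep v \<le> dep w \<and> anc (dep v) w = v" using w d by simp
next
  assume "w \<in> V \<and> dep v \<le> dep w \<and> anc (dep v) w = v"
  then show "w \<in> sub v" unfolding sub_def anc_def by blast
qed

lemma sub_V: "w \<in> sub v \<Longrightarrow> w \<in> V" by (simp add: sub_def)
lemma sub_refl: "v \<in> V \<Longrightarrow> v \<in> sub v" by (auto simp: sub_def intro: exI[of _ 0])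
lemma sub_dep: "w \<in> sub v \<Longrightarrow> dep v \<le> dep w" by (simp add: sub_iff)
lemma sub_dep_eq: "w \<in> sub v \<Longrightarrow> dep w = dep v \<Longrightarrow> w = v" by (simp add: sub_iff anc_def)
lemma sub_same_level: "w \<in> sub x \<Longrightarrow> w \<in> sub y \<Longrightarrow> dep x = dep y \<Longrightarrow> x = y" by (simp add: sub_iff)

lemma sub_down:
  assumes "w \<in> V" "par w \<in> sub v"
  shows "w \<in> sub v"
proof -
  obtain k where "(par ^^ k) (par w) = v" using assms(2) by (auto simp: sub_def)
  then have "(par ^^ Suc k) w = v" unfolding funpow_Suc_right by simp
  then show ?thesis using assms(1) unfolding sub_def by blast
qed

lemma sub_up: "w \<in> sub v \<Longrightarrow> w \<noteq> v \<Longrightarrow> par w \<in> sub v"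
proof -
  assume w: "w \<in> sub v" "w \<noteq> v"
  then obtain k where "w \<in> V" "(par ^^ k) w = v" by (auto simp: sub_def)
  moreover have "k \<noteq> 0" using calculation w by (cases k) auto
  ultimately obtain j where "(par ^^ Suc j) w = v" "w \<in> V" by (cases k) auto
  then have "(par ^^ j) (par w) = v" "par w \<in> V" unfolding funpow_Suc_right by (auto intro: par_V)
  then show ?thesis unfolding sub_def by blast
qed

lemma sub_trans:
  assumes "w \<in> sub x" "x \<in> sub v"
  shows "w \<in> sub v"
proof -
  obtain i j where "w \<in> V" "(par ^^ i) w = x" "(par ^^ j) x = v"
    using assms by (auto simp: sub_def)
  then have "w \<in> V" "(par ^^ (j + i)) w = v" unfolding funpow_add by auto
  then show ?thesis unfolding sub_def by blast
qed

lemma sub_kid: "x \<in> V \<Longrightarrow> k < 2 \<Longrightarrow> kid x k \<in> sub x"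
  using kid_props[of x k] sub_down[of "kid x k" x] sub_refl[of x] by simp

lemma dep_kid_lt: "x \<in> V \<Longrightarrow> k < 2 \<Longrightarrow> w \<in> sub (kid x k) \<Longrightarrow> dep x < dep w"
  using sub_dep[of w "kid x k"] dep_kid[of x k] by simp

lemma mv_exit:
  assumes "q \<in> sub v" "mv \<omega> t q \<notin> sub v"
  shows "q = v" "v \<noteq> r" "mv \<omega> t q = par v" "edge_at v q t" "(v, t mod L) \<in> \<omega>"
proof -
  obtain e where e: "edge_at e q t" "(e, t mod L) \<in> \<omega>" "mv \<omega> t q = opp e q"
    using assms by (cases rule: mv_cases[of \<omega> t q]) auto
  have eV: "e \<in> V" "e \<noteq> r" "q = e \<or> q = par e" using e unfolding edge_at_def by auto
  have qe: "q = e"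
  proof (rule ccontr)
    assume "q \<noteq> e"
    then have "q = par e" "mv \<omega> t q = e" using e eV by (auto simp: opp_def)
    then show False using sub_down[OF eV(1)] assms by simp
  qed
  then have mvq: "mv \<omega> t q = par q" using e by (simp add: opp_def)
  show qv: "q = v" using sub_up[OF assms(1)] assms(2) mvq by auto
  show "v \<noteq> r" "mv \<omega> t q = par v" "edge_at v q t" "(v, t mod L) \<in> \<omega>"
    using e eV qe qv mvq by simp_all
qed

lemma mv_enter:
  assumes "q \<notin> sub v" "mv \<omega> t q \<in> sub v"
  shows "mv \<omega> t q = v" "v \<noteq> r" "q = par v" "edge_at v q t" "(v, t mod L) \<in> \<omega>"
proof -
  have "mv \<omega> t (mv \<omega> t q) \<notin> sub v" using assms(1) by (simp add: mv_invol)
  note * = mv_exit[OF assms(2) this]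
  show "mv \<omega> t q = v" "v \<noteq> r" "(v, t mod L) \<in> \<omega>" by (fact *)+
  show q: "q = par v" using *(3) by (simp add: mv_invol)
  show "edge_at v q t" using *(4) unfolding edge_at_def q by simp
qed

lemma dep_mv_le: "x \<in> V \<Longrightarrow> dep (mv \<omega> t x) \<le> Suc (dep x)"
proof (cases rule: mv_cases[of \<omega> t x])
  case (2 e)
  then show ?thesis using dep_par[of e] by (auto simp: opp_def edge_at_def)
qed simp

text \<open>Depth grows by at most one per step, so no level is skipped.\<close>

lemma dep_wlk_first:
  assumes "x \<in> V" "dep x < d" "d \<le> dep (wlk \<omega> t x m)"
  shows "\<exists>l<m. dep (wlk \<omega> t x (Suc l)) = d \<and> (\<forall>i\<le>l. dep (wlk \<omega> t x i) < d)"
proof -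
  define i where "i = (LEAST i. d \<le> dep (wlk \<omega> t x i))"
  have i: "d \<le> dep (wlk \<omega> t x i)" unfolding i_def using assms(3) by (rule LeastI)
  have im: "i \<le> m" unfolding i_def using assms(3) by (rule Least_le)
  have lt: "dep (wlk \<omega> t x j) < d" if "j < i" for j
    using that not_less_Least[of j "\<lambda>i. d \<le> dep (wlk \<omega> t x i)"] unfolding i_def by simp
  obtain l where l: "i = Suc l" using i assms(2) by (cases i) auto
  have "dep (wlk \<omega> t x i) \<le> Suc (dep (wlk \<omega> t x l))"
    unfolding l using dep_mv_le[OF wlk_V[OF assms(1)]] by simp
  also have "\<dots> \<le> d" using lt[of l] l by simp
  finally have "dep (wlk \<omega> t x (Suc l)) = d" using i unfolding l by (rule antisym)
  moreover have "\<forall>j\<le>l. dep (wlk \<omega> t x j) < d" using lt l by (simp add: less_Suc_eq_le)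
  moreover have "l < m" using im l by simp
  ultimately show ?thesis by blast
qed

lemma card_level: "finite {w \<in> V. dep w = n} \<and> card {w \<in> V. dep w = n} \<le> D ^ n"
proof (induction n)
  case 0
  have "{w \<in> V. dep w = 0} = {r}" using dep_0 rV dep_r by auto
  then show ?case by simp
next
  case (Suc n)
  let ?A = "{w \<in> V. dep w = Suc n}" and ?B = "{w \<in> V. dep w = n} \<times> {..<D}"
  have inj: "inj_on (\<lambda>w. (par w, idx w)) ?A"
    by (rule inj_onI, rule idx_inj) (use dep_r in auto)
  have im: "(\<lambda>w. (par w, idx w)) ` ?A \<subseteq> ?B"
  proof (rule image_subsetI)
    fix w assume "w \<in> ?A"
    then have "w \<in> V" "w \<noteq> r" "dep w = Suc n" using dep_r by auto
    then show "(par w, idx w) \<in> ?B" using dep_par[of w] idx_less[of w] par_V[of w] by auto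
  qed
  have fin: "finite ?B" using Suc by simp
  have "card ?A \<le> card ?B" by (rule card_inj_on_le[OF inj im fin])
  also have "\<dots> \<le> D ^ n * D" using Suc by (simp add: card_cartesian_product)
  finally show ?case using inj_on_finite[OF inj im fin] by (simp add: mult.commute)
qed

lemma finite_upto: "finite {w \<in> V. dep w \<le> n}"
proof -
  have "{w \<in> V. dep w \<le> n} = (\<Union>k\<le>n. {w \<in> V. dep w = k})" by auto
  then show ?thesis using card_level by simp
qed

lemma finite_bits: "finite (bits n)"
proof -
  have "bits n \<subseteq> {w \<in> V. dep w \<le> n} \<times> {..<L}" by (auto simp: bits_def)
  then show ?thesis using finite_upto by (meson finite_SigmaI finite_lessThan finite_subset)
qed

text \<open>Hence \<open>Pr (bits n)\<close> suffices for everything that happens before depth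
  \<open>n\<close> is reached.\<close>

lemma edge_at_bits: "edge_at e q t \<Longrightarrow> dep q < n \<Longrightarrow> (e, t mod L) \<in> bits n"
  using dep_par[of e] L_pos unfolding edge_at_def bits_def by (auto simp: mod_L_mod_C)

end

section \<open>First passage to a deeper level while avoiding one child: a supermartingale
  estimate\<close>

section \<open>Transience of the walk in fresh environment\<close>

context coloured_tree
begin

definition win :: "nat \<Rightarrow> nat \<Rightarrow> ('a \<times> nat) set" where
  "win t N = {(e, u mod L) | e u. t \<le> u \<and> u < t + N}"

text \<open>Times less than a period apart read different bits; all freshness statements rest on
  this.\<close>

lemma mod_L_neq:
  assumes "t < u" "u < t + L"
  shows "u mod L \<noteq> t mod L"
proof
  assume "u mod L = t mod L"
  then have "L dvd u - t" using assms by (subst mod_eq_dvd_iff_nat[symmetric]) auto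
  then show False using assms by (auto dest: dvd_imp_le)
qed

lemma win_notin:
  assumes "N < L"
  shows "(e, t mod L) \<notin> win (Suc t) N"
proof
  assume "(e, t mod L) \<in> win (Suc t) N"
  then obtain u where "t mod L = u mod L" "Suc t \<le> u" "u < Suc t + N" unfolding win_def by blast
  then show False using mod_L_neq[of t u] assms by simp
qed

lemma wlk_win:
  assumes "\<omega> \<inter> win t N = \<omega>' \<inter> win t N" "l \<le> N"
  shows "wlk \<omega> t q l = wlk \<omega>' t q l"
proof -
  have "wlk \<omega>' t q l = wlk \<omega> t q l"
  proof (rule wlk_cong[OF _ assms(2)])
    fix l e assume "l < N"
    then have "(e, (t + l) mod L) \<in> win t N" unfolding win_def by (intro CollectI exI[of _ e] exI[of _ "t + l"]) simp
    then show "(e, (t + l) mod L) \<in> \<omega> \<longleftrightarrow> (e, (t + l) mod L) \<in> \<omega>'" using assms(1) by blast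
  qed
  then show ?thesis by simp
qed

text \<open>The subtree of the first child is left unexplored by most of the argument.\<close>

definition slab :: "'a \<Rightarrow> 'a set" where "slab x = sub x - sub (kid x 0)"

definition reaches :: "('a \<times> nat) set \<Rightarrow> 'a \<Rightarrow> nat \<Rightarrow> nat \<Rightarrow> 'a \<Rightarrow> nat \<Rightarrow> bool" where
  "reaches \<omega> x d t q N \<longleftrightarrow> (\<exists>m\<le>N. dep (wlk \<omega> t q m) = d \<and> (\<forall>l\<le>m. wlk \<omega> t q l \<in> slab x))"

lemma reaches_Suc: "reaches \<omega> x d t q (Suc N) \<longleftrightarrow> q \<in> slab x \<and> (dep q = d \<or> reaches \<omega> x d (Suc t) (mv \<omega> t q) N)"
proof
  assume "reaches \<omega> x d t q (Suc N)"
  then obtain m where m: "m \<le> Suc N" "dep (wlk \<omega> t q m) = d" "\<And>l. l \<le> m \<Longrightarrow> wlk \<omega> t q l \<in> slab x"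
    unfolding reaches_def by blast
  have q: "q \<in> slab x" using m(3)[of 0] by simp
  show "q \<in> slab x \<and> (dep q = d \<or> reaches \<omega> x d (Suc t) (mv \<omega> t q) N)"
  proof (cases m)
    case 0
    then show ?thesis using m q by simp
  next
    case (Suc m')
    have "wlk \<omega> (Suc t) (mv \<omega> t q) l \<in> slab x" if "l \<le> m'" for l
      using m(3)[of "Suc l"] that unfolding Suc wlk_Suc_left by simp
    moreover have "dep (wlk \<omega> (Suc t) (mv \<omega> t q) m') = d" using m(2) unfolding Suc wlk_Suc_left .
    moreover have "m' \<le> N" using m(1) Suc by simp
    ultimately show ?thesis using q unfolding reaches_def by blast
  qed
next
  assume *: "q \<in> slab x \<and> (dep q = d \<or> reaches \<omega> x d (Suc t) (mv \<omega> t q) N)"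
  show "reaches \<omega> x d t q (Suc N)"
  proof (cases "dep q = d")
    case True
    then show ?thesis using * unfolding reaches_def by (intro exI[of _ 0]) auto
  next
    case False
    then obtain m where m: "m \<le> N" "dep (wlk \<omega> (Suc t) (mv \<omega> t q) m) = d"
      "\<And>l. l \<le> m \<Longrightarrow> wlk \<omega> (Suc t) (mv \<omega> t q) l \<in> slab x"
      using * unfolding reaches_def by blast
    have "wlk \<omega> t q l \<in> slab x" if "l \<le> Suc m" for l
      using m(3)[of "l - 1"] that * unfolding wlk_Suc_left[symmetric] by (cases l) auto
    moreover have "dep (wlk \<omega> t q (Suc m)) = d" using m(2) unfolding wlk_Suc_left .
    moreover have "Suc m \<le> Suc N" using m(1) by simp
    ultimately show ?thesis unfolding reaches_def by blast
  qed
qed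

lemma reaches_depends: "depends (\<lambda>\<omega>. reaches \<omega> x d t q N) (win t N)"
proof -
  have "reaches \<omega>' x d t q N" if eq: "\<omega> \<inter> win t N = \<omega>' \<inter> win t N" and R: "reaches \<omega> x d t q N" for \<omega> \<omega>'
  proof -
    obtain m where m: "m \<le> N" "dep (wlk \<omega> t q m) = d" "\<forall>l\<le>m. wlk \<omega> t q l \<in> slab x"
      using R unfolding reaches_def by blast
    have "wlk \<omega>' t q l = wlk \<omega> t q l" if "l \<le> m" for l
      using wlk_win[OF eq, of l q] that m(1) by simp
    then show ?thesis unfolding reaches_def using m by auto
  qed
  then show ?thesis unfolding depends_def by metis
qed

text \<open>Markov property: the bit read at time \<open>t\<close> lies outside the window of the
  remaining \<open>N < L\<close> steps, so it is independent of the continuation from either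
  endpoint.\<close>

lemma reaches_pivot:
  assumes "i = (e, t mod L)" "i \<in> bits n" "edge_at e q t" "q \<in> slab x" "dep q \<noteq> d" "N < L"
  shows "Pr (bits n) \<pi> (\<lambda>\<omega>. \<not> reaches \<omega> x d t q (Suc N)) =
    \<pi> i * Pr (bits n) \<pi> (\<lambda>\<omega>. \<not> reaches \<omega> x d (Suc t) (opp e q) N)
    + (1 - \<pi> i) * Pr (bits n) \<pi> (\<lambda>\<omega>. \<not> reaches \<omega> x d (Suc t) q N)"
proof -
  let ?A = "\<lambda>\<omega>. \<not> reaches \<omega> x d t q (Suc N)" and ?B = "\<lambda>q \<omega>. \<not> reaches \<omega> x d (Suc t) q N"
  have step: "?A \<omega> = ?B (mv \<omega> t q) \<omega>" for \<omega>
    unfolding reaches_Suc using assms(4,5) by blast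
  have dep: "depends (?B q') (- {i})" for q'
  proof -
    have "depends (\<lambda>\<omega>. reaches \<omega> x d (Suc t) q' N) (- {i})"
      by (rule depends_mono[OF reaches_depends]) (use win_notin[OF assms(6)] assms(1) in blast)
    then show ?thesis unfolding depends_def by blast
  qed
  have free: "Pr (bits n) (\<pi>(i := y)) (?B q') = Pr (bits n) \<pi> (?B q')" for y q'
    using Pr_flip[OF finite_bits assms(2) dep, of \<pi> y q' "\<pi> i"] by simp
  have 1: "Pr (bits n) (\<pi>(i := 1)) ?A = Pr (bits n) (\<pi>(i := 1)) (?B (opp e q))"
  proof -
    have k: "Pr (bits n) (\<pi>(i := 1)) Q = Pr (bits n) (\<pi>(i := 1)) (\<lambda>\<omega>. Q \<omega> \<and> (i \<in> \<omega> \<longleftrightarrow> True))" for Q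
      by (rule Pr_known[OF finite_bits assms(2)]) simp
    show ?thesis
      by (subst (1 2) k, rule Pr_cong) (use step mv_on[OF assms(3)] assms(1) in auto)
  qed
  have 0: "Pr (bits n) (\<pi>(i := 0)) ?A = Pr (bits n) (\<pi>(i := 0)) (?B q)"
  proof -
    have k: "Pr (bits n) (\<pi>(i := 0)) Q = Pr (bits n) (\<pi>(i := 0)) (\<lambda>\<omega>. Q \<omega> \<and> (i \<in> \<omega> \<longleftrightarrow> False))" for Q
      by (rule Pr_known[OF finite_bits assms(2)]) simp
    show ?thesis
      by (subst (1 2) k, rule Pr_cong) (use step mv_off[OF assms(3)] assms(1) in auto)
  qed
  show ?thesis
    by (subst Pr_pivot[OF finite_bits assms(2)]) (simp only: 0 1 free)
qed

section \<open>A potential that compensates for the order in which the edges are offered\<close>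

definition phase :: "'a \<Rightarrow> nat \<Rightarrow> nat" where "phase q t = (t + (C - col q)) mod C"

lemma phase_less: "phase q t < C" by (simp add: phase_def C_pos)

lemma phase_Suc: "phase q (Suc t) = Suc (phase q t) mod C"
  unfolding phase_def by (simp add: mod_Suc_eq)

lemma t_phase: "t mod C = (col q + phase q t) mod C"
proof -
  have "(col q + phase q t) mod C = (col q + (t + (C - col q))) mod C"
    unfolding phase_def by (simp add: mod_add_right_eq)
  also have "col q + (t + (C - col q)) = t + C" using col_less[of q] by simp
  finally show ?thesis by simp
qed

lemma phase_self: "edge_at q q t \<longleftrightarrow> q \<in> V \<and> q \<noteq> r \<and> phase q t = 0"
proof -
  have "col q = t mod C \<longleftrightarrow> phase q t = 0"
  proof
    assume "col q = t mod C"
    then have "(col q + phase q t) mod C = (col q + 0) mod C" using t_phase[of t q] col_less[of q] by simp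
    then show "phase q t = 0" by (rule add_mod_cancel) (use phase_less C_pos in auto)
  next
    assume "phase q t = 0"
    then show "col q = t mod C" using t_phase[of t q] col_less[of q] by simp
  qed
  then show ?thesis unfolding edge_at_def by blast
qed

lemma phase_child:
  assumes "w \<in> V" "w \<noteq> r"
  shows "edge_at w (par w) t \<longleftrightarrow> phase (par w) t = Suc (idx w)"
proof -
  have "col w = t mod C \<longleftrightarrow> phase (par w) t = Suc (idx w)"
    unfolding t_phase[of t "par w"] col_par[OF assms]
  proof
    assume "(col (par w) + 1 + idx w) mod C = (col (par w) + phase (par w) t) mod C"
    then have "(col (par w) + phase (par w) t) mod C = (col (par w) + Suc (idx w)) mod C" by simp
    then show "phase (par w) t = Suc (idx w)"
      by (rule add_mod_cancel) (use phase_less idx_less[OF assms] in \<open>auto simp: C_def\<close>)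
  qed simp
  then show ?thesis unfolding edge_at_def using assms by blast
qed

lemma phase_after: "edge_at e e t \<Longrightarrow> phase e (Suc t) = 1"
  using C_ge_3 by (simp add: phase_Suc phase_self)

lemma edge_at_cases:
  assumes "edge_at e q t"
  obtains "e = q" "phase q t = 0" "q \<in> V" "q \<noteq> r" "opp e q = par q"
  | "par e = q" "e \<in> V" "e \<noteq> r" "phase q t = Suc (idx e)" "opp e q = e" "phase e (Suc t) = 1"
proof -
  have e: "e \<in> V" "e \<noteq> r" "q = e \<or> q = par e" "edge_at e e t" using assms unfolding edge_at_def by auto
  show thesis
  proof (cases "q = e")
    case True
    then show thesis using that(1) phase_self assms e by (simp add: opp_def)
  next
    case False
    then show thesis using that(2) phase_child[of e t] assms e phase_after[OF e(4)] by (simp add: opp_def)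
  qed
qed

text \<open>The powers of 3/5 alone do not decrease at every step, since the edges are offered one after the other; they are
corrected by a multiple of \<open>p\<close> depending on the phase, i.e. on the time since the parent edge was available. The
constants are one choice for which the inequalities \<open>potential_ineqs\<close> hold.\<close>

definition coef_below :: "nat \<Rightarrow> real" where
  "coef_below \<phi> = (if \<phi> = 1 then 0 else if \<phi> = 2 then 37/100
     else 74/100 - (real (if \<phi> = 0 then C else \<phi>) - 3) / (30 * real C))"

definition coef_top :: "nat \<Rightarrow> real" where
  "coef_top \<phi> = (if \<phi> = 1 then 17/100 else if \<phi> = 2 then 0
     else 37/100 - (real (if \<phi> = 0 then C else \<phi>) - 3) / (30 * real C))"

definition potential :: "real \<Rightarrow> 'a \<Rightarrow> 'a \<Rightarrow> nat \<Rightarrow> real" where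
  "potential p x q \<phi> = (if q = x then 1 + p * coef_top \<phi> else (3/5) ^ (dep q - dep x) * (1 + p * coef_below \<phi>))"

text \<open>Leaving the slab is absorbing with value 11/10. The starting value is close to 1, so the
  supermartingale property keeps the probability of leaving away from 1.\<close>

definition stopped_potential :: "real \<Rightarrow> 'a \<Rightarrow> 'a \<Rightarrow> nat \<Rightarrow> real" where
  "stopped_potential p x q t = (if q \<in> slab x then potential p x q (phase q t) else 11/10)"

text \<open>Half of what the coefficients lose per step in the phases from 3 on. The other half pays
  for the second-order term in \<open>potential_ineqs\<close>, so that the potential shrinks by
  \<open>1 - decay * p\<close> at every step.\<close>

definition decay :: real where "decay = 1 / (60 * real C)"

lemma decay: "0 < decay" "decay \<le> 1/180"
  using C_ge_3 C_pos unfolding decay_def by (auto simp: field_simps)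

lemma drift_bounds:
  assumes "\<phi> < C" "\<phi> \<noteq> 1" "\<phi> \<noteq> 2"
  shows "0 \<le> (real (if \<phi> = 0 then C else \<phi>) - 3) / (30 * real C)"
    "(real (if \<phi> = 0 then C else \<phi>) - 3) / (30 * real C) \<le> 1/30"
proof -
  have "3 \<le> (if \<phi> = 0 then C else \<phi>)" "(if \<phi> = 0 then C else \<phi>) \<le> C" using assms C_ge_3 by auto
  then have "3 \<le> real (if \<phi> = 0 then C else \<phi>)" "real (if \<phi> = 0 then C else \<phi>) \<le> real C"
    by linarith+
  moreover have "0 < real C" using C_pos by simp
  ultimately show "0 \<le> (real (if \<phi> = 0 then C else \<phi>) - 3) / (30 * real C)"
    "(real (if \<phi> = 0 then C else \<phi>) - 3) / (30 * real C) \<le> 1/30"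
    by (auto simp: divide_simps)
qed

lemma coef_below_bounds: "\<phi> < C \<Longrightarrow> \<phi> \<noteq> 1 \<Longrightarrow> \<phi> \<noteq> 2 \<Longrightarrow> 74/100 - 1/30 \<le> coef_below \<phi> \<and> coef_below \<phi> \<le> 74/100"
proof -
  assume *: "\<phi> < C" "\<phi> \<noteq> 1" "\<phi> \<noteq> 2"
  then have "coef_below \<phi> = 74/100 - (real (if \<phi> = 0 then C else \<phi>) - 3) / (30 * real C)"
    unfolding coef_below_def by (simp only: if_False)
  then show ?thesis using drift_bounds[OF *] by linarith
qed

lemma coef_top_bounds: "\<phi> < C \<Longrightarrow> \<phi> \<noteq> 1 \<Longrightarrow> \<phi> \<noteq> 2 \<Longrightarrow> 37/100 - 1/30 \<le> coef_top \<phi> \<and> coef_top \<phi> \<le> 37/100"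
proof -
  assume *: "\<phi> < C" "\<phi> \<noteq> 1" "\<phi> \<noteq> 2"
  then have "coef_top \<phi> = 37/100 - (real (if \<phi> = 0 then C else \<phi>) - 3) / (30 * real C)"
    unfolding coef_top_def by (simp only: if_False)
  then show ?thesis using drift_bounds[OF *] by linarith
qed

lemma coef_below_12: "coef_below 1 = 0" "coef_below (Suc 0) = 0" "coef_below 2 = 37/100" by (auto simp: coef_below_def)
lemma coef_top_12: "coef_top 1 = 17/100" "coef_top (Suc 0) = 17/100" "coef_top 2 = 0" by (auto simp: coef_top_def)

lemma coef_below_01: "\<phi> < C \<Longrightarrow> 0 \<le> coef_below \<phi> \<and> coef_below \<phi> \<le> 74/100"
  using coef_below_bounds[of \<phi>] coef_below_12 by (cases "\<phi> = 1"; cases "\<phi> = 2") auto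

lemma coef_top_01: "\<phi> < C \<Longrightarrow> 0 \<le> coef_top \<phi> \<and> coef_top \<phi> \<le> 37/100"
  using coef_top_bounds[of \<phi>] coef_top_12 by (cases "\<phi> = 1"; cases "\<phi> = 2") auto

lemma coef_below_3: "coef_below (3 mod C) = 74/100" and coef_top_3: "coef_top (3 mod C) = 37/100"
  using C_ge_3 by (cases "C = 3"; simp add: coef_below_def coef_top_def)+

lemma drift_step:
  assumes "3 \<le> \<phi>" "\<phi> < C"
  shows "coef_below (Suc \<phi> mod C) = coef_below \<phi> - 2 * decay" "coef_top (Suc \<phi> mod C) = coef_top \<phi> - 2 * decay"
proof -
  have "(if Suc \<phi> mod C = 0 then C else Suc \<phi> mod C) = Suc \<phi>"
    "Suc \<phi> mod C \<noteq> 1" "Suc \<phi> mod C \<noteq> 2"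
    using assms by (cases "Suc \<phi> = C"; simp)+
  then show "coef_below (Suc \<phi> mod C) = coef_below \<phi> - 2 * decay" "coef_top (Suc \<phi> mod C) = coef_top \<phi> - 2 * decay"
    using assms C_pos unfolding coef_below_def coef_top_def decay_def by (simp_all add: field_simps)
qed

lemma Suc_phase_small: "Suc 0 mod C = 1" "Suc (Suc 0) mod C = 2"
  using C_ge_3 by auto

end

text \<open>One inequality per kind of offered edge, with \<open>k\<close> in the role of
  \<open>decay\<close>: (1) the edge above \<open>x\<close> and (2) the edge to its first child,
  both leading out of the slab; (3) the first child of a vertex below \<open>x\<close>, or the
  second child of \<open>x\<close>; (4) a later phase, with or without an edge; (5) the way up from
  a vertex below \<open>x\<close>; (6) the second child of such a vertex. To first order in
  \<open>p\<close>, a round below \<open>x\<close> changes the potential by a factor with drift at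
  most 5/3 - 1 - 2 * (2/5) = -2/15; this slack finances the corrections.\<close>

lemma potential_ineqs:
  fixes p k A \<pi> :: real
  assumes p: "0 \<le> p" "p \<le> 1/100" and k: "0 < k" "k \<le> 1/180"
  shows "\<lbrakk>37/100 - 1/30 \<le> A; 0 \<le> \<pi>; \<pi> \<le> p\<rbrakk> \<Longrightarrow>
      \<pi> * (11/10) + (1 - \<pi>) * (1 + p * (17/100)) \<le> (1 - k * p) * (1 + p * A)"
    and "p * (11/10) + (1 - p) \<le> (1 - k * p) * (1 + p * (17/100))"
    and "p * (3/5) + (1 - p) * (1 + p * (37/100)) \<le> 1 - k * p"
    and "\<lbrakk>0 \<le> A; A \<le> 1; 0 \<le> \<pi>; \<pi> \<le> 1\<rbrakk> \<Longrightarrow> \<pi> * (3/5) + (1 - \<pi>) * (1 + p * (A - 2 * k)) \<le> (1 - k * p) * (1 + p * A)"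
    and "74/100 - 1/30 \<le> A \<Longrightarrow> p * ((5/3) * (1 + p)) + (1 - p) \<le> (1 - k * p) * (1 + p * A)"
    and "p * (3/5) + (1 - p) * (1 + p * (74/100)) \<le> (1 - k * p) * (1 + p * (37/100))"
proof -
  have kp: "0 \<le> k * p" "k * p \<le> p / 180" using p k mult_right_mono[of k "1/180" p] by auto
  have kp1: "k * p \<le> 1" using kp p by simp
  have pp: "0 \<le> p * p" "p * p \<le> p / 100" using p mult_left_mono[of p "1/100" p] by auto
  have kpp: "0 \<le> k * p * p" "k * p * p \<le> p / 180"
    using kp p mult_left_mono[of p 1 "k * p"] by auto
  have low: "(1 - k * p) * (1 + p * B) \<le> (1 - k * p) * (1 + p * A)" if "B \<le> A" for A B
    using that kp1 p by (intro mult_left_mono add_left_mono) auto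
  show "p * (11/10) + (1 - p) \<le> (1 - k * p) * (1 + p * (17/100))"
    using kp kpp pp p by (simp add: algebra_simps)
  have "p * (3/5) + (1 - p) * (1 + p * (37/100)) = 1 - 3/100 * p - 37/100 * (p * p)"
    by (simp add: field_simps)
  then show "p * (3/5) + (1 - p) * (1 + p * (37/100)) \<le> 1 - k * p"
    using kp pp p by linarith
  have lin: "1 + 34/100 * p - 74/100 * P \<le> 1 + 37/100 * p - K - 37/100 * Q"
    if "0 \<le> P" "K \<le> p / 180" "Q \<le> p / 180" for P K Q
    using that p by linarith
  have "p * (3/5) + (1 - p) * (1 + p * (74/100)) = 1 + 34/100 * p - 74/100 * (p * p)"
    "(1 - k * p) * (1 + p * (37/100)) = 1 + 37/100 * p - k * p - 37/100 * (k * p * p)"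
    by (simp_all add: field_simps)
  then show "p * (3/5) + (1 - p) * (1 + p * (74/100)) \<le> (1 - k * p) * (1 + p * (37/100))"
    using lin[OF pp(1) kp(2) kpp(2)] by argo
  show "p * ((5/3) * (1 + p)) + (1 - p) \<le> (1 - k * p) * (1 + p * A)" if "74/100 - 1/30 \<le> A"
  proof (rule order_trans[OF _ low[OF that]])
    have lin: "1 + 2/3 * p + 5/3 * P \<le> 1 + 53/75 * p - K - 53/75 * Q"
      if "P \<le> p / 100" "K \<le> p / 180" "Q \<le> p / 180" for P K Q
      using that p by linarith
    have "p * ((5/3) * (1 + p)) + (1 - p) = 1 + 2/3 * p + 5/3 * (p * p)"
      "(1 - k * p) * (1 + p * (74/100 - 1/30)) = 1 + 53/75 * p - k * p - 53/75 * (k * p * p)"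
      by (simp_all add: field_simps)
    then show "p * ((5/3) * (1 + p)) + (1 - p) \<le> (1 - k * p) * (1 + p * (74/100 - 1/30))"
      using lin[OF pp(2) kp(2) kpp(2)] by argo
  qed
  show "\<pi> * (11/10) + (1 - \<pi>) * (1 + p * (17/100)) \<le> (1 - k * p) * (1 + p * A)"
    if "37/100 - 1/30 \<le> A" "0 \<le> \<pi>" "\<pi> \<le> p"
  proof (rule order_trans[OF _ low[OF that(1)]])
    have "0 \<le> \<pi> * p" using that p by simp
    have lin: "1 + 1/10 * \<pi> + 17/100 * p - 17/100 * P \<le> 1 + 101/300 * p - K - 101/300 * Q"
      if "0 \<le> P" "K \<le> p / 180" "Q \<le> p / 180" for P K Q
      using that p \<open>\<pi> \<le> p\<close> by linarith
    have "\<pi> * (11/10) + (1 - \<pi>) * (1 + p * (17/100)) = 1 + 1/10 * \<pi> + 17/100 * p - 17/100 * (\<pi> * p)"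
      "(1 - k * p) * (1 + p * (37/100 - 1/30)) = 1 + 101/300 * p - k * p - 101/300 * (k * p * p)"
      by (simp_all add: field_simps)
    then show "\<pi> * (11/10) + (1 - \<pi>) * (1 + p * (17/100)) \<le> (1 - k * p) * (1 + p * (37/100 - 1/30))"
      using lin[OF \<open>0 \<le> \<pi> * p\<close> kp(2) kpp(2)] by argo
  qed
  show "\<pi> * (3/5) + (1 - \<pi>) * (1 + p * (A - 2 * k)) \<le> (1 - k * p) * (1 + p * A)"
    if "0 \<le> A" "A \<le> 1" "0 \<le> \<pi>" "\<pi> \<le> 1"
  proof -
    have pA: "0 \<le> p * A" "p * A \<le> 1" using that p mult_mono[of p 1 A 1] by auto
    have "3/5 \<le> 1 + p * (A - 2 * k)" using pA kp p by (simp add: algebra_simps)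
    then have "\<pi> * (3/5) + (1 - \<pi>) * (1 + p * (A - 2 * k)) \<le> \<pi> * (1 + p * (A - 2 * k)) + (1 - \<pi>) * (1 + p * (A - 2 * k))"
      using that by (intro add_right_mono mult_left_mono) auto
    also have "\<dots> = 1 + p * A - 2 * (k * p)" by (simp add: algebra_simps)
    also have "\<dots> \<le> 1 + p * A - k * p - k * p * (p * A)"
      using mult_left_mono[OF pA(2) kp(1)] by simp
    also have "\<dots> = (1 - k * p) * (1 + p * A)" by (simp add: algebra_simps)
    finally show ?thesis .
  qed
qed

context coloured_tree
begin

lemma slab_V: "q \<in> slab x \<Longrightarrow> q \<in> V" by (auto simp: slab_def dest: sub_V)

lemma sub_root_V: "w \<in> sub v \<Longrightarrow> v \<in> V"
  using dep_funpow_par unfolding sub_def by blast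

lemma slab_self: "x \<in> V \<Longrightarrow> x \<in> slab x"
  using dep_kid_lt[of x 0 x] by (auto simp: slab_def sub_refl)

lemma slab_child:
  assumes "w \<in> V" "w \<noteq> r" "par w \<in> slab x" "w \<noteq> kid x 0"
  shows "w \<in> slab x"
proof -
  have "w \<in> sub x" using sub_down[OF assms(1)] assms(3) by (simp add: slab_def)
  moreover have "w \<notin> sub (kid x 0)" using sub_up[of w "kid x 0"] assms(3,4) by (auto simp: slab_def)
  ultimately show ?thesis by (simp add: slab_def)
qed

lemma slab_par: "q \<in> slab x \<Longrightarrow> q \<noteq> x \<Longrightarrow> par q \<in> slab x"
  using sub_up[of q x] sub_down[of q "kid x 0"] slab_V[of q x] by (auto simp: slab_def)

lemma slab_dep: "q \<in> slab x \<Longrightarrow> q \<noteq> x \<Longrightarrow> dep x < dep q"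
  using sub_dep[of q x] sub_dep_eq[of q x] by (auto simp: slab_def le_less)

lemma slab_dep_le: "q \<in> slab x \<Longrightarrow> dep x \<le> dep q"
  using sub_dep[of q x] by (auto simp: slab_def)

lemma slab_not_r: "q \<in> slab x \<Longrightarrow> q \<noteq> x \<Longrightarrow> q \<noteq> r"
  using slab_dep[of q x] dep_r by auto

lemma par_notin_slab: "x \<in> V \<Longrightarrow> x \<noteq> r \<Longrightarrow> par x \<notin> slab x"
  using slab_dep_le[of "par x" x] dep_par[of x] by auto

lemma kid_eqI:
  assumes "e \<in> V" "e \<noteq> r" "idx e = k" "k < 2"
  shows "e = kid (par e) k"
  by (rule idx_inj) (use assms kid_props[OF par_V[OF assms(1)] assms(4)] in simp_all)

text \<open>Since two children always exist, an edge is missing only in phases from 3 on, or in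
  phase 0 at the root, which then has to be \<open>x\<close>.\<close>

lemma stopped_potential_none:
  assumes p: "0 \<le> p" "p \<le> 1/100" and q: "q \<in> slab x" and none: "\<And>e. \<not> edge_at e q t"
  shows "stopped_potential p x q (Suc t) \<le> (1 - decay * p) * stopped_potential p x q t"
proof -
  have qV: "q \<in> V" using q by (rule slab_V)
  have "phase q t \<noteq> Suc k" if "k < 2" for k
    using phase_child[OF kid_props(1,2)[OF qV that], of t] kid_props[OF qV that] none by auto
  from this[of 0] this[of 1] have n12: "phase q t \<noteq> 1" "phase q t \<noteq> 2" by (auto simp: numeral_2_eq_2)
  note ineq = potential_ineqs[OF p decay]
  show ?thesis
  proof (cases "phase q t = 0")
    case True
    then have "q = r" using phase_self[of q t] none[of q] qV by auto
    then have "q = x" using slab_not_r[OF q] by blast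
    moreover have "1 + p * (17/100) \<le> (1 - decay * p) * (1 + p * coef_top 0)"
      using ineq(1)[of "coef_top 0" 0] coef_top_bounds[of 0] C_pos p by simp
    ultimately show ?thesis using q True C_ge_3 by (simp add: stopped_potential_def potential_def phase_Suc Suc_phase_small coef_top_12)
  next
    case False
    then have \<phi>: "3 \<le> phase q t" "phase q t < C" using n12 phase_less by (auto simp: numeral_3_eq_3 numeral_2_eq_2)
    show ?thesis
    proof (cases "q = x")
      case True
      then show ?thesis using q ineq(4)[of "coef_top (phase q t)" 0] coef_top_01[OF \<phi>(2)] drift_step[OF \<phi>]
        by (simp add: stopped_potential_def potential_def phase_Suc)
    next
      case False
      have "1 + p * coef_below (Suc (phase q t) mod C) \<le> (1 - decay * p) * (1 + p * coef_below (phase q t))"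
        using ineq(4)[of "coef_below (phase q t)" 0] coef_below_01[OF \<phi>(2)] drift_step[OF \<phi>] by simp
      from mult_left_mono[OF this, of "(3/5) ^ (dep q - dep x)"] show ?thesis using q False
        by (simp add: stopped_potential_def potential_def phase_Suc algebra_simps)
    qed
  qed
qed

text \<open>The supermartingale inequality. Only the edge above \<open>x\<close> may carry a
  parameter smaller than \<open>p\<close>; inequality (1) allows this, because crossing that edge
  leads to the absorbing value.\<close>

lemma stopped_potential_edge:
  assumes p: "0 \<le> p" "p \<le> 1/100" and q: "q \<in> slab x" and e: "edge_at e q t"
    and pi: "0 \<le> \<pi>" "\<pi> \<le> p" "e \<noteq> x \<Longrightarrow> \<pi> = p"
  shows "\<pi> * stopped_potential p x (opp e q) (Suc t) + (1 - \<pi>) * stopped_potential p x q (Suc t) \<le> (1 - decay * p) * stopped_potential p x q t"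
proof -
  have qV: "q \<in> V" using q by (rule slab_V)
  have xV: "x \<in> V" using q sub_root_V by (auto simp: slab_def)
  note ineq = potential_ineqs[OF p decay]
  let ?k = "dep q - dep x"
  from e show ?thesis
  proof (cases rule: edge_at_cases)
    case 1
    show ?thesis
    proof (cases "q = x")
      case True
      have "stopped_potential p x (opp e q) (Suc t) = 11/10"
        using 1 True par_notin_slab[OF xV] by (simp add: stopped_potential_def)
      moreover have "stopped_potential p x q (Suc t) = 1 + p * (17/100)" "stopped_potential p x q t = 1 + p * coef_top 0"
        using q True 1 C_ge_3 by (auto simp: stopped_potential_def potential_def phase_Suc Suc_phase_small coef_top_12)
      moreover have "\<pi> * (11/10) + (1 - \<pi>) * (1 + p * (17/100)) \<le> (1 - decay * p) * (1 + p * coef_top 0)"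
        using ineq(1)[of "coef_top 0" \<pi>] coef_top_bounds[of 0] C_pos pi by simp
      ultimately show ?thesis by (simp only:)
    next
      case False
      have k: "0 < ?k" using slab_dep[OF q False] by simp
      have dpar: "dep (par q) - dep x = ?k - 1" using dep_par_diff[OF qV] by simp
      have "stopped_potential p x (par q) (Suc t) \<le> (3/5) ^ (?k - 1) * (1 + p)"
      proof (cases "par q = x")
        case True
        then have "?k - 1 = 0" using dpar by simp
        moreover have "p * coef_top (phase x (Suc t)) \<le> p * 1"
          using coef_top_01[OF phase_less, of x "Suc t"] p by (intro mult_left_mono) auto
        ultimately show ?thesis using True slab_self[OF xV] by (simp add: stopped_potential_def potential_def)
      next
        case ne: False
        have "p * coef_below (phase (par q) (Suc t)) \<le> p * 1"
          using coef_below_01[OF phase_less, of "par q" "Suc t"] p by (intro mult_left_mono) auto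
        then show ?thesis using slab_par[OF q False] ne dpar by (simp add: stopped_potential_def potential_def)
      qed
      then have "p * stopped_potential p x (opp e q) (Suc t) + (1 - p) * stopped_potential p x q (Suc t)
          \<le> p * ((3/5) ^ (?k - 1) * (1 + p)) + (1 - p) * (3/5) ^ ?k"
        using q False 1 p C_ge_3 by (intro add_mono mult_left_mono) (auto simp: stopped_potential_def potential_def phase_Suc Suc_phase_small coef_below_12)
      also have "\<dots> = (3/5) ^ ?k * (p * ((5/3) * (1 + p)) + (1 - p))"
        using k by (cases ?k) (auto simp: field_simps)
      also have "\<dots> \<le> (3/5) ^ ?k * ((1 - decay * p) * (1 + p * coef_below 0))"
        using ineq(5)[of "coef_below 0"] coef_below_bounds[of 0] C_pos by (intro mult_left_mono) auto
      also have "\<dots> = (1 - decay * p) * stopped_potential p x q t"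
        using q False 1 by (simp add: stopped_potential_def potential_def algebra_simps)
      finally show ?thesis using pi False 1 by auto
    qed
  next
    case 2
    have de: "dep e = Suc (dep q)" using dep_par[OF 2(2,3)] 2(1) by simp
    have ex: "e \<noteq> x" using de slab_dep_le[OF q] by auto
    then have pip: "\<pi> = p" using pi by simp
    have k1: "dep e - dep x = Suc ?k" using de slab_dep_le[OF q] by simp
    consider "idx e = 0" | "idx e = 1" | "2 \<le> idx e" by linarith
    then show ?thesis
    proof cases
      case i: 1
      have \<phi>: "phase q t = 1" "phase q (Suc t) = 2" using 2 i by (auto simp: phase_Suc Suc_phase_small)
      show ?thesis
      proof (cases "q = x")
        case True
        have "e = kid x 0" using kid_eqI[OF 2(2,3) i] 2(1) True by simp
        then have "e \<notin> slab x" using kid_props[OF xV, of 0] sub_refl[of e] 2(2) by (simp add: slab_def)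
        then show ?thesis using True q \<phi> 2 ineq(2) pip by (simp add: stopped_potential_def potential_def coef_top_12)
      next
        case False
        have "e \<noteq> kid x 0" using kid_props(3)[OF xV, of 0] 2(1) False by auto
        then have "e \<in> slab x" using slab_child[OF 2(2,3)] 2(1) q by simp
        then have "p * stopped_potential p x (opp e q) (Suc t) + (1 - p) * stopped_potential p x q (Suc t)
          = (3/5) ^ ?k * (p * (3/5) + (1 - p) * (1 + p * (37/100)))"
          using False q \<phi> 2 ex k1 by (simp add: stopped_potential_def potential_def coef_below_12 algebra_simps)
        also have "\<dots> \<le> (3/5) ^ ?k * (1 - decay * p)" using ineq(3) by (intro mult_left_mono) auto
        finally show ?thesis using False q \<phi> pip by (simp add: stopped_potential_def potential_def coef_below_12 mult.commute)
      qed
    next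
      case i: 2
      have \<phi>: "phase q t = 2" "phase q (Suc t) = 3 mod C" using 2 i by (auto simp: phase_Suc numeral_3_eq_3 numeral_2_eq_2)
      have "e \<noteq> kid x 0" using kid_props(4)[OF xV, of 0] i by auto
      then have es: "e \<in> slab x" using slab_child[OF 2(2,3)] 2(1) q by simp
      show ?thesis
      proof (cases "q = x")
        case True
        then show ?thesis using q \<phi> 2(5,6) ineq(3) pip es ex k1 by (simp add: stopped_potential_def potential_def coef_top_12 coef_top_3 coef_below_12)
      next
        case False
        have "p * stopped_potential p x (opp e q) (Suc t) + (1 - p) * stopped_potential p x q (Suc t)
          = (3/5) ^ ?k * (p * (3/5) + (1 - p) * (1 + p * (74/100)))"
          using False q \<phi> 2 ex k1 es by (simp add: stopped_potential_def potential_def coef_below_12 coef_below_3 algebra_simps)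
        also have "\<dots> \<le> (3/5) ^ ?k * ((1 - decay * p) * (1 + p * (37/100)))" using ineq(6) by (intro mult_left_mono) auto
        finally show ?thesis using False q \<phi> pip by (simp add: stopped_potential_def potential_def coef_below_12 algebra_simps)
      qed
    next
      case i: 3
      have \<phi>: "3 \<le> phase q t" "phase q t < C" "phase q (Suc t) = Suc (phase q t) mod C" using 2(4) i phase_less[of q t] by (auto simp: phase_Suc)
      have "e \<noteq> kid x 0" using kid_props(4)[OF xV, of 0] i by auto
      then have es: "e \<in> slab x" using slab_child[OF 2(2,3)] 2(1) q by simp
      show ?thesis
      proof (cases "q = x")
        case True
        then show ?thesis using q \<phi> 2 ineq(4)[of "coef_top (phase q t)" p] coef_top_01[OF \<phi>(2)] p drift_step[OF \<phi>(1,2)] pip es ex k1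
          by (simp add: stopped_potential_def potential_def coef_below_12)
      next
        case False
        have g1: "stopped_potential p x q (Suc t) = (3/5) ^ ?k * (1 + p * (coef_below (phase q t) - 2 * decay))"
          using False q \<phi>(3) drift_step(1)[OF \<phi>(1,2)] by (simp add: stopped_potential_def potential_def)
        have g2: "stopped_potential p x (opp e q) (Suc t) = (3/5) ^ ?k * (3/5)"
          using 2(5,6) ex k1 es by (simp add: stopped_potential_def potential_def coef_below_12)
        have "p * stopped_potential p x (opp e q) (Suc t) + (1 - p) * stopped_potential p x q (Suc t)
          = (3/5) ^ ?k * (p * (3/5) + (1 - p) * (1 + p * (coef_below (phase q t) - 2 * decay)))"
          unfolding g1 g2 by (simp add: algebra_simps)
        also have "\<dots> \<le> (3/5) ^ ?k * ((1 - decay * p) * (1 + p * coef_below (phase q t)))"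
          using ineq(4)[of "coef_below (phase q t)" p] coef_below_01[OF \<phi>(2)] p by (intro mult_left_mono) auto
        finally show ?thesis using False q \<phi> pip by (simp add: stopped_potential_def potential_def algebra_simps)
      qed
    qed
  qed
qed

lemma potential_pos: "0 \<le> p \<Longrightarrow> (3/5) ^ (dep q - dep x) \<le> potential p x q (phase q t)"
proof -
  assume p: "0 \<le> p"
  have "0 \<le> p * coef_below (phase q t)" "0 \<le> p * coef_top (phase q t)"
    using p coef_below_01[OF phase_less] coef_top_01[OF phase_less] by auto
  then show ?thesis by (auto simp: potential_def)
qed

text \<open>Failure means absorption, which contributes the potential divided by 11/10, or survival
  at depth at most \<open>d\<close> for all \<open>N\<close> steps. In the latter case the potential
  is at least \<open>(3/5) ^ (d - dep x)\<close>, although it has lost a factor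
  \<open>1 - decay * p\<close> per step in the mean. These are the two summands.\<close>

lemma reaches_bound_aux:
  assumes xV: "x \<in> V" and p: "0 \<le> p" "p \<le> 1/100" and dn: "d \<le> n" and pr: "prob_on (bits n) \<pi>"
    and q: "q \<in> slab x" "dep q \<le> d" and N: "N \<le> L"
    and pi: "\<And>e u. t \<le> u \<Longrightarrow> u < t + N \<Longrightarrow> e \<in> sub x \<Longrightarrow> (e, u mod L) \<in> bits n \<Longrightarrow>
        \<pi> (e, u mod L) \<le> p \<and> (e \<noteq> x \<longrightarrow> \<pi> (e, u mod L) = p)"
  shows "Pr (bits n) \<pi> (\<lambda>\<omega>. \<not> reaches \<omega> x d t q N) \<le>
    stopped_potential p x q t * (10/11 + (5/3) ^ (d - dep x) * (1 - decay * p) ^ N)"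
  using q N pi
proof (induction N arbitrary: t q)
  case 0
  have V: "stopped_potential p x q t \<ge> (3/5) ^ (dep q - dep x)" using 0 potential_pos[OF p(1)] by (simp add: stopped_potential_def)
  have "1 \<le> stopped_potential p x q t * (5/3) ^ (d - dep x)"
  proof -
    have "(1::real) = (3/5) ^ (d - dep x) * (5/3) ^ (d - dep x)" by (simp add: power_mult_distrib[symmetric])
    also have "\<dots> \<le> (3/5) ^ (dep q - dep x) * (5/3) ^ (d - dep x)"
      using 0 by (intro mult_right_mono power_decreasing) auto
    also have "\<dots> \<le> stopped_potential p x q t * (5/3) ^ (d - dep x)" using V by (intro mult_right_mono) auto
    finally show ?thesis .
  qed
  moreover have "0 \<le> stopped_potential p x q t" using V by (rule order_trans[rotated]) simp
  ultimately have "1 \<le> stopped_potential p x q t * (10/11 + (5/3) ^ (d - dep x) * (1 - decay * p) ^ 0)"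
    by (simp add: distrib_left)
  then show ?case using Pr_le_1[OF finite_bits pr] by (rule order_trans[rotated])
next
  case (Suc N)
  let ?V = "\<lambda>N. 10/11 + (5/3) ^ (d - dep x) * (1 - decay * p) ^ N"
  let ?U = "\<lambda>t q N. Pr (bits n) \<pi> (\<lambda>\<omega>. \<not> reaches \<omega> x d t q N)"
  have kp: "0 \<le> decay * p" "decay * p \<le> 1" using decay p mult_mono[of decay 1 p 1] by auto
  have Vpos: "0 \<le> ?V N" for N using kp by (intro add_nonneg_nonneg mult_nonneg_nonneg zero_le_power) auto
  have Vstep: "(1 - decay * p) * ?V N \<le> ?V (Suc N)"
    using kp by (simp add: algebra_simps)
  have gpos: "0 \<le> stopped_potential p x q' t'" for q' t'
    using order_trans[OF _ potential_pos[OF p(1), of q' x t']] by (simp add: stopped_potential_def)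
  have qV: "q \<in> V" using Suc.prems slab_V by blast
  show ?case
  proof (cases "dep q = d")
    case True
    then have "?U t q (Suc N) = 0" using Suc.prems by (simp add: reaches_Suc)
    then show ?thesis using gpos Vpos[of "Suc N"] by (simp add: mult_nonneg_nonneg)
  next
    case False
    have IH: "?U (Suc t) q' N \<le> stopped_potential p x q' (Suc t) * ?V N" if "dep q' \<le> d" "q' \<in> V" for q'
    proof (cases "q' \<in> slab x")
      case True
      then show ?thesis using that Suc.prems by (intro Suc.IH) auto
    next
      case False
      have "?U (Suc t) q' N \<le> 1" using Pr_le_1[OF finite_bits pr] .
      also have "1 \<le> stopped_potential p x q' (Suc t) * ?V N"
        using False kp by (simp add: stopped_potential_def distrib_left)
      finally show ?thesis .
    qed
    have dq: "dep q < d" using False Suc.prems by simp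
    have "?U t q (Suc N) \<le> ((1 - decay * p) * stopped_potential p x q t) * ?V N"
    proof (cases "\<exists>e. edge_at e q t")
      case True
      then obtain e where e: "edge_at e q t" by blast
      let ?i = "(e, t mod L)"
      have i: "?i \<in> bits n" by (rule edge_at_bits[OF e]) (use dq dn in simp)
      have esub: "e \<in> sub x"
        using e Suc.prems(1) sub_down[of e x] unfolding edge_at_def slab_def by auto
      have pi_e: "0 \<le> \<pi> ?i" "\<pi> ?i \<le> p" "e \<noteq> x \<Longrightarrow> \<pi> ?i = p"
        using Suc.prems(4)[of t e] i esub pr unfolding prob_on_def by auto
      have "dep (opp e q) \<le> d" "opp e q \<in> V"
        using dep_par[of e] dq e par_V unfolding edge_at_def opp_def by auto
      note IHs = IH[OF this] IH[OF Suc.prems(2) qV]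
      have "?U t q (Suc N) = \<pi> ?i * ?U (Suc t) (opp e q) N + (1 - \<pi> ?i) * ?U (Suc t) q N"
        using Suc.prems by (intro reaches_pivot[OF refl i e _ False]) auto
      also have "\<dots> \<le> \<pi> ?i * (stopped_potential p x (opp e q) (Suc t) * ?V N) + (1 - \<pi> ?i) * (stopped_potential p x q (Suc t) * ?V N)"
        using IHs pi_e p by (intro add_mono mult_left_mono) auto
      also have "\<dots> = (\<pi> ?i * stopped_potential p x (opp e q) (Suc t) + (1 - \<pi> ?i) * stopped_potential p x q (Suc t)) * ?V N"
        by (simp only: distrib_right mult.assoc)
      also have "\<dots> \<le> ((1 - decay * p) * stopped_potential p x q t) * ?V N"
        by (rule mult_right_mono[OF stopped_potential_edge[OF p Suc.prems(1) e pi_e] Vpos])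
      finally show ?thesis .
    next
      case none: False
      have "mv \<omega> t q = q" for \<omega> by (rule mv_none) (use none in blast)
      then have "?U t q (Suc N) = ?U (Suc t) q N" using False Suc.prems(1) by (simp add: reaches_Suc)
      also have "\<dots> \<le> stopped_potential p x q (Suc t) * ?V N" by (rule IH[OF Suc.prems(2) qV])
      also have "\<dots> \<le> ((1 - decay * p) * stopped_potential p x q t) * ?V N"
        by (rule mult_right_mono[OF stopped_potential_none[OF p Suc.prems(1)] Vpos]) (use none in blast)
      finally show ?thesis .
    qed
    also have "\<dots> = stopped_potential p x q t * ((1 - decay * p) * ?V N)" by (simp only: mult_ac)
    also have "\<dots> \<le> stopped_potential p x q t * ?V (Suc N)" by (rule mult_left_mono[OF Vstep gpos])
    finally show ?thesis .
  qed
qed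

lemma reaches_bound:
  assumes xV: "x \<in> V" and p: "0 \<le> p" "p \<le> 1/100" and dn: "dep x \<le> d" "d \<le> n"
    and pr: "prob_on (bits n) \<pi>" and N: "N \<le> L"
    and long: "(5/3) ^ (d - dep x) * (1 - decay * p) ^ N \<le> 1/100"
    and pi: "\<And>e u. t \<le> u \<Longrightarrow> u < t + N \<Longrightarrow> e \<in> sub x \<Longrightarrow> (e, u mod L) \<in> bits n \<Longrightarrow>
        \<pi> (e, u mod L) \<le> p \<and> (e \<noteq> x \<longrightarrow> \<pi> (e, u mod L) = p)"
  shows "1/20 \<le> Pr (bits n) \<pi> (\<lambda>\<omega>. reaches \<omega> x d t x N)"
proof -
  have "Pr (bits n) \<pi> (\<lambda>\<omega>. \<not> reaches \<omega> x d t x N) \<le>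
      stopped_potential p x x t * (10/11 + (5/3) ^ (d - dep x) * (1 - decay * p) ^ N)"
    using assms slab_self[OF xV] by (intro reaches_bound_aux) auto
  also have "\<dots> \<le> (1 + 1/100) * (10/11 + 1/100)"
  proof (rule mult_mono)
    have "p * coef_top (phase x t) \<le> (1/100) * 1" using p coef_top_01[OF phase_less, of x t] by (intro mult_mono) auto
    then show "stopped_potential p x x t \<le> 1 + 1/100" using slab_self[OF xV] by (simp add: stopped_potential_def potential_def)
    have "decay * p \<le> 1" using decay p mult_mono[of decay 1 p 1] by auto
    then show "0 \<le> 10/11 + (5/3) ^ (d - dep x) * (1 - decay * p) ^ N"
      by (intro add_nonneg_nonneg mult_nonneg_nonneg zero_le_power) auto
    show "10/11 + (5/3) ^ (d - dep x) * (1 - decay * p) ^ N \<le> 10/11 + 1/100"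
      using long by (rule add_left_mono)
  qed simp
  also have "\<dots> \<le> 19/20" by simp
  finally show ?thesis by (simp add: Pr_not finite_bits)
qed

end

section \<open>The walk after its first hit of a vertex, with two edges held closed\<close>

section \<open>Pausing at a vertex of the first excursion\<close>

lemma card_residue_ge:
  fixes a b c k w :: nat
  assumes "c < k"
  shows "w \<le> card {l. a \<le> l \<and> l < a + w * k \<and> (b + l) mod k = c}"
proof -
  define s where "s = (c + (k - (b + a) mod k)) mod k"
  have sk: "s < k" using assms by (simp add: s_def)
  have s: "(b + (a + i * k + s)) mod k = c" for i
  proof -
    have "(b + (a + i * k + s)) mod k = ((b + a) + s + i * k) mod k" by (simp add: algebra_simps)
    also have "\<dots> = ((b + a) + s) mod k" by simp
    also have "\<dots> = ((b + a) mod k + (c + (k - (b + a) mod k))) mod k"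
      unfolding s_def by (simp add: mod_add_left_eq mod_add_right_eq)
    also have "(b + a) mod k + (c + (k - (b + a) mod k)) = c + k"
      using assms mod_less_divisor[of k "b + a"] by linarith
    finally show ?thesis using assms by simp
  qed
  have "inj_on (\<lambda>i. a + i * k + s) {..<w}" using sk by (auto simp: inj_on_def)
  then have "w = card ((\<lambda>i. a + i * k + s) ` {..<w})" by (simp add: card_image)
  also have "\<dots> \<le> card {l. a \<le> l \<and> l < a + w * k \<and> (b + l) mod k = c}"
  proof (rule card_mono)
    show "finite {l. a \<le> l \<and> l < a + w * k \<and> (b + l) mod k = c}" by simp
    have "i * k + s < w * k" if "i < w" for i
    proof -
      have "i * k + s < Suc i * k" using sk by simp
      also have "\<dots> \<le> w * k" using that by (intro mult_right_mono) auto
      finally show ?thesis .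
    qed
    then show "(\<lambda>i. a + i * k + s) ` {..<w} \<subseteq> {l. a \<le> l \<and> l < a + w * k \<and> (b + l) mod k = c}"
      using s by (auto simp: add.assoc)
  qed
  finally show ?thesis .
qed

context coloured_tree
begin

definition escapes :: "('a \<times> nat) set \<Rightarrow> nat \<Rightarrow> nat \<Rightarrow> 'a \<Rightarrow> bool" where
  "escapes \<omega> n t v \<longleftrightarrow> (\<exists>k. n \<le> dep (wlk \<omega> t v k) \<and> (\<forall>l\<le>k. wlk \<omega> t v l \<in> sub v))"

text \<open>Step \<open>m\<close> is the last one before the entry, so \<open>x\<close> is occupied
  at step \<open>Suc m\<close>. The depth condition makes \<open>x\<close> the first visited vertex
  of its level, hence \<open>(x, m)\<close> unique for each level.\<close>

definition first_hit :: "nat \<Rightarrow> 'a \<Rightarrow> ('a \<times> nat) set \<Rightarrow> 'a \<Rightarrow> nat \<Rightarrow> bool" where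
  "first_hit t v \<omega> x m \<longleftrightarrow> x \<in> slab v \<and> wlk \<omega> t v (Suc m) = x \<and>
     (\<forall>l\<le>m. wlk \<omega> t v l \<in> slab v \<and> dep (wlk \<omega> t v l) < dep x)"

text \<open>The bit of the edge above \<open>v\<close> at the step before \<open>t\<close>, through which the walk may just have entered, is
unconstrained.\<close>

definition fresh :: "nat \<Rightarrow> real \<Rightarrow> 'a \<Rightarrow> nat \<Rightarrow> ('a \<times> nat \<Rightarrow> real) \<Rightarrow> bool" where
  "fresh n p v t \<pi> \<longleftrightarrow> prob_on (bits n) \<pi> \<and>
     (\<forall>e u. (e, u) \<in> bits n \<longrightarrow> e \<in> sub v \<longrightarrow> e \<noteq> v \<longrightarrow> \<pi> (e, u) = p) \<and>
     (\<forall>u. (v, u) \<in> bits n \<longrightarrow> u \<noteq> (t + L - 1) mod L \<longrightarrow> \<pi> (v, u) \<le> p)"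

text \<open>The walk from \<open>v\<close> escapes to depth \<open>n\<close>, and the paths to its first vertices at depths
\<open>d\<close> and \<open>n\<close> separate exactly at level \<open>j\<close>.\<close>

definition splits :: "('a \<times> nat) set \<Rightarrow> nat \<Rightarrow> nat \<Rightarrow> nat \<Rightarrow> 'a \<Rightarrow> nat \<Rightarrow> bool" where
  "splits \<omega> n d t v j \<longleftrightarrow> (\<exists>k kn. dep (wlk \<omega> t v k) = d \<and> (\<forall>l<k. dep (wlk \<omega> t v l) < d) \<and>
     n \<le> dep (wlk \<omega> t v kn) \<and> (\<forall>l<kn. dep (wlk \<omega> t v l) < n) \<and> (\<forall>l\<le>kn. wlk \<omega> t v l \<in> sub v) \<and>
     anc j (wlk \<omega> t v k) = anc j (wlk \<omega> t v kn) \<and>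
     anc (Suc j) (wlk \<omega> t v k) \<noteq> anc (Suc j) (wlk \<omega> t v kn))"

text \<open>The part of a configuration that is revealed when working at \<open>x\<close>. An edge
  being named by its lower endpoint, what is erased is the edge above \<open>x\<close>, the edge to
  its first child and everything below that child.\<close>

definition off :: "'a \<Rightarrow> ('a \<times> nat) set \<Rightarrow> ('a \<times> nat) set" where
  "off x \<omega> = {(e, u) \<in> \<omega>. e \<noteq> x \<and> e \<notin> sub (kid x 0)}"

lemma first_hit_cross:
  assumes "first_hit t v \<omega> x m"
  shows "wlk \<omega> t v m = par x" "x \<noteq> r" "edge_at x (par x) (t + m)" "(x, (t + m) mod L) \<in> \<omega>"
proof -
  have 1: "wlk \<omega> t v m \<notin> sub x" using assms sub_dep[of "wlk \<omega> t v m" x] by (auto simp: first_hit_def)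
  have 2: "mv \<omega> (t + m) (wlk \<omega> t v m) \<in> sub x"
    using assms slab_V[of x v] sub_refl[of x] by (simp add: first_hit_def)
  show q: "wlk \<omega> t v m = par x" and "x \<noteq> r" "(x, (t + m) mod L) \<in> \<omega>"
    using mv_enter[OF 1 2] by simp_all
  show "edge_at x (par x) (t + m)" using mv_enter(4)[OF 1 2] q by simp
qed

lemma first_hit_unique:
  assumes "first_hit t v \<omega> x m" "first_hit t v \<omega> x' m'" "dep x = dep x'"
  shows "x = x' \<and> m = m'"
proof -
  have "\<not> m < m'" if "first_hit t v \<omega> x m" "first_hit t v \<omega> x' m'" "dep x = dep x'" for x m x' m'
    using that unfolding first_hit_def by (metis Suc_leI nat_less_le)
  then have "m = m'" using assms by (metis linorder_neqE_nat)
  then show ?thesis using assms by (auto simp: first_hit_def)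
qed

lemma reaches_first_hit:
  assumes "reaches \<omega> v d t v N" "dep v < d"
  shows "\<exists>x m. m < N \<and> x \<in> V \<and> dep x = d \<and> first_hit t v \<omega> x m"
proof -
  obtain k where k: "k \<le> N" "dep (wlk \<omega> t v k) = d" "\<And>l. l \<le> k \<Longrightarrow> wlk \<omega> t v l \<in> slab v"
    using assms unfolding reaches_def by blast
  have vV: "v \<in> V" using k(3)[of 0] slab_V by simp
  obtain m where m: "m < k" "dep (wlk \<omega> t v (Suc m)) = d" "\<And>i. i \<le> m \<Longrightarrow> dep (wlk \<omega> t v i) < d"
    using dep_wlk_first[OF vV assms(2), of \<omega> t k] k by auto
  then show ?thesis
    using k by (intro exI[of _ "wlk \<omega> t v (Suc m)"] exI[of _ m]) (auto simp: first_hit_def wlk_V[OF vV] simp del: wlk.simps)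
qed

lemma edge_at_child_dep: "edge_at e q u \<Longrightarrow> par e = x \<Longrightarrow> dep x \<le> dep q"
  using dep_par[of e] unfolding edge_at_def by auto

text \<open>Child edges of \<open>x\<close> are offered only at depth \<open>dep x\<close> or more,
  which the walk has not reached by step \<open>m\<close>. Their absence makes the hit independent
  of the quiet window, which consists of such edges.\<close>

lemma first_hit_depends: "depends (\<lambda>\<omega>. first_hit t v \<omega> x m) {(e, u mod L) | e u. t \<le> u \<and> u \<le> t + m \<and> par e \<noteq> x}"
proof -
  let ?J = "{(e, u mod L) | e u. t \<le> u \<and> u \<le> t + m \<and> par e \<noteq> x}"
  have imp: "first_hit t v \<omega>' x m" if eq: "\<omega> \<inter> ?J = \<omega>' \<inter> ?J" and f: "first_hit t v \<omega> x m" for \<omega> \<omega>'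
  proof -
    have same: "wlk \<omega>' t v l = wlk \<omega> t v l" if "l \<le> Suc m" for l
    proof (rule wlk_cong[OF _ that])
      fix l e assume l: "l < Suc m" "edge_at e (wlk \<omega> t v l) (t + l)"
      then have "par e \<noteq> x" using edge_at_child_dep[OF l(2), of x] f by (auto simp: first_hit_def less_Suc_eq_le)
      then have "(e, (t + l) mod L) \<in> ?J" using l(1) by (intro CollectI exI[of _ e] exI[of _ "t + l"]) simp
      then show "(e, (t + l) mod L) \<in> \<omega> \<longleftrightarrow> (e, (t + l) mod L) \<in> \<omega>'" using eq by blast
    qed
    have 1: "wlk \<omega>' t v (Suc m) = wlk \<omega> t v (Suc m)" by (rule same) (rule order_refl)
    have 2: "wlk \<omega>' t v l \<in> slab v \<and> dep (wlk \<omega>' t v l) < dep x" if "l \<le> m" for l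
    proof -
      have "wlk \<omega>' t v l = wlk \<omega> t v l" by (rule same) (use that in simp)
      then show ?thesis using f that unfolding first_hit_def by presburger
    qed
    show ?thesis unfolding first_hit_def 1 using f 2 unfolding first_hit_def by blast
  qed
  show ?thesis
    unfolding depends_def
  proof (intro allI impI)
    fix S S' assume "S \<inter> ?J = S' \<inter> ?J"
    then show "first_hit t v S x m = first_hit t v S' x m" using imp[of S S'] imp[of S' S] by blast
  qed
qed

section \<open>The virtual walk over a fixed revealed configuration\<close>

context
  fixes v x :: 'a and t m :: nat and \<omega>0 :: "('a \<times> nat) set"
  assumes xV: "x \<in> V" and xr: "x \<noteq> r" and colx: "col x = (t + m) mod C"
    and off0: "\<And>e u. (e, u) \<in> \<omega>0 \<Longrightarrow> e \<noteq> x \<and> e \<notin> sub (kid x 0)"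
begin

abbreviation "z \<equiv> kid x 0"
text \<open>The virtual walk: the continuation of a walk that has entered \<open>x\<close> at step \<open>t + m\<close>, with the edges above
\<open>x\<close> and \<open>z\<close> closed. It is closed up at \<open>l\<close> when it meets the edge it came through at the time of entry.\<close>

definition vwalk :: "nat \<Rightarrow> 'a" where "vwalk l = wlk \<omega>0 (Suc (t + m)) x l"
definition asks_x :: "nat \<Rightarrow> bool" where "asks_x l \<longleftrightarrow> edge_at x (vwalk l) (Suc (t + m) + l)"
definition asks_z :: "nat \<Rightarrow> bool" where "asks_z l \<longleftrightarrow> edge_at z (vwalk l) (Suc (t + m) + l)"
definition exposed_x :: "nat \<Rightarrow> ('a \<times> nat) set" where
  "exposed_x k = {(x, (Suc (t + m) + l) mod L) | l. l < k \<and> asks_x l}"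
definition exposed_z :: "nat \<Rightarrow> ('a \<times> nat) set" where
  "exposed_z k = {(z, (Suc (t + m) + l) mod L) | l. l < k \<and> asks_z l}"
text \<open>Requests for the edge above \<open>x\<close> before the entry; on a first hit all of
  them were refused.\<close>

definition known_x :: "('a \<times> nat) set" where
  "known_x = {(x, (t + l) mod L) | l. l < m \<and> edge_at x (wlk \<omega>0 t v l) (t + l)}"
definition closed_at :: "nat \<Rightarrow> bool" where
  "closed_at l \<longleftrightarrow> vwalk l = x \<and> (Suc (t + m) + l) mod L = (t + m) mod L"

lemma zV: "z \<in> V" "z \<noteq> r" "par z = x" "dep z = Suc (dep x)" "z \<noteq> x" "idx z = 0"
  using kid_props[OF xV, of 0] dep_kid[OF xV, of 0] by auto

lemma x_notin_z: "x \<notin> sub z" using dep_kid_lt[OF xV, of 0 x] by auto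

lemma vwalk_Suc: "vwalk (Suc l) = mv \<omega>0 (Suc (t + m) + l) (vwalk l)" by (simp add: vwalk_def)

lemma vwalk_slab: "vwalk l \<in> slab x"
proof (induction l)
  case 0
  then show ?case using slab_self[OF xV] by (simp add: vwalk_def)
next
  case (Suc l)
  have "vwalk (Suc l) \<in> sub x"
    using mv_exit(5)[of "vwalk l" x] off0 Suc unfolding vwalk_Suc slab_def by blast
  moreover have "vwalk (Suc l) \<notin> sub z"
    using mv_enter(5)[of "vwalk l" z] off0 Suc sub_refl[OF zV(1)] unfolding vwalk_Suc slab_def by blast
  ultimately show ?case by (simp add: slab_def)
qed

lemma asks_x_iff: "asks_x l \<longleftrightarrow> vwalk l = x \<and> (Suc (t + m) + l) mod C = col x"
  using par_notin_slab[OF xV xr] vwalk_slab[of l] xV xr unfolding asks_x_def edge_at_def by auto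

lemma asks_z_iff: "asks_z l \<longleftrightarrow> vwalk l = x \<and> (Suc (t + m) + l) mod C = col z"
  using sub_refl[OF zV(1)] vwalk_slab[of l] zV unfolding asks_z_def edge_at_def slab_def by auto

text \<open>\<open>z\<close> has index 0, so its edge carries the colour right after that of the
  edge above \<open>x\<close>, and the refused walk is still at \<open>x\<close>. For this reason
  the first child is the reserved one.\<close>

lemma asks_x_next: "asks_x l \<Longrightarrow> vwalk (Suc l) = x \<and> asks_z (Suc l)"
proof -
  assume asks_x: "asks_x l"
  then have Yl: "vwalk l = x" "(Suc (t + m) + l) mod C = col x" by (auto simp: asks_x_iff)
  have "mv \<omega>0 (Suc (t + m) + l) x = x"
    by (rule mv_off[of x]) (use asks_x off0 Yl in \<open>auto simp: asks_x_def\<close>)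
  then have "vwalk (Suc l) = x" using Yl by (simp add: vwalk_Suc)
  moreover have "(Suc (t + m) + Suc l) mod C = col z"
  proof -
    have "(Suc (t + m) + Suc l) mod C = ((Suc (t + m) + l) mod C + 1) mod C" by (simp add: mod_Suc_eq)
    then show ?thesis using col_par[OF zV(1,2)] zV Yl by simp
  qed
  ultimately show ?thesis by (simp add: asks_z_iff)
qed

lemma mv_back: "vwalk (Suc l) = x \<Longrightarrow> vwalk l = mv \<omega>0 (Suc (t + m) + l) x"
  using mv_invol[of \<omega>0 "Suc (t + m) + l" "vwalk l"] by (simp add: vwalk_Suc)

text \<open>A recurrence after a multiple of the period pulls back to a return to \<open>x\<close>
  at step \<open>c\<close>. The step leading there has the time of the entry bit modulo
  \<open>L\<close>; at that time the edge above \<open>x\<close> has the current colour but is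
  closed in \<open>\<omega>0\<close>, so the virtual walk was at \<open>x\<close> already.\<close>

lemma closes:
  assumes "0 < c" "L dvd c" "vwalk a = vwalk (a + c)"
  shows "closed_at (c - 1)"
proof -
  have "vwalk c = x" unfolding vwalk_def by (rule wlk_closes[OF _ assms(2), of _ _ _ a]) (use assms in \<open>simp add: vwalk_def\<close>)
  then obtain l where l: "c = Suc l" "vwalk (Suc l) = x" using assms(1) by (cases c) auto
  have time: "(Suc (t + m) + l) mod L = (t + m) mod L"
  proof -
    have "Suc (t + m) + l = (t + m) + Suc l" by simp
    then show ?thesis using assms(2) unfolding l(1) by (metis add.right_neutral dvd_imp_mod_0 mod_add_right_eq)
  qed
  then have "(Suc (t + m) + l) mod C = (t + m) mod C" by (metis mod_L_mod_C)
  then have "mv \<omega>0 (Suc (t + m) + l) x = x"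
    by (intro mv_off[of x]) (use off0 xV xr colx in \<open>auto simp: edge_at_def\<close>)
  then have "vwalk l = x" using mv_back[OF l(2)] by simp
  then show ?thesis using time l(1) by (auto simp: closed_at_def)
qed

text \<open>Until the walk closes up, no bit of the two closed edges is requested twice, so
  different requests are independent.\<close>

lemma repeat_closed:
  assumes "l1 < l2" "vwalk l1 = x" "vwalk l2 = x" "(Suc (t + m) + l1) mod L = (Suc (t + m) + l2) mod L"
  shows "\<exists>l<l2. closed_at l"
proof -
  have "L dvd (Suc (t + m) + l2) - (Suc (t + m) + l1)"
    using assms by (subst mod_eq_dvd_iff_nat[symmetric]) auto
  then have "L dvd l2 - l1" by simp
  then have "closed_at (l2 - l1 - 1)" by (rule closes[OF _ _, of _ l1, rotated]) (use assms in auto)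
  moreover have "l2 - l1 - 1 < l2" using assms(1) by simp
  ultimately show ?thesis by blast
qed

text \<open>Run backwards from the closing time: for \<open>W\<close> steps all edges at
  \<open>x\<close> are closed in \<open>\<omega>0\<close>, so the walk must have waited at
  \<open>x\<close> for \<open>w\<close> whole rounds, asking for \<open>z\<close> once in each. The
  bound \<open>k0 + W + 1 \<le> L\<close> places these requests after \<open>k0\<close>.\<close>

lemma closed_exposes:
  assumes W: "W = w * C" "k0 + W + 1 \<le> L" and cl: "closed_at l"
    and quiet: "\<And>e u. e \<in> V \<Longrightarrow> e \<noteq> r \<Longrightarrow> par e = x \<Longrightarrow> e \<noteq> z \<Longrightarrow>
      t + m + L - W \<le> u \<Longrightarrow> u < t + m + L \<Longrightarrow> (e, u mod L) \<notin> \<omega>0"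
  shows "w \<le> card {i. k0 \<le> i \<and> i < l \<and> asks_z i}"
proof -
  have "(t + m + Suc l) mod L = (t + m) mod L" using cl by (simp add: closed_at_def)
  then have "L dvd (t + m + Suc l) - (t + m)" by (subst mod_eq_dvd_iff_nat[symmetric]) auto
  then have "L dvd Suc l" by simp
  then obtain c where c: "Suc l = L * c" by blast
  then obtain c' where c': "c = Suc c'" by (cases c) auto
  have lL: "L \<le> Suc l" unfolding c c' by simp
  have stay: "vwalk (l - i) = x" if "i \<le> W" for i
    using that
  proof (induction i)
    case 0
    then show ?case using cl by (simp add: closed_at_def)
  next
    case (Suc i)
    then have i: "Suc i \<le> l" using lL W by linarith
    let ?u = "Suc (t + m) + (l - Suc i)"
    have "Suc (l - Suc i) = l - i" using i by simp
    then have Y': "vwalk (l - Suc i) = mv \<omega>0 ?u x" using Suc mv_back[of "l - Suc i"] by simp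
    have "?u = (t + m + L - Suc i) + c' * L" using i lL c c' Suc.prems W by (simp add: algebra_simps)
    then have um: "?u mod L = (t + m + L - Suc i) mod L" by simp
    have "mv \<omega>0 ?u x = x"
    proof (rule mv_none)
      fix e assume e: "edge_at e x ?u"
      show "(e, ?u mod L) \<notin> \<omega>0"
      proof (cases "e = x \<or> e = z")
        case True
        then show ?thesis using off0 sub_refl[OF zV(1)] by blast
      next
        case False
        then show ?thesis unfolding um
          by (intro quiet) (use e Suc.prems W in \<open>auto simp: edge_at_def\<close>)
      qed
    qed
    then show ?case using Y' by simp
  qed
  have "w \<le> card {i. l - W \<le> i \<and> i < l - W + w * C \<and> (Suc (t + m) + i) mod C = col z}"
    by (rule card_residue_ge[OF col_less])
  also have "\<dots> \<le> card {i. k0 \<le> i \<and> i < l \<and> asks_z i}"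
  proof (rule card_mono)
    have "vwalk i = x" if "l - W \<le> i" "i < l" for i
      using stay[of "l - i"] that by simp
    moreover have "W \<le> l" "k0 \<le> l - W" using lL W by linarith+
    ultimately show "{i. l - W \<le> i \<and> i < l - W + w * C \<and> (Suc (t + m) + i) mod C = col z}
        \<subseteq> {i. k0 \<le> i \<and> i < l \<and> asks_z i}"
      using W by (auto simp: asks_z_iff)
  qed simp
  finally show ?thesis .
qed

lemma edge_slab:
  assumes "edge_at e q u" "q \<in> slab x" "e \<noteq> x" "e \<noteq> z"
  shows "e \<notin> sub z"
  using assms sub_up[of e z] unfolding edge_at_def slab_def by auto

text \<open>The only erased edges that can be offered inside the slab are those above
  \<open>x\<close> and \<open>z\<close>; with their requested bits closed, the real walk cannot
  notice the erasure.\<close>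

lemma follow:
  assumes "off x \<omega> = \<omega>0" "\<omega> \<inter> exposed_x k = {}" "\<omega> \<inter> exposed_z k = {}" "l \<le> k"
  shows "wlk \<omega> (Suc (t + m)) x l = vwalk l"
  unfolding vwalk_def
proof (rule wlk_cong[OF _ assms(4)])
  fix l e assume l: "l < k" and e: "edge_at e (wlk \<omega>0 (Suc (t + m)) x l) (Suc (t + m) + l)"
  have "(x, (Suc (t + m) + l) mod L) \<notin> \<omega>" if "e = x"
    using assms(2) l e that by (auto simp: exposed_x_def asks_x_def vwalk_def)
  moreover have "(z, (Suc (t + m) + l) mod L) \<notin> \<omega>" if "e = z"
    using assms(3) l e that by (auto simp: exposed_z_def asks_z_def vwalk_def)
  moreover have "e \<notin> sub z" if "e \<noteq> x" "e \<noteq> z"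
    using edge_slab[OF e _ that] vwalk_slab[of l] by (simp add: vwalk_def)
  ultimately show "(e, (Suc (t + m) + l) mod L) \<in> \<omega>0 \<longleftrightarrow> (e, (Suc (t + m) + l) mod L) \<in> \<omega>"
    using off0 assms(1) unfolding off_def by blast
qed

text \<open>A granted request would lead to \<open>par x\<close> or to \<open>z\<close>, both
  outside the slab; so staying inside forces every request to have been refused.\<close>

lemma follow_rev:
  assumes off: "off x \<omega> = \<omega>0" and stay: "\<And>l. l \<le> k \<Longrightarrow> wlk \<omega> (Suc (t + m)) x l \<in> slab x"
  shows "l \<le> k \<Longrightarrow> vwalk l = wlk \<omega> (Suc (t + m)) x l" "\<omega> \<inter> exposed_x k = {}" "\<omega> \<inter> exposed_z k = {}"
proof -
  have bits: "(x, (Suc (t + m) + l) mod L) \<notin> \<omega>"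
    if l: "l < k" and e: "edge_at x (wlk \<omega> (Suc (t + m)) x l) (Suc (t + m) + l)" for l
  proof
    assume "(x, (Suc (t + m) + l) mod L) \<in> \<omega>"
    then have "wlk \<omega> (Suc (t + m)) x (Suc l) = opp x (wlk \<omega> (Suc (t + m)) x l)"
      using mv_on[OF e] by simp
    moreover have "wlk \<omega> (Suc (t + m)) x l = x"
      using e stay[of l] l par_notin_slab[OF xV xr] unfolding edge_at_def by auto
    ultimately have "wlk \<omega> (Suc (t + m)) x (Suc l) = par x" unfolding opp_def by simp
    then show False using stay[of "Suc l"] l par_notin_slab[OF xV xr] by simp
  qed
  have bitsz: "(z, (Suc (t + m) + l) mod L) \<notin> \<omega>"
    if l: "l < k" and e: "edge_at z (wlk \<omega> (Suc (t + m)) x l) (Suc (t + m) + l)" for l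
  proof
    assume "(z, (Suc (t + m) + l) mod L) \<in> \<omega>"
    then have "wlk \<omega> (Suc (t + m)) x (Suc l) = opp z (wlk \<omega> (Suc (t + m)) x l)"
      using mv_on[OF e] by simp
    moreover have "wlk \<omega> (Suc (t + m)) x l \<noteq> z"
      using stay[of l] l sub_refl[OF zV(1)] unfolding slab_def by auto
    ultimately have "wlk \<omega> (Suc (t + m)) x (Suc l) = z"
      using e unfolding opp_def edge_at_def by auto
    then show False using stay[of "Suc l"] l sub_refl[OF zV(1)] unfolding slab_def by auto
  qed
  have eq: "vwalk l = wlk \<omega> (Suc (t + m)) x l" if "l \<le> k" for l
    unfolding vwalk_def
  proof (rule wlk_cong[OF _ that])
    fix l e assume l: "l < k" and e: "edge_at e (wlk \<omega> (Suc (t + m)) x l) (Suc (t + m) + l)"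
    have "e \<notin> sub z" if "e \<noteq> x" "e \<noteq> z"
      using edge_slab[OF e _ that] stay[of l] l by simp
    then show "(e, (Suc (t + m) + l) mod L) \<in> \<omega> \<longleftrightarrow> (e, (Suc (t + m) + l) mod L) \<in> \<omega>0"
      using bits[OF l] bitsz[OF l] e off0 off unfolding off_def by blast
  qed
  then show "l \<le> k \<Longrightarrow> vwalk l = wlk \<omega> (Suc (t + m)) x l" .
  show "\<omega> \<inter> exposed_x k = {}" using bits eq by (auto simp: exposed_x_def asks_x_def)
  show "\<omega> \<inter> exposed_z k = {}" using bitsz eq by (auto simp: exposed_z_def asks_z_def)
qed

lemma edge_not_below: "edge_at e q u \<Longrightarrow> dep q < dep x \<Longrightarrow> e \<noteq> x \<Longrightarrow> e \<notin> sub z"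
  using dep_par[of e] sub_dep[of e z] zV(4) unfolding edge_at_def by auto

lemma first_hit_follow:
  assumes off: "off x \<omega> = \<omega>0" and first_hit: "first_hit t v \<omega> x m"
  shows "l \<le> m \<Longrightarrow> wlk \<omega>0 t v l = wlk \<omega> t v l" "\<omega> \<inter> known_x = {}"
proof -
  have bits: "(x, (t + l) mod L) \<notin> \<omega>" if l: "l < m" and e: "edge_at x (wlk \<omega> t v l) (t + l)" for l
  proof
    assume "(x, (t + l) mod L) \<in> \<omega>"
    then have "wlk \<omega> t v (Suc l) = opp x (wlk \<omega> t v l)" using mv_on[OF e] by simp
    moreover have "wlk \<omega> t v l \<noteq> x" using first_hit l unfolding first_hit_def by (metis less_imp_le less_irrefl)
    ultimately have "wlk \<omega> t v (Suc l) = x" using e unfolding opp_def edge_at_def by auto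
    then show False using first_hit l unfolding first_hit_def by (metis Suc_leI less_irrefl)
  qed
  have eq: "wlk \<omega>0 t v l = wlk \<omega> t v l" if "l \<le> m" for l
  proof (rule wlk_cong[OF _ that])
    fix l e assume l: "l < m" and e: "edge_at e (wlk \<omega> t v l) (t + l)"
    have "e \<notin> sub z" if "e \<noteq> x"
      using edge_not_below[OF e _ that] first_hit l unfolding first_hit_def by simp
    then show "(e, (t + l) mod L) \<in> \<omega> \<longleftrightarrow> (e, (t + l) mod L) \<in> \<omega>0"
      using bits[OF l] e off0 off unfolding off_def by blast
  qed
  then show "l \<le> m \<Longrightarrow> wlk \<omega>0 t v l = wlk \<omega> t v l" .
  show "\<omega> \<inter> known_x = {}" using bits eq by (auto simp: known_x_def)
qed

text \<open>Given the revealed part, a first hit is a cylinder event for the edge above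
  \<open>x\<close>: earlier requests refused, entry bit open.\<close>

lemma first_hit_follow_rev:
  assumes off: "off x \<omega> = \<omega>0" and k: "\<omega> \<inter> known_x = {}" and x: "(x, (t + m) mod L) \<in> \<omega>" "x \<in> slab v"
    and path: "\<And>l. l \<le> m \<Longrightarrow> wlk \<omega>0 t v l \<in> slab v \<and> dep (wlk \<omega>0 t v l) < dep x"
    and last: "wlk \<omega>0 t v m = par x"
  shows "first_hit t v \<omega> x m" 
proof -
  have eq: "wlk \<omega> t v l = wlk \<omega>0 t v l" if "l \<le> m" for l
  proof (rule wlk_cong[OF _ that])
    fix l e assume l: "l < m" and e: "edge_at e (wlk \<omega>0 t v l) (t + l)"
    have "e \<notin> sub z" if "e \<noteq> x"
      using edge_not_below[OF e _ that] path[of l] l by simp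
    moreover have "(x, (t + l) mod L) \<notin> \<omega>" if "e = x"
      using k l e that by (auto simp: known_x_def)
    ultimately show "(e, (t + l) mod L) \<in> \<omega>0 \<longleftrightarrow> (e, (t + l) mod L) \<in> \<omega>"
      using off0 off unfolding off_def by blast
  qed
  have "edge_at x (par x) (t + m)" using xV xr colx by (simp add: edge_at_def)
  then have "mv \<omega> (t + m) (par x) = x"
    using mv_on[of x "par x" "t + m" \<omega>] x(1) par_neq[OF xV xr] by (simp add: opp_def)
  then have "wlk \<omega> t v (Suc m) = x" using eq[of m] last by simp
  then show ?thesis using eq path x(2) unfolding first_hit_def by simp
qed

abbreviation "hit_bit \<equiv> (x, (t + m) mod L)"

text \<open>The bits whose values are prescribed when the virtual path is followed for
  \<open>k\<close> steps: \<open>hit_bit\<close> open, all others closed.\<close>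

definition exposed :: "nat \<Rightarrow> ('a \<times> nat) set" where "exposed k = known_x \<union> exposed_x k \<union> exposed_z k \<union> {hit_bit}"
definition requests :: "nat \<Rightarrow> nat \<Rightarrow> nat" where "requests k0 k = card {i. k0 \<le> i \<and> i < k \<and> asks_z i}"

lemma requests_mono: "k \<le> k' \<Longrightarrow> requests k0 k \<le> requests k0 k'"
  unfolding requests_def by (intro card_mono) auto

lemma exposed_x_mono: "k \<le> k' \<Longrightarrow> exposed_x k \<subseteq> exposed_x k'" and exposed_z_mono: "k \<le> k' \<Longrightarrow> exposed_z k \<subseteq> exposed_z k'"
  unfolding exposed_x_def exposed_z_def by fastforce+

lemma hit_bit_notin_exposed_x: "(\<And>l. l < k \<Longrightarrow> \<not> closed_at l) \<Longrightarrow> hit_bit \<notin> exposed_x k"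
proof
  assume nc: "\<And>l. l < k \<Longrightarrow> \<not> closed_at l" and "hit_bit \<in> exposed_x k"
  then obtain l where "l < k" "asks_x l" "(Suc (t + m) + l) mod L = (t + m) mod L" unfolding exposed_x_def by auto
  then show False using nc[of l] unfolding closed_at_def asks_x_iff by blast
qed

lemma hit_bit_notin_exposed_z: "hit_bit \<notin> exposed_z k" using zV by (auto simp: exposed_z_def)

lemma hit_bit_notin_known_x: "m < L \<Longrightarrow> hit_bit \<notin> known_x"
proof
  assume "m < L" "hit_bit \<in> known_x"
  then obtain l where "l < m" "(t + m) mod L = (t + l) mod L" by (auto simp: known_x_def)
  then show False using mod_L_neq[of "t + l" "t + m"] \<open>m < L\<close> by simp
qed

lemma card_asks_x_le: "card {i. k0 \<le> i \<and> i < k \<and> asks_x i} \<le> Suc (requests k0 k)"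
proof -
  have "card {i. k0 \<le> i \<and> i < k \<and> asks_x i} = card (Suc ` {i. k0 \<le> i \<and> i < k \<and> asks_x i})"
    by (simp add: card_image)
  also have "\<dots> \<le> card (insert k {i. k0 \<le> i \<and> i < k \<and> asks_z i})"
  proof (rule card_mono)
    show "Suc ` {i. k0 \<le> i \<and> i < k \<and> asks_x i} \<subseteq> insert k {i. k0 \<le> i \<and> i < k \<and> asks_z i}"
    proof (rule image_subsetI)
      fix i assume "i \<in> {i. k0 \<le> i \<and> i < k \<and> asks_x i}"
      then show "Suc i \<in> insert k {i. k0 \<le> i \<and> i < k \<and> asks_z i}" using asks_x_next[of i] by auto
    qed
  qed simp
  also have "\<dots> \<le> Suc (requests k0 k)" unfolding requests_def by (rule card_insert_le_m1[THEN order_trans]) (auto simp: card_insert_if)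
  finally show ?thesis .
qed

text \<open>By the pairing of requests. With fewer than \<open>w\<close> requests for
  \<open>z\<close> the bound is below \<open>2 * w\<close>; this is the origin of the factor
  \<open>(1 - p) ^ (2 * w)\<close>.\<close>

lemma card_new_le: "card (exposed k - exposed k0) \<le> Suc (2 * requests k0 k)"
proof -
  let ?P = "{i. k0 \<le> i \<and> i < k \<and> asks_x i}" and ?Z = "{i. k0 \<le> i \<and> i < k \<and> asks_z i}"
  have "exposed k - exposed k0 \<subseteq> (\<lambda>l. (x, (Suc (t + m) + l) mod L)) ` ?P \<union> (\<lambda>l. (z, (Suc (t + m) + l) mod L)) ` ?Z"
    unfolding exposed_def exposed_x_def exposed_z_def by (auto simp: not_le) (metis (mono_tags, lifting) mem_Collect_eq image_eqI not_le)+
  then have "card (exposed k - exposed k0) \<le> card ((\<lambda>l. (x, (Suc (t + m) + l) mod L)) ` ?P \<union> (\<lambda>l. (z, (Suc (t + m) + l) mod L)) ` ?Z)"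
    by (intro card_mono) auto
  also have "\<dots> \<le> card ?P + card ?Z"
    by (rule card_Un_le[THEN order_trans]) (intro add_mono card_image_le; simp)
  also have "\<dots> \<le> Suc (requests k0 k) + requests k0 k" using card_asks_x_le by (simp add: requests_def)
  finally show ?thesis by simp
qed

section \<open>Weights of the cylinders along the virtual walk\<close>

context
  fixes n N W w k0 dK :: nat and p \<theta> :: real and \<rho> :: "'a \<times> nat \<Rightarrow> real" and b :: "('a \<times> nat) set"
  assumes xv: "x \<in> slab v" and mL: "m < L" and dK: "dep x < dK" "dK \<le> n"
    and path: "\<And>l. l \<le> m \<Longrightarrow> wlk \<omega>0 t v l \<in> slab v \<and> dep (wlk \<omega>0 t v l) < dep x"
    and last: "wlk \<omega>0 t v m = par x"
    and k0: "dep (vwalk k0) = dK" "\<And>l. l < k0 \<Longrightarrow> dep (vwalk l) < dK" "k0 \<le> N"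
    and W: "W = w * C" "N + W + 1 \<le> L"
    and quiet: "\<And>e u. e \<in> V \<Longrightarrow> e \<noteq> r \<Longrightarrow> par e = x \<Longrightarrow> e \<noteq> z \<Longrightarrow>
      t + m + L - W \<le> u \<Longrightarrow> u < t + m + L \<Longrightarrow> (e, u mod L) \<notin> \<omega>0"
    and p: "0 \<le> p" "p \<le> 1"
    and pr: "prob_on (bits n) \<rho>"
    and \<rho>p: "\<And>e u. (e, u) \<in> bits n \<Longrightarrow> e = x \<or> e \<in> sub z \<Longrightarrow> \<rho> (e, u) = p"
    and known: "\<And>e u. (e, u) \<in> bits n \<Longrightarrow> e \<noteq> x \<Longrightarrow> e \<notin> sub z \<Longrightarrow> \<rho> (e, u) = (if (e, u) \<in> b then 1 else 0)"
    and \<omega>0: "\<omega>0 = off x (b \<inter> bits n)"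
begin

text \<open>All revealed bits are deterministic under \<open>\<rho>\<close>, so the revealed part
  may be assumed to equal \<open>\<omega>0\<close>.\<close>

lemma Pr_off: "Pr (bits n) \<rho> A = Pr (bits n) \<rho> (\<lambda>S. A S \<and> off x S = \<omega>0)"
proof -
  let ?J = "{(e, u) \<in> bits n. e \<noteq> x \<and> e \<notin> sub z}"
  have "Pr (bits n) \<rho> A = Pr (bits n) \<rho> (\<lambda>S. A S \<and> S \<inter> ?J = b \<inter> ?J)"
    by (rule Pr_known_set[OF finite_bits]) (use known in auto)
  also have "\<dots> = Pr (bits n) \<rho> (\<lambda>S. A S \<and> off x S = \<omega>0)"
  proof (rule Pr_cong)
    fix S assume "S \<subseteq> bits n"
    then have "off x S = S \<inter> ?J" "\<omega>0 = b \<inter> ?J" unfolding \<omega>0 off_def by auto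
    then show "(A S \<and> S \<inter> ?J = b \<inter> ?J) = (A S \<and> off x S = \<omega>0)" by simp
  qed
  finally show ?thesis .
qed

lemma exposed_bits: "exposed k \<subseteq> bits n" "asks_z i \<Longrightarrow> (z, (Suc (t + m) + i) mod L) \<in> bits n"
proof -
  have xn: "dep x < n" using dK by simp
  have "hit_bit \<in> bits n" by (rule edge_at_bits[of x x]) (use xn xV xr colx in \<open>auto simp: edge_at_def\<close>)
  moreover have "exposed_x k \<subseteq> bits n"
  proof
    fix i assume "i \<in> exposed_x k"
    then obtain l where l: "asks_x l" "i = (x, (Suc (t + m) + l) mod L)" unfolding exposed_x_def by blast
    then show "i \<in> bits n" using edge_at_bits[of x x _ n] xn asks_x_iff[of l] unfolding asks_x_def by metis
  qed
  moreover have asks_z_bits: "(z, (Suc (t + m) + i) mod L) \<in> bits n" if "asks_z i" for i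
    by (rule edge_at_bits[of z x]) (use that xn asks_z_iff[of i] in \<open>auto simp: asks_z_def\<close>)
  moreover have "known_x \<subseteq> bits n"
  proof
    fix i assume "i \<in> known_x"
    then obtain l where l: "l < m" "edge_at x (wlk \<omega>0 t v l) (t + l)" "i = (x, (t + l) mod L)"
      unfolding known_x_def by blast
    have "dep (wlk \<omega>0 t v l) < n" using path[of l] l(1) xn by simp
    then show "i \<in> bits n" using edge_at_bits[OF l(2)] l(3) by simp
  qed
  ultimately show "exposed k \<subseteq> bits n" unfolding exposed_def exposed_z_def by blast
  show "(z, (Suc (t + m) + i) mod L) \<in> bits n" if "asks_z i" using asks_z_bits[OF that] .
qed

text \<open>Closing up would by itself have produced \<open>w\<close> requests. Below that count,
  the virtual walk has not yet met the entry bit, which is open in reality and would send the real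
  walk back up.\<close>

lemma not_closed: "requests k0 k < w \<Longrightarrow> l < k \<Longrightarrow> \<not> closed_at l"
proof
  assume "requests k0 k < w" "l < k" "closed_at l"
  moreover have "w \<le> requests k0 l"
    unfolding requests_def by (rule closed_exposes[OF W(1) _ \<open>closed_at l\<close> quiet]) (use W k0 in auto)
  ultimately show False using requests_mono[of l k k0] by simp
qed

lemma exposed_x_z: "i \<in> exposed k \<Longrightarrow> fst i = x \<or> fst i = z"
  unfolding exposed_def known_x_def exposed_x_def exposed_z_def by auto

lemma finite_exposed: "finite (exposed k)" using exposed_bits(1) finite_bits by (rule finite_subset)

lemma wt_exposed:
  assumes "requests k0 k < w" "k0 \<le> k"
  shows "(1 - p) ^ (2 * w) * wt (exposed k0) \<rho> {hit_bit} \<le> wt (exposed k) \<rho> {hit_bit}"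
proof -
  have sub: "exposed k0 \<subseteq> exposed k" using exposed_x_mono[OF assms(2)] exposed_z_mono[OF assms(2)] unfolding exposed_def by blast
  have "wt (exposed k) \<rho> {hit_bit} = wt (exposed k - exposed k0) \<rho> {hit_bit} * wt (exposed k0) \<rho> {hit_bit}"
    unfolding wt_def by (rule prod.subset_diff[OF sub finite_exposed])
  also have "wt (exposed k - exposed k0) \<rho> {hit_bit} = (\<Prod>i\<in>exposed k - exposed k0. 1 - p)"
    unfolding wt_def
  proof (rule prod.cong)
    fix i assume i: "i \<in> exposed k - exposed k0"
    then have "i \<noteq> hit_bit" unfolding exposed_def by blast
    moreover have "i \<in> bits n" using i exposed_bits(1) by blast
    ultimately show "(if i \<in> {hit_bit} then \<rho> i else 1 - \<rho> i) = 1 - p"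
      using exposed_x_z[of i k] i \<rho>p[of "fst i" "snd i"] sub_refl[OF zV(1)] by auto
  qed simp
  also have "\<dots> = (1 - p) ^ card (exposed k - exposed k0)" by simp
  finally have "wt (exposed k) \<rho> {hit_bit} = (1 - p) ^ card (exposed k - exposed k0) * wt (exposed k0) \<rho> {hit_bit}" .
  moreover have "card (exposed k - exposed k0) \<le> 2 * w" using card_new_le[of k k0] assms(1) by simp
  then have "(1 - p) ^ (2 * w) \<le> (1 - p) ^ card (exposed k - exposed k0)"
    by (intro power_decreasing) (use p in auto)
  moreover have "0 \<le> wt (exposed k0) \<rho> {hit_bit}"
    by (rule wt_nonneg) (use pr exposed_bits(1) in \<open>auto simp: prob_on_def\<close>)
  ultimately show ?thesis by (simp add: mult_right_mono)
qed

text \<open>The benchmark for both cases: a first hit followed by a run to depth \<open>dK\<close>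
  forces the bits exposed up to \<open>k0\<close> into their prescribed state, so lower bounds are
  needed only relative to the weight of this cylinder.\<close>

lemma cyl_upper:
  "Pr (bits n) \<rho> (\<lambda>S. first_hit t v S x m \<and> reaches S x dK (Suc (t + m)) x N) \<le> wt (exposed k0) \<rho> {hit_bit}"
proof -
  have "Pr (bits n) \<rho> (\<lambda>S. (first_hit t v S x m \<and> reaches S x dK (Suc (t + m)) x N) \<and> off x S = \<omega>0)
     \<le> Pr (bits n) \<rho> (\<lambda>S. S \<inter> exposed k0 = {hit_bit} \<inter> exposed k0 \<and> True)"
  proof (rule Pr_mono[OF pr])
    fix S assume S: "(first_hit t v S x m \<and> reaches S x dK (Suc (t + m)) x N) \<and> off x S = \<omega>0"
    obtain k where k: "dep (wlk S (Suc (t + m)) x k) = dK"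
      "\<And>l. l \<le> k \<Longrightarrow> wlk S (Suc (t + m)) x l \<in> slab x"
      using S unfolding reaches_def by blast
    have offS: "off x S = \<omega>0" using S by simp
    note f = follow_rev[OF offS k(2)]
    have "dep (vwalk k) = dK" using f(1)[of k] k(1) by simp
    then have "k0 \<le> k" using k0(2)[of k] by (cases "k < k0") auto
    then have "S \<inter> exposed_x k0 = {}" "S \<inter> exposed_z k0 = {}"
      using f(2,3) exposed_x_mono[of k0 k] exposed_z_mono[of k0 k] by blast+
    moreover have "S \<inter> known_x = {}" using first_hit_follow(2) S by blast
    moreover have "hit_bit \<in> S" using first_hit_cross(4) S by blast
    ultimately show "S \<inter> exposed k0 = {hit_bit} \<inter> exposed k0 \<and> True" unfolding exposed_def by blast
  qed
  also have "\<dots> = wt (exposed k0) \<rho> {hit_bit}"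
    by (subst Pr_constrain[OF finite_bits exposed_bits(1)]) (simp add: finite_bits)
  finally show ?thesis by (subst Pr_off)
qed

lemma cyl_follow:
  assumes "off x S = \<omega>0" "hit_bit \<in> S" "S \<inter> exposed k \<subseteq> {hit_bit}" "\<And>l. l < k \<Longrightarrow> \<not> closed_at l"
  shows "first_hit t v S x m" "l \<le> m \<Longrightarrow> wlk S t v l = wlk \<omega>0 t v l"
    "l \<le> k \<Longrightarrow> wlk S t v (Suc m + l) = vwalk l"
proof -
  have disj: "S \<inter> known_x = {}" "S \<inter> exposed_x k = {}" "S \<inter> exposed_z k = {}"
    using assms(3) hit_bit_notin_known_x[OF mL] hit_bit_notin_exposed_x[OF assms(4)] hit_bit_notin_exposed_z[of k] unfolding exposed_def by blast+
  show first_hit: "first_hit t v S x m" by (rule first_hit_follow_rev[OF assms(1) disj(1) assms(2) xv path last])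
  show "l \<le> m \<Longrightarrow> wlk S t v l = wlk \<omega>0 t v l" using first_hit_follow(1)[OF assms(1) first_hit] by simp
  have "wlk S t v (Suc m) = x" using first_hit unfolding first_hit_def by blast
  then have "wlk S t v (Suc m + l) = wlk S (Suc (t + m)) x l" using wlk_add[of S t v "Suc m" l] by simp
  then show "l \<le> k \<Longrightarrow> wlk S t v (Suc m + l) = vwalk l" using follow[OF assms(1) disj(2,3)] by simp
qed

lemma slab_sub: "q \<in> slab x \<Longrightarrow> q \<in> sub v"
  using xv sub_trans unfolding slab_def by blast

lemma before_in_sub:
  assumes "off x S = \<omega>0" "hit_bit \<in> S" "S \<inter> exposed k \<subseteq> {hit_bit}" "\<And>l. l < k \<Longrightarrow> \<not> closed_at l"
    and l: "l \<le> Suc m + k"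
  shows "wlk S t v l \<in> sub v"
proof (cases "l \<le> m")
  case True
  then show ?thesis using cyl_follow(2)[OF assms(1-4)] path[of l] by (simp add: slab_def)
next
  case False
  then obtain l' where "l = Suc m + l'" "l' \<le> k" using l by (metis add_diff_inverse_nat nat_add_left_cancel_le not_less_eq_eq Suc_leI not_le)
  then show ?thesis using cyl_follow(3)[OF assms(1-4)] slab_sub[OF vwalk_slab] by simp
qed

text \<open>Refusing the fewer than \<open>w\<close> further requests costs at most
  \<open>(1 - p) ^ (2 * w)\<close>, and on the smaller cylinder the real walk copies the virtual one
  down to depth \<open>n\<close>.\<close>

lemma case_escape:
  assumes k: "n \<le> dep (vwalk k)" "requests k0 k < w"
  shows "(1 - p) ^ (2 * w) * wt (exposed k0) \<rho> {hit_bit} \<le> Pr (bits n) \<rho> (\<lambda>S. first_hit t v S x m \<and> escapes S n t v)"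
proof -
  have "k0 \<le> k"
    using k0(2)[of k] k(1) dK by (cases "k < k0") auto
  then have "(1 - p) ^ (2 * w) * wt (exposed k0) \<rho> {hit_bit} \<le> wt (exposed k) \<rho> {hit_bit}" by (rule wt_exposed[OF k(2)])
  also have "\<dots> = Pr (bits n) \<rho> (\<lambda>S. S \<inter> exposed k = {hit_bit} \<inter> exposed k \<and> True)"
    by (subst Pr_constrain[OF finite_bits exposed_bits(1)]) (simp add: finite_bits)
  also have "\<dots> = Pr (bits n) \<rho> (\<lambda>S. (S \<inter> exposed k = {hit_bit} \<inter> exposed k \<and> True) \<and> off x S = \<omega>0)" by (rule Pr_off)
  also have "\<dots> \<le> Pr (bits n) \<rho> (\<lambda>S. first_hit t v S x m \<and> escapes S n t v)"
  proof (rule Pr_mono[OF pr])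
    fix S assume S: "(S \<inter> exposed k = {hit_bit} \<inter> exposed k \<and> True) \<and> off x S = \<omega>0"
    have "hit_bit \<in> exposed k" by (simp add: exposed_def)
    then have *: "off x S = \<omega>0" "hit_bit \<in> S" "S \<inter> exposed k \<subseteq> {hit_bit}" using S by auto
    note nc = not_closed[OF k(2)]
    have "n \<le> dep (wlk S t v (Suc m + k))" using cyl_follow(3)[OF * nc, of k] k(1) by simp
    moreover have "\<forall>l\<le>Suc m + k. wlk S t v l \<in> sub v" using before_in_sub[OF * nc] by blast
    ultimately show "first_hit t v S x m \<and> escapes S n t v" using cyl_follow(1)[OF * nc] unfolding escapes_def by blast
  qed
  finally show ?thesis .
qed

text \<open>Otherwise the virtual walk would stay within depth \<open>n\<close> for ever. By
  pigeonhole over the multiples of \<open>L\<close> it would recur, hence close up, and closing up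
  alone produces \<open>w\<close> requests.\<close>

lemma exposure_exists:
  assumes "\<And>k. n \<le> dep (vwalk k) \<Longrightarrow> w \<le> requests k0 k"
  shows "\<exists>k. w \<le> requests k0 k"
proof (rule ccontr)
  assume none: "\<nexists>k. w \<le> requests k0 k"
  then have lt: "dep (vwalk k) \<le> n" for k using assms[of k] by (meson nat_le_linear)
  have "(\<lambda>c. vwalk (c * L)) ` UNIV \<subseteq> {q \<in> V. dep q \<le> n}" using lt vwalk_slab slab_V by blast
  then have "\<not> inj (\<lambda>c. vwalk (c * L))"
    using finite_upto[of n] by (meson finite_imageD finite_subset infinite_UNIV_nat)
  then obtain c1 c2 where c: "c1 < c2" "vwalk (c1 * L) = vwalk (c2 * L)"
    unfolding inj_def by (metis linorder_neqE_nat)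
  have e: "c2 * L = c1 * L + (c2 - c1) * L" using c(1) by (simp add: algebra_simps diff_mult_distrib)
  have cl: "closed_at ((c2 - c1) * L - 1)"
    by (rule closes[of _ "c1 * L"]) (use c L_pos e in auto)
  have "w \<le> requests k0 ((c2 - c1) * L - 1)"
    unfolding requests_def by (rule closed_exposes[OF W(1) _ cl quiet]) (use W k0 in auto)
  then show False using none by blast
qed

text \<open>Depth \<open>dK\<close> is first visited inside the slab, before \<open>z\<close> is
  entered, and depth \<open>n\<close> is first visited below \<open>z\<close>; hence the two paths
  part exactly at \<open>x\<close>.\<close>

lemma splits_from_kid:
  assumes S: "off x S = \<omega>0" "hit_bit \<in> S" "S \<inter> exposed i \<subseteq> {hit_bit}" "\<And>l. l < i \<Longrightarrow> \<not> closed_at l"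
    and i: "k0 \<le> i" "asks_z i" "(z, (Suc (t + m) + i) mod L) \<in> S"
    and low: "\<And>l. l \<le> i \<Longrightarrow> dep (vwalk l) < n"
    and esc: "escapes S n (Suc (Suc (t + m) + i)) z"
  shows "splits S n dK t v (dep x)"
proof -
  have f: "l \<le> m \<Longrightarrow> wlk S t v l = wlk \<omega>0 t v l" "l \<le> i \<Longrightarrow> wlk S t v (Suc m + l) = vwalk l" for l
    using cyl_follow(2,3)[OF S] by blast+
  \<comment> \<open>Time of arrival at \<open>z\<close>: \<open>Suc m\<close> steps to
    \<open>x\<close>, then \<open>i\<close> virtual steps, then the crossing.\<close>
  define s where "s = Suc m + Suc i"
  have Yi: "vwalk i = x" using i(2) by (simp add: asks_z_iff)
  have at_s: "wlk S t v s = z"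
  proof -
    have "wlk S t v s = mv S (t + (Suc m + i)) (vwalk i)" using f(2)[of i] by (simp add: s_def)
    also have "t + (Suc m + i) = Suc (t + m) + i" by simp
    also have "mv S (Suc (t + m) + i) (vwalk i) = opp z (vwalk i)"
      by (rule mv_on) (use i in \<open>auto simp: asks_z_def\<close>)
    also have "\<dots> = z" using Yi zV by (simp add: opp_def)
    finally show ?thesis .
  qed
  define B where "B q = wlk S (Suc (Suc (t + m) + i)) z q" for q
  have after: "wlk S t v (s + q) = B q" for q
    using wlk_add[of S t v s q] at_s by (simp add: s_def B_def algebra_simps)
  obtain kz' where kz': "n \<le> dep (B kz')" "\<And>l. l \<le> kz' \<Longrightarrow> B l \<in> sub z"
    using esc unfolding escapes_def B_def by blast
  define kz where "kz = (LEAST k. n \<le> dep (B k))"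
  have kz: "n \<le> dep (B kz)" unfolding kz_def by (rule LeastI[of "\<lambda>k. n \<le> dep (B k)", OF kz'(1)])
  have kz_le: "kz \<le> kz'" unfolding kz_def by (rule Least_le[of "\<lambda>k. n \<le> dep (B k)", OF kz'(1)])
  have kz_lt: "dep (B l) < n" if "l < kz" for l
    using not_less_Least[of l "\<lambda>k. n \<le> dep (B k)"] that unfolding kz_def by simp
  have zsub: "q \<in> sub z \<Longrightarrow> q \<in> sub x" for q
    using sub_trans[OF _ sub_kid[OF xV, of 0]] by simp
  have zsubv: "q \<in> sub z \<Longrightarrow> q \<in> sub v" for q
    using zsub[of q] sub_trans[of q x v] xv by (simp add: slab_def)
  have split: "l \<le> m \<or> (\<exists>l'\<le>i. l = Suc m + l') \<or> (\<exists>q\<le>kz. l = s + q)" if "l \<le> s + kz" for l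
  proof -
    consider "l \<le> m" | "m < l" "l < s" | "s \<le> l" by linarith
    then show ?thesis
    proof cases
      case 2
      then have "l = Suc m + (l - Suc m)" "l - Suc m \<le> i" by (auto simp: s_def)
      then show ?thesis by blast
    next
      case 3
      then have "l = s + (l - s)" "l - s \<le> kz" using that by auto
      then show ?thesis by blast
    qed blast
  qed
  have pathd: "dep (wlk S t v l) < dep x" if "l \<le> m" for l using f(1)[OF that] path[OF that] by simp
  have 1: "dep (wlk S t v (Suc m + k0)) = dK" using f(2)[OF i(1)] k0 by simp
  have 2: "dep (wlk S t v l) < dK" if "l < Suc m + k0" for l
  proof (cases "l \<le> m")
    case True
    then show ?thesis using pathd dK by (meson less_trans)
  next
    case False
    then have "l = Suc m + (l - Suc m)" "l - Suc m < k0" "l - Suc m \<le> i" using that i(1) by auto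
    then show ?thesis using f(2)[of "l - Suc m"] k0(2) by metis
  qed
  have 3: "n \<le> dep (wlk S t v (s + kz))" using after kz by simp
  have 4: "dep (wlk S t v l) < n" if "l < s + kz" for l
    using split[OF less_imp_le[OF that]]
  proof (elim disjE exE conjE)
    assume "l \<le> m"
    then show ?thesis using pathd[of l] dK by simp
  next
    fix l' assume "l' \<le> i" "l = Suc m + l'"
    then show ?thesis using f(2) low by simp
  next
    fix q assume "q \<le> kz" "l = s + q"
    then show ?thesis using after kz_lt[of q] that by simp
  qed
  have 5: "wlk S t v l \<in> sub v" if "l \<le> s + kz" for l
    using split[OF that]
  proof (elim disjE exE conjE)
    fix q assume "q \<le> kz" "l = s + q"
    then show ?thesis using after zsubv[OF kz'(2)] kz_le by simp
  qed (use before_in_sub[OF S] in \<open>auto simp del: wlk.simps\<close>)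
  have u: "wlk S t v (Suc m + k0) = vwalk k0" "wlk S t v (s + kz) \<in> sub z"
    using f(2)[OF i(1)] after kz'(2)[OF kz_le] by auto
  have 6: "anc (dep x) (wlk S t v (Suc m + k0)) = anc (dep x) (wlk S t v (s + kz))"
    using vwalk_slab[of k0] zsub[OF u(2)] unfolding u(1) slab_def by (simp add: sub_iff)
  have 7: "anc (Suc (dep x)) (wlk S t v (Suc m + k0)) \<noteq> anc (Suc (dep x)) (wlk S t v (s + kz))"
  proof
    assume "anc (Suc (dep x)) (wlk S t v (Suc m + k0)) = anc (Suc (dep x)) (wlk S t v (s + kz))"
    then have "anc (dep z) (vwalk k0) = z" using u zV(4) by (simp add: sub_iff)
    moreover have "dep z \<le> dep (vwalk k0)" using zV(4) k0 dK by simp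
    ultimately have "vwalk k0 \<in> sub z" using vwalk_slab[of k0] by (simp add: sub_iff slab_V)
    then show False using vwalk_slab[of k0] by (simp add: slab_def)
  qed
  show ?thesis unfolding splits_def
    by (intro exI[of _ "Suc m + k0"] exI[of _ "s + kz"] conjI allI impI) (fact 1 | rule 2 3 4 5 6 7; assumption?)+
qed

text \<open>Each request in \<open>T\<close> may be granted instead of refused. Relative to the
  benchmark this event has weight at least \<open>p * (1 - p) ^ (2 * w)\<close>, times the escape
  probability from \<open>z\<close>. The events are disjoint, because a later one needs the earlier
  requests refused.\<close>

lemma case_split:
  assumes none: "\<And>k. n \<le> dep (vwalk k) \<Longrightarrow> w \<le> requests k0 k" and \<theta>: "0 \<le> \<theta>"
    and IH: "\<And>t' \<pi>'. fresh n p z t' \<pi>' \<Longrightarrow> \<theta> \<le> Pr (bits n) \<pi>' (\<lambda>S. escapes S n t' z)"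
  shows "(w * p * (1 - p) ^ (2 * w) * \<theta>) * wt (exposed k0) \<rho> {hit_bit}
    \<le> Pr (bits n) \<rho> (\<lambda>S. first_hit t v S x m \<and> splits S n dK t v (dep x))"
proof -
  define ks where "ks = (LEAST k. w \<le> requests k0 k)"
  have ks: "w \<le> requests k0 ks" unfolding ks_def by (rule LeastI_ex) (rule exposure_exists[OF none])
  have ks_lt: "requests k0 k < w" if "k < ks" for k
    using not_less_Least[of k "\<lambda>k. w \<le> requests k0 k"] that unfolding ks_def by simp
  have low: "dep (vwalk l) < n" if "l < ks" for l
    using none[of l] ks_lt[OF that] by (cases "dep (vwalk l) < n") auto
  define T where "T = {i. k0 \<le> i \<and> i < ks \<and> asks_z i}"
  have cT: "w \<le> card T" using ks by (simp add: T_def requests_def)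
  have fT: "finite T" unfolding T_def by simp
  define \<zeta> where "\<zeta> i = (z, (Suc (t + m) + i) mod L)" for i
  define R where "R i = insert (\<zeta> i) (exposed i)" for i
  define A where "A i S \<longleftrightarrow> S \<inter> R i = {hit_bit, \<zeta> i} \<inter> R i \<and> escapes S n (Suc (Suc (t + m) + i)) z" for i S
  have T: "k0 \<le> i" "requests k0 i < w" "asks_z i" "vwalk i = x" "\<And>l. l < i \<Longrightarrow> \<not> closed_at l" "\<zeta> i \<notin> exposed i" "R i \<subseteq> bits n"
    if "i \<in> T" for i
  proof -
    show i: "k0 \<le> i" "requests k0 i < w" "asks_z i" using that ks_lt by (auto simp: T_def)
    then show "vwalk i = x" by (simp add: asks_z_iff)
    show nc: "\<And>l. l < i \<Longrightarrow> \<not> closed_at l" using not_closed[OF i(2)] by blast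
    show "\<zeta> i \<notin> exposed i"
    proof
      assume "\<zeta> i \<in> exposed i"
      then have "\<zeta> i \<in> exposed_z i" using zV by (auto simp: \<zeta>_def exposed_def known_x_def exposed_x_def)
      then obtain l where "l < i" "asks_z l" "(Suc (t + m) + i) mod L = (Suc (t + m) + l) mod L"
        by (auto simp: \<zeta>_def exposed_z_def)
      then show False using repeat_closed[of l i] nc \<open>vwalk i = x\<close> by (auto simp: asks_z_iff)
    qed
    show "R i \<subseteq> bits n" using exposed_bits i(3) by (simp add: R_def \<zeta>_def)
  qed
  have nih: "\<zeta> i \<noteq> hit_bit" for i using zV by (simp add: \<zeta>_def)
  have ihR: "hit_bit \<in> R i" for i by (simp add: R_def exposed_def)
  have wtQ: "0 \<le> wt (exposed k0) \<rho> {hit_bit}"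
    by (rule wt_nonneg) (use pr exposed_bits(1) in \<open>auto simp: prob_on_def\<close>)
  have each: "(p * (1 - p) ^ (2 * w) * \<theta>) * wt (exposed k0) \<rho> {hit_bit} \<le> Pr (bits n) \<rho> (\<lambda>S. A i S \<and> off x S = \<omega>0)"
    if iT: "i \<in> T" for i
  proof -
    note i = T[OF iT]
    let ?\<rho> = "\<lambda>j. if j \<in> R i then (if j \<in> {hit_bit, \<zeta> i} then 1 else 0) else \<rho> j"
    have "\<theta> \<le> Pr (bits n) ?\<rho> (\<lambda>S. escapes S n (Suc (Suc (t + m) + i)) z)"
    \<comment> \<open>The environment of \<open>z\<close> is still fresh after freezing: refused
      bits of its edge get parameter 0, and the one bit forced open belongs to the step before the
      new starting time, which \<open>fresh\<close> exempts.\<close>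
    proof (rule IH, unfold fresh_def, intro conjI allI impI)
      show "prob_on (bits n) ?\<rho>" using pr by (auto simp: prob_on_def)
      fix e u assume e: "(e, u) \<in> bits n" "e \<in> sub z" "e \<noteq> z"
      then have "e \<noteq> x" using x_notin_z by auto
      then have "(e, u) \<notin> R i" using e exposed_x_z[of "(e, u)" i] by (auto simp: R_def \<zeta>_def)
      then show "?\<rho> (e, u) = p" using \<rho>p[OF e(1)] e(2) by simp
    next
      fix u assume u: "(z, u) \<in> bits n" "u \<noteq> (Suc (Suc (t + m) + i) + L - 1) mod L"
      have "Suc (Suc (t + m) + i) + L - 1 = (Suc (t + m) + i) + L" by simp
      then have "u \<noteq> (Suc (t + m) + i) mod L" using u(2) by (simp only: mod_add_self2 not_False_eq_True)
      then have "(z, u) \<noteq> \<zeta> i" "(z, u) \<noteq> hit_bit" using zV by (auto simp: \<zeta>_def)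
      then show "?\<rho> (z, u) \<le> p" using \<rho>p[OF u(1)] sub_refl[OF zV(1)] p zV(5) by auto
    qed
    moreover have "(p * (1 - p) ^ (2 * w)) * wt (exposed k0) \<rho> {hit_bit} \<le> wt (R i) \<rho> {hit_bit, \<zeta> i}"
    proof -
      have "wt (R i) \<rho> {hit_bit, \<zeta> i} = \<rho> (\<zeta> i) * wt (exposed i) \<rho> {hit_bit, \<zeta> i}"
        unfolding wt_def R_def by (subst prod.insert[OF finite_exposed i(6)]) simp
      also have "wt (exposed i) \<rho> {hit_bit, \<zeta> i} = wt (exposed i) \<rho> {hit_bit}"
        unfolding wt_def using i(6) by (intro prod.cong) auto
      also have "\<rho> (\<zeta> i) = p"
        using \<rho>p[of z] exposed_bits(2)[OF i(3)] sub_refl[OF zV(1)] by (simp add: \<zeta>_def)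
      finally show ?thesis using mult_left_mono[OF wt_exposed[OF i(2,1)] p(1)] by (simp add: mult.assoc)
    qed
    ultimately have "((p * (1 - p) ^ (2 * w)) * wt (exposed k0) \<rho> {hit_bit}) * \<theta>
        \<le> wt (R i) \<rho> {hit_bit, \<zeta> i} * Pr (bits n) ?\<rho> (\<lambda>S. escapes S n (Suc (Suc (t + m) + i)) z)"
      using \<theta> p wtQ by (intro mult_mono) (auto intro: order_trans[rotated])
    also have "\<dots> = Pr (bits n) \<rho> (A i)"
      unfolding A_def by (rule Pr_constrain[OF finite_bits i(7), symmetric])
    also have "\<dots> = Pr (bits n) \<rho> (\<lambda>S. A i S \<and> off x S = \<omega>0)" by (rule Pr_off)
    finally show ?thesis by (simp only: mult_ac)
  qed
  have "(w * p * (1 - p) ^ (2 * w) * \<theta>) * wt (exposed k0) \<rho> {hit_bit}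
      = real w * ((p * (1 - p) ^ (2 * w) * \<theta>) * wt (exposed k0) \<rho> {hit_bit})" by (simp only: mult_ac)
  also have "\<dots> \<le> real (card T) * ((p * (1 - p) ^ (2 * w) * \<theta>) * wt (exposed k0) \<rho> {hit_bit})"
    using cT p \<theta> wtQ by (intro mult_right_mono) auto
  also have "\<dots> = (\<Sum>i\<in>T. (p * (1 - p) ^ (2 * w) * \<theta>) * wt (exposed k0) \<rho> {hit_bit})" by simp
  also have "\<dots> \<le> (\<Sum>i\<in>T. Pr (bits n) \<rho> (\<lambda>S. A i S \<and> off x S = \<omega>0))" by (rule sum_mono) (rule each)
  also have "\<dots> \<le> Pr (bits n) \<rho> (\<lambda>S. first_hit t v S x m \<and> splits S n dK t v (dep x))"
  proof (rule Pr_sum_le[OF pr fT])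
    have not_both: "\<not> (A i1 S \<and> A i2 S)" if "i1 \<in> T" "i2 \<in> T" "i1 < i2" for i1 i2 S
    proof
      assume AA: "A i1 S \<and> A i2 S"
      have "\<zeta> i1 \<in> S" using AA unfolding A_def R_def by blast
      moreover have "\<zeta> i1 \<in> exposed_z i2" using T(3)[OF that(1)] that(3) unfolding exposed_z_def \<zeta>_def by blast
      moreover have "\<zeta> i1 \<noteq> \<zeta> i2" using calculation(2) T(6)[OF that(2)] unfolding exposed_def by auto
      ultimately show False using AA nih[of i1] unfolding A_def R_def exposed_def by blast
    qed
    fix S i1 i2 assume "i1 \<in> T" "i2 \<in> T" "A i1 S \<and> off x S = \<omega>0" "A i2 S \<and> off x S = \<omega>0"
    then show "i1 = i2" using not_both[of i1 i2 S] not_both[of i2 i1 S] by (meson linorder_neqE_nat)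
  next
    fix S i assume iT: "i \<in> T" and S: "A i S \<and> off x S = \<omega>0"
    note i = T[OF iT]
    have "S \<inter> exposed i \<subseteq> {hit_bit}" "hit_bit \<in> S" "\<zeta> i \<in> S"
      using S i(6) ihR[of i] unfolding A_def R_def by blast+
    then have *: "off x S = \<omega>0" "hit_bit \<in> S" "S \<inter> exposed i \<subseteq> {hit_bit}" "(z, (Suc (t + m) + i) mod L) \<in> S"
      using S by (auto simp: \<zeta>_def)
    have "dep (vwalk l) < n" if "l \<le> i" for l using low[of l] that iT by (simp add: T_def)
    then have "splits S n dK t v (dep x)"
      using S by (intro splits_from_kid[OF *(1-3) i(5) i(1,3) *(4)]) (auto simp: A_def)
    then show "first_hit t v S x m \<and> splits S n dK t v (dep x)" using cyl_follow(1)[OF *(1-3) i(5)] by blast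
  qed
  finally show ?thesis .
qed

end

end

end

section \<open>A self-improving recursion for the escape probability\<close>

section \<open>Uniform escape probability\<close>

context coloured_tree
begin

text \<open>Modulo \<open>L\<close> these are the \<open>W\<close> steps just before the hit time
  \<open>h\<close>; the shift by \<open>L\<close> keeps the natural-number subtraction exact for
  \<open>W \<le> L\<close>.\<close>

definition quiet_window :: "nat \<Rightarrow> ('a \<times> nat) set \<Rightarrow> 'a \<Rightarrow> nat \<Rightarrow> bool" where
  "quiet_window W S x h \<longleftrightarrow> (\<forall>e u. e \<in> V \<and> e \<noteq> r \<and> par e = x \<and> e \<noteq> kid x 0 \<and>
      h + L - W \<le> u \<and> u < h + L \<longrightarrow> (e, u mod L) \<notin> S)"

text \<open>The run to depth \<open>d\<close> leaves a mark outside the subtree of the first child,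
  from which the splitting level can be read off later. The quiet window makes closing up impossible
  without many requests.\<close>

definition launch :: "nat \<Rightarrow> 'a \<Rightarrow> nat \<Rightarrow> nat \<Rightarrow> nat \<Rightarrow> 'a \<Rightarrow> nat \<Rightarrow> ('a \<times> nat) set \<Rightarrow> bool" where
  "launch t v d N W x m S \<longleftrightarrow> first_hit t v S x m \<and> reaches S x d (Suc (t + m)) x N \<and> quiet_window W S x (t + m)"

text \<open>The virtual walk reaches depth \<open>n\<close> after fewer than \<open>w\<close> requests for the edge to the first child of \<open>x\<close>, counted from
its first visit to depth \<open>d\<close>.\<close>

definition few_exposures :: "nat \<Rightarrow> nat \<Rightarrow> nat \<Rightarrow> nat \<Rightarrow> 'a \<Rightarrow> nat \<Rightarrow> ('a \<times> nat) set \<Rightarrow> bool" where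
  "few_exposures n t d w x m S \<longleftrightarrow> (\<exists>k. n \<le> dep (vwalk x t m (off x S) k) \<and>
      requests x t m (off x S) (LEAST k. dep (vwalk x t m (off x S) k) = d) k < w)"

text \<open>With the revealed part frozen the virtual walk is deterministic, so one of the two
  alternatives is empty and its inequality trivial. If no configuration over
  \<open>\<omega>0\<close> launches, both left sides vanish; otherwise a single witness
  \<open>S0\<close> supplies all facts about the virtual walk, which depend on
  \<open>\<omega>0\<close> only.\<close>

lemma section_bounds_known:
  assumes vV: "v \<in> V" and xv: "x \<in> slab v" "dep v < dep x" and d: "dep x < d" "d \<le> n" and mL: "m < L"
    and W: "W = w * C" "N + W + 1 \<le> L" and p: "0 \<le> p" "p \<le> 1" and \<theta>: "0 \<le> \<theta>"
    and IH: "\<And>t' \<pi>'. fresh n p (kid x 0) t' \<pi>' \<Longrightarrow> \<theta> \<le> Pr (bits n) \<pi>' (\<lambda>S. escapes S n t' (kid x 0))"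
    and pr: "prob_on (bits n) \<rho>"
    and \<rho>p: "\<And>e u. (e, u) \<in> bits n \<Longrightarrow> e = x \<or> e \<in> sub (kid x 0) \<Longrightarrow> \<rho> (e, u) = p"
    and known: "\<And>e u. (e, u) \<in> bits n \<Longrightarrow> e \<noteq> x \<Longrightarrow> e \<notin> sub (kid x 0) \<Longrightarrow> \<rho> (e, u) = (if (e, u) \<in> b then 1 else 0)"
  shows "(1 - p) ^ (2 * w) * Pr (bits n) \<rho> (\<lambda>S. launch t v d N W x m S \<and> few_exposures n t d w x m S)
      \<le> Pr (bits n) \<rho> (\<lambda>S. first_hit t v S x m \<and> escapes S n t v) \<and>
    (w * p * (1 - p) ^ (2 * w) * \<theta>) * Pr (bits n) \<rho> (\<lambda>S. launch t v d N W x m S \<and> \<not> few_exposures n t d w x m S)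
      \<le> Pr (bits n) \<rho> (\<lambda>S. first_hit t v S x m \<and> splits S n d t v (dep x))"
proof -
  define \<omega>0 where "\<omega>0 = off x (b \<inter> bits n)"
  have xV: "x \<in> V" using xv slab_V by blast
  have xr: "x \<noteq> r" using xv(2) dep_r by auto
  have off0: "e \<noteq> x \<and> e \<notin> sub (kid x 0)" if "(e, u) \<in> \<omega>0" for e u
    using that unfolding \<omega>0_def off_def by blast
  let ?J = "{(e, u) \<in> bits n. e \<noteq> x \<and> e \<notin> sub (kid x 0)}"
  have Proff: "Pr (bits n) \<rho> A = Pr (bits n) \<rho> (\<lambda>S. A S \<and> off x S = \<omega>0)" for A
  proof -
    have "Pr (bits n) \<rho> A = Pr (bits n) \<rho> (\<lambda>S. A S \<and> S \<inter> ?J = b \<inter> ?J)"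
      by (rule Pr_known_set[OF finite_bits]) (use known in auto)
    also have "\<dots> = Pr (bits n) \<rho> (\<lambda>S. A S \<and> off x S = \<omega>0)"
    proof (rule Pr_cong)
      fix S assume "S \<subseteq> bits n"
      then have "off x S = S \<inter> ?J" "\<omega>0 = b \<inter> ?J" unfolding \<omega>0_def off_def by auto
      then show "(A S \<and> S \<inter> ?J = b \<inter> ?J) = (A S \<and> off x S = \<omega>0)" by simp
    qed
    finally show ?thesis .
  qed
  have nonneg: "0 \<le> Pr (bits n) \<rho> A" for A using pr by (rule Pr_nonneg)
  show ?thesis
  proof (cases "\<exists>S0. S0 \<subseteq> bits n \<and> off x S0 = \<omega>0 \<and> launch t v d N W x m S0")
    case False
    have "Pr (bits n) \<rho> (\<lambda>S. launch t v d N W x m S \<and> B S) = 0" for B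
    proof -
      have "Pr (bits n) \<rho> (\<lambda>S. launch t v d N W x m S \<and> B S) = Pr (bits n) \<rho> (\<lambda>_. False)"
        by (subst Proff, rule Pr_cong) (use False in blast)
      then show ?thesis by simp
    qed
    then show ?thesis using nonneg by simp
  next
    case True
    then obtain S0 where S0: "off x S0 = \<omega>0" "first_hit t v S0 x m" "reaches S0 x d (Suc (t + m)) x N" "quiet_window W S0 x (t + m)"
      unfolding launch_def by blast
    have colx: "col x = (t + m) mod C" using first_hit_cross(3)[OF S0(2)] by (simp add: edge_at_def)
    note base = xV xr colx off0
    have path: "wlk \<omega>0 t v l \<in> slab v \<and> dep (wlk \<omega>0 t v l) < dep x" if "l \<le> m" for l
      using first_hit_follow(1)[OF base S0(1,2) that] S0(2) that unfolding first_hit_def by simp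
    have last: "wlk \<omega>0 t v m = par x"
      using first_hit_follow(1)[OF base S0(1,2) order_refl] first_hit_cross(1)[OF S0(2)] by simp
    obtain k where k: "k \<le> N" "dep (wlk S0 (Suc (t + m)) x k) = d"
      "\<And>l. l \<le> k \<Longrightarrow> wlk S0 (Suc (t + m)) x l \<in> slab x"
      using S0(3) unfolding reaches_def by blast
    have Yk: "dep (vwalk x t m \<omega>0 k) = d" using follow_rev(1)[OF base S0(1) k(3) order_refl] k(2) by simp
    define k0 where "k0 = (LEAST k. dep (vwalk x t m \<omega>0 k) = d)"
    have k0: "dep (vwalk x t m \<omega>0 k0) = d" unfolding k0_def using Yk by (rule LeastI)
    have k0N: "k0 \<le> N" using Least_le[of "\<lambda>k. dep (vwalk x t m \<omega>0 k) = d", OF Yk] k(1) unfolding k0_def by simp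
    have Yw: "vwalk x t m \<omega>0 l = wlk \<omega>0 (Suc (t + m)) x l" for l by (rule vwalk_def[OF base])
    have k0_lt: "dep (vwalk x t m \<omega>0 l) < d" if "l < k0" for l
    proof (rule ccontr)
      assume "\<not> dep (vwalk x t m \<omega>0 l) < d"
      then have "d \<le> dep (wlk \<omega>0 (Suc (t + m)) x l)" unfolding Yw[symmetric] by (rule leI)
      from dep_wlk_first[OF xV d(1) this] obtain i where i: "i < l" "dep (wlk \<omega>0 (Suc (t + m)) x (Suc i)) = d"
        by (elim exE conjE) (rule that)
      have i2: "dep (vwalk x t m \<omega>0 (Suc i)) = d" using i(2) Yw[of "Suc i"] by argo
      have "k0 \<le> Suc i"
        using Least_le[of "\<lambda>k. dep (vwalk x t m \<omega>0 k) = d", OF i2] by (simp add: k0_def)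
      then show False using i(1) that by simp
    qed
    have q: "(e, u mod L) \<notin> \<omega>0" if "e \<in> V" "e \<noteq> r" "par e = x" "e \<noteq> kid x 0" "t + m + L - W \<le> u" "u < t + m + L" for e u
    proof -
      have "(e, u mod L) \<notin> S0"
        using S0(4)[unfolded quiet_window_def, rule_format, of e u] that by simp
      moreover have "\<omega>0 \<subseteq> S0" using S0(1) unfolding off_def by blast
      ultimately show ?thesis by blast
    qed
    note prem = xV xr colx off0 xv(1) mL d path last k0 k0_lt k0N W q p pr \<rho>p known \<omega>0_def
    define Q where "Q = wt (exposed v x t m \<omega>0 k0) \<rho> {(x, (t + m) mod L)}"
    have up: "Pr (bits n) \<rho> (\<lambda>S. launch t v d N W x m S \<and> B S) \<le> Q" for B
    proof -
      have "Pr (bits n) \<rho> (\<lambda>S. launch t v d N W x m S \<and> B S)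
          \<le> Pr (bits n) \<rho> (\<lambda>S. first_hit t v S x m \<and> reaches S x d (Suc (t + m)) x N)"
        by (rule Pr_mono[OF pr]) (simp add: launch_def)
      also have "\<dots> \<le> Q" unfolding Q_def by (rule cyl_upper[OF prem])
      finally show ?thesis .
    qed
    define cII where "cII \<longleftrightarrow> (\<exists>k. n \<le> dep (vwalk x t m \<omega>0 k) \<and> requests x t m \<omega>0 k0 k < w)"
    have few_exposures: "few_exposures n t d w x m S = cII" if "off x S = \<omega>0" for S
      unfolding few_exposures_def cII_def k0_def that by simp
    show ?thesis
    proof (cases cII)
      case True
      then obtain k where k: "n \<le> dep (vwalk x t m \<omega>0 k)" "requests x t m \<omega>0 k0 k < w" unfolding cII_def by blast
      have "Pr (bits n) \<rho> (\<lambda>S. launch t v d N W x m S \<and> \<not> few_exposures n t d w x m S) = Pr (bits n) \<rho> (\<lambda>_. False)"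
        by (subst Proff, rule Pr_cong) (use few_exposures True in auto)
      then have z2: "Pr (bits n) \<rho> (\<lambda>S. launch t v d N W x m S \<and> \<not> few_exposures n t d w x m S) = 0" by simp
      have "(1 - p) ^ (2 * w) * Pr (bits n) \<rho> (\<lambda>S. launch t v d N W x m S \<and> few_exposures n t d w x m S) \<le> (1 - p) ^ (2 * w) * Q"
        using up p by (intro mult_left_mono) auto
      also have "\<dots> \<le> Pr (bits n) \<rho> (\<lambda>S. first_hit t v S x m \<and> escapes S n t v)"
        unfolding Q_def by (rule case_escape[OF prem k])
      finally show ?thesis using z2 nonneg by simp
    next
      case False
      then have none: "w \<le> requests x t m \<omega>0 k0 k" if "n \<le> dep (vwalk x t m \<omega>0 k)" for k
        using that unfolding cII_def by (meson not_le)
      have "Pr (bits n) \<rho> (\<lambda>S. launch t v d N W x m S \<and> few_exposures n t d w x m S) = Pr (bits n) \<rho> (\<lambda>_. False)"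
        by (subst Proff, rule Pr_cong) (use few_exposures False in auto)
      then have z1: "Pr (bits n) \<rho> (\<lambda>S. launch t v d N W x m S \<and> few_exposures n t d w x m S) = 0" by simp
      have "(w * p * (1 - p) ^ (2 * w) * \<theta>) * Pr (bits n) \<rho> (\<lambda>S. launch t v d N W x m S \<and> \<not> few_exposures n t d w x m S)
          \<le> (w * p * (1 - p) ^ (2 * w) * \<theta>) * Q"
        using up p \<theta> by (intro mult_left_mono) auto
      also have "\<dots> \<le> Pr (bits n) \<rho> (\<lambda>S. first_hit t v S x m \<and> splits S n d t v (dep x))"
        unfolding Q_def by (rule case_split[OF prem none \<theta> IH])
      finally show ?thesis using z1 nonneg by simp
    qed
  qed
qed

lemma section_bounds:
  assumes vV: "v \<in> V" and xv: "x \<in> slab v" "dep v < dep x" and d: "dep x < d" "d \<le> n" and mL: "m < L"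
    and W: "W = w * C" "N + W + 1 \<le> L" and p: "0 \<le> p" "p \<le> 1" and \<theta>: "0 \<le> \<theta>"
    and IH: "\<And>t' \<pi>'. fresh n p (kid x 0) t' \<pi>' \<Longrightarrow> \<theta> \<le> Pr (bits n) \<pi>' (\<lambda>S. escapes S n t' (kid x 0))"
    and g: "fresh n p v t \<pi>"
  shows "(1 - p) ^ (2 * w) * Pr (bits n) \<pi> (\<lambda>S. launch t v d N W x m S \<and> few_exposures n t d w x m S)
      \<le> Pr (bits n) \<pi> (\<lambda>S. first_hit t v S x m \<and> escapes S n t v)" (is ?A)
    and "(w * p * (1 - p) ^ (2 * w) * \<theta>) * Pr (bits n) \<pi> (\<lambda>S. launch t v d N W x m S \<and> \<not> few_exposures n t d w x m S)
      \<le> Pr (bits n) \<pi> (\<lambda>S. first_hit t v S x m \<and> splits S n d t v (dep x))" (is ?B)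
proof -
  let ?J = "{(e, u) \<in> bits n. e \<noteq> x \<and> e \<notin> sub (kid x 0)}"
  have pr: "prob_on (bits n) \<pi>" using g by (simp add: fresh_def)
  have xV: "x \<in> V" using xv slab_V by blast
  have xsub: "x \<in> sub v" "x \<noteq> v" using xv by (auto simp: slab_def)
  have \<pi>p: "\<pi> (e, u) = p" if "(e, u) \<in> bits n" "e = x \<or> e \<in> sub (kid x 0)" for e u
  proof -
    have "e \<in> sub x" using that(2) sub_refl[OF xV] sub_trans[OF _ sub_kid[OF xV, of 0]] by auto
    then have "e \<in> sub v" "e \<noteq> v" using sub_trans[OF _ xsub(1)] sub_dep[of e x] xv(2) by auto
    then show ?thesis using g that(1) unfolding fresh_def by blast
  qed
  have kn: "(1 - p) ^ (2 * w) * Pr (bits n) \<rho> (\<lambda>S. launch t v d N W x m S \<and> few_exposures n t d w x m S)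
      \<le> Pr (bits n) \<rho> (\<lambda>S. first_hit t v S x m \<and> escapes S n t v) \<and>
    (w * p * (1 - p) ^ (2 * w) * \<theta>) * Pr (bits n) \<rho> (\<lambda>S. launch t v d N W x m S \<and> \<not> few_exposures n t d w x m S)
      \<le> Pr (bits n) \<rho> (\<lambda>S. first_hit t v S x m \<and> splits S n d t v (dep x))"
    if "prob_on (bits n) \<rho>" "\<And>i. i \<notin> ?J \<Longrightarrow> \<rho> i = \<pi> i" "\<And>i. i \<in> ?J \<Longrightarrow> \<rho> i = (if i \<in> b then 1 else 0)" for \<rho> b
  proof (rule section_bounds_known[OF vV xv d mL W p \<theta> IH that(1)])
    fix e u assume "(e, u) \<in> bits n" "e = x \<or> e \<in> sub (kid x 0)"
    then show "\<rho> (e, u) = p" using that(2)[of "(e, u)"] \<pi>p by simp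
  next
    fix e u assume "(e, u) \<in> bits n" "e \<noteq> x" "e \<notin> sub (kid x 0)"
    then show "\<rho> (e, u) = (if (e, u) \<in> b then 1 else 0)" using that(3)[of "(e, u)"] by simp
  qed
  have J: "?J \<subseteq> bits n" by blast
  show ?A by (rule Pr_reveal[OF finite_bits J pr]) (rule kn[THEN conjunct1])
  show ?B by (rule Pr_reveal[OF finite_bits J pr]) (rule kn[THEN conjunct2])
qed

lemma card_children: "finite {e \<in> V. e \<noteq> r \<and> par e = x} \<and> card {e \<in> V. e \<noteq> r \<and> par e = x} \<le> D"
proof -
  have inj: "inj_on idx {e \<in> V. e \<noteq> r \<and> par e = x}" by (rule inj_onI, rule idx_inj) auto
  have im: "idx ` {e \<in> V. e \<noteq> r \<and> par e = x} \<subseteq> {..<D}" using idx_less by auto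
  show ?thesis using inj_on_finite[OF inj im] card_inj_on_le[OF inj im] by simp
qed

lemma fresh_sub:
  assumes "fresh n p v t \<pi>" "(e, u) \<in> bits n" "e \<in> sub v" "e \<noteq> v"
  shows "\<pi> (e, u) = p"
  using assms unfolding fresh_def by blast

text \<open>The bit above \<open>v\<close> exempted by \<open>fresh\<close> belongs to the step
  before \<open>t\<close>, which a run of \<open>N < L\<close> steps from \<open>t\<close> does not
  read.\<close>

lemma reaches_fresh:
  assumes vV: "v \<in> V" and g: "fresh n p v t \<pi>" and p: "0 \<le> p" "p \<le> 1/100" and d: "dep v \<le> d" "d \<le> n" "d - dep v \<le> K"
    and N: "N + 1 \<le> L" and long: "(5/3) ^ K * (1 - decay * p) ^ N \<le> 1/100"
  shows "1/20 \<le> Pr (bits n) \<pi> (\<lambda>S. reaches S v d t v N)"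
proof (rule reaches_bound[OF vV p d(1,2)])
  show "prob_on (bits n) \<pi>" using g by (simp add: fresh_def)
  have "decay * p \<le> 1" using decay p mult_mono[of decay 1 p 1] by auto
  then have "(5/3) ^ (d - dep v) * (1 - decay * p) ^ N \<le> (5/3) ^ K * (1 - decay * p) ^ N"
    using d(3) by (intro mult_right_mono power_increasing) auto
  then show "(5/3) ^ (d - dep v) * (1 - decay * p) ^ N \<le> 1/100" using long by (rule order_trans)
  fix e u assume u: "t \<le> u" "u < t + N" and e: "e \<in> sub v" "(e, u mod L) \<in> bits n"
  show "\<pi> (e, u mod L) \<le> p \<and> (e \<noteq> v \<longrightarrow> \<pi> (e, u mod L) = p)"
  proof (cases "e = v")
    case True
    have "u mod L \<noteq> (t + L - 1) mod L" using mod_L_neq[of u "t + L - 1"] u N L_pos by linarith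
    then show ?thesis using g e True unfolding fresh_def by blast
  qed (use fresh_sub[OF g e(2,1)] in auto)
qed (use N in auto)

definition hits :: "'a \<Rightarrow> nat \<Rightarrow> nat \<Rightarrow> ('a \<times> nat) set" where
  "hits v d N = {x \<in> slab v. dep x = d} \<times> {..<N}"

lemma finite_hits: "finite (hits v d N)"
proof -
  have "hits v d N \<subseteq> {w \<in> V. dep w \<le> d} \<times> {..<N}" using slab_V by (auto simp: hits_def)
  then show ?thesis using finite_upto by (meson finite_SigmaI finite_lessThan finite_subset)
qed

text \<open>For a fixed level the first hits are disjoint over \<open>(x, m)\<close>, and together
  they cover the event that the level is reached inside the slab.\<close>

lemma sum_first_hit:
  assumes "v \<in> V" "fresh n p v t \<pi>" "0 \<le> p" "p \<le> 1/100" "dep v < d" "d \<le> n" "d - dep v \<le> K"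
    and "N + 1 \<le> L" "(5/3) ^ K * (1 - decay * p) ^ N \<le> 1/100"
  shows "1/20 \<le> (\<Sum>(x, m)\<in>hits v d N. Pr (bits n) \<pi> (\<lambda>S. first_hit t v S x m))"
proof -
  have pr: "prob_on (bits n) \<pi>" using assms(2) by (simp add: fresh_def)
  have "1/20 \<le> Pr (bits n) \<pi> (\<lambda>S. reaches S v d t v N)"
    by (rule reaches_fresh[OF assms(1-4) less_imp_le[OF assms(5)] assms(6-9)])
  also have "\<dots> \<le> Pr (bits n) \<pi> (\<lambda>S. \<exists>xm\<in>hits v d N. first_hit t v S (fst xm) (snd xm))"
  proof (rule Pr_mono[OF pr])
    fix S assume "reaches S v d t v N"
    from reaches_first_hit[OF this assms(5)] obtain x m where "m < N" "dep x = d" "first_hit t v S x m" by blast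
    then show "\<exists>xm\<in>hits v d N. first_hit t v S (fst xm) (snd xm)"
      by (intro bexI[of _ "(x, m)"]) (auto simp: hits_def first_hit_def)
  qed
  also have "\<dots> = (\<Sum>xm\<in>hits v d N. Pr (bits n) \<pi> (\<lambda>S. first_hit t v S (fst xm) (snd xm)))"
  proof (rule Pr_UN_disjoint[OF finite_hits])
    fix S xm ym assume a: "xm \<in> hits v d N" "ym \<in> hits v d N" "first_hit t v S (fst xm) (snd xm)" "first_hit t v S (fst ym) (snd ym)"
    then have "dep (fst xm) = dep (fst ym)" by (auto simp: hits_def)
    from first_hit_unique[OF a(3,4) this] show "xm = ym" by (simp add: prod_eq_iff)
  qed
  finally show ?thesis by (simp add: case_prod_unfold)
qed

lemma quiet_prob:
  assumes p: "0 \<le> p" "p \<le> 1" and xV: "x \<in> V"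
    and \<pi>: "\<And>e u. (e, u) \<in> bits n \<Longrightarrow> e \<in> V \<Longrightarrow> e \<noteq> r \<Longrightarrow> par e = x \<Longrightarrow> \<pi> (e, u) = p"
  shows "(1 - p) ^ (D * W) \<le> Pr (bits n) \<pi> (\<lambda>S. quiet_window W S x h)"
proof -
  define Q where "Q = {(e, u mod L) | e u. e \<in> V \<and> e \<noteq> r \<and> par e = x \<and> e \<noteq> kid x 0 \<and> h + L - W \<le> u \<and> u < h + L} \<inter> bits n"
  have "Pr (bits n) \<pi> (\<lambda>S. quiet_window W S x h) = Pr (bits n) \<pi> (\<lambda>S. S \<inter> Q = {} \<inter> Q \<and> True)"
    by (rule Pr_cong) (auto simp: quiet_window_def Q_def)
  also have "\<dots> = wt Q \<pi> {}"
    by (subst Pr_constrain[OF finite_bits]) (auto simp: Q_def finite_bits)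
  also have "\<dots> = (\<Prod>i\<in>Q. 1 - p)" unfolding wt_def by (rule prod.cong) (auto simp: Q_def \<pi>)
  also have "\<dots> = (1 - p) ^ card Q" by simp
  finally have eq: "Pr (bits n) \<pi> (\<lambda>S. quiet_window W S x h) = (1 - p) ^ card Q" .
  let ?ch = "{e \<in> V. e \<noteq> r \<and> par e = x}"
  have "Q \<subseteq> (\<lambda>(e, i). (e, (h + L - W + i) mod L)) ` (?ch \<times> {..<W})"
  proof
    fix i assume "i \<in> Q"
    then obtain e u where e: "i = (e, u mod L)" "e \<in> ?ch" "h + L - W \<le> u" "u < h + L" unfolding Q_def by blast
    then have "i = (\<lambda>(e, i). (e, (h + L - W + i) mod L)) (e, u - (h + L - W))" "u - (h + L - W) < W" by auto
    then show "i \<in> (\<lambda>(e, i). (e, (h + L - W + i) mod L)) ` (?ch \<times> {..<W})" using e(2) by blast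
  qed
  then have "card Q \<le> card (?ch \<times> {..<W})"
    by (rule surj_card_le[rotated]) (use card_children in auto)
  also have "\<dots> \<le> D * W" using card_children[of x] by (simp add: card_cartesian_product)
  finally have "(1 - p) ^ (D * W) \<le> (1 - p) ^ card Q" using p by (intro power_decreasing) auto
  then show ?thesis using eq by simp
qed

text \<open>The three ingredients read disjoint bits: hit and run take place at different times, run
  and quiet window fit into one period without overlap, and the window consists of child edges of
  \<open>x\<close>, which the hit does not read. The run contributes 1/20, the window
  \<open>(1 - p) ^ (D * W)\<close>.\<close>

lemma launch_prob:
  assumes vV: "v \<in> V" and g: "fresh n p v t \<pi>" and p: "0 \<le> p" "p \<le> 1/100"
    and x: "x \<in> slab v" "dep v < dep x" and d: "dep x < d" "d \<le> n" "d - dep x \<le> K" and mN: "m < N"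
    and N: "2 * N + W + 1 \<le> L" and long: "(5/3) ^ K * (1 - decay * p) ^ N \<le> 1/100"
  shows "Pr (bits n) \<pi> (\<lambda>S. first_hit t v S x m) * ((1 - p) ^ (D * W) / 20) \<le> Pr (bits n) \<pi> (launch t v d N W x m)"
proof -
  have pr: "prob_on (bits n) \<pi>" using g by (simp add: fresh_def)
  have xV: "x \<in> V" using x slab_V by blast
  have xsub: "x \<in> sub v" using x by (simp add: slab_def)
  have \<pi>p: "\<pi> (e, u) = p" if "(e, u) \<in> bits n" "e \<in> sub x" for e u
    using fresh_sub[OF g that(1) sub_trans[OF that(2) xsub]] sub_dep[OF that(2)] x(2) by (cases "e = v") auto
  have ch: "e \<in> sub x" if "e \<in> V" "par e = x" for e using sub_down[OF that(1)] that(2) sub_refl[OF xV] by simp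
  define J1 J2 J3 where "J1 = {(e::'a, u mod L) | e u. t \<le> u \<and> u \<le> t + m \<and> par e \<noteq> x}"
    and "J2 = win (Suc (t + m)) N"
    and "J3 = {(e, u mod L) | e u. e \<in> V \<and> e \<noteq> r \<and> par e = x \<and> e \<noteq> kid x 0 \<and> t + m + L - W \<le> u \<and> u < t + m + L}"
  have dq: "depends (\<lambda>S. quiet_window W S x (t + m)) J3"
    unfolding depends_def quiet_window_def J3_def by blast
  have 23: "bits n \<inter> J2 \<inter> J3 = {}"
  proof -
    have False if i2: "i \<in> J2" and i3: "i \<in> J3" for i
    proof -
      obtain u where u: "snd i = u mod L" "Suc (t + m) \<le> u" "u < Suc (t + m) + N"
        using i2 unfolding J2_def win_def by auto
      obtain u' where u': "snd i = u' mod L" "t + m + L - W \<le> u'" "u' < t + m + L"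
        using i3 unfolding J3_def by auto
      have "u < u'" "u' < u + L" using u u' N by linarith+
      then show False using mod_L_neq[of u u'] u(1) u'(1) by simp
    qed
    then show ?thesis by blast
  qed
  have 12: "bits n \<inter> J1 \<inter> (J2 \<union> J3) = {}"
  proof -
    have False if i1: "i \<in> J1" and i2: "i \<in> J2" for i
    proof -
      obtain u where u: "snd i = u mod L" "t \<le> u" "u \<le> t + m"
        using i1 unfolding J1_def by auto
      obtain u' where u': "snd i = u' mod L" "Suc (t + m) \<le> u'" "u' < Suc (t + m) + N"
        using i2 unfolding J2_def win_def by auto
      have "u < u'" "u' < u + L" using u u' N mN by linarith+
      then show False using mod_L_neq[of u u'] u(1) u'(1) by simp
    qed
    moreover have False if "i \<in> J1" "i \<in> J3" for i using that unfolding J1_def J3_def by auto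
    ultimately show ?thesis by blast
  qed
  have A: "1/20 \<le> Pr (bits n) \<pi> (\<lambda>S. reaches S x d (Suc (t + m)) x N)"
  proof (rule reaches_fresh[OF xV _ p less_imp_le[OF d(1)] d(2,3) _ long])
    show "fresh n p x (Suc (t + m)) \<pi>" unfolding fresh_def using pr \<pi>p sub_refl[OF xV] by auto
  qed (use N in simp)
  have B: "(1 - p) ^ (D * W) \<le> Pr (bits n) \<pi> (\<lambda>S. quiet_window W S x (t + m))"
    by (rule quiet_prob[OF _ _ xV]) (use p \<pi>p ch in auto)
  have "(1 - p) ^ (D * W) / 20 \<le> Pr (bits n) \<pi> (\<lambda>S. reaches S x d (Suc (t + m)) x N) * Pr (bits n) \<pi> (\<lambda>S. quiet_window W S x (t + m))"
    using mult_mono[OF A B] p by (simp add: Pr_nonneg[OF pr])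
  also have "\<dots> = Pr (bits n) \<pi> (\<lambda>S. reaches S x d (Suc (t + m)) x N \<and> quiet_window W S x (t + m))"
    by (rule Pr_indep[OF finite_bits pr _ dq 23, symmetric]) (use reaches_depends in \<open>simp add: J2_def\<close>)
  finally have C: "(1 - p) ^ (D * W) / 20 \<le> Pr (bits n) \<pi> (\<lambda>S. reaches S x d (Suc (t + m)) x N \<and> quiet_window W S x (t + m))" .
  have "Pr (bits n) \<pi> (\<lambda>S. first_hit t v S x m) * ((1 - p) ^ (D * W) / 20)
     \<le> Pr (bits n) \<pi> (\<lambda>S. first_hit t v S x m) * Pr (bits n) \<pi> (\<lambda>S. reaches S x d (Suc (t + m)) x N \<and> quiet_window W S x (t + m))"
    by (rule mult_left_mono[OF C Pr_nonneg[OF pr]])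
  also have "\<dots> = Pr (bits n) \<pi> (\<lambda>S. first_hit t v S x m \<and> (reaches S x d (Suc (t + m)) x N \<and> quiet_window W S x (t + m)))"
  proof (rule Pr_indep[OF finite_bits pr _ _ 12, symmetric])
    show "depends (\<lambda>S. first_hit t v S x m) J1" unfolding J1_def by (rule first_hit_depends)
    show "depends (\<lambda>S. reaches S x d (Suc (t + m)) x N \<and> quiet_window W S x (t + m)) (J2 \<union> J3)"
      by (rule depends_conj[OF depends_mono[OF reaches_depends] depends_mono[OF dq]]) (auto simp: J2_def)
  qed
  also have "\<dots> = Pr (bits n) \<pi> (launch t v d N W x m)" by (rule Pr_cong) (simp add: launch_def)
  finally show ?thesis .
qed

lemma anc_anc: "i \<le> j \<Longrightarrow> j \<le> dep u \<Longrightarrow> anc i u = (par ^^ (j - i)) (anc j u)"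
proof -
  assume "i \<le> j" "j \<le> dep u"
  then have "dep u - i = (j - i) + (dep u - j)" by simp
  then show ?thesis unfolding anc_def by (metis comp_apply funpow_add)
qed

lemma splits_escapes: "splits S n d t v j \<Longrightarrow> escapes S n t v"
  unfolding splits_def escapes_def by blast

lemma first_unique:
  fixes P :: "nat \<Rightarrow> nat"
  assumes "d \<le> P k" "\<And>l. l < k \<Longrightarrow> P l < d" "d \<le> P k'" "\<And>l. l < k' \<Longrightarrow> P l < d"
  shows "k = k'"
  using assms by (metis linorder_neqE_nat not_le)

text \<open>A common ancestor at level \<open>j'\<close> entails common ancestors at all levels
  above it, in particular at \<open>Suc j\<close> when \<open>j < j'\<close>.\<close>

lemma splits_unique:
  assumes "splits S n d t v j" "splits S n d t v j'" "j < d" "j' < d" "d \<le> n"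
  shows "j = j'"
proof -
  have "\<not> j < j'" if S: "splits S n d t v j" "splits S n d t v j'" "j' < d" for j j'
  proof
    assume lt: "j < j'"
    let ?w = "wlk S t v"
    obtain k kn where 1: "dep (?w k) = d" "\<forall>l<k. dep (?w l) < d" "n \<le> dep (?w kn)" "\<forall>l<kn. dep (?w l) < n"
      "anc (Suc j) (?w k) \<noteq> anc (Suc j) (?w kn)" using S(1) unfolding splits_def by blast
    obtain k' kn' where 2: "dep (?w k') = d" "\<forall>l<k'. dep (?w l) < d" "n \<le> dep (?w kn')" "\<forall>l<kn'. dep (?w l) < n"
      "anc j' (?w k') = anc j' (?w kn')" using S(2) unfolding splits_def by blast
    have "k = k'" by (rule first_unique[of d "\<lambda>l. dep (?w l)"]) (use 1 2 in auto)
    moreover have "kn = kn'" by (rule first_unique[of n "\<lambda>l. dep (?w l)"]) (use 1 2 in auto)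
    ultimately have "anc j' (?w k) = anc j' (?w kn)" using 2(5) by simp
    moreover have "anc (Suc j) (?w k) = (par ^^ (j' - Suc j)) (anc j' (?w k))"
      by (rule anc_anc) (use lt 1 S(3) in auto)
    moreover have "anc (Suc j) (?w kn) = (par ^^ (j' - Suc j)) (anc j' (?w kn))"
      by (rule anc_anc) (use lt 1 S(3) assms(5) in auto)
    ultimately show False using 1(5) by simp
  qed
  from this[OF assms(1,2,4)] this[OF assms(2,1,3)] show ?thesis by simp
qed

text \<open>On each level the launches have total probability at least
  \<open>(1 - p) ^ (D * W) / 400\<close>, with 20 * 20 for reaching the level and for the run below
  it. Those with few requests feed the escape event and so account for at most
  \<open>q / (1 - p) ^ (2 * w)\<close>; the others feed the splitting event of that level. Splitting
  events of the \<open>K - 1\<close> levels are disjoint and imply escape.\<close>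

lemma escape_step:
  assumes vV: "v \<in> V" and g: "fresh n p v t \<pi>" and p: "0 \<le> p" "p \<le> 1/100"
    and W: "W = w * C" "2 * N + W + 1 \<le> L" and long: "(5/3) ^ K * (1 - decay * p) ^ N \<le> 1/100"
    and d: "d = dep v + K" "d \<le> n" and \<theta>: "0 \<le> \<theta>"
    and IH: "\<And>u t' \<pi>'. u \<in> V \<Longrightarrow> dep v < dep u \<Longrightarrow> fresh n p u t' \<pi>' \<Longrightarrow> \<theta> \<le> Pr (bits n) \<pi>' (\<lambda>S. escapes S n t' u)"
  defines "q \<equiv> Pr (bits n) \<pi> (\<lambda>S. escapes S n t v)"
  shows "real (K - 1) * (w * p * (1 - p) ^ (2 * w) * \<theta> * ((1 - p) ^ (D * W) / 400 - q / (1 - p) ^ (2 * w))) \<le> q"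
proof -
  have pr: "prob_on (bits n) \<pi>" using g by (simp add: fresh_def)
  have p1: "0 \<le> p" "p \<le> 1" "0 < 1 - p" using p by auto
  define a2 where "a2 = (1 - p) ^ (2 * w)"
  have a2: "0 < a2" using p1 by (simp add: a2_def)
  define c where "c = w * p * a2 * \<theta>"
  have c: "0 \<le> c" using p1 a2 \<theta> by (simp add: c_def)
  have level: "c * ((1 - p) ^ (D * W) / 400 - q / a2) \<le> Pr (bits n) \<pi> (\<lambda>S. splits S n d t v j)"
    if j: "dep v < j" "j < d" for j
  proof -
    let ?X = "hits v j N"
    have X: "x \<in> slab v" "dep x = j" "m < N" "m < L" if "(x, m) \<in> ?X" for x m
      using that W by (auto simp: hits_def)
    have IHx: "\<theta> \<le> Pr (bits n) \<pi>' (\<lambda>S. escapes S n t' (kid x 0))"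
      if "(x, m) \<in> ?X" "fresh n p (kid x 0) t' \<pi>'" for x m t' \<pi>'
    proof (rule IH[OF _ _ that(2)])
      have xV: "x \<in> V" using X(1)[OF that(1)] slab_V by blast
      show "kid x 0 \<in> V" using kid_props[OF xV, of 0] by simp
      show "dep v < dep (kid x 0)" using dep_kid[OF xV, of 0] X(2)[OF that(1)] j by simp
    qed
    have b1: "a2 * Pr (bits n) \<pi> (\<lambda>S. launch t v d N W x m S \<and> few_exposures n t d w x m S)
        \<le> Pr (bits n) \<pi> (\<lambda>S. first_hit t v S x m \<and> escapes S n t v)" if "(x, m) \<in> ?X" for x m
      unfolding a2_def
      by (rule section_bounds(1)[OF vV X(1)[OF that] _ _ d(2) X(4)[OF that] W(1) _ p1(1,2) \<theta> IHx[OF that] g])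
        (use j X(2)[OF that] W in auto)
    have b2: "c * Pr (bits n) \<pi> (\<lambda>S. launch t v d N W x m S \<and> \<not> few_exposures n t d w x m S)
        \<le> Pr (bits n) \<pi> (\<lambda>S. first_hit t v S x m \<and> splits S n d t v j)" if "(x, m) \<in> ?X" for x m
      unfolding c_def a2_def X(2)[OF that, symmetric]
      by (rule section_bounds(2)[OF vV X(1)[OF that] _ _ d(2) X(4)[OF that] W(1) _ p1(1,2) \<theta> IHx[OF that] g])
        (use j X(2)[OF that] W in auto)
    have hh: "Pr (bits n) \<pi> (launch t v d N W x m) = Pr (bits n) \<pi> (\<lambda>S. launch t v d N W x m S \<and> few_exposures n t d w x m S)
        + Pr (bits n) \<pi> (\<lambda>S. launch t v d N W x m S \<and> \<not> few_exposures n t d w x m S)" for x m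
      unfolding Pr_def sum.distrib[symmetric] by (rule sum.cong) auto
    have disj: "xm = ym" if "xm \<in> ?X" "ym \<in> ?X" "first_hit t v S (fst xm) (snd xm)" "first_hit t v S (fst ym) (snd ym)" for S xm ym
    proof -
      have "dep (fst xm) = dep (fst ym)" using that X by (metis prod.collapse)
      from first_hit_unique[OF that(3,4) this] show ?thesis by (simp add: prod_eq_iff)
    qed
    define sH where "sH = (\<Sum>(x, m)\<in>?X. Pr (bits n) \<pi> (launch t v d N W x m))"
    define s1 where "s1 = (\<Sum>(x, m)\<in>?X. Pr (bits n) \<pi> (\<lambda>S. launch t v d N W x m S \<and> few_exposures n t d w x m S))"
    define s2 where "s2 = (\<Sum>(x, m)\<in>?X. Pr (bits n) \<pi> (\<lambda>S. launch t v d N W x m S \<and> \<not> few_exposures n t d w x m S))"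
    have sH: "sH = s1 + s2" unfolding sH_def s1_def s2_def sum.distrib[symmetric]
      by (rule sum.cong) (auto simp: hh)
    have "a2 * s1 \<le> (\<Sum>(x, m)\<in>?X. Pr (bits n) \<pi> (\<lambda>S. first_hit t v S x m \<and> escapes S n t v))"
      unfolding s1_def sum_distrib_left by (rule sum_mono) (use b1 in auto)
    also have "\<dots> \<le> q"
      unfolding q_def case_prod_unfold by (rule Pr_sum_le[OF pr finite_hits]) (use disj in blast)+
    finally have s1: "s1 \<le> q / a2" using a2 by (simp add: field_simps)
    have "c * s2 \<le> (\<Sum>(x, m)\<in>?X. Pr (bits n) \<pi> (\<lambda>S. first_hit t v S x m \<and> splits S n d t v j))"
      unfolding s2_def sum_distrib_left by (rule sum_mono) (use b2 in auto)
    also have "\<dots> \<le> Pr (bits n) \<pi> (\<lambda>S. splits S n d t v j)"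
      unfolding case_prod_unfold by (rule Pr_sum_le[OF pr finite_hits]) (use disj in blast)+
    finally have s2: "c * s2 \<le> Pr (bits n) \<pi> (\<lambda>S. splits S n d t v j)" .
    have "(1 - p) ^ (D * W) / 400 = (1/20) * ((1 - p) ^ (D * W) / 20)" by simp
    also have "\<dots> \<le> (\<Sum>(x, m)\<in>?X. Pr (bits n) \<pi> (\<lambda>S. first_hit t v S x m)) * ((1 - p) ^ (D * W) / 20)"
      by (rule mult_right_mono[OF sum_first_hit[OF vV g p j(1) _ _ _ long]]) (use j d W p1 in auto)
    also have "\<dots> = (\<Sum>(x, m)\<in>?X. Pr (bits n) \<pi> (\<lambda>S. first_hit t v S x m) * ((1 - p) ^ (D * W) / 20))"
      by (simp add: sum_distrib_right case_prod_unfold)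
    also have "\<dots> \<le> sH" unfolding sH_def
    proof (rule sum_mono, clarify)
      fix x m assume xm: "(x, m) \<in> ?X"
      show "Pr (bits n) \<pi> (\<lambda>S. first_hit t v S x m) * ((1 - p) ^ (D * W) / 20) \<le> Pr (bits n) \<pi> (launch t v d N W x m)"
        by (rule launch_prob[OF vV g p X(1)[OF xm] _ _ d(2) _ X(3)[OF xm] W(2) long]) (use X(2)[OF xm] j d in auto)
    qed
    finally have "(1 - p) ^ (D * W) / 400 - q / a2 \<le> s2" using sH s1 by simp
    then have "c * ((1 - p) ^ (D * W) / 400 - q / a2) \<le> c * s2" using c by (rule mult_left_mono)
    then show ?thesis using s2 by simp
  qed
  let ?J = "{dep v<..<d}"
  have "card ?J = K - 1" using d by simp
  then have "real (K - 1) * (c * ((1 - p) ^ (D * W) / 400 - q / a2)) = (\<Sum>j\<in>?J. c * ((1 - p) ^ (D * W) / 400 - q / a2))"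
    by simp
  also have "\<dots> \<le> (\<Sum>j\<in>?J. Pr (bits n) \<pi> (\<lambda>S. splits S n d t v j))"
    by (rule sum_mono) (use level in auto)
  also have "\<dots> \<le> q" unfolding q_def
  proof (rule Pr_sum_le[OF pr])
    fix S j j' assume "j \<in> ?J" "j' \<in> ?J" "splits S n d t v j" "splits S n d t v j'"
    then show "j = j'" by (intro splits_unique[OF _ _ _ _ d(2)]) auto
  qed (use splits_escapes in auto)
  finally show ?thesis by (simp add: c_def a2_def mult.assoc)
qed

text \<open>Induction from depth \<open>n\<close> upwards. If the probability were below the claimed
  \<open>\<theta>\<close>, at least half of each level's launches would remain for splitting (hence
  800 = 2 * 400), and by \<open>super\<close> the sum over the levels would reach
  \<open>\<theta>\<close>. So the bound does not deteriorate with the distance to depth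
  \<open>n\<close>.\<close>

lemma escape_bound:
  assumes p: "0 \<le> p" "p \<le> 1/100"
    and W: "W = w * C" "2 * N + W + 1 \<le> L" and long: "(5/3) ^ K * (1 - decay * p) ^ N \<le> 1/100"
    and super: "1 \<le> real (K - 1) * (w * p * (1 - p) ^ (2 * w) * ((1 - p) ^ (D * W) / 800))"
    and vV: "v \<in> V" and g: "fresh n p v t \<pi>"
  shows "(1 - p) ^ (2 * w) * ((1 - p) ^ (D * W) / 800) \<le> Pr (bits n) \<pi> (\<lambda>S. escapes S n t v)"
  using vV g
proof (induction "n - dep v" arbitrary: v t \<pi> rule: less_induct)
  case less
  have pr: "prob_on (bits n) \<pi>" using less.prems(2) by (simp add: fresh_def)
  have p1: "0 \<le> 1 - p" "1 - p \<le> 1" using p by auto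
  define \<theta> where "\<theta> = (1 - p) ^ (2 * w) * ((1 - p) ^ (D * W) / 800)"
  have pow1: "(1 - p) ^ i \<le> 1" "0 < (1 - p) ^ i" for i using p by (auto intro: power_le_one)
  have \<theta>0: "0 \<le> \<theta>" using pow1(2)[of "2 * w"] pow1(2)[of "D * W"] by (simp add: \<theta>_def)
  have \<theta>1: "\<theta> \<le> 1/800"
    using mult_mono[OF pow1(1)[of "2 * w"] pow1(1)[of "D * W"]] pow1(2)[of "D * W"] unfolding \<theta>_def by simp
  show ?case
  proof (cases "n \<le> dep v")
    case True
    have "escapes S n t v" for S
      unfolding escapes_def using True sub_refl[OF less.prems(1)] by (intro exI[of _ 0]) simp
    then show ?thesis using \<theta>1 by (simp add: finite_bits \<theta>_def)
  next
    case False
    then have vn: "dep v < n" by simp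
    show ?thesis
    proof (cases "dep v + K \<le> n")
      \<comment> \<open>Within \<open>K\<close> levels of the target a single downward run
        suffices.\<close>
      case short: False
      have "\<theta> \<le> 1/20" using \<theta>1 by simp
      also have "\<dots> \<le> Pr (bits n) \<pi> (\<lambda>S. reaches S v n t v N)"
        by (rule reaches_fresh[OF less.prems p _ _ _ _ long]) (use vn short W in auto)
      also have "\<dots> \<le> Pr (bits n) \<pi> (\<lambda>S. escapes S n t v)"
        by (rule Pr_mono[OF pr]) (auto simp: reaches_def escapes_def slab_def)
      finally show ?thesis unfolding \<theta>_def .
    next
      case True
      define q where "q = Pr (bits n) \<pi> (\<lambda>S. escapes S n t v)"
      define a2 where "a2 = (1 - p) ^ (2 * w)"
      define h where "h = (1 - p) ^ (D * W) / 800"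
      have a2: "0 < a2" using pow1 by (simp add: a2_def)
      have IH: "\<theta> \<le> Pr (bits n) \<pi>' (\<lambda>S. escapes S n t' u)"
        if "u \<in> V" "dep v < dep u" "fresh n p u t' \<pi>'" for u t' \<pi>'
        unfolding \<theta>_def by (rule less.hyps[OF _ that(1,3)]) (use vn that(2) in simp)
      have step: "real (K - 1) * (w * p * a2 * \<theta> * (2 * h - q / a2)) \<le> q"
        using escape_step[OF less.prems p W long refl True \<theta>0 IH] unfolding q_def a2_def h_def by simp
      show ?thesis
      proof (rule ccontr)
        assume "\<not> ?thesis"
        then have lt: "q < \<theta>" "q < a2 * h" unfolding q_def \<theta>_def a2_def h_def by auto
        then have "h \<le> 2 * h - q / a2" using a2 by (simp add: field_simps)
        then have "real (K - 1) * (w * p * a2 * \<theta> * h) \<le> real (K - 1) * (w * p * a2 * \<theta> * (2 * h - q / a2))"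
          using p a2 \<theta>0 by (intro mult_left_mono) auto
        then have "real (K - 1) * (w * p * a2 * h) * \<theta> \<le> q" using step by (simp add: mult_ac)
        moreover have "\<theta> \<le> real (K - 1) * (w * p * a2 * h) * \<theta>"
          using mult_right_mono[OF super \<theta>0] unfolding a2_def h_def by simp
        ultimately show False using lt(1) by simp
      qed
    qed
  qed
qed

end

text \<open>For \<open>w\<close> about \<open>1 / p\<close> the powers
  \<open>(1 - p) ^ (2 * w)\<close> and \<open>(1 - p) ^ (D * (w * C))\<close> are at least these
  exponentials, by \<open>1 - p \<ge> exp (- 2 * p)\<close>; this removes \<open>p\<close> from the
  escape bound.\<close>

definition esc_const :: "nat \<Rightarrow> real" where
  "esc_const D = exp (- 4) * (exp (- (2 * real D * real (Suc D))) / 800)"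

text \<open>Enough levels for \<open>K - 1\<close> times \<open>p * w\<close> times
  \<open>esc_const D\<close> to reach 1, given \<open>p * w \<ge> 1/2\<close>.\<close>

definition esc_levels :: "nat \<Rightarrow> nat" where
  "esc_levels D = Suc (nat \<lceil>2 / esc_const D\<rceil>)"

text \<open>The value of \<open>p * N\<close> at which \<open>exp (- decay * p * N)\<close> beats
  \<open>(5/3) ^ K\<close> by a factor of 100; \<open>60 * Suc D\<close> is the inverse of
  \<open>decay\<close>.\<close>

definition esc_block :: "nat \<Rightarrow> real" where
  "esc_block D = (real (esc_levels D) * ln (5/3) + ln 100) * (60 * real (Suc D))"

text \<open>Two runs and the quiet window fit into a period once \<open>M * p\<close> exceeds this;
  the 3 absorbs the rounding of \<open>N\<close> and the extra step.\<close>

definition esc_time :: "nat \<Rightarrow> real" where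
  "esc_time D = 2 * esc_block D + real (Suc D) + 3"

lemma esc_const_pos: "0 < esc_const D" by (simp add: esc_const_def)

lemma esc_block_pos: "0 \<le> esc_block D" unfolding esc_block_def by simp

lemma one_minus_ge_exp:
  fixes p :: real
  assumes "0 \<le> p" "p \<le> 1/100"
  shows "exp (- (2 * p)) \<le> 1 - p"
proof -
  have "1 + 2 * p \<le> exp (2 * p)" by (rule exp_ge_add_one_self)
  then have "exp (- (2 * p)) \<le> 1 / (1 + 2 * p)"
    using assms by (simp add: exp_minus field_simps)
  also have "\<dots> \<le> 1 - p"
  proof -
    have "p * p \<le> p * (1/100)" using assms by (intro mult_left_mono) auto
    then have "1 \<le> (1 - p) * (1 + 2 * p)" using assms by (simp add: algebra_simps)
    then show ?thesis using assms by (simp add: divide_le_eq)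
  qed
  finally show ?thesis .
qed

lemma one_minus_power_ge:
  fixes p :: real
  assumes "0 \<le> p" "p \<le> 1/100" "p * real k \<le> a"
  shows "exp (- (2 * a)) \<le> (1 - p) ^ k"
proof -
  have "exp (- (2 * a)) \<le> exp (real k * (- (2 * p)))" using assms(3) by (simp add: mult_ac)
  also have "\<dots> = exp (- (2 * p)) ^ k" by (rule exp_of_nat_mult)
  also have "\<dots> \<le> (1 - p) ^ k" by (rule power_mono[OF one_minus_ge_exp[OF assms(1,2)]]) simp
  finally show ?thesis .
qed

context coloured_tree
begin

lemma uniform_escape:
  assumes p: "0 < p" "p \<le> 1/100" and Mp: "esc_time D \<le> real M * p" and vV: "v \<in> V" and g: "fresh n p v t \<pi>"
  shows "esc_const D \<le> Pr (bits n) \<pi> (\<lambda>S. escapes S n t v)"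
proof -
  \<comment> \<open>Rounding down keeps \<open>p * w\<close> between 1/2 and 1: large enough for the
    recursion, small enough for the cost.\<close>
  define w where "w = nat \<lfloor>1 / p\<rfloor>"
  have w: "real w \<le> 1 / p" "1 / p - 1 < real w" 
  proof -
    have "real w = real_of_int \<lfloor>1 / p\<rfloor>" unfolding w_def using p by simp
    then show "real w \<le> 1 / p" "1 / p - 1 < real w" using floor_correct[of "1 / p"] by linarith+
  qed
  have wp: "p * real w \<le> 1" "1/2 \<le> p * real w"
  proof -
    show "p * real w \<le> 1" using w(1) p by (simp add: field_simps)
    have "1 - p \<le> p * real w" using w(2) p by (simp add: field_simps)
    then show "1/2 \<le> p * real w" using p by simp
  qed
  have Cr: "real C = real (Suc D)" by (simp add: C_def)
  have a2: "exp (- 4) \<le> (1 - p) ^ (2 * w)"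
    using one_minus_power_ge[of p "2 * w" 2] p wp by simp
  have hh: "exp (- (2 * real D * real (Suc D))) \<le> (1 - p) ^ (D * (w * C))"
  proof -
    have "p * real (D * (w * C)) = (p * real w) * (real D * real (Suc D))" using Cr by simp
    also have "\<dots> \<le> 1 * (real D * real (Suc D))" using wp by (intro mult_right_mono) auto
    finally show ?thesis using one_minus_power_ge[of p "D * (w * C)" "real D * real (Suc D)"] p
      by (simp add: mult_ac)
  qed
  let ?K = "esc_levels D"
  define N where "N = nat \<lceil>esc_block D / p\<rceil>"
  have N: "esc_block D / p \<le> real N" "real N \<le> esc_block D / p + 1"
    unfolding N_def using esc_block_pos[of D] p by (auto simp: zero_le_divide_iff)
  have "2 * real N + real (w * C) + 1 \<le> real M * real C"
  proof -
    have "p * (2 * real N + real (w * C) + 1) \<le> 2 * (esc_block D + p) + real C + p"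
    proof -
      have "p * real N \<le> esc_block D + p" using N(2) p by (simp add: field_simps)
      moreover have "p * (real w * real C) \<le> 1 * real C" 
        using mult_right_mono[OF wp(1), of "real C"] by (simp add: mult.assoc)
      ultimately show ?thesis by (simp add: algebra_simps)
    qed
    also have "\<dots> \<le> esc_time D" using p Cr by (simp add: esc_time_def)
    also have "\<dots> \<le> real M * p" by (rule Mp)
    also have "\<dots> \<le> p * (real M * real C)" using p C_pos mult_left_mono[of 1 "real C" "real M * p"] by (simp add: mult_ac)
    finally show ?thesis using p by simp
  qed
  then have "real (2 * N + w * C + 1) \<le> real L" unfolding L_def by simp
  then have L: "2 * N + w * C + 1 \<le> L" unfolding of_nat_le_iff .
  have long: "(5/3) ^ ?K * (1 - decay * p) ^ N \<le> 1/100"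
  proof -
    have k1: "decay * p \<le> 1" using decay p mult_mono[of decay 1 p 1] by auto
    have "(1 - decay * p) ^ N \<le> exp (- (decay * p)) ^ N"
      using k1 exp_ge_add_one_self[of "- (decay * p)"] by (intro power_mono) auto
    also have "\<dots> = exp (- (decay * (p * real N)))" by (simp add: exp_of_nat_mult[symmetric] mult_ac)
    also have "\<dots> \<le> exp (- (decay * esc_block D))"
      using N(1) p decay by (simp add: field_simps)
    also have "decay * esc_block D = real ?K * ln (5/3) + ln 100"
      unfolding decay_def esc_block_def Cr by simp
    also have "exp (- (real ?K * ln (5/3) + ln 100)) = (1 / (5/3) ^ ?K) * (1/100)"
      by (simp add: exp_add exp_diff exp_minus exp_of_nat_mult field_simps)
    finally have "(1 - decay * p) ^ N \<le> (1 / (5/3) ^ ?K) * (1/100)" .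
    then have "(5/3) ^ ?K * (1 - decay * p) ^ N \<le> (5/3) ^ ?K * ((1 / (5/3) ^ ?K) * (1/100))"
      by (intro mult_left_mono) auto
    then show ?thesis by simp
  qed
  have prod_ge: "esc_const D \<le> (1 - p) ^ (2 * w) * ((1 - p) ^ (D * (w * C)) / 800)"
    unfolding esc_const_def using a2 hh p by (intro mult_mono divide_right_mono) auto
  have super: "1 \<le> real (?K - 1) * (w * p * (1 - p) ^ (2 * w) * ((1 - p) ^ (D * (w * C)) / 800))"
  proof -
    have "2 / esc_const D \<le> real (?K - 1)"
      unfolding esc_levels_def using esc_const_pos[of D] by (simp add: real_nat_ceiling_ge)
    moreover have "1 \<le> y * ((1/2) * c)" if "2 / c \<le> y" "0 < c" for c y :: real
      using that by (simp add: field_simps)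
    ultimately have "1 \<le> real (?K - 1) * ((1/2) * esc_const D)" using esc_const_pos[of D] by blast
    also have "\<dots> \<le> real (?K - 1) * ((p * real w) * ((1 - p) ^ (2 * w) * ((1 - p) ^ (D * (w * C)) / 800)))"
      using wp prod_ge esc_const_pos[of D] p by (intro mult_left_mono mult_mono) auto
    finally show ?thesis by (simp only: mult_ac)
  qed
  show ?thesis
    by (rule order_trans[OF prod_ge escape_bound[OF _ p(2) refl L long super vV g]]) (use p in simp)
qed

section \<open>Independent attempts along a ray\<close>

primrec ray :: "nat \<Rightarrow> 'a" where
  "ray 0 = r"
| "ray (Suc k) = kid (ray k) 0"

definition bush :: "nat \<Rightarrow> 'a" where "bush k = kid (ray k) 1"

lemma ray: "ray k \<in> V \<and> dep (ray k) = k"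
  by (induction k) (use rV dep_r kid_props dep_kid in auto)

lemma ray_sub: "j \<le> k \<Longrightarrow> ray k \<in> sub (ray j)"
proof (induction k rule: dec_induct)
  case base
  then show ?case using ray sub_refl by blast
next
  case (step k)
  then show ?case using sub_trans[OF sub_kid[of "ray k" 0]] ray[of k] by simp
qed

lemma bush: "bush k \<in> V" "dep (bush k) = Suc k" "bush k \<noteq> r" "bush k \<in> sub (ray k)"
  using ray[of k] kid_props[of "ray k" 1] dep_kid[of "ray k" 1] sub_kid[of "ray k" 1] unfolding bush_def by auto

text \<open>The ray descends through first children and the bushes are second children, so for
  \<open>k > j\<close> the subtree of \<open>bush k\<close> lies below the sibling of
  \<open>bush j\<close>.\<close>

lemma bush_disjoint:
  assumes "j \<noteq> k"
  shows "sub (bush j) \<inter> sub (bush k) = {}"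
proof -
  have "sub (bush j) \<inter> sub (bush k) = {}" if "j < k" for j k
  proof -
    have "w \<in> sub (ray (Suc j))" if "w \<in> sub (bush k)" for w
      using that sub_trans bush(4)[of k] ray_sub[of "Suc j" k] \<open>j < k\<close> by (meson Suc_leI)
    moreover have "sub (ray (Suc j)) \<inter> sub (bush j) = {}"
      using sub_same_level[of _ "ray (Suc j)" "bush j"] ray[of "Suc j"] bush(2)[of j] kid_neq[of "ray j"] ray[of j]
      by (auto simp: bush_def)
    ultimately show ?thesis by blast
  qed
  from this[of j k] this[of k j] assms show ?thesis by (metis Int_commute linorder_neqE_nat)
qed

definition silent_esc :: "nat \<Rightarrow> nat \<Rightarrow> ('a \<times> nat) set \<Rightarrow> bool" where
  "silent_esc n k S \<longleftrightarrow> (\<forall>u. (bush k, u) \<in> bits n \<longrightarrow> (bush k, u) \<notin> S) \<and> escapes S n 0 (bush k)"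

text \<open>Inside \<open>sub v\<close> the walk is offered only edges named by vertices of
  \<open>sub v\<close>; the edge above \<open>v\<close> is among them.\<close>

lemma escapes_depends: "depends (\<lambda>S. escapes S n t v) {(e, u). e \<in> sub v}"
proof -
  have imp: "escapes S' n t v" if eq: "S \<inter> {(e, u). e \<in> sub v} = S' \<inter> {(e, u). e \<in> sub v}" and E: "escapes S n t v" for S S'
  proof -
    obtain k where k: "n \<le> dep (wlk S t v k)" "\<And>l. l \<le> k \<Longrightarrow> wlk S t v l \<in> sub v"
      using E unfolding escapes_def by blast
    have same: "wlk S' t v l = wlk S t v l" if "l \<le> k" for l
    proof (rule wlk_cong[OF _ that])
      fix l e assume l: "l < k" and e: "edge_at e (wlk S t v l) (t + l)"
      have "e \<in> sub v" using e k(2)[of l] l sub_down[of e v] unfolding edge_at_def by auto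
      then show "(e, (t + l) mod L) \<in> S \<longleftrightarrow> (e, (t + l) mod L) \<in> S'" using eq by blast
    qed
    then show ?thesis using k unfolding escapes_def by (intro exI[of _ k]) auto
  qed
  show ?thesis unfolding depends_def
  proof (intro allI impI)
    fix S S' :: "('a \<times> nat) set" assume "S \<inter> {(e, u). e \<in> sub v} = S' \<inter> {(e, u). e \<in> sub v}"
    then show "escapes S n t v = escapes S' n t v" using imp[of S S'] imp[of S' S] by blast
  qed
qed

lemma silent_esc_depends: "depends (silent_esc n k) {(e, u). e \<in> sub (bush k)}"
proof -
  have "bush k \<in> sub (bush k)" using sub_refl bush by blast
  then have "depends (\<lambda>S. \<forall>u. (bush k, u) \<in> bits n \<longrightarrow> (bush k, u) \<notin> S) {(e, u). e \<in> sub (bush k)}"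
    unfolding depends_def by blast
  from depends_conj[OF this escapes_depends] show ?thesis unfolding silent_esc_def .
qed

lemma card_edge_bits: "card {(e', u) \<in> bits n. e' = e} \<le> M"
proof -
  have "inj_on (\<lambda>(e', u). u div C) {(e', u) \<in> bits n. e' = e}"
    by (rule inj_onI) (auto simp: bits_def, metis div_mult_mod_eq)
  moreover have "(\<lambda>(e', u). u div C) ` {(e', u) \<in> bits n. e' = e} \<subseteq> {..<M}"
    by (auto simp: bits_def L_def less_mult_imp_div_less)
  ultimately show ?thesis using card_inj_on_le[of _ _ "{..<M}"] by fastforce
qed

text \<open>Silencing the edge costs \<open>(1 - p) ^ M\<close>, one bit per round. The silenced
  bits have parameter 0, so the environment of the bush remains fresh.\<close>

lemma silent_esc_prob:
  assumes p: "0 < p" "p \<le> 1/100" and Mp: "esc_time D \<le> real M * p"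
  shows "(1 - p) ^ M * esc_const D \<le> Pr (bits n) (\<lambda>_. p) (silent_esc n k)"
proof -
  define Q where "Q = {(e, u) \<in> bits n. e = bush k}"
  let ?\<pi> = "\<lambda>i. if i \<in> Q then (if i \<in> {} then 1 else 0) else p"
  have "Pr (bits n) (\<lambda>_. p) (silent_esc n k) = Pr (bits n) (\<lambda>_. p) (\<lambda>S. S \<inter> Q = {} \<inter> Q \<and> escapes S n 0 (bush k))"
    by (rule Pr_cong) (auto simp: silent_esc_def Q_def)
  also have "\<dots> = wt Q (\<lambda>_. p) {} * Pr (bits n) ?\<pi> (\<lambda>S. escapes S n 0 (bush k))"
    by (rule Pr_constrain[OF finite_bits]) (auto simp: Q_def)
  also have "\<dots> \<ge> (1 - p) ^ M * esc_const D"
  proof (rule mult_mono)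
    have "(1 - p) ^ M \<le> (1 - p) ^ card Q"
      using card_edge_bits[of n "bush k"] p unfolding Q_def by (intro power_decreasing) auto
    then show "(1 - p) ^ M \<le> wt Q (\<lambda>_. p) {}" by (simp add: wt_def)
    show "esc_const D \<le> Pr (bits n) ?\<pi> (\<lambda>S. escapes S n 0 (bush k))"
      by (rule uniform_escape[OF p Mp bush(1)]) (use p in \<open>auto simp: fresh_def prob_on_def Q_def\<close>)
  qed (use p esc_const_pos[of D] in \<open>auto simp: wt_def intro: prod_nonneg\<close>)
  finally show ?thesis .
qed

lemma no_silent_esc_prob:
  assumes p: "0 < p" "p \<le> 1/100" and Mp: "esc_time D \<le> real M * p"
  shows "Pr (bits n) (\<lambda>_. p) (\<lambda>S. \<forall>k<m. \<not> silent_esc n k S) \<le> (1 - (1 - p) ^ M * esc_const D) ^ m"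
proof (induction m)
  case (Suc m)
  have pr: "prob_on (bits n) (\<lambda>_. p)" using p by (simp add: prob_on_def)
  have "Pr (bits n) (\<lambda>_. p) (\<lambda>S. \<forall>k<Suc m. \<not> silent_esc n k S)
      = Pr (bits n) (\<lambda>_. p) (\<lambda>S. (\<forall>k<m. \<not> silent_esc n k S) \<and> \<not> silent_esc n m S)"
    by (rule Pr_cong) (auto simp: less_Suc_eq)
  also have "\<dots> = Pr (bits n) (\<lambda>_. p) (\<lambda>S. \<forall>k<m. \<not> silent_esc n k S) * Pr (bits n) (\<lambda>_. p) (\<lambda>S. \<not> silent_esc n m S)"
  proof (rule Pr_indep[OF finite_bits pr])
    show "depends (\<lambda>S. \<not> silent_esc n m S) {(e, u). e \<in> sub (bush m)}"
      using silent_esc_depends[of n m] unfolding depends_def by blast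
    have "depends (silent_esc n k) (\<Union>k<m. {(e, u). e \<in> sub (bush k)})" if "k < m" for k
      by (rule depends_mono[OF silent_esc_depends]) (use that in blast)
    then show "depends (\<lambda>S. \<forall>k<m. \<not> silent_esc n k S) (\<Union>k<m. {(e, u). e \<in> sub (bush k)})"
      unfolding depends_def by blast
    show "bits n \<inter> (\<Union>k<m. {(e, u). e \<in> sub (bush k)}) \<inter> {(e, u). e \<in> sub (bush m)} = {}"
      using bush_disjoint[of _ m] by fastforce
  qed
  also have "\<dots> \<le> (1 - (1 - p) ^ M * esc_const D) ^ m * (1 - (1 - p) ^ M * esc_const D)"
  proof (rule mult_mono[OF Suc.IH])
    show "Pr (bits n) (\<lambda>_. p) (\<lambda>S. \<not> silent_esc n m S) \<le> 1 - (1 - p) ^ M * esc_const D"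
      using silent_esc_prob[OF assms, of n m] by (simp add: Pr_not finite_bits)
    have "(1 - p) ^ M * esc_const D \<le> 1"
      using silent_esc_prob[OF assms, of n m] Pr_le_1[OF finite_bits pr] by (rule order_trans)
    then show "0 \<le> (1 - (1 - p) ^ M * esc_const D) ^ m" by simp
  qed (rule Pr_nonneg[OF pr])
  finally show ?case by (simp only: power_Suc2)
qed (simp add: finite_bits)

end

section \<open>From exponential waiting times to independent slot bits\<close>

section \<open>Rings in disjoint time slots are independent\<close>

abbreviation "EXP1 \<equiv> density lborel (exponential_density 1)"

text \<open>The slot containing a time \<open>u > 0\<close>: slot \<open>i\<close> is \<open>(i \<delta>, (i + 1) \<delta>]\<close>. For \<open>u \<le> 0\<close> the value is junk.\<close>

definition sidx :: "real \<Rightarrow> real \<Rightarrow> nat" where "sidx \<delta> u = nat (\<lceil>u / \<delta>\<rceil> - 1)"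

definition slots :: "real \<Rightarrow> nat set \<Rightarrow> real set" where
  "slots \<delta> A = {u. 0 < u \<and> sidx \<delta> u \<in> A}"

text \<open>The length of the part of the slots in \<open>A\<close> after time \<open>s\<close>; \<open>exp (- remaining \<delta> A s)\<close> is the probability that a Poisson
process started afresh at \<open>s\<close> misses them.\<close>

definition remaining :: "real \<Rightarrow> nat set \<Rightarrow> real \<Rightarrow> real" where
  "remaining \<delta> A s = (\<Sum>i\<in>A. max 0 (min \<delta> ((real i + 1) * \<delta> - s)))"

lemma sidx_iff:
  assumes "0 < \<delta>" "0 < u"
  shows "i = sidx \<delta> u \<longleftrightarrow> real i * \<delta> < u \<and> u \<le> (real i + 1) * \<delta>"
proof -
  have pos: "0 < \<lceil>u / \<delta>\<rceil>" using assms by simp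
  have "i = sidx \<delta> u \<longleftrightarrow> \<lceil>u / \<delta>\<rceil> = int i + 1" unfolding sidx_def using pos by linarith
  also have "\<dots> \<longleftrightarrow> real i < u / \<delta> \<and> u / \<delta> \<le> real i + 1"
    by (simp add: ceiling_eq_iff)
  also have "\<dots> \<longleftrightarrow> real i * \<delta> < u \<and> u \<le> (real i + 1) * \<delta>"
    using assms by (simp add: field_simps)
  finally show ?thesis .
qed

lemma slots_measurable [measurable]: "slots \<delta> A \<in> sets borel"
proof -
  have "sidx \<delta> \<in> borel \<rightarrow>\<^sub>M count_space UNIV"
    unfolding sidx_def by measurable
  then show ?thesis unfolding slots_def by measurable
qed

lemma remaining_measurable [measurable]: "remaining \<delta> A \<in> borel_measurable borel"
  unfolding remaining_def by measurable

lemma remaining_0: "0 < \<delta> \<Longrightarrow> remaining \<delta> A 0 = real (card A) * \<delta>"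
proof -
  assume d: "0 < \<delta>"
  have "max 0 (min \<delta> ((real i + 1) * \<delta> - 0)) = \<delta>" for i :: nat
  proof -
    have "1 * \<delta> \<le> (real i + 1) * \<delta>" using d by (intro mult_right_mono) auto
    then show ?thesis using d by simp
  qed
  then show ?thesis unfolding remaining_def by simp
qed

lemma remaining_late:
  assumes "0 < \<delta>" "A \<subseteq> {..<M}" "real M * \<delta> \<le> s"
  shows "remaining \<delta> A s = 0"
  unfolding remaining_def
proof (rule sum.neutral, rule ballI)
  fix i assume "i \<in> A"
  then have "real i + 1 \<le> real M" using assms(2) by auto
  then have "(real i + 1) * \<delta> \<le> real M * \<delta>" using assms(1) by (intro mult_right_mono) auto
  then have "(real i + 1) * \<delta> - s \<le> 0" using assms(3) by linarith
  then show "max 0 (min \<delta> ((real i + 1) * \<delta> - s)) = 0" using assms(1) by simp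
qed

lemma remaining_deriv:
  assumes d: "0 < \<delta>" and A: "finite A"
    and u: "\<And>i. i \<in> A \<Longrightarrow> u \<noteq> real i * \<delta> \<and> u \<noteq> (real i + 1) * \<delta>"
  shows "(remaining \<delta> A has_real_derivative (- (if u \<in> slots \<delta> A then 1 else 0))) (at u)"
proof -
  let ?c = "\<lambda>i. if real i * \<delta> < u \<and> u < (real i + 1) * \<delta> then - 1 else 0 :: real"
  have each: "((\<lambda>s. max 0 (min \<delta> ((real i + 1) * \<delta> - s))) has_real_derivative ?c i) (at u)" if i: "i \<in> A" for i
  proof -
    consider "u < real i * \<delta>" | "real i * \<delta> < u" "u < (real i + 1) * \<delta>" | "(real i + 1) * \<delta> < u"
      using u[OF i] by linarith
    then show ?thesis
    proof cases
      case 1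
      have "((\<lambda>s. \<delta>) has_real_derivative ?c i) (at u)" using 1 by simp
      then show ?thesis
        by (rule has_field_derivative_transform_within_open[of _ _ _ "{..<real i * \<delta>}"])
          (use 1 d in \<open>auto simp: algebra_simps\<close>)
    next
      case 2
      have "((\<lambda>s. (real i + 1) * \<delta> - s) has_real_derivative ?c i) (at u)"
        using 2 by (auto intro!: derivative_eq_intros)
      then show ?thesis
        by (rule has_field_derivative_transform_within_open[of _ _ _ "{real i * \<delta><..<(real i + 1) * \<delta>}"])
          (use 2 d in \<open>auto simp: algebra_simps\<close>)
    next
      case 3
      have "((\<lambda>s. 0) has_real_derivative ?c i) (at u)" using 3 by simp
      then show ?thesis
        by (rule has_field_derivative_transform_within_open[of _ _ _ "{(real i + 1) * \<delta><..}"])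
          (use 3 d in auto)
    qed
  qed
  have "(\<Sum>i\<in>A. ?c i) = - (if u \<in> slots \<delta> A then 1 else 0)"
  proof (cases "0 < u")
    case True
    have "?c i = (if sidx \<delta> u = i then - 1 else 0)" if "i \<in> A" for i
      using sidx_iff[OF d True, of i] u[OF that] by auto
    then have "(\<Sum>i\<in>A. ?c i) = (\<Sum>i\<in>A. if sidx \<delta> u = i then - 1 else 0)" by simp
    also have "\<dots> = - (if u \<in> slots \<delta> A then 1 else 0)"
      using A True by (simp add: slots_def)
    finally show ?thesis .
  next
    case False
    have "?c i = 0" for i
    proof -
      have "0 \<le> real i * \<delta>" using d by simp
      then show ?thesis using False by simp
    qed
    then show ?thesis using False by (simp add: slots_def)
  qed
  moreover have "(remaining \<delta> A has_real_derivative (\<Sum>i\<in>A. ?c i)) (at u)"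
    unfolding remaining_def by (rule DERIV_sum) (rule each)
  ultimately show ?thesis by simp
qed

lemma continuous_on_remaining: "continuous_on S (remaining \<delta> A)"
  unfolding remaining_def by (intro continuous_intros)

lemma exp_minus_at_top: "((\<lambda>x::real. exp (- x)) \<longlongrightarrow> 0) at_top"
  by (rule filterlim_compose[OF exp_at_bot filterlim_uminus_at_bot_at_top])

text \<open>Decomposition at the next ring after \<open>s\<close>: the slots are missed iff this
  ring misses them and so does the process restarted at it.\<close>

lemma void_step:
  assumes d: "0 < \<delta>" and AM: "A \<subseteq> {..<M}"
  shows "(\<integral>\<^sup>+y. indicator (- slots \<delta> A) (s + y) * ennreal (exp (- remaining \<delta> A (s + y))) \<partial>EXP1)
    = ennreal (exp (- remaining \<delta> A s))"
proof -
  have A: "finite A" using AM by (rule finite_subset) simp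
  \<comment> \<open>Beyond \<open>b\<close> all slots of \<open>A\<close> are over and the integrand
    is just \<open>exp (- y)\<close>.\<close>
  define b where "b = max 0 (real M * \<delta> - s)"
  have b: "0 \<le> b" "real M * \<delta> \<le> s + b" by (auto simp: b_def)
  define f where "f y = exp (- y) * (indicator (- slots \<delta> A) (s + y) * exp (- remaining \<delta> A (s + y)))" for y
  \<comment> \<open>An antiderivative of \<open>f\<close>: the exponent
    \<open>y + remaining \<delta> A (s + y)\<close> has slope 1 outside the slots and 0 inside,
    which is the indicator in \<open>f\<close>. Slot boundaries form the exceptional set
    \<open>P\<close>.\<close>
  define G where "G y = - exp (- (y + remaining \<delta> A (s + y)))" for y
  define P where "P = (\<lambda>i. real i * \<delta> - s) ` A \<union> (\<lambda>i. (real i + 1) * \<delta> - s) ` A"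
  have fb: "f \<in> borel_measurable borel" unfolding f_def by measurable
  have late: "s + y \<notin> slots \<delta> A" "remaining \<delta> A (s + y) = 0" if "b < y" for y
  proof -
    have y: "real M * \<delta> < s + y" using that b by linarith
    then show "remaining \<delta> A (s + y) = 0" using remaining_late[OF d AM] by simp
    show "s + y \<notin> slots \<delta> A"
    proof
      assume u: "s + y \<in> slots \<delta> A"
      then have "sidx \<delta> (s + y) < M" "0 < s + y" using AM by (auto simp: slots_def)
      then have "s + y \<le> (real (sidx \<delta> (s + y)) + 1) * \<delta>" "real (sidx \<delta> (s + y)) + 1 \<le> real M"
        using sidx_iff[OF d, of "s + y" "sidx \<delta> (s + y)"] by auto
      then have "s + y \<le> real M * \<delta>" using d by (meson mult_right_mono less_imp_le order_trans)
      then show False using y by simp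
    qed
  qed
  have "(f has_integral (G b - G 0)) {0..b}"
  proof (rule fundamental_theorem_of_calculus_interior_strong[OF _ b(1)])
    show "finite P" unfolding P_def using A by simp
    fix y assume y: "y \<in> {0<..<b} - P"
    have "(remaining \<delta> A has_real_derivative (- (if s + y \<in> slots \<delta> A then 1 else 0))) (at (s + y))"
      by (rule remaining_deriv[OF d A]) (use y in \<open>force simp: P_def\<close>)
    then have "((\<lambda>y. remaining \<delta> A (s + y)) has_real_derivative (- (if s + y \<in> slots \<delta> A then 1 else 0)) * 1) (at y)"
      by (rule DERIV_chain2[where g = "\<lambda>y. s + y"]) (auto intro!: derivative_eq_intros)
    then have "(G has_real_derivative f y) (at y)"
      unfolding G_def f_def
      by (auto intro!: derivative_eq_intros simp: exp_add[symmetric] algebra_simps split: if_splits)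
    then show "(G has_vector_derivative f y) (at y)"
      by (rule has_field_derivative_subset[THEN has_real_derivative_iff_has_vector_derivative[THEN iffD1]]) simp
  next
    show "continuous_on {0..b} G" unfolding G_def
      by (intro continuous_intros continuous_on_compose2[OF continuous_on_remaining[of UNIV]]) auto
  qed
  moreover have "G b - G 0 = exp (- remaining \<delta> A s) - exp (- b)"
    unfolding G_def using remaining_late[OF d AM b(2)] by simp
  ultimately have hi: "(f has_integral (exp (- remaining \<delta> A s) - exp (- b))) {0..b}" by simp
  have f0: "0 \<le> f y" for y unfolding f_def by simp
  have I1: "(\<integral>\<^sup>+y. indicator {0..b} y * f y \<partial>lborel) = ennreal (exp (- remaining \<delta> A s) - exp (- b))"
    by (rule nn_integral_has_integral_lebesgue[OF f0 hi])
  have nonneg: "0 \<le> exp (- remaining \<delta> A s) - exp (- b)"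
    by (rule has_integral_nonneg[OF hi f0])
  have I2: "(\<integral>\<^sup>+y. ennreal (exp (- y)) * indicator {b..} y \<partial>lborel) = ennreal (0 - (- exp (- b)))"
  proof (rule nn_integral_FTC_atLeast)
    show "((\<lambda>x::real. - exp (- x)) \<longlongrightarrow> 0) at_top"
      using tendsto_minus[OF exp_minus_at_top] by simp
  qed (auto intro!: derivative_eq_intros)
  have "(\<integral>\<^sup>+y. indicator (- slots \<delta> A) (s + y) * ennreal (exp (- remaining \<delta> A (s + y))) \<partial>EXP1)
    = (\<integral>\<^sup>+y. ennreal (exponential_density 1 y) *
        (indicator (- slots \<delta> A) (s + y) * ennreal (exp (- remaining \<delta> A (s + y)))) \<partial>lborel)"
    by (rule nn_integral_density) measurable
  also have "\<dots> = (\<integral>\<^sup>+y. ennreal (indicator {0..b} y * f y) + ennreal (exp (- y)) * indicator {b..} y \<partial>lborel)"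
  proof (rule nn_integral_cong_AE)
    have "AE y in lborel. y \<noteq> b" by (rule AE_lborel_singleton)
    then show "AE y in lborel. ennreal (exponential_density 1 y) *
        (indicator (- slots \<delta> A) (s + y) * ennreal (exp (- remaining \<delta> A (s + y)))) =
        ennreal (indicator {0..b} y * f y) + ennreal (exp (- y)) * indicator {b..} y"
    proof eventually_elim
      case (elim y)
      consider "y < 0" | "0 \<le> y" "y < b" | "b < y" using elim by linarith
      then show ?case
      proof cases
        case 1
        then show ?thesis using b(1) by (simp add: exponential_density_def)
      next
        case 2
        then show ?thesis by (simp add: exponential_density_def f_def ennreal_mult ennreal_indicator)
      next
        case 3
        then show ?thesis using b(1) late[OF 3] by (simp add: exponential_density_def)
      qed
    qed
  qed
  also have "\<dots> = (\<integral>\<^sup>+y. indicator {0..b} y * f y \<partial>lborel) + (\<integral>\<^sup>+y. ennreal (exp (- y)) * indicator {b..} y \<partial>lborel)"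
    by (rule nn_integral_add) (use fb in measurable)
  also have "\<dots> = ennreal (exp (- remaining \<delta> A s) - exp (- b)) + ennreal (exp (- b))"
    unfolding I1 I2 by simp
  also have "\<dots> = ennreal (exp (- remaining \<delta> A s))"
    using nonneg by (subst ennreal_plus[symmetric]) auto
  finally show ?thesis .
qed

text \<open>The same fixed-point form, with the constant 2 in place of the indicator; iterated, it
  yields the Laplace transform of the partial sums at 1.\<close>

lemma laplace_step: "(\<integral>\<^sup>+y. 2 * ennreal (exp (- (s + y))) \<partial>EXP1) = ennreal (exp (- s))"
proof -
  have "(\<integral>\<^sup>+y. 2 * ennreal (exp (- (s + y))) \<partial>EXP1)
    = (\<integral>\<^sup>+y. ennreal (exponential_density 1 y) * (2 * ennreal (exp (- (s + y)))) \<partial>lborel)"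
    by (rule nn_integral_density) measurable
  also have "\<dots> = (\<integral>\<^sup>+y. ennreal (2 * exp (- s) * exp (- (2 * y))) * indicator {0..} y \<partial>lborel)"
  proof (rule nn_integral_cong)
    fix y :: real
    have "2 * ennreal (exp (- (s + y))) = ennreal (2 * exp (- (s + y)))"
      by (simp add: ennreal_mult)
    then show "ennreal (exponential_density 1 y) * (2 * ennreal (exp (- (s + y)))) =
        ennreal (2 * exp (- s) * exp (- (2 * y))) * indicator {0..} y"
      by (auto simp: exponential_density_def indicator_def ennreal_mult[symmetric] exp_add[symmetric] mult_ac)
  qed
  also have "\<dots> = ennreal (0 - (- (exp (- s) * exp (- (2 * 0)))))"
  proof (rule nn_integral_FTC_atLeast)
    have "((\<lambda>x::real. exp (- (2 * x))) \<longlongrightarrow> 0) at_top"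
      using tendsto_mult[OF exp_minus_at_top exp_minus_at_top] by (simp add: exp_add[symmetric])
    from tendsto_minus[OF tendsto_mult_left[OF this, of "exp (- s)"]]
    show "((\<lambda>x. - (exp (- s) * exp (- (2 * x)))) \<longlongrightarrow> 0) at_top" by simp
  qed (auto intro!: derivative_eq_intros)
  finally show ?thesis by simp
qed

section \<open>Iterating the renewal identity over finitely many edges\<close>

definition psum :: "('e \<times> nat \<Rightarrow> real) \<Rightarrow> 'e \<Rightarrow> nat \<Rightarrow> real" where
  "psum x e k = (\<Sum>j<k. x (e, j))"

lemma psum_measurable:
  assumes "\<And>j. j < k \<Longrightarrow> (e, j) \<in> J"
  shows "(\<lambda>x. psum x e k) \<in> borel_measurable (\<Pi>\<^sub>M i\<in>J. EXP1)"
  unfolding psum_def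
proof (rule borel_measurable_sum)
  fix j assume "j \<in> {..<k}"
  then have "(\<lambda>x. x (e, j)) \<in> (\<Pi>\<^sub>M i\<in>J. EXP1) \<rightarrow>\<^sub>M EXP1" using assms by (intro measurable_component_singleton) auto
  then show "(\<lambda>x. x (e, j)) \<in> borel_measurable (\<Pi>\<^sub>M i\<in>J. EXP1)"
    by (simp cong: measurable_cong_sets)
qed

interpretation EXP1: prob_space EXP1
  by (rule prob_space_exponential_density) simp

interpretation EXPP: product_prob_space "\<lambda>_. EXP1" UNIV
  by unfold_locales

text \<open>Integrating out the last increment of one edge turns the last \<open>w\<close> times
  \<open>\<Psi>\<close> into \<open>\<Psi>\<close> at the previous sum. Peeling single increments
  leads through unequal numbers of increments per edge, hence the function \<open>K\<close> and the
  induction on its sum.\<close>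

lemma renewal_product:
  fixes w \<Psi> :: "'e \<Rightarrow> real \<Rightarrow> ennreal"
  assumes F: "finite F"
    and meas [measurable]: "\<And>e. w e \<in> borel_measurable borel" "\<And>e. \<Psi> e \<in> borel_measurable borel"
    and step: "\<And>e s. e \<in> F \<Longrightarrow> (\<integral>\<^sup>+y. w e (s + y) * \<Psi> e (s + y) \<partial>EXP1) = \<Psi> e s"
  shows "(\<integral>\<^sup>+x. (\<Prod>e\<in>F. (\<Prod>j<K e. w e (psum x e (Suc j))) * \<Psi> e (psum x e (K e))) \<partial>(\<Pi>\<^sub>M i\<in>(SIGMA e:F. {..<K e}). EXP1))
    = (\<Prod>e\<in>F. \<Psi> e 0)"
proof (induction "\<Sum>e\<in>F. K e" arbitrary: K)
  case 0
  then have K0: "K e = 0" if "e \<in> F" for e using F that by simp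
  then have J: "(SIGMA e:F. {..<K e}) = {}" by auto
  have "(\<Prod>e\<in>F. (\<Prod>j<K e. w e (psum x e (Suc j))) * \<Psi> e (psum x e (K e))) = (\<Prod>e\<in>F. \<Psi> e 0)" for x
    by (rule prod.cong) (use K0 in \<open>auto simp: psum_def\<close>)
  then show ?case unfolding J
    by (simp add: EXPP.emeasure_space_1 PiM_empty)
next
  case (Suc n)
  then obtain f where f: "f \<in> F" "K f \<noteq> 0" by (metis Zero_not_Suc sum.neutral)
  then obtain k where k: "K f = Suc k" by (cases "K f") auto
  define K' where "K' = K(f := k)"
  let ?J' = "SIGMA e:F. {..<K' e}"
  have J: "(SIGMA e:F. {..<K e}) = insert (f, k) ?J'"
    using f k unfolding K'_def by (auto split: if_splits)
  have nin: "(f, k) \<notin> ?J'" by (simp add: K'_def)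
  have fin: "finite ?J'" using F by simp
  let ?g = "\<lambda>K x. (\<Prod>e\<in>F. (\<Prod>j<K e. w e (psum x e (Suc j))) * \<Psi> e (psum x e (K e)))"
  have meas_g: "?g K'' \<in> borel_measurable (\<Pi>\<^sub>M i\<in>J. EXP1)" if "(SIGMA e:F. {..<K'' e}) \<subseteq> J" for K'' :: "'e \<Rightarrow> nat" and J
  proof -
    have [measurable]: "(\<lambda>x. psum x e i) \<in> borel_measurable (\<Pi>\<^sub>M i\<in>J. EXP1)" if "e \<in> F" "i \<le> K'' e" for e i
      by (rule psum_measurable) (use that \<open>(SIGMA e:F. {..<K'' e}) \<subseteq> J\<close> in auto)
    show ?thesis
      by (intro borel_measurable_prod_ennreal borel_measurable_times measurable_compose[OF _ meas(1)] measurable_compose[OF _ meas(2)]) auto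
  qed
  have sumK': "n = (\<Sum>e\<in>F. K' e)"
  proof -
    have "(\<Sum>e\<in>F. K e) = K f + (\<Sum>e\<in>F - {f}. K e)" by (rule sum.remove[OF F f(1)])
    moreover have "(\<Sum>e\<in>F. K' e) = K' f + (\<Sum>e\<in>F - {f}. K' e)" by (rule sum.remove[OF F f(1)])
    moreover have "(\<Sum>e\<in>F - {f}. K' e) = (\<Sum>e\<in>F - {f}. K e)" by (rule sum.cong) (auto simp: K'_def)
    ultimately show ?thesis using Suc(2) k by (simp add: K'_def)
  qed
  have "(\<integral>\<^sup>+x. ?g K x \<partial>(\<Pi>\<^sub>M i\<in>(SIGMA e:F. {..<K e}). EXP1)) =
      (\<integral>\<^sup>+x. (\<integral>\<^sup>+y. ?g K (x((f, k) := y)) \<partial>EXP1) \<partial>(\<Pi>\<^sub>M i\<in>?J'. EXP1))"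
    unfolding J by (rule EXPP.product_nn_integral_insert[OF fin nin]) (rule meas_g, use J in simp)
  also have "\<dots> = (\<integral>\<^sup>+x. ?g K' x \<partial>(\<Pi>\<^sub>M i\<in>?J'. EXP1))"
  proof (rule nn_integral_cong)
    fix x
    define R where "R = (\<Prod>e\<in>F - {f}. (\<Prod>j<K e. w e (psum x e (Suc j))) * \<Psi> e (psum x e (K e)))"
    define B where "B = (\<Prod>j<k. w f (psum x f (Suc j)))"
    have ps: "psum (x((f, k) := y)) e i = psum x e i" if "e \<noteq> f \<or> i \<le> k" for e i y
      unfolding psum_def by (rule sum.cong) (use that in auto)
    have psk: "psum (x((f, k) := y)) f (Suc k) = psum x f k + y" for y
      using ps[of f k y] by (simp add: psum_def)
    have "?g K (x((f, k) := y)) = R * B * (w f (psum x f k + y) * \<Psi> f (psum x f k + y))" for y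
    proof -
      have "?g K (x((f, k) := y)) = ((\<Prod>j<Suc k. w f (psum (x((f, k) := y)) f (Suc j))) * \<Psi> f (psum (x((f, k) := y)) f (Suc k))) *
        (\<Prod>e\<in>F - {f}. (\<Prod>j<K e. w e (psum (x((f, k) := y)) e (Suc j))) * \<Psi> e (psum (x((f, k) := y)) e (K e)))"
        by (subst prod.remove[OF F f(1)]) (simp add: k)
      also have "(\<Prod>e\<in>F - {f}. (\<Prod>j<K e. w e (psum (x((f, k) := y)) e (Suc j))) * \<Psi> e (psum (x((f, k) := y)) e (K e))) = R"
        unfolding R_def by (rule prod.cong) (use ps in auto)
      also have "(\<Prod>j<Suc k. w f (psum (x((f, k) := y)) f (Suc j))) = B * w f (psum x f k + y)"
      proof -
        have "(\<Prod>j<k. w f (psum (x((f, k) := y)) f (Suc j))) = B" unfolding B_def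
          by (rule prod.cong) (use ps in auto)
        then show ?thesis using psk by simp
      qed
      finally show ?thesis unfolding psk by (simp only: mult_ac)
    qed
    then have "(\<integral>\<^sup>+y. ?g K (x((f, k) := y)) \<partial>EXP1) = (\<integral>\<^sup>+y. R * B * (w f (psum x f k + y) * \<Psi> f (psum x f k + y)) \<partial>EXP1)"
      by simp
    also have "\<dots> = R * B * (\<integral>\<^sup>+y. w f (psum x f k + y) * \<Psi> f (psum x f k + y) \<partial>EXP1)"
      by (rule nn_integral_cmult) measurable
    also have "\<dots> = R * B * \<Psi> f (psum x f k)" using step[OF f(1)] by simp
    also have "\<dots> = ?g K' x"
    proof -
      have "?g K' x = (B * \<Psi> f (psum x f k)) * (\<Prod>e\<in>F - {f}. (\<Prod>j<K' e. w e (psum x e (Suc j))) * \<Psi> e (psum x e (K' e)))"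
        by (subst prod.remove[OF F f(1)]) (simp add: K'_def B_def)
      also have "(\<Prod>e\<in>F - {f}. (\<Prod>j<K' e. w e (psum x e (Suc j))) * \<Psi> e (psum x e (K' e))) = R"
        unfolding R_def by (rule prod.cong) (auto simp: K'_def)
      finally show ?thesis by (simp add: mult_ac)
    qed
    finally show "(\<integral>\<^sup>+y. ?g K (x((f, k) := y)) \<partial>EXP1) = ?g K' x" .
  qed
  also have "\<dots> = (\<Prod>e\<in>F. \<Psi> e 0)" by (rule Suc(1)[OF sumK'])
  finally show ?case .
qed

abbreviation Om :: "'e set \<Rightarrow> ('e \<times> nat \<Rightarrow> real) measure" where
  "Om G \<equiv> (\<Pi>\<^sub>M i\<in>G \<times> (UNIV :: nat set). EXP1)"

lemma prob_space_Om: "prob_space (Om G)"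
  by (rule prob_space_PiM) (rule EXP1.prob_space_axioms)

lemma psum_Om [measurable]: "e \<in> G \<Longrightarrow> (\<lambda>x. psum x e k) \<in> borel_measurable (Om G)"
  by (rule psum_measurable) simp

lemma renewal_Om:
  fixes w \<Psi> :: "'e \<Rightarrow> real \<Rightarrow> ennreal"
  assumes F: "finite F" "F \<subseteq> G"
    and meas [measurable]: "\<And>e. w e \<in> borel_measurable borel" "\<And>e. \<Psi> e \<in> borel_measurable borel"
    and step: "\<And>e s. e \<in> F \<Longrightarrow> (\<integral>\<^sup>+y. w e (s + y) * \<Psi> e (s + y) \<partial>EXP1) = \<Psi> e s"
  shows "(\<integral>\<^sup>+x. (\<Prod>e\<in>F. (\<Prod>j<k. w e (psum x e (Suc j))) * \<Psi> e (psum x e k)) \<partial>Om G) = (\<Prod>e\<in>F. \<Psi> e 0)"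
proof -
  interpret P: product_prob_space "\<lambda>_. EXP1" "G \<times> (UNIV :: nat set)" by unfold_locales
  let ?J = "SIGMA e:F. {..<k}"
  let ?g = "\<lambda>x. (\<Prod>e\<in>F. (\<Prod>j<k. w e (psum x e (Suc j))) * \<Psi> e (psum x e k))"
  have J: "finite ?J" "?J \<subseteq> G \<times> UNIV" using F by auto
  have meas_g: "?g \<in> borel_measurable (\<Pi>\<^sub>M i\<in>?J. EXP1)"
  proof -
    have [measurable]: "(\<lambda>x. psum x e i) \<in> borel_measurable (\<Pi>\<^sub>M i\<in>?J. EXP1)" if "e \<in> F" "i \<le> k" for e i
      by (rule psum_measurable) (use that in auto)
    show ?thesis
      by (intro borel_measurable_prod_ennreal borel_measurable_times measurable_compose[OF _ meas(1)] measurable_compose[OF _ meas(2)]) auto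
  qed
  have "(\<Prod>e\<in>F. \<Psi> e 0) = (\<integral>\<^sup>+x. ?g x \<partial>(\<Pi>\<^sub>M i\<in>?J. EXP1))"
    by (rule renewal_product[OF F(1) meas step, symmetric])
  also have "\<dots> = (\<integral>\<^sup>+x. ?g x \<partial>distr (Om G) (\<Pi>\<^sub>M i\<in>?J. EXP1) (\<lambda>x. restrict x ?J))"
    by (subst P.distr_PiM_restrict_finite[OF J]) simp
  also have "\<dots> = (\<integral>\<^sup>+x. ?g (restrict x ?J) \<partial>Om G)"
    by (rule nn_integral_distr) (use meas_g measurable_restrict_subset[OF J(2)] in \<open>simp_all add: measurable_distr_eq1\<close>)
  also have "\<dots> = (\<integral>\<^sup>+x. ?g x \<partial>Om G)"
  proof (rule nn_integral_cong)
    fix x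
    have ps: "psum (restrict x ?J) e i = psum x e i" if "e \<in> F" "i \<le> k" for e i
      unfolding psum_def by (rule sum.cong) (use that in auto)
    show "?g (restrict x ?J) = ?g x"
      by (intro prod.cong arg_cong2[where f = times] arg_cong2[where f = w] arg_cong2[where f = \<Psi>]) (use ps in auto)
  qed
  finally show ?thesis by simp
qed

text \<open>\<open>exp (- psum x e k)\<close> has expectation \<open>(1/2) ^ k\<close>, which is
  summable; so almost surely the series converges and its terms tend to 0.\<close>

lemma AE_psum_unbounded:
  assumes "e \<in> G"
  shows "AE x in Om G. filterlim (psum x e) at_top sequentially"
proof -
  interpret prob_space "Om G" by (rule prob_space_Om)
  let ?E = "\<lambda>k x. ennreal (exp (- psum x e k))"
  have I: "(\<integral>\<^sup>+x. ?E k x \<partial>Om G) = ennreal ((1/2) ^ k)" for k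
  proof -
    have "(\<integral>\<^sup>+x. 2 ^ k * ?E k x \<partial>Om G) = 1"
      using renewal_Om[of "{e}" G "\<lambda>_ _. 2" "\<lambda>_ u. ennreal (exp (- u))" k] laplace_step assms by simp
    moreover have "(\<integral>\<^sup>+x. 2 ^ k * ?E k x \<partial>Om G) = 2 ^ k * (\<integral>\<^sup>+x. ?E k x \<partial>Om G)"
      using assms by (intro nn_integral_cmult) measurable
    ultimately have eq: "2 ^ k * (\<integral>\<^sup>+x. ?E k x \<partial>Om G) = 1" by simp
    have two: "(2::ennreal) ^ k = ennreal (2 ^ k)" by (simp add: ennreal_power[symmetric])
    have "(\<integral>\<^sup>+x. ?E k x \<partial>Om G) = ennreal ((1/2) ^ k) * (2 ^ k * (\<integral>\<^sup>+x. ?E k x \<partial>Om G))"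
      unfolding two mult.assoc[symmetric] by (simp add: ennreal_mult[symmetric] power_mult_distrib[symmetric])
    then show ?thesis unfolding eq by simp
  qed
  have "(\<integral>\<^sup>+x. (\<Sum>k. ?E k x) \<partial>Om G) = (\<Sum>k. \<integral>\<^sup>+x. ?E k x \<partial>Om G)"
    using assms by (intro nn_integral_suminf) measurable
  also have "\<dots> = (\<Sum>k. ennreal ((1/2) ^ k))" using I by simp
  also have "\<dots> = ennreal (\<Sum>k. (1/2) ^ k)" by (rule suminf_ennreal2) (auto intro: summable_geometric)
  finally have "(\<integral>\<^sup>+x. (\<Sum>k. ?E k x) \<partial>Om G) \<noteq> \<infinity>" by simp
  then have "AE x in Om G. (\<Sum>k. ?E k x) \<noteq> \<infinity>"
    using assms by (intro nn_integral_PInf_AE) measurable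
  then show ?thesis
  proof eventually_elim
    case (elim x)
    then have "summable (\<lambda>k. exp (- psum x e k))" by (intro summable_suminf_not_top) auto
    then have lim: "(\<lambda>k. exp (- psum x e k)) \<longlonglongrightarrow> 0" by (rule summable_LIMSEQ_zero)
    show ?case
    proof (rule filterlim_at_top_dense[THEN iffD2], rule allI)
      fix B
      have "eventually (\<lambda>k. exp (- psum x e k) < exp (- B)) sequentially"
        by (rule order_tendstoD(2)[OF lim]) simp
      then show "eventually (\<lambda>k. B < psum x e k) sequentially" by simp
    qed
  qed
qed

lemma AE_increments_pos:
  assumes "e \<in> G"
  shows "AE x in Om G. \<forall>j. 0 < x (e, j)"
proof -
  interpret P: product_prob_space "\<lambda>_. EXP1" "G \<times> (UNIV :: nat set)" by unfold_locales
  have "AE y in lborel. y \<noteq> (0::real)" by (rule AE_lborel_singleton)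
  then have "AE y in EXP1. 0 < y"
    by (subst AE_density) (auto simp: exponential_density_def elim!: eventually_mono)
  then have "AE x in Om G. 0 < x (e, j)" for j
    using assms by (intro P.AE_component) auto
  then show ?thesis by (simp add: AE_all_countable)
qed

lemma prod_le_1_ennreal:
  fixes f :: "'i \<Rightarrow> ennreal"
  assumes "\<And>i. i \<in> I \<Longrightarrow> f i \<le> 1"
  shows "prod f I \<le> 1"
proof (cases "finite I")
  case True
  then show ?thesis using assms
  proof induction
    case (insert i I)
    have "f i * prod f I \<le> 1 * 1"
      by (rule mult_mono[OF insert.prems insert.IH]) (simp_all add: insert.prems)
    then show ?case using insert.hyps by simp
  qed simp
qed simp

lemma void_measurable:
  assumes F: "finite F" "F \<subseteq> G"
  shows "{x \<in> space (Om G). \<forall>e\<in>F. \<forall>k. psum x e (Suc k) \<notin> slots \<delta> (A e)} \<in> sets (Om G)"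
proof -
  have each: "{x \<in> space (Om G). psum x e (Suc k) \<notin> slots \<delta> (A e)} \<in> sets (Om G)" if "e \<in> F" for e k
  proof -
    have "e \<in> G" using that F(2) by blast
    then have "(\<lambda>x. psum x e (Suc k)) \<in> borel_measurable (Om G)" by (rule psum_Om)
    moreover have "- slots \<delta> (A e) \<in> sets borel" by (rule borel_comp[OF slots_measurable])
    ultimately have "(\<lambda>x. psum x e (Suc k)) -` (- slots \<delta> (A e)) \<inter> space (Om G) \<in> sets (Om G)"
      by (rule measurable_sets)
    moreover have "{x \<in> space (Om G). psum x e (Suc k) \<notin> slots \<delta> (A e)} =
        (\<lambda>x. psum x e (Suc k)) -` (- slots \<delta> (A e)) \<inter> space (Om G)" by (simp add: set_eq_iff conj_commute)
    ultimately show ?thesis by (simp only:)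
  qed
  have "{x \<in> space (Om G). \<forall>k. psum x e (Suc k) \<notin> slots \<delta> (A e)} \<in> sets (Om G)" if "e \<in> F" for e
    by (rule sets.sets_Collect_countable_All) (rule each[OF that])
  then show ?thesis by (rule sets.sets_Collect_finite_All[OF _ F(1)])
qed

text \<open>The renewal product has the same integral for every \<open>k\<close>. As the partial
  sums go to infinity, \<open>\<Psi>\<close> becomes 1 and the integrand becomes the indicator of
  the void event, so dominated convergence identifies its probability.\<close>

lemma void_prob:
  fixes A :: "'e \<Rightarrow> nat set"
  assumes F: "finite F" "F \<subseteq> G" and d: "0 < \<delta>" and A: "\<And>e. e \<in> F \<Longrightarrow> A e \<subseteq> {..<M}"
  shows "measure (Om G) {x \<in> space (Om G). \<forall>e\<in>F. \<forall>k. psum x e (Suc k) \<notin> slots \<delta> (A e)}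
    = (\<Prod>e\<in>F. exp (- (real (card (A e)) * \<delta>)))"
proof -
  interpret prob_space "Om G" by (rule prob_space_Om)
  let ?w = "\<lambda>e u. indicator (- slots \<delta> (A e)) u :: ennreal"
  let ?\<Psi> = "\<lambda>e u. ennreal (exp (- remaining \<delta> (A e) u))"
  let ?u = "\<lambda>k x. (\<Prod>e\<in>F. (\<Prod>j<k. ?w e (psum x e (Suc j))) * ?\<Psi> e (psum x e k))"
  let ?V = "{x \<in> space (Om G). \<forall>e\<in>F. \<forall>k. psum x e (Suc k) \<notin> slots \<delta> (A e)}"
  have eG: "(\<lambda>x. psum x e k) \<in> borel_measurable (Om G)" if "e \<in> F" for e k
    by (rule psum_Om) (use that F in auto)
  have V: "?V \<in> sets (Om G)" by (rule void_measurable[OF F])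
  have "(\<lambda>k. \<integral>\<^sup>+x. ?u k x \<partial>Om G) \<longlonglongrightarrow> (\<integral>\<^sup>+x. indicator ?V x \<partial>Om G)"
  proof (rule nn_integral_dominated_convergence[where w = "\<lambda>_. 1"])
    have mw: "?w e \<in> borel_measurable borel" for e
      by (rule borel_measurable_indicator) (rule borel_comp[OF slots_measurable])
    have m\<Psi>: "?\<Psi> e \<in> borel_measurable borel" for e
      by measurable
    have p1: "(\<lambda>x. ?w e (psum x e (Suc j))) \<in> borel_measurable (Om G)" if "e \<in> F" for e j
      by (rule measurable_compose[OF eG[OF that] mw])
    have p2: "(\<lambda>x. ?\<Psi> e (psum x e k)) \<in> borel_measurable (Om G)" if "e \<in> F" for e k
      by (rule measurable_compose[OF eG[OF that] m\<Psi>])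
    have p3: "(\<lambda>x. (\<Prod>j<k. ?w e (psum x e (Suc j)))) \<in> borel_measurable (Om G)" if "e \<in> F" for e k
      by (rule borel_measurable_prod_ennreal) (rule p1[OF that])
    show "?u k \<in> borel_measurable (Om G)" for k
      by (rule borel_measurable_prod_ennreal, rule borel_measurable_times_ennreal) (erule p3, erule p2)
    show "AE x in Om G. ?u k x \<le> 1" for k
    proof (rule AE_I2)
      fix x
      have "0 \<le> remaining \<delta> (A e) s" for e s unfolding remaining_def by (rule sum_nonneg) simp
      then have \<Psi>1: "?\<Psi> e s \<le> 1" for e s by simp
      have w1: "(\<Prod>j<k. ?w e (psum x e (Suc j))) \<le> 1" for e by (rule prod_le_1_ennreal) (simp add: indicator_def)
      show "?u k x \<le> 1"
      proof (rule prod_le_1_ennreal)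
        fix e
        have "(\<Prod>j<k. ?w e (psum x e (Suc j))) * ?\<Psi> e (psum x e k) \<le> 1 * 1"
          by (rule mult_mono[OF w1 \<Psi>1]) auto
        then show "(\<Prod>j<k. ?w e (psum x e (Suc j))) * ?\<Psi> e (psum x e k) \<le> 1" by simp
      qed
    qed
    show "(\<integral>\<^sup>+x. 1 \<partial>Om G) < \<infinity>" by (simp add: emeasure_space_1)
    have "AE x in Om G. \<forall>e\<in>F. filterlim (psum x e) at_top sequentially"
      by (rule AE_finite_allI[OF F(1)]) (rule AE_psum_unbounded[OF subsetD[OF F(2)]])
    then show "AE x in Om G. (\<lambda>k. ?u k x) \<longlonglongrightarrow> indicator ?V x"
    proof (rule AE_mp, intro AE_I2 impI)
      fix x assume xs: "x \<in> space (Om G)" and lim: "\<forall>e\<in>F. filterlim (psum x e) at_top sequentially"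
      have "eventually (\<lambda>k. \<forall>e\<in>F. real M * \<delta> \<le> psum x e k) sequentially"
        using F(1) lim by (intro eventually_ball_finite) (auto simp: filterlim_at_top)
      then have late: "eventually (\<lambda>k. \<forall>e\<in>F. ?\<Psi> e (psum x e k) = 1) sequentially"
        by eventually_elim (use remaining_late[OF d A] in auto)
      have "eventually (\<lambda>k. ?u k x = indicator ?V x) sequentially"
      proof (cases "x \<in> ?V")
        case True
        from late show ?thesis
          by eventually_elim (use True in \<open>auto simp: indicator_def intro!: prod.neutral\<close>)
      next
        case False
        then obtain e j where e: "e \<in> F" "psum x e (Suc j) \<in> slots \<delta> (A e)" using xs by auto
        have "eventually (\<lambda>k. j < k) sequentially" by (rule eventually_gt_at_top)
        then show ?thesis
        proof eventually_elim
          case (elim k)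
          have "(\<Prod>j<k. ?w e (psum x e (Suc j))) = 0" by (rule prod_zero) (use e elim in \<open>auto intro!: bexI[of _ j]\<close>)
          then have "?u k x = 0" by (intro prod_zero[OF F(1)] bexI[OF _ e(1)]) simp
          then show ?case using False by simp
        qed
      qed
      then show "(\<lambda>k. ?u k x) \<longlonglongrightarrow> indicator ?V x" by (rule tendsto_eventually)
    qed
    show "indicator ?V \<in> borel_measurable (Om G)" using V by (rule borel_measurable_indicator)
    show "(\<lambda>_. 1) \<in> borel_measurable (Om G)" by simp
  qed
  moreover have "(\<integral>\<^sup>+x. ?u k x \<partial>Om G) = (\<Prod>e\<in>F. ?\<Psi> e 0)" for k
  proof (rule renewal_Om[OF F])
    show "?w e \<in> borel_measurable borel" for e
      by (rule borel_measurable_indicator) (rule borel_comp[OF slots_measurable])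
    show "?\<Psi> e \<in> borel_measurable borel" for e by measurable
    show "(\<integral>\<^sup>+y. ?w e (s + y) * ?\<Psi> e (s + y) \<partial>EXP1) = ?\<Psi> e s" if "e \<in> F" for e s
      by (rule void_step[OF d A[OF that]])
  qed
  ultimately have "(\<lambda>k::nat. \<Prod>e\<in>F. ?\<Psi> e 0) \<longlonglongrightarrow> (\<integral>\<^sup>+x. indicator ?V x \<partial>Om G)" by (simp only:)
  then have "(\<integral>\<^sup>+x. indicator ?V x \<partial>Om G) = (\<Prod>e\<in>F. ?\<Psi> e 0)"
    by (rule LIMSEQ_unique[OF _ tendsto_const])
  then have "emeasure (Om G) ?V = (\<Prod>e\<in>F. ennreal (exp (- (real (card (A e)) * \<delta>))))"
    using V remaining_0[OF d] by simp
  also have "\<dots> = ennreal (\<Prod>e\<in>F. exp (- (real (card (A e)) * \<delta>)))"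
    by (rule prod_ennreal) simp
  finally show ?thesis by (simp add: measure_def prod_nonneg)
qed

section \<open>The slot bits are independent Bernoulli variables\<close>

definition rbit :: "real \<Rightarrow> ('e \<times> nat \<Rightarrow> real) \<Rightarrow> 'e \<times> nat \<Rightarrow> bool" where
  "rbit \<delta> x b \<longleftrightarrow> (\<exists>k. 0 < psum x (fst b) (Suc k) \<and> sidx \<delta> (psum x (fst b) (Suc k)) = snd b)"

lemma void_iff_rbit: "(\<forall>k. psum x e (Suc k) \<notin> slots \<delta> A) \<longleftrightarrow> (\<forall>i\<in>A. \<not> rbit \<delta> x (e, i))"
  by (auto simp: rbit_def slots_def)

lemma rbit_measurable:
  assumes "fst b \<in> G"
  shows "{x \<in> space (Om G). rbit \<delta> x b} \<in> sets (Om G)"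
proof -
  have "{x \<in> space (Om G). \<forall>e\<in>{fst b}. \<forall>k. psum x e (Suc k) \<notin> slots \<delta> {snd b}} \<in> sets (Om G)"
    by (rule void_measurable) (use assms in auto)
  then have "{x \<in> space (Om G). \<not> rbit \<delta> x b} \<in> sets (Om G)"
    unfolding void_iff_rbit by simp
  then have "space (Om G) - {x \<in> space (Om G). \<not> rbit \<delta> x b} \<in> sets (Om G)" by (rule sets.compl_sets)
  moreover have "space (Om G) - {x \<in> space (Om G). \<not> rbit \<delta> x b} = {x \<in> space (Om G). rbit \<delta> x b}" by blast
  ultimately show ?thesis by (simp only:)
qed

lemma rbit_pattern_measurable:
  assumes "finite B" "fst ` B \<subseteq> G"
  shows "{x \<in> space (Om G). \<forall>b\<in>B. rbit \<delta> x b \<longleftrightarrow> b \<in> S} \<in> sets (Om G)"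
proof (rule sets.sets_Collect_finite_All[OF _ assms(1)])
  fix b assume "b \<in> B"
  then have b: "{x \<in> space (Om G). rbit \<delta> x b} \<in> sets (Om G)" using assms(2) by (intro rbit_measurable) auto
  show "{x \<in> space (Om G). rbit \<delta> x b \<longleftrightarrow> b \<in> S} \<in> sets (Om G)"
  proof (cases "b \<in> S")
    case False
    have "space (Om G) - {x \<in> space (Om G). rbit \<delta> x b} \<in> sets (Om G)" using b by (rule sets.compl_sets)
    moreover have "space (Om G) - {x \<in> space (Om G). rbit \<delta> x b} = {x \<in> space (Om G). rbit \<delta> x b \<longleftrightarrow> b \<in> S}"
      using False by blast
    ultimately show ?thesis by (simp only:)
  qed (use b in simp)
qed

text \<open>Void probabilities determine the law: a bit is switched on by subtracting the event with
  that bit off from the event that leaves it free. Hence the induction over the open bits, with the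
  closed ones arbitrary.\<close>

lemma rbit_zero_one:
  assumes d: "0 < \<delta>" and Z: "finite Z" "Z \<subseteq> G \<times> {..<M}" and W: "finite W" "W \<subseteq> G \<times> {..<M}" and disj: "Z \<inter> W = {}"
  shows "measure (Om G) {x \<in> space (Om G). \<forall>b\<in>Z \<union> W. rbit \<delta> x b \<longleftrightarrow> b \<in> W}
    = exp (- \<delta>) ^ card Z * (1 - exp (- \<delta>)) ^ card W"
  using W Z disj
proof (induction W arbitrary: Z)
  case empty
  define A where "A e = {i. (e, i) \<in> Z}" for e
  have ZS: "Z = Sigma (fst ` Z) A" by (force simp: A_def)
  have fA: "finite (A e)" for e
  proof -
    have "A e \<subseteq> snd ` Z" by (force simp: A_def)
    then show ?thesis using empty.prems(2) by (meson finite_imageI finite_subset)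
  qed
  have cZ: "card Z = (\<Sum>e\<in>fst ` Z. card (A e))"
    by (subst ZS, rule card_SigmaI) (use empty.prems fA in auto)
  have "(\<forall>b\<in>Z \<union> {}. rbit \<delta> x b \<longleftrightarrow> b \<in> {}) \<longleftrightarrow> (\<forall>e\<in>fst ` Z. \<forall>k. psum x e (Suc k) \<notin> slots \<delta> (A e))" for x
    unfolding void_iff_rbit A_def by (auto intro: rev_image_eqI)
  then have "measure (Om G) {x \<in> space (Om G). \<forall>b\<in>Z \<union> {}. rbit \<delta> x b \<longleftrightarrow> b \<in> {}} =
      measure (Om G) {x \<in> space (Om G). \<forall>e\<in>fst ` Z. \<forall>k. psum x e (Suc k) \<notin> slots \<delta> (A e)}"
    by (simp only:)
  also have "\<dots> = (\<Prod>e\<in>fst ` Z. exp (- (real (card (A e)) * \<delta>)))"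
  proof (rule void_prob[OF _ _ d])
    show "finite (fst ` Z)" using empty.prems(2) by (rule finite_imageI)
    show "fst ` Z \<subseteq> G" using empty.prems(3) by auto
    show "A e \<subseteq> {..<M}" for e unfolding A_def using empty.prems(3) by blast
  qed
  also have "\<dots> = (\<Prod>e\<in>fst ` Z. exp (- \<delta>) ^ card (A e))"
  proof (rule prod.cong)
    show "exp (- (real (card (A e)) * \<delta>)) = exp (- \<delta>) ^ card (A e)" for e
      using exp_of_nat_mult[of "card (A e)" "- \<delta>"] by simp
  qed simp
  also have "\<dots> = exp (- \<delta>) ^ card Z" unfolding cZ by (rule power_sum[symmetric])
  finally show ?case by simp
next
  case (insert b W)
  interpret prob_space "Om G" by (rule prob_space_Om)
  let ?X = "\<lambda>Z W. {x \<in> space (Om G). \<forall>b\<in>Z \<union> W. rbit \<delta> x b \<longleftrightarrow> b \<in> W}"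
  have m: "?X Z' W' \<in> sets (Om G)" if "Z' \<union> W' = insert b (Z \<union> W)" for Z' W'
  proof (rule rbit_pattern_measurable)
    show "finite (Z' \<union> W')" unfolding that using insert.prems(2) insert.hyps(1) by simp
    show "fst ` (Z' \<union> W') \<subseteq> G" unfolding that using insert.prems(1,3) by auto
  qed
  have bZ: "b \<notin> Z" using insert.prems(4) by blast
  have eq: "?X Z W = ?X Z (insert b W) \<union> ?X (insert b Z) W"
  proof (rule set_eqI)
    fix x
    have "(\<forall>c\<in>Z \<union> W. rbit \<delta> x c \<longleftrightarrow> c \<in> insert b W) \<longleftrightarrow> (\<forall>c\<in>Z \<union> W. rbit \<delta> x c \<longleftrightarrow> c \<in> W)"
      using bZ insert.hyps(2) by (intro ball_cong) auto
    then show "x \<in> ?X Z W \<longleftrightarrow> x \<in> ?X Z (insert b W) \<union> ?X (insert b Z) W"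
      using insert.hyps(2) by simp blast
  qed
  have dj: "?X Z (insert b W) \<inter> ?X (insert b Z) W = {}" using insert.hyps(2) by simp blast
  have "measure (Om G) (?X Z W) = measure (Om G) (?X Z (insert b W)) + measure (Om G) (?X (insert b Z) W)"
    unfolding eq by (rule finite_measure_Union[OF m m dj]) simp_all
  then have "measure (Om G) (?X Z (insert b W)) = measure (Om G) (?X Z W) - measure (Om G) (?X (insert b Z) W)"
    by (simp only: eq_diff_eq)
  also have "measure (Om G) (?X Z W) = exp (- \<delta>) ^ card Z * (1 - exp (- \<delta>)) ^ card W"
    by (rule insert.IH) (use insert.prems in auto)
  also have "measure (Om G) (?X (insert b Z) W) = exp (- \<delta>) ^ card (insert b Z) * (1 - exp (- \<delta>)) ^ card W"
    by (rule insert.IH) (use insert.prems insert.hyps(2) in auto)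
  also have "card (insert b Z) = Suc (card Z)" using bZ insert.prems(2) by simp
  also have "exp (- \<delta>) ^ card Z * (1 - exp (- \<delta>)) ^ card W - exp (- \<delta>) ^ Suc (card Z) * (1 - exp (- \<delta>)) ^ card W =
      exp (- \<delta>) ^ card Z * (1 - exp (- \<delta>)) ^ Suc (card W)"
    by (simp add: algebra_simps)
  also have "Suc (card W) = card (insert b W)" using insert.hyps by simp
  finally show ?case .
qed

lemma rbit_event:
  assumes d: "0 < \<delta>" and B: "finite B" "B \<subseteq> G \<times> {..<M}"
  shows "{x \<in> space (Om G). \<Phi> {b \<in> B. rbit \<delta> x b}} \<in> sets (Om G)"
    and "measure (Om G) {x \<in> space (Om G). \<Phi> {b \<in> B. rbit \<delta> x b}} =
      (\<Sum>S\<in>Pow B. if \<Phi> S then (\<Prod>b\<in>B. if b \<in> S then 1 - exp (- \<delta>) else 1 - (1 - exp (- \<delta>))) else 0)"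
proof -
  interpret prob_space "Om G" by (rule prob_space_Om)
  let ?X = "\<lambda>S. {x \<in> space (Om G). \<forall>b\<in>B. rbit \<delta> x b \<longleftrightarrow> b \<in> S}"
  let ?P = "{S \<in> Pow B. \<Phi> S}"
  have m: "?X S \<in> sets (Om G)" for S by (rule rbit_pattern_measurable) (use B in auto)
  have U: "{x \<in> space (Om G). \<Phi> {b \<in> B. rbit \<delta> x b}} = (\<Union>S\<in>?P. ?X S)"
  proof (intro set_eqI iffI)
    fix x assume x: "x \<in> {x \<in> space (Om G). \<Phi> {b \<in> B. rbit \<delta> x b}}"
    then have "{b \<in> B. rbit \<delta> x b} \<in> ?P" "x \<in> ?X {b \<in> B. rbit \<delta> x b}" by auto
    then show "x \<in> (\<Union>S\<in>?P. ?X S)" by blast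
  next
    fix x assume "x \<in> (\<Union>S\<in>?P. ?X S)"
    then obtain S where S: "S \<subseteq> B" "\<Phi> S" "x \<in> ?X S" by blast
    then have "{b \<in> B. rbit \<delta> x b} = S" by auto
    then show "x \<in> {x \<in> space (Om G). \<Phi> {b \<in> B. rbit \<delta> x b}}" using S by simp
  qed
  have finP: "finite ?P" using B by simp
  show "{x \<in> space (Om G). \<Phi> {b \<in> B. rbit \<delta> x b}} \<in> sets (Om G)"
    unfolding U using finP m by (intro sets.finite_UN) auto
  have "measure (Om G) (\<Union>S\<in>?P. ?X S) = (\<Sum>S\<in>?P. measure (Om G) (?X S))"
    by (rule finite_measure_finite_Union[OF finP]) (use m in \<open>auto simp: disjoint_family_on_def\<close>)
  also have "\<dots> = (\<Sum>S\<in>?P. (\<Prod>b\<in>B. if b \<in> S then 1 - exp (- \<delta>) else 1 - (1 - exp (- \<delta>))))"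
  proof (rule sum.cong)
    fix S assume "S \<in> ?P"
    then have S: "S \<subseteq> B" by blast
    then have "(B - S) \<union> S = B" by blast
    then have "measure (Om G) (?X S) = exp (- \<delta>) ^ card (B - S) * (1 - exp (- \<delta>)) ^ card S"
      using rbit_zero_one[OF d, of "B - S" G M S] S B finite_subset[OF S B(1)] by auto
    also have "\<dots> = (\<Prod>b\<in>B - S. 1 - (1 - exp (- \<delta>))) * (\<Prod>b\<in>S. 1 - exp (- \<delta>))" by simp
    also have "\<dots> = (\<Prod>b\<in>B. if b \<in> S then 1 - exp (- \<delta>) else 1 - (1 - exp (- \<delta>)))"
      by (subst prod.subset_diff[OF S B(1)], intro arg_cong2[where f = times] prod.cong) auto
    finally show "measure (Om G) (?X S) = (\<Prod>b\<in>B. if b \<in> S then 1 - exp (- \<delta>) else 1 - (1 - exp (- \<delta>)))" .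
  qed simp
  finally show "measure (Om G) {x \<in> space (Om G). \<Phi> {b \<in> B. rbit \<delta> x b}} =
      (\<Sum>S\<in>Pow B. if \<Phi> S then (\<Prod>b\<in>B. if b \<in> S then 1 - exp (- \<delta>) else 1 - (1 - exp (- \<delta>))) else 0)"
    unfolding U using B by (simp add: sum.If_cases Int_def Collect_conj_eq[symmetric] conj_commute)
qed

lemma one_minus_exp_le: "1 - exp (- \<delta>) \<le> (\<delta> :: real)"
  using exp_ge_add_one_self[of "- \<delta>"] by simp

text \<open>Coinciding rings share a slot for every mesh. Over \<open>M\<close> slots of length
  \<open>T / M\<close> this has probability at most \<open>M * (T / M) ^ 2\<close>, which tends to
  0.\<close>

lemma AE_rings_distinct:
  assumes e: "e \<in> G" "f \<in> G" "e \<noteq> f" and T: "0 < T"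
  shows "AE x in Om G. \<forall>k l. 0 < psum x e (Suc k) \<longrightarrow> psum x e (Suc k) \<le> T \<longrightarrow> psum x e (Suc k) \<noteq> psum x f (Suc l)"
proof -
  interpret prob_space "Om G" by (rule prob_space_Om)
  define N where "N M = (\<Union>i<M. {x \<in> space (Om G). rbit (T / M) x (e, i) \<and> rbit (T / M) x (f, i)})" for M :: nat
  have Nm: "N M \<in> sets (Om G)" for M
    unfolding N_def using e by (intro sets.finite_UN sets.sets_Collect_conj rbit_measurable) auto
  have Np: "measure (Om G) (N M) \<le> T ^ 2 / M" if M: "0 < M" for M :: nat
  proof -
    let ?\<delta> = "T / real M"
    have d: "0 < ?\<delta>" using T M by simp
    have "measure (Om G) (N M) \<le> (\<Sum>i<M. measure (Om G) {x \<in> space (Om G). rbit ?\<delta> x (e, i) \<and> rbit ?\<delta> x (f, i)})"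
      unfolding N_def using e by (intro finite_measure_subadditive_finite) (auto intro!: sets.sets_Collect_conj rbit_measurable)
    also have "\<dots> \<le> (\<Sum>i<M. ?\<delta> ^ 2)"
    proof (rule sum_mono)
      fix i assume "i \<in> {..<M}"
      have "{x \<in> space (Om G). rbit ?\<delta> x (e, i) \<and> rbit ?\<delta> x (f, i)} =
          {x \<in> space (Om G). \<forall>b\<in>{} \<union> {(e, i), (f, i)}. rbit ?\<delta> x b \<longleftrightarrow> b \<in> {(e, i), (f, i)}}" by auto
      then have "measure (Om G) {x \<in> space (Om G). rbit ?\<delta> x (e, i) \<and> rbit ?\<delta> x (f, i)}
          = (1 - exp (- ?\<delta>)) ^ card {(e, i), (f, i)}"
        using rbit_zero_one[OF d, of "{}" G M "{(e, i), (f, i)}"] e \<open>i \<in> {..<M}\<close> by simp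
      also have "\<dots> = (1 - exp (- ?\<delta>)) ^ 2" using e(3) by (simp add: power2_eq_square)
      also have "\<dots> \<le> ?\<delta> ^ 2" using d one_minus_exp_le[of ?\<delta>] by (intro power_mono) auto
      finally show "measure (Om G) {x \<in> space (Om G). rbit ?\<delta> x (e, i) \<and> rbit ?\<delta> x (f, i)} \<le> ?\<delta> ^ 2" .
    qed
    also have "\<dots> = T ^ 2 / M" using M by (simp add: power2_eq_square)
    finally show ?thesis .
  qed
  define Z where "Z = (\<Inter>M. N (Suc M))"
  have Zm: "Z \<in> sets (Om G)" unfolding Z_def using Nm by (intro sets.countable_INT) auto
  have "measure (Om G) Z \<le> 0"
  proof (rule field_le_epsilon)
    fix \<epsilon> :: real assume \<epsilon>: "0 < \<epsilon>"
    obtain M :: nat where M: "T ^ 2 / \<epsilon> < real M" using reals_Archimedean2 by blast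
    have "measure (Om G) Z \<le> measure (Om G) (N (Suc M))"
      by (rule finite_measure_mono[OF _ Nm]) (auto simp: Z_def)
    also have "\<dots> \<le> T ^ 2 / real (Suc M)" by (rule Np) simp
    also have "\<dots> \<le> \<epsilon>"
    proof -
      have "T ^ 2 < \<epsilon> * real M" using M \<epsilon> by (simp add: field_simps)
      then show ?thesis using \<epsilon> by (simp add: field_simps)
    qed
    finally show "measure (Om G) Z \<le> 0 + \<epsilon>" by simp
  qed
  then have "emeasure (Om G) Z = 0" by (simp add: emeasure_eq_measure measure_le_0_iff)
  then have Znull: "Z \<in> null_sets (Om G)" using Zm by auto
  show ?thesis
  proof (rule AE_I'[OF Znull], rule subsetI)
    fix x assume x: "x \<in> {x \<in> space (Om G). \<not> (\<forall>k l. 0 < psum x e (Suc k) \<longrightarrow> psum x e (Suc k) \<le> T \<longrightarrow> psum x e (Suc k) \<noteq> psum x f (Suc l))}"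
    then obtain k l where kl: "0 < psum x e (Suc k)" "psum x e (Suc k) \<le> T" "psum x e (Suc k) = psum x f (Suc l)" by blast
    show "x \<in> Z" unfolding Z_def N_def
    proof (intro INT_I UN_I CollectI conjI)
      fix M :: nat
      let ?\<delta> = "T / real (Suc M)" and ?s = "psum x e (Suc k)"
      have d: "0 < ?\<delta>" using T by simp
      have "real (sidx ?\<delta> ?s) * ?\<delta> < ?s" using sidx_iff[OF d kl(1), of "sidx ?\<delta> ?s"] by simp
      also have "?s \<le> real (Suc M) * ?\<delta>" using kl(2) by simp
      finally have "real (sidx ?\<delta> ?s) < real (Suc M)" using d by (simp only: mult_less_cancel_right_pos)
      then show "sidx ?\<delta> ?s \<in> {..<Suc M}" by (simp only: of_nat_less_iff lessThan_iff)
      show "x \<in> space (Om G)" using x by blast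
      show "rbit ?\<delta> x (e, sidx ?\<delta> ?s)" unfolding rbit_def fst_conv snd_conv using kl by blast
      show "rbit ?\<delta> x (f, sidx ?\<delta> ?s)" unfolding rbit_def fst_conv snd_conv by (rule exI[of _ l]) (use kl in simp)
    qed
  qed
qed

section \<open>Acyclic connected graphs described by a parent function\<close>

section \<open>Trees as graphs\<close>

locale bounded_tree =
  fixes V :: "'a set" and E :: "'a \<Rightarrow> 'a \<Rightarrow> bool" and r :: 'a and D :: nat
  assumes tree: "rooted_tree V E r"
    and degree: "\<And>v. v \<in> V \<Longrightarrow> finite (neighbours V E v) \<and> card (neighbours V E v) \<le> D"
    and offspring_ge_2: "\<And>v. v \<in> V \<Longrightarrow> 2 \<le> card (offspring V E r v)"
begin

definition dep :: "'a \<Rightarrow> nat" where "dep v = gdist V E r v"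

lemma r_in: "r \<in> V" and sym: "\<And>u w. u \<in> V \<Longrightarrow> w \<in> V \<Longrightarrow> E u w \<Longrightarrow> E w u"
  and irrefl: "\<And>u. u \<in> V \<Longrightarrow> \<not> E u u" and connected: "\<And>v. v \<in> V \<Longrightarrow> (r, v) \<in> (adj V E)\<^sup>*"
  and acyclic: "\<not> has_cycle V E"
  using tree unfolding rooted_tree_def simple_graph_def connected_graph_def by blast+

lemma dep_reach: "v \<in> V \<Longrightarrow> (r, v) \<in> adj V E ^^ dep v"
  unfolding dep_def gdist_def using connected[of v] by (auto dest: rtrancl_imp_relpow intro: LeastI)

lemma dep_le: "(r, v) \<in> adj V E ^^ n \<Longrightarrow> dep v \<le> n"
  unfolding dep_def gdist_def by (rule Least_le)

lemma dep_root: "dep r = 0"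
  using dep_le[of r 0] by simp

lemma dep_eq_0: "v \<in> V \<Longrightarrow> dep v = 0 \<longleftrightarrow> v = r"
  using dep_reach[of v] dep_root by auto

lemma dep_edge_le:
  assumes "u \<in> V" "w \<in> V" "E u w"
  shows "dep w \<le> Suc (dep u)"
proof (rule dep_le)
  show "(r, w) \<in> adj V E ^^ Suc (dep u)"
    using dep_reach[OF assms(1)] assms by (auto simp: adj_def)
qed

definition par :: "'a \<Rightarrow> 'a" where
  "par v = (if v = r then r else (SOME u. u \<in> V \<and> E u v \<and> dep v = Suc (dep u)))"

lemma par_root: "par r = r"
  by (simp add: par_def)

lemma par_props:
  assumes "v \<in> V" "v \<noteq> r"
  shows "par v \<in> V" "E (par v) v" "dep v = Suc (dep (par v))"
proof -
  obtain n where n: "dep v = Suc n" using dep_eq_0[OF assms(1)] assms(2) by (cases "dep v") auto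
  then obtain u where u: "(r, u) \<in> adj V E ^^ n" "u \<in> V" "E u v"
    using dep_reach[OF assms(1)] by (auto simp: adj_def)
  then have "u \<in> V \<and> E u v \<and> dep v = Suc (dep u)"
    using dep_le[OF u(1)] dep_edge_le[OF u(2) assms(1) u(3)] n by auto
  then have "par v \<in> V \<and> E (par v) v \<and> dep v = Suc (dep (par v))"
    unfolding par_def if_not_P[OF assms(2)] by (rule someI)
  then show "par v \<in> V" "E (par v) v" "dep v = Suc (dep (par v))" by auto
qed

lemma par_in: "v \<in> V \<Longrightarrow> par v \<in> V"
  using par_props(1)[of v] par_root r_in by (cases "v = r") auto

text \<open>Both ends climb to their parents until these coincide. The depth bound allows a vertex
  one level deeper to be appended when a cycle is to be closed.\<close>

lemma level_path:
  assumes "x \<in> V" "y \<in> V" "x \<noteq> y" "dep x = n" "dep y = n"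
  shows "\<exists>xs. 3 \<le> length xs \<and> hd xs = x \<and> last xs = y \<and> distinct xs \<and> set xs \<subseteq> {v \<in> V. dep v \<le> n} \<and> successively E xs"
  using assms
proof (induction n arbitrary: x y)
  case 0
  then show ?case using dep_eq_0[of x] dep_eq_0[of y] by simp
next
  case (Suc n)
  have r: "x \<noteq> r" "y \<noteq> r" using Suc.prems(4,5) dep_root by auto
  have px: "par x \<in> V" "E x (par x)" "dep (par x) = n"
    using par_props[OF Suc.prems(1) r(1)] sym[OF _ Suc.prems(1)] Suc.prems(4) by simp_all
  have py: "par y \<in> V" "E (par y) y" "dep (par y) = n"
    using par_props[OF Suc.prems(2) r(2)] Suc.prems(5) by simp_all
  have "\<exists>xs. xs \<noteq> [] \<and> hd xs = par x \<and> last xs = par y \<and> distinct xs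
      \<and> set xs \<subseteq> {v \<in> V. dep v \<le> n} \<and> successively E xs"
  proof (cases "par x = par y")
    case True
    show ?thesis by (rule exI[of _ "[par y]"]) (simp add: True py)
  next
    case False
    show ?thesis
    proof (rule ex_forward[OF Suc.IH[OF px(1) py(1) False px(3) py(3)]])
      fix xs
      assume xs: "3 \<le> length xs \<and> hd xs = par x \<and> last xs = par y \<and> distinct xs \<and> set xs \<subseteq> {v \<in> V. dep v \<le> n} \<and> successively E xs"
      then have "xs \<noteq> []" by auto
      with xs show "xs \<noteq> [] \<and> hd xs = par x \<and> last xs = par y \<and> distinct xs
          \<and> set xs \<subseteq> {v \<in> V. dep v \<le> n} \<and> successively E xs" by blast
    qed
  qed
  then obtain xs where xs: "xs \<noteq> []" "hd xs = par x" "last xs = par y" "distinct xs"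
      "set xs \<subseteq> {v \<in> V. dep v \<le> n}" "successively E xs" by blast
  show ?case
  proof (intro exI[of _ "x # xs @ [y]"] conjI)
    have "x \<notin> set xs" "y \<notin> set xs" using xs(5) Suc.prems(4,5) by auto
    then show "distinct (x # xs @ [y])" using xs(4) Suc.prems(3) by simp
    show "3 \<le> length (x # xs @ [y])" using xs(1) by (cases xs) simp_all
    show "set (x # xs @ [y]) \<subseteq> {v \<in> V. dep v \<le> Suc n}" using xs(5) Suc.prems by auto
    show "successively E (x # xs @ [y])"
      using xs(1,2,3,6) px(2) py(2) by (simp add: successively_Cons successively_append_iff)
  qed simp_all
qed

lemma no_long_successively:
  assumes "3 \<le> length xs" "distinct xs" "set xs \<subseteq> V" "successively E xs"
  shows "\<not> E (last xs) (hd xs)"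
  using assms acyclic unfolding has_cycle_def successively_conv_nth by blast

text \<open>Any other neighbour that is not deeper would close a cycle: a path between two vertices
  of equal depth if the depths agree, and otherwise such a path to \<open>par w\<close> with
  \<open>w\<close> appended.\<close>

lemma edge_parent:
  assumes "u \<in> V" "w \<in> V" "E u w" "dep u \<le> dep w"
  shows "w \<noteq> r \<and> u = par w"
proof -
  have w: "w \<noteq> r"
  proof
    assume "w = r"
    then have "u = r" using assms dep_root dep_eq_0[of u] by auto
    then show False using assms irrefl \<open>w = r\<close> by auto
  qed
  have uw: "u \<noteq> w" using assms irrefl by auto
  have wu: "E w u" by (rule sym[OF assms(1-3)])
  note pw = par_props[OF assms(2) w]
  have "u = par w"
  proof (rule ccontr)
    assume ne: "u \<noteq> par w"
    show False
    proof (cases "dep u = dep w")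
      case True
      then obtain xs where xs: "3 \<le> length xs" "hd xs = u" "last xs = w" "distinct xs"
          "set xs \<subseteq> {v \<in> V. dep v \<le> dep w}" "successively E xs"
        using level_path[OF assms(1,2) uw, of "dep w"] by blast
      have "set xs \<subseteq> V" using xs(5) by blast
      then show False using no_long_successively[OF xs(1,4) _ xs(6)] xs(2,3) wu by simp
    next
      case False
      then have du: "dep u = dep (par w)" using pw(3) assms(4) dep_edge_le[OF assms(1-3)] by simp
      obtain xs where xs: "3 \<le> length xs" "hd xs = u" "last xs = par w" "distinct xs"
          "set xs \<subseteq> {v \<in> V. dep v \<le> dep (par w)}" "successively E xs"
        using level_path[OF assms(1) pw(1) ne du] by blast
      have ne: "xs \<noteq> []" using xs(1) by auto
      have "w \<notin> set xs" using xs(5) pw(3) by auto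
      then have "\<not> E (last (xs @ [w])) (hd (xs @ [w]))"
        using xs ne pw assms(2) by (intro no_long_successively) (auto simp: successively_append_iff)
      then show False using wu xs(2) ne by simp
    qed
  qed
  then show ?thesis using w by simp
qed

lemma adjacent_iff:
  assumes "u \<in> V" "w \<in> V"
  shows "E u w \<longleftrightarrow> (w \<noteq> r \<and> u = par w) \<or> (u \<noteq> r \<and> w = par u)"
proof
  assume "E u w"
  then show "(w \<noteq> r \<and> u = par w) \<or> (u \<noteq> r \<and> w = par u)"
    using edge_parent[OF assms] edge_parent[OF assms(2,1)] sym[OF assms] linear[of "dep u" "dep w"] by blast
next
  assume "(w \<noteq> r \<and> u = par w) \<or> (u \<noteq> r \<and> w = par u)"
  then show "E u w" using par_props(2)[OF assms(1)] par_props(2)[OF assms(2)] sym[OF assms(2,1)] by blast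
qed

lemma offspring_eq:
  assumes "v \<in> V"
  shows "offspring V E r v = {w \<in> V. w \<noteq> r \<and> par w = v}"
proof (intro set_eqI iffI)
  fix w assume "w \<in> offspring V E r v"
  then have w: "w \<in> V" "E v w" "dep v < dep w" by (auto simp: offspring_def neighbours_def dep_def)
  then show "w \<in> {w \<in> V. w \<noteq> r \<and> par w = v}" using edge_parent[OF assms w(1,2)] by auto
next
  fix w assume "w \<in> {w \<in> V. w \<noteq> r \<and> par w = v}"
  then show "w \<in> offspring V E r v"
    using par_props[of w] by (auto simp: offspring_def neighbours_def dep_def)
qed

text \<open>The enumeration depends on the parent only, so siblings share one bijection. As its
  range is an initial segment, the indices 0 and 1 occur.\<close>

definition idx :: "'a \<Rightarrow> nat" where
  "idx w = (SOME h. bij_betw h (offspring V E r (par w)) {0..<card (offspring V E r (par w))}) w"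

lemma idx_bij:
  assumes v: "v \<in> V"
  shows "bij_betw idx (offspring V E r v) {0..<card (offspring V E r v)}"
proof -
  let ?h = "SOME h. bij_betw h (offspring V E r v) {0..<card (offspring V E r v)}"
  have "finite (offspring V E r v)" using degree[OF v] by (auto simp: offspring_def)
  then have "\<exists>h. bij_betw h (offspring V E r v) {0..<card (offspring V E r v)}" by (rule ex_bij_betw_finite_nat)
  then have "bij_betw ?h (offspring V E r v) {0..<card (offspring V E r v)}" by (rule someI_ex)
  moreover have "idx w = ?h w" if "w \<in> offspring V E r v" for w
    using that offspring_eq[OF v] unfolding idx_def by auto
  ultimately show ?thesis using bij_betw_cong[of "offspring V E r v" idx ?h] by blast
qed

lemma coloured: "0 < M \<Longrightarrow> coloured_tree V r par dep idx D M"
proof (unfold_locales)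
  have child: "w \<in> offspring V E r (par w)" if "w \<in> V" "w \<noteq> r" for w
    using that offspring_eq[OF par_in[OF that(1)]] by auto
  have cD: "card (offspring V E r v) \<le> D" if "v \<in> V" for v
  proof -
    have "card (offspring V E r v) \<le> card (neighbours V E v)"
      using degree[OF that] by (intro card_mono) (auto simp: offspring_def)
    then show ?thesis using degree[OF that] by simp
  qed
  show "idx v < D" if v: "v \<in> V" "v \<noteq> r" for v
  proof -
    have "idx v \<in> {0..<card (offspring V E r (par v))}"
      using bij_betwE[OF idx_bij[OF par_in[OF v(1)]]] child[OF v] by blast
    then show ?thesis using cD[OF par_in[OF v(1)]] by simp
  qed
  show "v = w" if vw: "v \<in> V" "w \<in> V" "v \<noteq> r" "w \<noteq> r" "par v = par w" "idx v = idx w" for v w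
    using inj_onD[OF bij_betw_imp_inj_on[OF idx_bij[OF par_in[OF vw(1)]]] vw(6)] child[OF vw(1,3)] child[OF vw(2,4)] vw(5)
    by simp
  show "\<exists>w\<in>V. w \<noteq> r \<and> par w = v \<and> idx w = k" if v: "v \<in> V" "k < 2" for v k
  proof -
    have "k \<in> idx ` offspring V E r v"
      using bij_betw_imp_surj_on[OF idx_bij[OF v(1)]] offspring_ge_2[OF v(1)] v(2) by simp
    then show ?thesis using offspring_eq[OF v(1)] by blast
  qed
qed (use r_in dep_root par_root par_in par_props(3) in auto)

definition edge :: "'a \<Rightarrow> 'a set" where "edge e = {e, par e}"

lemma edge_inj: "inj_on edge (V - {r})"
proof (rule inj_onI)
  fix e f assume e: "e \<in> V - {r}" and f: "f \<in> V - {r}" and eq: "edge e = edge f"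
  show "e = f"
  proof (rule ccontr)
    assume "e \<noteq> f"
    then have ef: "e = par f" "par e = f" using eq unfolding edge_def doubleton_eq_iff by auto
    have "dep e = Suc (dep (par e))" "dep f = Suc (dep (par f))" using par_props(3) e f by auto
    then show False unfolding ef(1)[symmetric] ef(2) by simp
  qed
qed

lemma graph_edges_eq: "graph_edges V E = edge ` (V - {r})"
proof (intro set_eqI iffI)
  fix A assume "A \<in> graph_edges V E"
  then obtain u w where uw: "A = {u, w}" "u \<in> V" "w \<in> V" "E u w" by (auto simp: graph_edges_def)
  then show "A \<in> edge ` (V - {r})"
    using adjacent_iff[OF uw(2,3)] unfolding edge_def uw(1) by blast
next
  fix A assume "A \<in> edge ` (V - {r})"
  then obtain e where e: "A = {e, par e}" "e \<in> V" "e \<noteq> r" by (auto simp: edge_def)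
  then have "A = {par e, e}" "par e \<in> V" "E (par e) e" using par_props[OF e(2,3)] by auto
  then show "A \<in> graph_edges V E" unfolding graph_edges_def using e(2) by blast
qed

end

section \<open>Particle trajectories and the absence of explosion\<close>

section \<open>Trajectories of the stirring process\<close>

lemma ring_time_psum: "ring_time \<zeta> e k = psum \<zeta> e (Suc k)"
  unfolding ring_time_def psum_def by (simp only: lessThan_Suc_atMost)

lemma stir_step_stop: "next_jumps V E \<zeta> T p = {} \<Longrightarrow> stir_step V E \<zeta> T p = p"
  by (simp add: stir_step_def)

lemma stir_step_unique:
  assumes "q \<in> next_jumps V E \<zeta> T p"
    and "\<And>q'. q' \<in> next_jumps V E \<zeta> T p \<Longrightarrow> fst q' \<le> fst q \<Longrightarrow> q' = q"
  shows "stir_step V E \<zeta> T p = (snd q, fst q)"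
proof -
  let ?J = "next_jumps V E \<zeta> T p"
  have "(SOME q. q \<in> ?J \<and> (\<forall>q'\<in>?J. fst q \<le> fst q')) = q"
  proof (rule some_equality)
    show "q \<in> ?J \<and> (\<forall>q'\<in>?J. fst q \<le> fst q')" using assms by (metis linear order_refl)
    show "q' = q" if "q' \<in> ?J \<and> (\<forall>q\<in>?J. fst q' \<le> fst q)" for q' using assms that by blast
  qed
  then show ?thesis using assms(1) by (auto simp: stir_step_def Let_def)
qed

lemma stir_step_finite:
  assumes "finite (next_jumps V E \<zeta> T p)" "next_jumps V E \<zeta> T p \<noteq> {}"
  shows "\<exists>q\<in>next_jumps V E \<zeta> T p. stir_step V E \<zeta> T p = (snd q, fst q)"
proof -
  let ?J = "next_jumps V E \<zeta> T p"
  let ?q = "SOME q. q \<in> ?J \<and> (\<forall>q'\<in>?J. fst q \<le> fst q')"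
  have "Min (fst ` ?J) \<in> fst ` ?J" using assms by (intro Min_in) auto
  then obtain q where q: "q \<in> ?J" "fst q = Min (fst ` ?J)" by auto
  have "q \<in> ?J \<and> (\<forall>q'\<in>?J. fst q \<le> fst q')" unfolding q(2) using q(1) assms(1) by simp
  then have "?q \<in> ?J \<and> (\<forall>q'\<in>?J. fst ?q \<le> fst q')" by (rule someI)
  moreover have "stir_step V E \<zeta> T p = (snd ?q, fst ?q)" using assms(2) by (simp add: stir_step_def Let_def)
  ultimately show ?thesis by blast
qed

lemma stir_traj_0: "stir_traj V E \<zeta> T v 0 = (v, 0)"
  by (simp add: stir_traj_def)

lemma stir_traj_Suc: "stir_traj V E \<zeta> T v (Suc k) = stir_step V E \<zeta> T (stir_traj V E \<zeta> T v k)"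
  by (simp add: stir_traj_def)

lemma stir_traj_stop:
  assumes "next_jumps V E \<zeta> T (stir_traj V E \<zeta> T v k) = {}" "k \<le> l"
  shows "stir_traj V E \<zeta> T v l = stir_traj V E \<zeta> T v k"
  using assms(2)
proof (induction l rule: dec_induct)
  case (step l)
  then show ?case using stir_step_stop[OF assms(1)] by (simp add: stir_traj_Suc)
qed simp

lemma stirring_perm_eq:
  assumes "next_jumps V E \<zeta> T (stir_traj V E \<zeta> T v k) = {}"
  shows "stirring_perm V E \<zeta> T v = fst (stir_traj V E \<zeta> T v k)"
proof -
  define P where "P N \<longleftrightarrow> (\<forall>n\<ge>N. stir_traj V E \<zeta> T v n = stir_traj V E \<zeta> T v N)" for N
  have k: "P k" unfolding P_def using stir_traj_stop[OF assms] by blast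
  then have "P (LEAST N. P N)" "(LEAST N. P N) \<le> k" by (rule LeastI, rule Least_le)
  then have "stir_traj V E \<zeta> T v k = stir_traj V E \<zeta> T v (LEAST N. P N)" unfolding P_def by blast
  moreover have "\<exists>N. P N" using k by blast
  ultimately show ?thesis unfolding stirring_perm_def P_def[symmetric] by simp
qed

context bounded_tree
begin

text \<open>Notions such as \<open>sub\<close> and \<open>opp\<close> do not involve the number of
  slots; the instance with one slot makes them available before a mesh is chosen.\<close>

sublocale one: coloured_tree V r par dep idx D 1
  by (rule coloured) simp

definition touch :: "'a \<Rightarrow> 'a \<Rightarrow> bool" where
  "touch e u \<longleftrightarrow> e \<in> V \<and> e \<noteq> r \<and> (u = e \<or> u = par e)"

definition rings :: "('a set \<times> nat \<Rightarrow> real) \<Rightarrow> 'a \<Rightarrow> real set" where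
  "rings \<zeta> e = range (ring_time \<zeta> (edge e))"

lemma touch_V: "touch e u \<Longrightarrow> u \<in> V"
  unfolding touch_def using par_in by blast

lemma opp_V: "touch e u \<Longrightarrow> one.opp e u \<in> V"
  unfolding touch_def one.opp_def using par_in by simp

lemma touch_dep:
  assumes "touch e u"
  shows "dep e \<le> Suc (dep u)" "dep (one.opp e u) \<le> Suc (dep u)"
  using assms par_props(3)[of e] unfolding touch_def one.opp_def by auto

lemma next_jumps_eq:
  assumes u: "u \<in> V"
  shows "next_jumps V E \<zeta> T (u, t) = {(s, one.opp e u) | e s. touch e u \<and> s \<in> rings \<zeta> e \<and> t < s \<and> s \<le> T}"
    (is "_ = ?R")
proof (intro set_eqI iffI)
  fix q assume "q \<in> next_jumps V E \<zeta> T (u, t)"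
  then obtain s w k where q: "q = (s, w)" "w \<in> V" "E u w" "s = ring_time \<zeta> {u, w} k" "t < s" "s \<le> T"
    unfolding next_jumps_def by auto
  have neq: "u \<noteq> w" using q(3) irrefl[OF u] by blast
  obtain e where "touch e u" "one.opp e u = w" "edge e = {u, w}"
  proof (cases "w \<noteq> r \<and> u = par w")
    case True
    show ?thesis
    proof (rule that[of w])
      show "touch w u" unfolding touch_def using True q(2) by blast
      show "one.opp w u = w" unfolding one.opp_def using neq by simp
      show "edge w = {u, w}" unfolding edge_def using True by blast
    qed
  next
    case False
    then have *: "u \<noteq> r \<and> w = par u" using adjacent_iff[OF u q(2)] q(3) by blast
    show ?thesis
    proof (rule that[of u])
      show "touch u u" unfolding touch_def using * u by blast
      show "one.opp u u = w" unfolding one.opp_def using * by simp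
      show "edge u = {u, w}" unfolding edge_def using * by blast
    qed
  qed
  then show "q \<in> ?R" using q unfolding rings_def by auto
next
  fix q assume "q \<in> ?R"
  then obtain e s k where q: "q = (s, one.opp e u)" "touch e u" "s = ring_time \<zeta> (edge e) k" "t < s" "s \<le> T"
    unfolding rings_def by auto
  have e: "e \<in> V" "e \<noteq> r" "u = e \<or> u = par e" using q(2) unfolding touch_def by auto
  have ne: "par e \<noteq> e" by (rule one.par_neq[OF e(1,2)])
  have "edge e = {u, one.opp e u}" unfolding edge_def one.opp_def using e(3) ne by auto
  moreover have "E u (one.opp e u)"
    using par_props(2)[OF e(1,2)] sym[OF par_in[OF e(1)] e(1)] e(3) ne unfolding one.opp_def by auto
  ultimately show "q \<in> next_jumps V E \<zeta> T (u, t)"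
    using q u opp_V[OF q(2)] unfolding next_jumps_def by auto
qed

end

text \<open>The barrier condition excludes explosion: in each of \<open>W\<close> time windows only finite clusters of edges ring.\<close>

locale regular_rings = bounded_tree V E r D
  for V :: "'a set" and E :: "'a \<Rightarrow> 'a \<Rightarrow> bool" and r D +
  fixes \<zeta> :: "'a set \<times> nat \<Rightarrow> real" and T :: real and W :: nat
  assumes T_pos: "0 < T" and W_pos: "0 < W"
    and increments: "\<And>e j. e \<in> V \<Longrightarrow> e \<noteq> r \<Longrightarrow> 0 < \<zeta> (edge e, j)"
    and unbounded: "\<And>e. e \<in> V \<Longrightarrow> e \<noteq> r \<Longrightarrow> filterlim (psum \<zeta> (edge e)) at_top sequentially"
    and distinct_rings: "\<And>e f s. e \<in> V \<Longrightarrow> e \<noteq> r \<Longrightarrow> f \<in> V \<Longrightarrow> f \<noteq> r \<Longrightarrow>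
      s \<in> rings \<zeta> e \<Longrightarrow> s \<in> rings \<zeta> f \<Longrightarrow> s \<le> T \<Longrightarrow> e = f"
    and barrier: "\<And>d i. i < W \<Longrightarrow> \<exists>m. \<forall>w\<in>V. dep w = d + m \<longrightarrow>
      (\<exists>x. w \<in> one.sub x \<and> d < dep x \<and> (\<forall>s\<in>rings \<zeta> x. sidx (T / W) s \<noteq> i))"
begin

abbreviation "traj \<equiv> stir_traj V E \<zeta> T"
abbreviation "perm \<equiv> stirring_perm V E \<zeta> T"
abbreviation "jumps \<equiv> next_jumps V E \<zeta> T"

lemma ring_pos:
  assumes "e \<in> V" "e \<noteq> r" "s \<in> rings \<zeta> e"
  shows "0 < s"
  using assms(3) increments[OF assms(1,2)] unfolding rings_def ring_time_def
  by (auto intro!: sum_pos)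

lemma finite_rings:
  assumes "e \<in> V" "e \<noteq> r"
  shows "finite {s \<in> rings \<zeta> e. s \<le> T}"
proof -
  have "eventually (\<lambda>k. T < psum \<zeta> (edge e) k) sequentially"
    using unbounded[OF assms] unfolding filterlim_at_top_dense by blast
  then obtain N where N: "\<And>k. N \<le> k \<Longrightarrow> T < psum \<zeta> (edge e) k" unfolding eventually_sequentially by blast
  have "{s \<in> rings \<zeta> e. s \<le> T} \<subseteq> ring_time \<zeta> (edge e) ` {..<N}"
  proof
    fix s assume "s \<in> {s \<in> rings \<zeta> e. s \<le> T}"
    then obtain k where k: "s = ring_time \<zeta> (edge e) k" "s \<le> T" unfolding rings_def by blast
    have "k < N" using N[of "Suc k"] k unfolding ring_time_psum by (meson le_SucI linorder_not_le)
    then show "s \<in> ring_time \<zeta> (edge e) ` {..<N}" using k(1) by blast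
  qed
  then show ?thesis by (rule finite_subset) simp
qed

lemma finite_rings_upto: "finite (SIGMA e:{e \<in> V. e \<noteq> r \<and> dep e \<le> d}. {s \<in> rings \<zeta> e. s \<le> T})"
proof (rule finite_SigmaI)
  show "finite {e \<in> V. e \<noteq> r \<and> dep e \<le> d}" by (rule finite_subset[OF _ one.finite_upto[of d]]) blast
qed (use finite_rings in blast)

lemma finite_jumps:
  assumes "u \<in> V"
  shows "finite (jumps (u, t))"
proof (rule finite_subset)
  show "jumps (u, t) \<subseteq> (\<lambda>(e, s). (s, one.opp e u)) ` (SIGMA e:{e \<in> V. e \<noteq> r \<and> dep e \<le> Suc (dep u)}. {s \<in> rings \<zeta> e. s \<le> T})"
  proof
    fix q assume "q \<in> jumps (u, t)"
    then obtain e s where q: "q = (s, one.opp e u)" "touch e u" "s \<in> rings \<zeta> e" "s \<le> T"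
      unfolding next_jumps_eq[OF assms] by blast
    have "(e, s) \<in> (SIGMA e:{e \<in> V. e \<noteq> r \<and> dep e \<le> Suc (dep u)}. {s \<in> rings \<zeta> e. s \<le> T})"
      using q touch_dep(1)[OF q(2)] unfolding touch_def by blast
    then show "q \<in> (\<lambda>(e, s). (s, one.opp e u)) ` (SIGMA e:{e \<in> V. e \<noteq> r \<and> dep e \<le> Suc (dep u)}. {s \<in> rings \<zeta> e. s \<le> T})"
      by (rule rev_image_eqI) (simp add: q(1))
  qed
qed (rule finite_imageI[OF finite_rings_upto])

lemma step_cases:
  assumes "u \<in> V"
  obtains "jumps (u, t) = {}" "stir_step V E \<zeta> T (u, t) = (u, t)"
  | e s where "touch e u" "s \<in> rings \<zeta> e" "t < s" "s \<le> T" "stir_step V E \<zeta> T (u, t) = (one.opp e u, s)"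
proof (cases "jumps (u, t) = {}")
  case True
  then show ?thesis using that(1) stir_step_stop by blast
next
  case False
  obtain q where q: "q \<in> jumps (u, t)" "stir_step V E \<zeta> T (u, t) = (snd q, fst q)"
    using stir_step_finite[OF finite_jumps[OF assms] False] by blast
  then obtain e s where es: "q = (s, one.opp e u)" "touch e u" "s \<in> rings \<zeta> e" "t < s" "s \<le> T"
    unfolding next_jumps_eq[OF assms] by blast
  show ?thesis by (rule that(2)[OF es(2-5)]) (use q(2) es(1) in simp)
qed

lemma traj_V: "v \<in> V \<Longrightarrow> fst (traj v k) \<in> V"
proof (induction k)
  case (Suc k)
  then obtain u t where ut: "traj v k = (u, t)" "u \<in> V" by (cases "traj v k") auto
  show ?case
  proof (cases rule: step_cases[OF ut(2), of t])
    case 1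
    then show ?thesis using ut by (simp add: stir_traj_Suc)
  next
    case (2 e s)
    then show ?thesis using ut opp_V by (simp add: stir_traj_Suc)
  qed
qed (simp add: stir_traj_0)

end

lemma eventually_constant_slot:
  fixes f :: "nat \<Rightarrow> nat"
  assumes "mono f" "\<And>k. f k < b"
  obtains N where "\<And>k. N \<le> k \<Longrightarrow> f k = f N"
proof -
  have "\<exists>N. True \<and> (\<forall>k. True \<longrightarrow> f k \<le> f N)"
    by (rule ex_has_greatest_nat[of "\<lambda>_. True" 0 f b]) (use assms(2) in \<open>auto intro: less_imp_le\<close>)
  then obtain N where "\<And>k. f k \<le> f N" by blast
  then show ?thesis using that[of N] monoD[OF assms(1)] by (meson order_antisym)
qed

lemma sidx_mono: "0 < \<delta> \<Longrightarrow> s \<le> t \<Longrightarrow> sidx \<delta> s \<le> sidx \<delta> t"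
  unfolding sidx_def by (intro nat_mono diff_right_mono ceiling_mono divide_right_mono) auto

lemma sidx_less:
  assumes "0 < \<delta>" "0 < s" "s \<le> real M * \<delta>"
  shows "sidx \<delta> s < M"
proof -
  have "real (sidx \<delta> s) * \<delta> < s" using sidx_iff[OF assms(1,2), of "sidx \<delta> s"] by simp
  also note assms(3)
  finally have "real (sidx \<delta> s) < real M" using assms(1) by (simp only: mult_less_cancel_right_pos)
  then show ?thesis by (simp only: of_nat_less_iff)
qed

context regular_rings
begin

text \<open>A trajectory with infinitely many jumps would leave every finite set, so within its final time
window it would cross every edge of arbitrarily long descending paths.\<close>

lemma terminates:
  assumes v: "v \<in> V"
  shows "\<exists>k. jumps (traj v k) = {}"
proof (rule ccontr)
  assume "\<nexists>k. jumps (traj v k) = {}"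
  then have nonempty: "\<And>k. jumps (traj v k) \<noteq> {}" by blast
  define u where "u k = fst (traj v k)" for k
  define \<tau> where "\<tau> k = snd (traj v k)" for k
  have trj: "traj v k = (u k, \<tau> k)" for k by (simp add: u_def \<tau>_def)
  have uV: "u k \<in> V" for k unfolding u_def by (rule traj_V[OF v])
  have "\<exists>e. touch e (u k) \<and> \<tau> (Suc k) \<in> rings \<zeta> e \<and> \<tau> k < \<tau> (Suc k) \<and> \<tau> (Suc k) \<le> T \<and> u (Suc k) = one.opp e (u k)" for k
  proof (cases rule: step_cases[OF uV[of k], of "\<tau> k"])
    case 1
    then show ?thesis using nonempty[of k] trj[of k] by simp
  next
    case (2 e s)
    have "(u (Suc k), \<tau> (Suc k)) = (one.opp e (u k), s)"
      using 2(5) trj[of "Suc k"] unfolding stir_traj_Suc trj[of k] by simp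
    then show ?thesis using 2(1-4) by auto
  qed
  then obtain e where e: "\<And>k. touch (e k) (u k)" "\<And>k. \<tau> (Suc k) \<in> rings \<zeta> (e k)" "\<And>k. \<tau> k < \<tau> (Suc k)"
      "\<And>k. \<tau> (Suc k) \<le> T" "\<And>k. u (Suc k) = one.opp (e k) (u k)" by metis
  have \<tau>mono: "strict_mono \<tau>" using e(3) by (simp add: strict_mono_Suc_iff)
  have dstep: "dep (u (Suc k)) \<le> Suc (dep (u k))" for k unfolding e(5) by (rule touch_dep(2)[OF e(1)])
  \<comment> \<open>Jump times increase strictly, so every visit to a bounded depth uses up a new
    ring of one of finitely many edges.\<close>
  have fin: "finite {k. dep (u k) \<le> d}" for d
  proof (rule inj_on_finite)
    show "inj_on (\<lambda>k. (e k, \<tau> (Suc k))) {k. dep (u k) \<le> d}"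
      using strict_mono_eq[OF \<tau>mono] by (auto intro!: inj_onI)
    show "(\<lambda>k. (e k, \<tau> (Suc k))) ` {k. dep (u k) \<le> d} \<subseteq> (SIGMA e:{e \<in> V. e \<noteq> r \<and> dep e \<le> Suc d}. {s \<in> rings \<zeta> e. s \<le> T})"
    proof (rule image_subsetI)
      fix k assume "k \<in> {k. dep (u k) \<le> d}"
      then have "dep (e k) \<le> Suc d" using touch_dep(1)[OF e(1)[of k]] by simp
      then show "(e k, \<tau> (Suc k)) \<in> (SIGMA e:{e \<in> V. e \<noteq> r \<and> dep e \<le> Suc d}. {s \<in> rings \<zeta> e. s \<le> T})"
        using e(1,2,4)[of k] unfolding touch_def by simp
    qed
  qed (rule finite_rings_upto)
  let ?\<delta> = "T / real W"
  have \<delta>: "0 < ?\<delta>" "real W * ?\<delta> = T" using T_pos W_pos by auto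
  have eV: "e k \<in> V" "e k \<noteq> r" for k using e(1)[of k] unfolding touch_def by auto
  \<comment> \<open>Slot indices along the jumps are monotone and bounded, so all late jumps fall
    into one window.\<close>
  obtain N where N: "\<And>k. N \<le> k \<Longrightarrow> sidx ?\<delta> (\<tau> (Suc k)) = sidx ?\<delta> (\<tau> (Suc N))"
  proof (rule eventually_constant_slot)
    show "mono (\<lambda>k. sidx ?\<delta> (\<tau> (Suc k)))"
      using strict_mono_mono[OF \<tau>mono] by (intro monoI sidx_mono[OF \<delta>(1)]) (auto dest: monoD)
    show "sidx ?\<delta> (\<tau> (Suc k)) < W" for k
      by (rule sidx_less[OF \<delta>(1) ring_pos[OF eV e(2)]]) (use e(4) \<delta>(2) in simp)
  qed blast
  define i where "i = sidx ?\<delta> (\<tau> (Suc N))"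
  have "i < W" unfolding i_def
    by (rule sidx_less[OF \<delta>(1) ring_pos[OF eV e(2)]]) (use e(4) \<delta>(2) in simp)
  then obtain m where m: "\<And>w. w \<in> V \<Longrightarrow> dep w = dep (u N) + m \<Longrightarrow>
      \<exists>x. w \<in> one.sub x \<and> dep (u N) < dep x \<and> (\<forall>s\<in>rings \<zeta> x. sidx ?\<delta> s \<noteq> i)"
    using barrier[of i "dep (u N)"] by blast
  \<comment> \<open>As \<open>x\<close> is deeper than \<open>u N\<close>, the vertex
    \<open>u N\<close> is not below \<open>x\<close>; a later position below \<open>x\<close>
    therefore requires the edge above \<open>x\<close> to have been crossed, and so to have rung in
    window \<open>i\<close>.\<close>
  have crossed: "\<exists>s\<in>rings \<zeta> x. sidx ?\<delta> s = i" if "N \<le> k" "u k \<in> one.sub x" "dep (u N) < dep x" for k x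
    using that
  proof (induction k arbitrary: x rule: dec_induct)
    case base
    then show ?case using one.sub_iff[of "u N" x] by simp
  next
    case (step k)
    have ek: "u k = e k \<or> u k = par (e k)" using e(1)[of k] unfolding touch_def by blast
    have "x = e k \<or> u k \<in> one.sub x"
    proof (cases "u k = e k")
      case True
      then have "par (e k) \<in> one.sub x" using step.prems(1) e(5)[of k] unfolding one.opp_def by simp
      then show ?thesis using one.sub_down[OF eV(1)] True by simp
    next
      case False
      then have "e k \<in> one.sub x" using step.prems(1) e(5)[of k] unfolding one.opp_def by simp
      then show ?thesis using one.sub_up[of "e k" x] False ek by auto
    qed
    then show ?case
    proof
      assume "x = e k"
      then show ?thesis using e(2)[of k] N[OF step.hyps(1)] unfolding i_def by blast
    next
      assume "u k \<in> one.sub x"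
      then show ?thesis by (rule step.IH[OF _ step.prems(2)])
    qed
  qed
  define P where "P k \<longleftrightarrow> N \<le> k \<and> dep (u N) + m \<le> dep (u k)" for k
  have "finite ({k. dep (u k) \<le> dep (u N) + m} \<union> {..<N})" using fin by simp
  then obtain k' where "k' \<notin> {k. dep (u k) \<le> dep (u N) + m} \<union> {..<N}"
    using ex_new_if_finite infinite_UNIV_nat by blast
  then have "P k'" unfolding P_def by simp
  define k where "k = (LEAST k. P k)"
  have Pk: "P k" unfolding k_def using \<open>P k'\<close> by (rule LeastI)
  have "dep (u k) = dep (u N) + m"
  proof (cases "k = N")
    case True
    then show ?thesis using Pk unfolding P_def by simp
  next
    case False
    then obtain l where l: "k = Suc l" "N \<le> l" using Pk unfolding P_def by (cases k) auto
    have "\<not> P l" using l(1) not_less_Least[of l P] unfolding k_def by simp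
    then show ?thesis using Pk dstep[of l] l unfolding P_def by simp
  qed
  then obtain x where "u k \<in> one.sub x" "dep (u N) < dep x" "\<forall>s\<in>rings \<zeta> x. sidx ?\<delta> s \<noteq> i"
    using m[OF uV[of k]] by blast
  then show False using crossed[of k x] Pk unfolding P_def by blast
qed

end

section \<open>Coupling of the bit-driven walk with the stirring process\<close>

section \<open>The discretised walk follows the trajectories\<close>

lemma sidx_eq_imp_close:
  assumes "0 < \<delta>" "0 < s" "0 < t" "sidx \<delta> s = sidx \<delta> t"
  shows "\<bar>s - t\<bar> < \<delta>"
proof -
  have "real (sidx \<delta> t) * \<delta> < s" "s \<le> (real (sidx \<delta> t) + 1) * \<delta>"
    using sidx_iff[OF assms(1,2), of "sidx \<delta> t"] assms(4) by auto
  moreover have "real (sidx \<delta> t) * \<delta> < t" "t \<le> (real (sidx \<delta> t) + 1) * \<delta>"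
    using sidx_iff[OF assms(1,3), of "sidx \<delta> t"] by auto
  ultimately show ?thesis by (simp add: algebra_simps abs_less_iff)
qed

lemma eventually_separated:
  assumes X: "finite X" "\<And>s. s \<in> X \<Longrightarrow> 0 < s" and T: "0 < T"
  shows "eventually (\<lambda>M. inj_on (sidx (T / real M)) X) sequentially"
proof -
  have "eventually (\<lambda>M. \<forall>s\<in>X. \<forall>t\<in>X. s \<noteq> t \<longrightarrow> sidx (T / real M) s \<noteq> sidx (T / real M) t) sequentially"
  proof (intro eventually_ball_finite[OF X(1)] ballI)
    fix s t assume st: "s \<in> X" "t \<in> X"
    show "eventually (\<lambda>M. s \<noteq> t \<longrightarrow> sidx (T / real M) s \<noteq> sidx (T / real M) t) sequentially"
    proof (cases "s = t")
      case False
      have "(\<lambda>M. T / real M) \<longlonglongrightarrow> 0" by (rule lim_const_over_n)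
      then have "eventually (\<lambda>M. T / real M < \<bar>s - t\<bar>) sequentially"
        by (rule order_tendstoD(2)) (use False in simp)
      moreover have "eventually (\<lambda>M. 0 < M) sequentially" by (rule eventually_gt_at_top)
      ultimately show ?thesis
      proof eventually_elim
        case (elim M)
        then have "0 < T / real M" using T by simp
        then show ?case using sidx_eq_imp_close[of "T / real M" s t] X(2)[OF st(1)] X(2)[OF st(2)] elim(1) by auto
      qed
    qed simp
  qed
  then show ?thesis unfolding inj_on_def by eventually_elim blast
qed

context bounded_tree
begin

text \<open>Position \<open>u\<close> of an edge lies in slot \<open>u div C\<close>, with
  \<open>C = Suc D\<close>. Several rings of one edge in a slot would collapse to one bit; the
  coupling therefore demands separated rings.\<close>

definition pattern :: "real \<Rightarrow> nat \<Rightarrow> nat \<Rightarrow> ('a set \<times> nat \<Rightarrow> real) \<Rightarrow> ('a \<times> nat) set" where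
  "pattern T M n \<zeta> = {b \<in> coloured_tree.bits V r par dep idx D M n. rbit (T / real M) \<zeta> (edge (fst b), snd b div Suc D)}"

end

context regular_rings
begin

lemma rbit_iff_rings:
  assumes "e \<in> V" "e \<noteq> r"
  shows "rbit \<delta> \<zeta> (edge e, i) \<longleftrightarrow> (\<exists>s\<in>rings \<zeta> e. sidx \<delta> s = i)"
proof -
  have "0 < psum \<zeta> (edge e) (Suc k)" for k
    by (rule ring_pos[OF assms]) (auto simp: rings_def ring_time_psum)
  then show ?thesis unfolding rbit_def rings_def ring_time_psum by simp
qed

definition separated :: "nat \<Rightarrow> nat \<Rightarrow> bool" where
  "separated M n \<longleftrightarrow> inj_on (sidx (T / real M)) {s. \<exists>e\<in>V. e \<noteq> r \<and> dep e \<le> n \<and> s \<in> rings \<zeta> e \<and> s \<le> T}"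

lemma eventually_sep: "eventually (\<lambda>M. separated M n) sequentially"
  unfolding separated_def
proof (rule eventually_separated[OF _ _ T_pos])
  have "{s. \<exists>e\<in>V. e \<noteq> r \<and> dep e \<le> n \<and> s \<in> rings \<zeta> e \<and> s \<le> T} \<subseteq>
      snd ` (SIGMA e:{e \<in> V. e \<noteq> r \<and> dep e \<le> n}. {s \<in> rings \<zeta> e. s \<le> T})" by force
  then show "finite {s. \<exists>e\<in>V. e \<noteq> r \<and> dep e \<le> n \<and> s \<in> rings \<zeta> e \<and> s \<le> T}"
    by (rule finite_subset) (rule finite_imageI[OF finite_rings_upto])
qed (use ring_pos in blast)

lemma separatedD:
  assumes "separated M n" "e \<in> V" "e \<noteq> r" "dep e \<le> n" "s \<in> rings \<zeta> e" "s \<le> T"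
    "f \<in> V" "f \<noteq> r" "dep f \<le> n" "t \<in> rings \<zeta> f" "t \<le> T" "sidx (T / real M) s = sidx (T / real M) t"
  shows "s = t" "e = f"
proof -
  show "s = t"
    by (rule inj_onD[OF assms(1)[unfolded separated_def], where x = s and y = t]) (use assms in blast)+
  then show "e = f" using distinct_rings[OF assms(2,3,7,8,5)] assms(6,10) by simp
qed

end

locale coupled = regular_rings V E r D \<zeta> T W + c: coloured_tree V r par dep idx D M
  for V :: "'a set" and E :: "'a \<Rightarrow> 'a \<Rightarrow> bool" and r D \<zeta> T W M +
  fixes n :: nat
  assumes sep: "separated M n"
begin

abbreviation "\<delta> \<equiv> T / real M"
abbreviation "S \<equiv> pattern T M n \<zeta>"
abbreviation "walk \<equiv> c.wlk S"

lemma \<delta>_pos: "0 < \<delta>" and M\<delta>: "real M * \<delta> = T"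
  using T_pos c.M_pos by auto

lemma S_iff:
  assumes "touch e x" "dep x < n" "i < M" "a < c.C"
  shows "c.edge_at e x (i * c.C + a) \<and> (e, (i * c.C + a) mod c.L) \<in> S \<longleftrightarrow>
    c.col e = a \<and> (\<exists>s\<in>rings \<zeta> e. sidx \<delta> s = i)"
proof -
  have e: "e \<in> V" "e \<noteq> r" "x = e \<or> x = par e" using assms(1) unfolding touch_def by auto
  have md: "(i * c.C + a) mod c.C = a" using assms(4) by simp
  have dv: "(i * c.C + a) div c.C = i" using assms(4) by simp
  have "i * c.C + a < Suc i * c.C" using assms(4) by simp
  also have "\<dots> \<le> M * c.C" using assms(3) by (intro mult_le_mono1) simp
  finally have lt: "i * c.C + a < c.L" unfolding c.L_def .
  have "dep e \<le> n" using touch_dep(1)[OF assms(1)] assms(2) by simp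
  then show ?thesis
    using e lt md dv rbit_iff_rings[OF e(1,2)] unfolding c.edge_at_def pattern_def c.bits_def c.C_def[symmetric] by auto
qed

lemma quiet:
  assumes x: "x \<in> V" "dep x < n" and i: "i < M" and a: "a + l \<le> c.C"
    and no: "\<And>e s. touch e x \<Longrightarrow> a \<le> c.col e \<Longrightarrow> c.col e < a + l \<Longrightarrow> s \<in> rings \<zeta> e \<Longrightarrow> sidx \<delta> s \<noteq> i"
    and l': "l' \<le> l"
  shows "walk (i * c.C + a) x l' = x"
proof (rule c.wlk_const[OF _ l'])
  fix m e assume m: "m < l" and at: "c.edge_at e x (i * c.C + a + m)"
  have t: "touch e x" using at unfolding c.edge_at_def touch_def by blast
  show "(e, (i * c.C + a + m) mod c.L) \<notin> S"
    using S_iff[OF t x(2) i, of "a + m"] no[OF t] at m a by (auto simp: add.assoc)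
qed

text \<open>Near \<open>x\<close> and its other endpoint only \<open>e\<close> rings in this slot,
  and its colour comes up once per round; so the walk waits, crosses once and waits again.\<close>

lemma single_ring:
  assumes x: "touch e x" "dep x < n" and y: "dep (c.opp e x) < n" and i: "i < M"
    and s: "s \<in> rings \<zeta> e" "sidx \<delta> s = i"
    and only: "\<And>f s. touch f x \<or> touch f (c.opp e x) \<Longrightarrow> s \<in> rings \<zeta> f \<Longrightarrow> sidx \<delta> s = i \<Longrightarrow> f = e"
  shows "walk (i * c.C) x c.C = c.opp e x" "l \<le> c.C \<Longrightarrow> walk (i * c.C) x l \<in> {x, c.opp e x}"
proof -
  let ?a = "c.col e" and ?y = "c.opp e x"
  have xV: "x \<in> V" and yV: "?y \<in> V" using touch_V[OF x(1)] opp_V[OF x(1)] by auto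
  have aC: "?a < c.C" by (rule c.col_less)
  have before: "walk (i * c.C) x l = x" if "l \<le> ?a" for l
    using quiet[OF xV x(2) i, of 0 ?a l] only that aC by auto
  have at: "c.edge_at e x (i * c.C + ?a)" "(e, (i * c.C + ?a) mod c.L) \<in> S"
    using S_iff[OF x i aC] s by blast+
  have cross: "walk (i * c.C) x (Suc ?a) = ?y" using before[of ?a] c.mv_on[OF at] by simp
  have after: "walk (i * c.C) x (Suc ?a + l) = ?y" if "Suc ?a + l \<le> c.C" for l
  proof -
    have "walk (i * c.C) x (Suc ?a + l) = walk (i * c.C + Suc ?a) ?y l"
      unfolding c.wlk_add cross ..
    also have "\<dots> = ?y"
      by (rule quiet[OF yV y i that]) (use only in fastforce, simp)
    finally show ?thesis .
  qed
  have le: "walk (i * c.C) x l \<in> {x, ?y} \<and> (l = c.C \<longrightarrow> walk (i * c.C) x l = ?y)" if "l \<le> c.C" for l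
  proof (cases "l \<le> ?a")
    case True
    then show ?thesis using before[OF True] aC by auto
  next
    case False
    then obtain m where "l = Suc ?a + m" by (metis not_less_eq_eq le_Suc_ex)
    then have "walk (i * c.C) x l = ?y" using after[of m] that by (simp only:)
    then show ?thesis by blast
  qed
  show "walk (i * c.C) x c.C = ?y" using le[of c.C] by simp
  show "walk (i * c.C) x l \<in> {x, ?y}" if "l \<le> c.C" using le[OF that] by simp
qed

lemma slot_of:
  assumes "real i * \<delta> < s" "s \<le> real (Suc i) * \<delta>"
  shows "sidx \<delta> s = i"
proof -
  have "0 \<le> real i * \<delta>" by (rule mult_nonneg_nonneg[OF of_nat_0_le_iff less_imp_le[OF \<delta>_pos]])
  then have "0 < s" using assms(1) by simp
  moreover have "s \<le> (real i + 1) * \<delta>" using assms(2) by (simp add: add.commute)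
  ultimately show ?thesis using sidx_iff[OF \<delta>_pos, of s i] assms(1) by blast
qed

lemma slotD:
  assumes "e \<in> V" "e \<noteq> r" "s \<in> rings \<zeta> e" "sidx \<delta> s = i" "i < M"
  shows "real i * \<delta> < s" "s \<le> real (Suc i) * \<delta>" "s \<le> T"
proof -
  have *: "real i * \<delta> < s \<and> s \<le> (real i + 1) * \<delta>"
    using sidx_iff[OF \<delta>_pos ring_pos[OF assms(1-3)], of i] assms(4) by blast
  then show "real i * \<delta> < s" "s \<le> real (Suc i) * \<delta>" by (auto simp: add.commute)
  have "real (Suc i) * \<delta> \<le> real M * \<delta>" using assms(5) \<delta>_pos by (intro mult_right_mono) auto
  then show "s \<le> T" using * unfolding M\<delta> by (simp add: add.commute)
qed

text \<open>Slot by slot: at the relevant depths a slot contains at most one ring, and the round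
  either performs the corresponding jump or does nothing. The condition on \<open>jumps\<close> says
  that all rings up to the slot boundary have been processed.\<close>

lemma follow:
  assumes v: "v \<in> V" and shallow: "\<And>k. dep (fst (traj v k)) < n" and "i \<le> M"
  shows "\<exists>k. walk 0 v (i * c.C) = fst (traj v k) \<and> snd (traj v k) \<le> real i * \<delta> \<and>
    (\<forall>q\<in>jumps (traj v k). real i * \<delta> < fst q) \<and> (\<forall>j\<le>i * c.C. dep (walk 0 v j) < n)"
  using assms(3)
proof (induction i)
  case 0
  have "\<forall>q\<in>jumps (traj v 0). real 0 * \<delta> < fst q"
    unfolding stir_traj_0 next_jumps_eq[OF v] by auto
  moreover have "dep v < n" using shallow[of 0] by (simp add: stir_traj_0)
  ultimately show ?case by (intro exI[of _ 0]) (simp add: stir_traj_0)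
next
  case (Suc i)
  then obtain k where "walk 0 v (i * c.C) = fst (traj v k)" "snd (traj v k) \<le> real i * \<delta>"
      "\<forall>q\<in>jumps (traj v k). real i * \<delta> < fst q" and past: "\<forall>j\<le>i * c.C. dep (walk 0 v j) < n" by auto
  moreover obtain x t where xt: "traj v k = (x, t)" by (cases "traj v k") blast
  ultimately have k: "walk 0 v (i * c.C) = x" "t \<le> real i * \<delta>" "\<forall>q\<in>jumps (x, t). real i * \<delta> < fst q" by simp_all
  have i: "i < M" using Suc.prems by simp
  have x: "x \<in> V" "dep x < n" using traj_V[OF v, of k] shallow[of k] xt by simp_all
  have shift: "walk 0 v (i * c.C + l) = walk (i * c.C) x l" for l
    using c.wlk_add[of S 0 v "i * c.C" l] k(1) by simp
  have sC: "Suc i * c.C = i * c.C + c.C" by simp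
  have low: "dep (walk 0 v j) < n" if "\<And>l. l \<le> c.C \<Longrightarrow> dep (walk (i * c.C) x l) < n" "j \<le> Suc i * c.C" for j
  proof (cases "j \<le> i * c.C")
    case False
    then have "j = i * c.C + (j - i * c.C)" "j - i * c.C \<le> c.C" using that(2) by simp_all
    then show ?thesis using shift[of "j - i * c.C"] that(1)[of "j - i * c.C"] by simp
  qed (use past in blast)
  show ?case
  proof (cases "\<exists>e s. touch e x \<and> s \<in> rings \<zeta> e \<and> sidx \<delta> s = i")
    case True
    then obtain e s where es: "touch e x" "s \<in> rings \<zeta> e" "sidx \<delta> s = i" by blast
    have e: "e \<in> V" "e \<noteq> r" using es(1) unfolding touch_def by auto
    have en: "dep e \<le> n" using touch_dep(1)[OF es(1)] x(2) by simp
    note s = slotD[OF e es(2,3) i]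
    have same: "f = e \<and> s' = s" if "f \<in> V" "f \<noteq> r" "dep f \<le> n" "s' \<in> rings \<zeta> f" "sidx \<delta> s' = i" for f s'
      using separatedD[OF sep that(1-4) slotD(3)[OF that(1,2,4,5) i] e en es(2) s(3)] that(5) es(3) by simp
    have q: "(s, one.opp e x) \<in> jumps (x, t)"
      unfolding next_jumps_eq[OF x(1)] using es s k(2) by (intro CollectI exI[of _ e] exI[of _ s]) auto
    have "stir_step V E \<zeta> T (x, t) = (snd (s, one.opp e x), fst (s, one.opp e x))"
    proof (rule stir_step_unique[OF q])
      fix q' assume q': "q' \<in> jumps (x, t)" "fst q' \<le> fst (s, one.opp e x)"
      then obtain f s' where f: "q' = (s', one.opp f x)" "touch f x" "s' \<in> rings \<zeta> f"
        unfolding next_jumps_eq[OF x(1)] by blast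
      have "real i * \<delta> < s'" using k(3) q'(1) f(1) by force
      moreover have "s' \<le> real (Suc i) * \<delta>" using q'(2) f(1) s(2) by simp
      ultimately have "sidx \<delta> s' = i" by (rule slot_of)
      moreover have "dep f \<le> n" using touch_dep(1)[OF f(2)] x(2) by simp
      moreover have "f \<in> V" "f \<noteq> r" using f(2) unfolding touch_def by auto
      ultimately have "f = e \<and> s' = s" using same f(3) by blast
      then show "q' = (s, one.opp e x)" using f(1) by simp
    qed
    then have next_k: "traj v (Suc k) = (c.opp e x, s)" unfolding stir_traj_Suc xt by simp
    have y: "c.opp e x \<in> V" "dep (c.opp e x) < n" using opp_V[OF es(1)] shallow[of "Suc k"] next_k by simp_all
    have touching: "f \<in> V" "f \<noteq> r" "dep f \<le> n" if "touch f x \<or> touch f (c.opp e x)" for f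
      using that touch_dep(1)[of f x] touch_dep(1)[of f "c.opp e x"] x(2) y(2) unfolding touch_def by auto
    have only: "f = e" if "touch f x \<or> touch f (c.opp e x)" "s' \<in> rings \<zeta> f" "sidx \<delta> s' = i" for f s'
      using same[OF touching[OF that(1)] that(2,3)] by blast
    have w1: "walk (i * c.C) x c.C = c.opp e x"
      by (rule single_ring(1)[OF es(1) x(2) y(2) i es(2,3)]) (rule only)
    have w2: "walk (i * c.C) x l \<in> {x, c.opp e x}" if "l \<le> c.C" for l
      by (rule single_ring(2)[OF es(1) x(2) y(2) i es(2,3) _ that]) (rule only)
    have "\<forall>q\<in>jumps (c.opp e x, s). real (Suc i) * \<delta> < fst q"
    proof
      fix q' assume "q' \<in> jumps (c.opp e x, s)"
      then obtain f s' where f: "q' = (s', one.opp f (c.opp e x))" "touch f (c.opp e x)" "s' \<in> rings \<zeta> f" "s < s'"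
        unfolding next_jumps_eq[OF y(1)] by blast
      show "real (Suc i) * \<delta> < fst q'"
      proof (rule ccontr)
        assume "\<not> real (Suc i) * \<delta> < fst q'"
        then have "s' \<le> real (Suc i) * \<delta>" using f(1) by simp
        then have "sidx \<delta> s' = i" using s(1) f(4) by (intro slot_of) auto
        then have "s' = s" using same[OF touching f(3)] f(2) by blast
        then show False using f(4) by simp
      qed
    qed
    moreover have "walk 0 v (Suc i * c.C) = c.opp e x" unfolding sC shift by (rule w1)
    moreover have "\<forall>j\<le>Suc i * c.C. dep (walk 0 v j) < n"
    proof (intro allI impI, rule low)
      show "dep (walk (i * c.C) x l) < n" if "l \<le> c.C" for l
        using w2[OF that] x(2) y(2) by auto
    qed
    ultimately have "walk 0 v (Suc i * c.C) = fst (traj v (Suc k)) \<and> snd (traj v (Suc k)) \<le> real (Suc i) * \<delta> \<and>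
        (\<forall>q\<in>jumps (traj v (Suc k)). real (Suc i) * \<delta> < fst q) \<and> (\<forall>j\<le>Suc i * c.C. dep (walk 0 v j) < n)"
      unfolding next_k fst_conv snd_conv using s(2) by (intro conjI)
    show ?thesis by (rule exI[of _ "Suc k"]) fact
  next
    case False
    have stay: "walk (i * c.C) x l = x" if "l \<le> c.C" for l
      using quiet[OF x i _ _ that, of 0] False by simp
    have "\<forall>q\<in>jumps (x, t). real (Suc i) * \<delta> < fst q"
    proof
      fix q assume q: "q \<in> jumps (x, t)"
      then obtain f s' where f: "q = (s', one.opp f x)" "touch f x" "s' \<in> rings \<zeta> f"
        unfolding next_jumps_eq[OF x(1)] by blast
      show "real (Suc i) * \<delta> < fst q"
      proof (rule ccontr)
        assume "\<not> real (Suc i) * \<delta> < fst q"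
        then have "sidx \<delta> s' = i" using k(3) q f(1) by (intro slot_of) force+
        then show False using False f by blast
      qed
    qed
    moreover have "t \<le> real (Suc i) * \<delta>"
      by (rule order_trans[OF k(2)], rule mult_right_mono[OF _ less_imp_le[OF \<delta>_pos]]) simp
    moreover have "walk 0 v (Suc i * c.C) = x" unfolding sC shift by (rule stay) simp
    moreover have "\<forall>j\<le>Suc i * c.C. dep (walk 0 v j) < n"
    proof (intro allI impI, rule low)
      show "dep (walk (i * c.C) x l) < n" if "l \<le> c.C" for l
        using stay[OF that] x(2) by simp
    qed
    ultimately have "walk 0 v (Suc i * c.C) = fst (traj v k) \<and> snd (traj v k) \<le> real (Suc i) * \<delta> \<and>
        (\<forall>q\<in>jumps (traj v k). real (Suc i) * \<delta> < fst q) \<and> (\<forall>j\<le>Suc i * c.C. dep (walk 0 v j) < n)"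
      unfolding xt fst_conv snd_conv by (intro conjI)
    show ?thesis by (rule exI[of _ k]) fact
  qed
qed

lemma period:
  assumes v: "v \<in> V" and shallow: "\<And>k. dep (fst (traj v k)) < n"
  shows "walk 0 v c.L = perm v" "j \<le> c.L \<Longrightarrow> dep (walk 0 v j) < n"
proof -
  obtain k where k: "walk 0 v (M * c.C) = fst (traj v k)" "\<forall>q\<in>jumps (traj v k). real M * \<delta> < fst q"
      "\<forall>j\<le>M * c.C. dep (walk 0 v j) < n"
    using follow[OF assms order_refl] by blast
  obtain x t where xt: "traj v k = (x, t)" by (cases "traj v k") blast
  have x: "x \<in> V" using traj_V[OF v, of k] xt by simp
  have "jumps (traj v k) = {}"
    using k(2) unfolding xt next_jumps_eq[OF x] M\<delta> by fastforce
  then show "walk 0 v c.L = perm v" using k(1) stirring_perm_eq[of V E \<zeta> T v k] unfolding c.L_def by simp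
  show "j \<le> c.L \<Longrightarrow> dep (walk 0 v j) < n" using k(3) unfolding c.L_def by blast
qed

text \<open>One period of the walk is one application of \<open>perm\<close>. Later periods repeat
  the walk from later points of the orbit, so an orbit with shallow trajectories confines the
  periodic walk.\<close>

lemma no_escape:
  assumes v: "\<And>q. (perm ^^ q) v \<in> V" and shallow: "\<And>q k. dep (fst (traj ((perm ^^ q) v) k)) < n"
  shows "\<not> c.escapes S n 0 v"
proof -
  have L: "walk (q * c.L) x j = walk 0 x j" for q x j by (rule c.wlk_mod) simp
  have turns: "walk 0 v (q * c.L) = (perm ^^ q) v" for q
  proof (induction q)
    case (Suc q)
    have "walk 0 v (Suc q * c.L) = walk 0 v (q * c.L + c.L)" by (simp add: add.commute)
    also have "\<dots> = walk (0 + q * c.L) (walk 0 v (q * c.L)) c.L" by (rule c.wlk_add)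
    also have "\<dots> = walk 0 ((perm ^^ q) v) c.L" using L Suc.IH by simp
    also have "\<dots> = (perm ^^ Suc q) v" using period(1)[OF v[of q] shallow] by simp
    finally show ?case .
  qed simp
  have "dep (walk 0 v j) < n" for j
  proof -
    have "walk 0 v j = walk 0 v (j div c.L * c.L + j mod c.L)" by (simp only: div_mult_mod_eq)
    also have "\<dots> = walk (0 + j div c.L * c.L) (walk 0 v (j div c.L * c.L)) (j mod c.L)" by (rule c.wlk_add)
    also have "\<dots> = walk 0 ((perm ^^ (j div c.L)) v) (j mod c.L)" using L turns by simp
    finally show ?thesis
      using period(2)[OF v[of "j div c.L"] shallow, of "j mod c.L"] c.L_pos by simp
  qed
  then show ?thesis unfolding c.escapes_def by (meson linorder_not_less)
qed

end

context regular_rings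
begin

lemma perm_V:
  assumes "v \<in> V"
  shows "(perm ^^ q) v \<in> V"
proof (induction q)
  case (Suc q)
  obtain k where "jumps (traj ((perm ^^ q) v) k) = {}" using terminates[OF Suc.IH] by blast
  then show ?case using stirring_perm_eq traj_V[OF Suc.IH] by fastforce
qed (use assms in simp)

text \<open>The positions between times 0 and \<open>T\<close> count as well; termination leaves
  finitely many of them per trajectory.\<close>

lemma finite_orbit_shallow:
  assumes v: "v \<in> V" and fin: "finite {(perm ^^ q) v | q. True}"
  shows "\<exists>n. \<forall>q k. dep (fst (traj ((perm ^^ q) v) k)) < n"
proof -
  have fin1: "finite (range (\<lambda>k. dep (fst (traj x k))))" if "x \<in> {(perm ^^ q) v | q. True}" for x
  proof -
    have "x \<in> V" using that perm_V[OF v] by blast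
    then obtain N where N: "jumps (traj x N) = {}" using terminates by blast
    have "range (\<lambda>k. dep (fst (traj x k))) \<subseteq> (\<lambda>k. dep (fst (traj x k))) ` {..N}"
    proof (rule image_subsetI)
      fix k
      show "dep (fst (traj x k)) \<in> (\<lambda>k. dep (fst (traj x k))) ` {..N}"
      proof (cases "k \<le> N")
        case False
        then have "traj x k = traj x N" using stir_traj_stop[OF N, of k] by simp
        then show ?thesis by auto
      qed auto
    qed
    then show ?thesis by (rule finite_subset) simp
  qed
  let ?B = "\<Union>x\<in>{(perm ^^ q) v | q. True}. range (\<lambda>k. dep (fst (traj x k)))"
  have "finite ?B" by (rule finite_UN_I[OF fin fin1])
  then obtain b where b: "\<forall>d\<in>?B. d < b" unfolding finite_nat_set_iff_bounded by blast
  show ?thesis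
  proof (intro exI[of _ b] allI)
    fix q k
    have "dep (fst (traj ((perm ^^ q) v) k)) \<in> ?B" by blast
    then show "dep (fst (traj ((perm ^^ q) v) k)) < b" by (rule bspec[OF b])
  qed
qed

text \<open>\<open>M0\<close> comes after \<open>n\<close>, because the mesh has to separate the
  rings of all edges down to depth \<open>n\<close>.\<close>

lemma no_infinite_cycle_imp_no_escape:
  assumes "\<not> has_infinite_cycle V perm" "v \<in> V"
  shows "\<exists>n0. \<forall>n\<ge>n0. \<exists>M0. \<forall>M\<ge>M0. 0 < M \<longrightarrow>
    \<not> coloured_tree.escapes V r par dep idx D M (pattern T M n \<zeta>) n 0 v"
proof -
  have "finite {(perm ^^ q) v | q. True}" using assms unfolding has_infinite_cycle_def by blast
  then obtain n0 where n0: "\<And>q k. dep (fst (traj ((perm ^^ q) v) k)) < n0"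
    using finite_orbit_shallow[OF assms(2)] by blast
  show ?thesis
  proof (rule exI[of _ n0], intro allI impI)
    fix n assume n: "n0 \<le> n"
    obtain M0 where M0: "\<And>M. M0 \<le> M \<Longrightarrow> separated M n"
      using eventually_sep[of n] unfolding eventually_sequentially by blast
    show "\<exists>M0. \<forall>M\<ge>M0. 0 < M \<longrightarrow> \<not> coloured_tree.escapes V r par dep idx D M (pattern T M n \<zeta>) n 0 v"
    proof (intro exI[of _ M0] allI impI)
      fix M assume M: "M0 \<le> M" "0 < M"
      interpret c: coloured_tree V r par dep idx D M by (rule coloured[OF M(2)])
      interpret coupled V E r D \<zeta> T W M n
        by unfold_locales (rule M0[OF M(1)])
      show "\<not> c.escapes (pattern T M n \<zeta>) n 0 v"
        by (rule no_escape[OF perm_V[OF assms(2)]]) (rule less_le_trans[OF n0 n])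
    qed
  qed
qed

end

section \<open>Almost sure properties of the Poisson clocks\<close>

section \<open>The ring times are almost surely regular\<close>

context bounded_tree
begin

lemma countable_V: "countable V"
proof -
  have "V = (\<Union>n. {w \<in> V. dep w \<le> n})" by auto
  also have "countable \<dots>" using one.finite_upto by (intro countable_UN) (auto intro: countable_finite)
  finally show ?thesis .
qed

lemma stirring_space_eq: "stirring_space V E = Om (edge ` (V - {r}))"
  unfolding stirring_space_def graph_edges_eq ..

lemma slot_path_prob:
  assumes \<delta>: "0 < \<delta>" and w: "w \<in> V" "dep w = d + m"
  shows "measure (Om (edge ` (V - {r}))) {x \<in> space (Om (edge ` (V - {r}))). \<forall>j<m. rbit \<delta> x (edge ((par ^^ j) w), i)} \<le> \<delta> ^ m"
    and "{x \<in> space (Om (edge ` (V - {r}))). \<forall>j<m. rbit \<delta> x (edge ((par ^^ j) w), i)} \<in> sets (Om (edge ` (V - {r})))"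
proof -
  let ?b = "\<lambda>j. (edge ((par ^^ j) w), i)"
  have j: "(par ^^ j) w \<in> V - {r}" "dep ((par ^^ j) w) = d + m - j" if "j < m" for j
  proof -
    have *: "(par ^^ j) w \<in> V \<and> dep ((par ^^ j) w) = d + m - j" using one.dep_funpow_par[OF w(1), of j] w(2) that by simp
    then have "(par ^^ j) w \<noteq> r" using dep_root that by auto
    then show "(par ^^ j) w \<in> V - {r}" "dep ((par ^^ j) w) = d + m - j" using * by auto
  qed
  have "inj_on ?b {..<m}"
  proof (rule inj_onI)
    fix a b assume ab: "a \<in> {..<m}" "b \<in> {..<m}" "?b a = ?b b"
    then have "(par ^^ a) w = (par ^^ b) w" using inj_onD[OF edge_inj _ j(1) j(1), of a b] by simp
    then have "dep ((par ^^ a) w) = dep ((par ^^ b) w)" by simp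
    then show "a = b" using j(2)[of a] j(2)[of b] ab by simp
  qed
  then have card: "card (?b ` {..<m}) = m" by (simp add: card_image)
  have G: "?b ` {..<m} \<subseteq> edge ` (V - {r}) \<times> {..<Suc i}"
  proof (rule image_subsetI)
    fix k assume "k \<in> {..<m}"
    then show "?b k \<in> edge ` (V - {r}) \<times> {..<Suc i}" using j(1)[of k] by blast
  qed
  have "{x \<in> space (Om (edge ` (V - {r}))). \<forall>j<m. rbit \<delta> x (?b j)} =
      {x \<in> space (Om (edge ` (V - {r}))). \<forall>b\<in>{} \<union> ?b ` {..<m}. rbit \<delta> x b \<longleftrightarrow> b \<in> ?b ` {..<m}}"
    by auto
  then have "measure (Om (edge ` (V - {r}))) {x \<in> space (Om (edge ` (V - {r}))). \<forall>j<m. rbit \<delta> x (?b j)} = (1 - exp (- \<delta>)) ^ m"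
    using rbit_zero_one[OF \<delta>, of "{}" "edge ` (V - {r})" "Suc i" "?b ` {..<m}"] G card by simp
  also have "\<dots> \<le> \<delta> ^ m" using \<delta> one_minus_exp_le[of \<delta>] by (intro power_mono) auto
  finally show "measure (Om (edge ` (V - {r}))) {x \<in> space (Om (edge ` (V - {r}))). \<forall>j<m. rbit \<delta> x (?b j)} \<le> \<delta> ^ m" .
  have each: "{x \<in> space (Om (edge ` (V - {r}))). rbit \<delta> x (?b k)} \<in> sets (Om (edge ` (V - {r})))" if "k \<in> {..<m}" for k
    by (rule rbit_measurable) (use j(1)[of k] that in simp)
  have "{x \<in> space (Om (edge ` (V - {r}))). \<forall>j\<in>{..<m}. rbit \<delta> x (?b j)} \<in> sets (Om (edge ` (V - {r})))"
    by (rule sets.sets_Collect_finite_All[OF each]) simp_all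
  then show "{x \<in> space (Om (edge ` (V - {r}))). \<forall>j<m. rbit \<delta> x (?b j)} \<in> sets (Om (edge ` (V - {r})))"
    by (simp only: lessThan_iff Ball_def)
qed

text \<open>The condition on \<open>\<delta>\<close> makes the cluster of edges ringing in one slot a subcritical branching process.\<close>

lemma AE_barrier:
  assumes \<delta>: "0 < \<delta>" "real D * \<delta> \<le> 1/2"
  shows "AE x in Om (edge ` (V - {r})). \<exists>m. \<forall>w\<in>V. dep w = d + m \<longrightarrow> (\<exists>j<m. \<not> rbit \<delta> x (edge ((par ^^ j) w), i))"
proof -
  let ?M = "Om (edge ` (V - {r}))"
  interpret prob_space ?M by (rule prob_space_Om)
  let ?R = "\<lambda>m w. {x \<in> space ?M. \<forall>j<m. rbit \<delta> x (edge ((par ^^ j) w), i)}"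
  define B where "B m = (\<Union>w\<in>{w \<in> V. dep w = d + m}. ?R m w)" for m
  have fin: "finite {w \<in> V. dep w = n}" for n using one.card_level by blast
  have Bm: "B m \<in> sets ?M" for m unfolding B_def
    by (rule sets.finite_UN[OF fin]) (use slot_path_prob(2)[OF \<delta>(1)] in blast)
  have Bp: "measure ?M (B m) \<le> real D ^ d * (1/2) ^ m" for m
  proof -
    have "measure ?M (B m) \<le> (\<Sum>w\<in>{w \<in> V. dep w = d + m}. measure ?M (?R m w))"
      unfolding B_def by (rule finite_measure_subadditive_finite[OF fin]) (use slot_path_prob(2)[OF \<delta>(1)] in blast)
    also have "\<dots> \<le> (\<Sum>w\<in>{w \<in> V. dep w = d + m}. \<delta> ^ m)"
      by (rule sum_mono) (use slot_path_prob(1)[OF \<delta>(1)] in blast)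
    also have "\<dots> = real (card {w \<in> V. dep w = d + m}) * \<delta> ^ m" by simp
    also have "\<dots> \<le> real (D ^ (d + m)) * \<delta> ^ m"
      using one.card_level[of "d + m"] \<delta>(1) by (intro mult_right_mono) auto
    also have "\<dots> = real D ^ d * (real D * \<delta>) ^ m" by (simp add: power_add power_mult_distrib)
    also have "\<dots> \<le> real D ^ d * (1/2) ^ m"
      using \<delta> by (intro mult_left_mono power_mono) auto
    finally show ?thesis .
  qed
  have "measure ?M (\<Inter>m. B m) \<le> 0"
  proof (rule LIMSEQ_le_const)
    show "(\<lambda>m. real D ^ d * (1/2) ^ m) \<longlonglongrightarrow> 0"
      by (intro tendsto_mult_right_zero LIMSEQ_realpow_zero) auto
    have "measure ?M (\<Inter>m. B m) \<le> measure ?M (B m)" for m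
      by (rule finite_measure_mono[OF _ Bm]) blast
    then show "\<exists>N. \<forall>m\<ge>N. measure ?M (\<Inter>m. B m) \<le> real D ^ d * (1/2) ^ m" using Bp order_trans by blast
  qed
  moreover have "(\<Inter>m. B m) \<in> sets ?M" using Bm by (intro sets.countable_INT) auto
  ultimately have "(\<Inter>m. B m) \<in> null_sets ?M" by (auto simp: null_sets_def emeasure_eq_measure measure_le_0_iff)
  then show ?thesis
  proof (rule AE_I')
    show "{x \<in> space ?M. \<not> (\<exists>m. \<forall>w\<in>V. dep w = d + m \<longrightarrow> (\<exists>j<m. \<not> rbit \<delta> x (edge ((par ^^ j) w), i)))} \<subseteq> (\<Inter>m. B m)"
      unfolding B_def by blast
  qed
qed

lemma AE_regular_rings:
  assumes T: "0 < T" and W: "0 < W" "real D * (T / real W) \<le> 1/2"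
  shows "AE \<zeta> in stirring_space V E. regular_rings V E r D \<zeta> T W"
proof -
  let ?G = "edge ` (V - {r})"
  have cG: "countable ?G" using countable_V by (intro countable_image countable_Diff)
  have "AE x in Om ?G. \<forall>e\<in>?G. \<forall>j. 0 < x (e, j)"
    by (subst AE_ball_countable[OF cG], rule ballI) (rule AE_increments_pos)
  moreover have "AE x in Om ?G. \<forall>e\<in>?G. filterlim (psum x e) at_top sequentially"
    by (subst AE_ball_countable[OF cG], rule ballI) (rule AE_psum_unbounded)
  moreover have "AE x in Om ?G. \<forall>e\<in>?G. \<forall>f\<in>?G - {e}. \<forall>k l. 0 < psum x e (Suc k) \<longrightarrow> psum x e (Suc k) \<le> T \<longrightarrow> psum x e (Suc k) \<noteq> psum x f (Suc l)"
  proof (subst AE_ball_countable[OF cG], rule ballI)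
    fix e assume e: "e \<in> ?G"
    have "countable (?G - {e})" using cG by (rule countable_Diff)
    then show "AE x in Om ?G. \<forall>f\<in>?G - {e}. \<forall>k l. 0 < psum x e (Suc k) \<longrightarrow> psum x e (Suc k) \<le> T \<longrightarrow> psum x e (Suc k) \<noteq> psum x f (Suc l)"
      by (subst AE_ball_countable, assumption, intro ballI, intro AE_rings_distinct[OF e _ _ T]) auto
  qed
  moreover have "AE x in Om ?G. \<forall>d. \<forall>i. \<exists>m. \<forall>w\<in>V. dep w = d + m \<longrightarrow> (\<exists>j<m. \<not> rbit (T / W) x (edge ((par ^^ j) w), i))"
    unfolding AE_all_countable by (intro allI AE_barrier) (use T W in simp_all)
  ultimately show ?thesis unfolding stirring_space_eq
  proof eventually_elim
    case (elim \<zeta>)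
    have pos: "0 < psum \<zeta> (edge e) (Suc k)" if "e \<in> V" "e \<noteq> r" for e k
      unfolding psum_def using elim(1) that by (intro sum_pos) auto
    show ?case
    proof unfold_locales
      fix e j assume "e \<in> V" "e \<noteq> r"
      then show "0 < \<zeta> (edge e, j)" using elim(1) by simp
    next
      fix e assume "e \<in> V" "e \<noteq> r"
      then show "filterlim (psum \<zeta> (edge e)) at_top sequentially" using elim(2) by simp
    next
      fix e f s assume e: "e \<in> V" "e \<noteq> r" and f: "f \<in> V" "f \<noteq> r" and s: "s \<in> rings \<zeta> e" "s \<in> rings \<zeta> f" "s \<le> T"
      obtain k l where kl: "s = psum \<zeta> (edge e) (Suc k)" "s = psum \<zeta> (edge f) (Suc l)"
        using s unfolding rings_def ring_time_psum by blast
      have "edge e = edge f"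
      proof (rule ccontr)
        assume "edge e \<noteq> edge f"
        then have "edge f \<in> ?G - {edge e}" "edge e \<in> ?G" using e f by auto
        then have "psum \<zeta> (edge e) (Suc k) \<noteq> psum \<zeta> (edge f) (Suc l)"
          using elim(3) pos[OF e, of k] s(3) unfolding kl(1) by blast
        then show False using kl by simp
      qed
      then show "e = f" using inj_onD[OF edge_inj] e f by blast
    next
      fix i d
      obtain m where m: "\<forall>w\<in>V. dep w = d + m \<longrightarrow> (\<exists>j<m. \<not> rbit (T / W) \<zeta> (edge ((par ^^ j) w), i))"
        using spec[OF spec[OF elim(4), of d], of i] by (rule exE)
      show "\<exists>m. \<forall>w\<in>V. dep w = d + m \<longrightarrow>
          (\<exists>x. w \<in> one.sub x \<and> d < dep x \<and> (\<forall>s\<in>rings \<zeta> x. sidx (T / W) s \<noteq> i))"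
      proof (intro exI[of _ m] ballI impI)
        fix w assume w: "w \<in> V" "dep w = d + m"
        then obtain j where j: "j < m" "\<not> rbit (T / W) \<zeta> (edge ((par ^^ j) w), i)"
          using mp[OF bspec[OF m w(1)] w(2)] by blast
        let ?x = "(par ^^ j) w"
        have x: "?x \<in> V" "dep ?x = d + m - j" using one.dep_funpow_par[OF w(1), of j] w(2) j(1) by auto
        then have "?x \<noteq> r" "d < dep ?x" using dep_root j(1) by auto
        moreover have "w \<in> one.sub ?x" unfolding one.sub_def using w(1) by blast
        moreover have "\<forall>s\<in>rings \<zeta> ?x. sidx (T / W) s \<noteq> i"
          using j(2) pos[OF x(1) \<open>?x \<noteq> r\<close>] unfolding rbit_def rings_def ring_time_psum fst_conv snd_conv by blast
        ultimately show "\<exists>x. w \<in> one.sub x \<and> d < dep x \<and> (\<forall>s\<in>rings \<zeta> x. sidx (T / W) s \<noteq> i)"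
          by (intro exI[of _ ?x]) (rule conjI[OF _ conjI])
      qed
    qed (use T W in auto)
  qed
qed

end

section \<open>Passage to the limit in the mesh, the depth and the number of attempts\<close>

section \<open>Infinite cycles\<close>

text \<open>Continuity from below: a uniform bound on late events also bounds the event that all but
  finitely many of them occur.\<close>

lemma (in prob_space) measure_liminf_le:
  fixes A :: "nat \<Rightarrow> 'a set"
  assumes A: "\<And>j. A j \<in> sets M" and le: "\<And>j. j0 \<le> j \<Longrightarrow> measure M (A j) \<le> q"
  shows "(\<Union>J. \<Inter>j\<in>{J..}. A j) \<in> sets M" and "measure M (\<Union>J. \<Inter>j\<in>{J..}. A j) \<le> q"
proof -
  have B: "(\<Inter>j\<in>{J..}. A j) \<in> sets M" for J using A by (intro sets.countable_INT') auto
  then show "(\<Union>J. \<Inter>j\<in>{J..}. A j) \<in> sets M" by (intro sets.countable_UN) auto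
  have inc: "incseq (\<lambda>J. \<Inter>j\<in>{J..}. A j)" unfolding incseq_def by fastforce
  have lim: "(\<lambda>J. measure M (\<Inter>j\<in>{J..}. A j)) \<longlonglongrightarrow> measure M (\<Union>J. \<Inter>j\<in>{J..}. A j)"
    by (rule finite_Lim_measure_incseq[OF _ inc]) (use B in auto)
  show "measure M (\<Union>J. \<Inter>j\<in>{J..}. A j) \<le> q"
  proof (rule LIMSEQ_le_const2[OF lim], intro exI allI impI)
    fix J
    have "measure M (\<Inter>j\<in>{J..}. A j) \<le> measure M (A (max J j0))"
      by (rule finite_measure_mono[OF _ A]) auto
    also have "\<dots> \<le> q" by (rule le) simp
    finally show "measure M (\<Inter>j\<in>{J..}. A j) \<le> q" .
  qed
qed

lemma esc_const_le_1: "esc_const D \<le> 1"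
proof -
  have "exp (- 4) * (exp (- (2 * real D * real (Suc D))) / 800) \<le> 1 * (1 / (800::real))"
    by (intro mult_mono divide_right_mono) auto
  then show ?thesis unfolding esc_const_def by simp
qed

text \<open>\<open>M * (1 - exp (- (T / M)))\<close> is at least \<open>T / (1 + T / M)\<close>,
  because \<open>exp x \<ge> 1 + x\<close>, and the latter tends to \<open>T > b\<close>.\<close>

lemma eventually_slot_prob:
  assumes T: "0 < T" and b: "b < T"
  shows "eventually (\<lambda>M. 0 < 1 - exp (- (T / real M)) \<and> 1 - exp (- (T / real M)) \<le> 1/100 \<and>
    b \<le> real M * (1 - exp (- (T / real M)))) sequentially"
proof -
  have lim0: "(\<lambda>M. T / real M) \<longlonglongrightarrow> 0" by (rule lim_const_over_n)
  then have "(\<lambda>M. T / (1 + T / real M)) \<longlonglongrightarrow> T / (1 + 0)" by (intro tendsto_intros) auto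
  then have "eventually (\<lambda>M. b < T / (1 + T / real M)) sequentially"
    by (rule order_tendstoD(1)) (use b in simp)
  moreover have "eventually (\<lambda>M. T / real M < 1/100) sequentially" by (rule order_tendstoD(2)[OF lim0]) simp
  moreover have "eventually (\<lambda>M. 0 < M) sequentially" by (rule eventually_gt_at_top)
  ultimately show ?thesis
  proof eventually_elim
    case (elim M)
    define x where "x = T / real M"
    have x: "0 < x" "real M * x = T" using T elim(3) by (auto simp: x_def)
    have "exp (- x) \<le> 1 / (1 + x)"
      using exp_ge_add_one_self[of x] x(1) by (simp add: exp_minus field_simps)
    then have "x / (1 + x) \<le> 1 - exp (- x)" using x(1) by (simp add: field_simps)
    then have "real M * (x / (1 + x)) \<le> real M * (1 - exp (- x))" by (intro mult_left_mono) auto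
    then have "T / (1 + x) \<le> real M * (1 - exp (- x))" using x(2) by simp
    then show ?case using elim(1,2) x(1) one_minus_exp_le[of x] unfolding x_def[symmetric] by auto
  qed
qed

context bounded_tree
begin

abbreviation "bush k \<equiv> coloured_tree.bush V r par idx k"

definition stuck :: "real \<Rightarrow> nat \<Rightarrow> nat \<Rightarrow> nat \<Rightarrow> ('a set \<times> nat \<Rightarrow> real) set" where
  "stuck T m n M = {x \<in> space (stirring_space V E). \<forall>k<m.
    \<not> coloured_tree.silent_esc V r par dep idx D M n k (pattern T M n x)}"

text \<open>The map \<open>?g\<close> identifies positions in \<open>bits\<close> with pairs of
  graph edge and slot. It is injective, since the positions of one edge share their residue modulo
  \<open>C\<close>.\<close>

lemma stuck_event:
  assumes T: "0 < T" and M: "0 < M"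
  shows "stuck T m n M \<in> sets (stirring_space V E)"
    and "measure (stirring_space V E) (stuck T m n M) =
      Pr (coloured_tree.bits V r par dep idx D M n) (\<lambda>_. 1 - exp (- (T / real M)))
        (\<lambda>S. \<forall>k<m. \<not> coloured_tree.silent_esc V r par dep idx D M n k S)"
proof -
  interpret c: coloured_tree V r par dep idx D M by (rule coloured[OF M])
  let ?G = "edge ` (V - {r})" and ?\<delta> = "T / real M"
  let ?p = "1 - exp (- ?\<delta>)"
  let ?g = "\<lambda>b. (edge (fst b), snd b div c.C)"
  let ?I = "c.bits n" and ?B = "?g ` c.bits n"
  let ?A = "\<lambda>S. \<forall>k<m. \<not> c.silent_esc n k S"
  let ?\<Phi> = "\<lambda>S'. ?A {b \<in> ?I. ?g b \<in> S'}"
  have \<delta>: "0 < ?\<delta>" using T M by simp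
  have inj: "inj_on ?g ?I"
  proof (rule inj_onI)
    fix a b assume ab: "a \<in> ?I" "b \<in> ?I" "?g a = ?g b"
    obtain e j where a: "a = (e, j)" by (cases a)
    obtain f l where b: "b = (f, l)" by (cases b)
    have "e = f" by (rule inj_onD[OF edge_inj]) (use ab a b in \<open>auto simp: c.bits_def\<close>)
    moreover have "j = l"
    proof -
      have "j mod c.C = l mod c.C" "j div c.C = l div c.C" using ab a b \<open>e = f\<close> by (auto simp: c.bits_def)
      then show ?thesis by (metis div_mult_mod_eq)
    qed
    ultimately show "a = b" using a b by simp
  qed
  have finB: "finite ?B" using c.finite_bits by (rule finite_imageI)
  have BG: "?B \<subseteq> ?G \<times> {..<M}"
  proof (rule image_subsetI)
    fix b assume "b \<in> ?I"
    then have "fst b \<in> V - {r}" "snd b < M * c.C" by (auto simp: c.bits_def c.L_def)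
    then show "?g b \<in> ?G \<times> {..<M}" using less_mult_imp_div_less by auto
  qed
  have pat: "pattern T M n x = {b \<in> ?I. ?g b \<in> {b' \<in> ?B. rbit ?\<delta> x b'}}" for x
    unfolding pattern_def c.C_def[symmetric] by blast
  have eq: "stuck T m n M = {x \<in> space (Om ?G). ?\<Phi> {b' \<in> ?B. rbit ?\<delta> x b'}}"
    unfolding stuck_def stirring_space_eq pat[symmetric] ..
  show "stuck T m n M \<in> sets (stirring_space V E)"
    unfolding eq stirring_space_eq by (rule rbit_event(1)[OF \<delta> finB BG])
  have "measure (stirring_space V E) (stuck T m n M) =
      (\<Sum>S'\<in>Pow ?B. if ?\<Phi> S' then (\<Prod>b\<in>?B. if b \<in> S' then ?p else 1 - ?p) else 0)"
    unfolding eq stirring_space_eq by (rule rbit_event(2)[OF \<delta> finB BG])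
  also have "\<dots> = (\<Sum>S\<in>Pow ?I. if ?\<Phi> (?g ` S) then (\<Prod>b\<in>?B. if b \<in> ?g ` S then ?p else 1 - ?p) else 0)"
    by (rule sum.reindex_bij_betw[OF bij_betw_Pow, symmetric]) (rule inj_on_imp_bij_betw[OF inj])
  also have "\<dots> = (\<Sum>S\<in>Pow ?I. if ?A S then wt ?I (\<lambda>_. ?p) S else 0)"
  proof (rule sum.cong)
    fix S assume "S \<in> Pow ?I"
    then have S: "S \<subseteq> ?I" by blast
    have mem: "?g b \<in> ?g ` S \<longleftrightarrow> b \<in> S" if "b \<in> ?I" for b
      by (rule inj_on_image_mem_iff[OF inj that S])
    have "{b \<in> ?I. ?g b \<in> ?g ` S} = S" using S mem by blast
    moreover have "(\<Prod>b\<in>?B. if b \<in> ?g ` S then ?p else 1 - ?p) = wt ?I (\<lambda>_. ?p) S"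
      unfolding wt_def prod.reindex[OF inj] comp_def by (rule prod.cong) (simp_all only: mem)
    ultimately show "(if ?\<Phi> (?g ` S) then (\<Prod>b\<in>?B. if b \<in> ?g ` S then ?p else 1 - ?p) else 0) =
        (if ?A S then wt ?I (\<lambda>_. ?p) S else 0)" by (simp only:)
  qed simp
  finally show "measure (stirring_space V E) (stuck T m n M) = Pr ?I (\<lambda>_. ?p) ?A" unfolding Pr_def .
qed

text \<open>With \<open>p = 1 - exp (- (T / M))\<close> the silence factor
  \<open>(1 - p) ^ M\<close> equals \<open>exp (- T)\<close> for every mesh, so the bound depends
  neither on \<open>M\<close> nor on \<open>n\<close>.\<close>

lemma stuck_le:
  assumes T: "0 < T" and M: "0 < M"
    and p: "0 < 1 - exp (- (T / real M))" "1 - exp (- (T / real M)) \<le> 1/100"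
      "esc_time D \<le> real M * (1 - exp (- (T / real M)))"
  shows "measure (stirring_space V E) (stuck T m n M) \<le> (1 - exp (- T) * esc_const D) ^ m"
proof -
  interpret c: coloured_tree V r par dep idx D M by (rule coloured[OF M])
  have "exp (- (T / real M)) ^ M = exp (- T)"
    using M exp_of_nat_mult[of M "- (T / real M)"] by simp
  then have "(1 - (1 - exp (- (T / real M)))) ^ M = exp (- T)" by simp
  then show ?thesis unfolding stuck_event(2)[OF T M]
    using c.no_silent_esc_prob[OF p, where n = n and m = m] by (simp only:)
qed

text \<open>Without an infinite cycle, the first \<open>m\<close> attempts all fail for every large
  \<open>n\<close> and, given \<open>n\<close>, every large \<open>M\<close>; this places
  \<open>\<zeta>\<close> in \<open>Z m\<close>, of measure at most \<open>q ^ m\<close>, for all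
  \<open>m\<close>. Covering by these measurable sets avoids any measurability claim about infinite
  cycles.\<close>

lemma AE_has_infinite_cycle:
  assumes T: "0 < T" "esc_time D < T"
  shows "AE \<zeta> in stirring_space V E. has_infinite_cycle V (stirring_perm V E \<zeta> T)"
proof -
  let ?P = "stirring_space V E"
  interpret prob_space ?P unfolding stirring_space_eq by (rule prob_space_Om)
  define q where "q = 1 - exp (- T) * esc_const D"
  have "exp (- T) * esc_const D \<le> 1 * 1"
    using esc_const_pos[of D] esc_const_le_1[of D] T(1) by (intro mult_mono) auto
  then have q: "0 \<le> q" "q < 1" using esc_const_pos[of D] unfolding q_def by auto
  obtain M0 where M0: "\<And>M. M0 \<le> M \<Longrightarrow> 0 < 1 - exp (- (T / real M)) \<and> 1 - exp (- (T / real M)) \<le> 1/100 \<and>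
      esc_time D \<le> real M * (1 - exp (- (T / real M)))"
    using eventually_slot_prob[OF T] unfolding eventually_sequentially by blast
  define Z1 where "Z1 m n = (\<Union>J. \<Inter>j\<in>{J..}. stuck T m n (Suc j))" for m n
  define Z where "Z m = (\<Union>J. \<Inter>n\<in>{J..}. Z1 m n)" for m
  have Z1: "Z1 m n \<in> sets ?P" "measure ?P (Z1 m n) \<le> q ^ m" for m n
  proof -
    have s: "stuck T m n (Suc j) \<in> sets ?P" for j by (rule stuck_event(1)[OF T(1)]) simp
    have le: "measure ?P (stuck T m n (Suc j)) \<le> q ^ m" if "M0 \<le> j" for j
      unfolding q_def by (rule stuck_le[OF T(1)]) (use M0[of "Suc j"] that in simp_all)
    show "Z1 m n \<in> sets ?P" "measure ?P (Z1 m n) \<le> q ^ m"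
      unfolding Z1_def by (rule measure_liminf_le[OF s le], assumption)+
  qed
  have Z: "Z m \<in> sets ?P" "measure ?P (Z m) \<le> q ^ m" for m
    unfolding Z_def by (rule measure_liminf_le[OF Z1])+
  have "measure ?P (\<Inter>m. Z m) \<le> 0"
  proof (rule LIMSEQ_le_const)
    show "(\<lambda>m. q ^ m) \<longlonglongrightarrow> 0" using q by (rule LIMSEQ_realpow_zero)
    have "measure ?P (\<Inter>m. Z m) \<le> measure ?P (Z m)" for m
      by (rule finite_measure_mono[OF _ Z(1)]) blast
    then show "\<exists>N. \<forall>m\<ge>N. measure ?P (\<Inter>m. Z m) \<le> q ^ m" using Z(2) order_trans by blast
  qed
  moreover have "(\<Inter>m. Z m) \<in> sets ?P" using Z(1) by (intro sets.countable_INT) auto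
  ultimately have "(\<Inter>m. Z m) \<in> null_sets ?P" by (auto simp: null_sets_def emeasure_eq_measure measure_le_0_iff)
  then have notin: "AE \<zeta> in ?P. \<zeta> \<notin> (\<Inter>m. Z m)" by (rule AE_not_in)
  \<comment> \<open>Windows so short that the clusters of edges ringing in one window are
    subcritical; this number of windows is independent of the mesh \<open>M\<close>.\<close>
  obtain W :: nat where W: "2 * real D * T < real W" using reals_Archimedean2 by blast
  have "0 \<le> 2 * real D * T" using T(1) by simp
  then have "0 < real W" using W by (rule le_less_trans)
  then have W0: "0 < W" by simp
  have "real D * (T / real W) = (real D * T) / real W" by simp
  also have "\<dots> \<le> 1/2" using W \<open>0 < real W\<close> by (simp add: pos_divide_le_eq)
  finally have "real D * (T / real W) \<le> 1/2" .
  then have "AE \<zeta> in ?P. regular_rings V E r D \<zeta> T W" by (rule AE_regular_rings[OF T(1) W0])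
  then show ?thesis using notin AE_space
  proof eventually_elim
    case (elim \<zeta>)
    interpret regular_rings V E r D \<zeta> T W by (rule elim(1))
    show ?case
    proof (rule ccontr)
      assume no: "\<not> has_infinite_cycle V perm"
      have ev: "eventually (\<lambda>n. \<exists>M0. \<forall>M\<ge>M0. 0 < M \<longrightarrow>
          \<not> coloured_tree.escapes V r par dep idx D M (pattern T M n \<zeta>) n 0 (bush k)) sequentially" for k
        unfolding eventually_sequentially by (rule no_infinite_cycle_imp_no_escape[OF no one.bush(1)])
      have "\<zeta> \<in> Z m" for m
      proof -
        have "eventually (\<lambda>n. \<forall>k\<in>{..<m}. \<exists>M0. \<forall>M\<ge>M0. 0 < M \<longrightarrow>
            \<not> coloured_tree.escapes V r par dep idx D M (pattern T M n \<zeta>) n 0 (bush k)) sequentially"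
          by (rule eventually_ball_finite) (use ev in auto)
        then obtain J where J: "\<And>n k. J \<le> n \<Longrightarrow> k < m \<Longrightarrow> \<exists>M0. \<forall>M\<ge>M0. 0 < M \<longrightarrow>
            \<not> coloured_tree.escapes V r par dep idx D M (pattern T M n \<zeta>) n 0 (bush k)"
          unfolding eventually_sequentially by blast
        have "\<zeta> \<in> Z1 m n" if n: "J \<le> n" for n
        proof -
          have "eventually (\<lambda>M. \<forall>k\<in>{..<m}. 0 < M \<longrightarrow>
              \<not> coloured_tree.escapes V r par dep idx D M (pattern T M n \<zeta>) n 0 (bush k)) sequentially"
            by (rule eventually_ball_finite) (use J[OF n] in \<open>auto simp: eventually_sequentially\<close>)
          then obtain J' where J': "\<And>M k. J' \<le> M \<Longrightarrow> k < m \<Longrightarrow> 0 < M \<Longrightarrow>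
              \<not> coloured_tree.escapes V r par dep idx D M (pattern T M n \<zeta>) n 0 (bush k)"
            unfolding eventually_sequentially by blast
          have "\<zeta> \<in> stuck T m n (Suc j)" if "J' \<le> j" for j
          proof -
            interpret c: coloured_tree V r par dep idx D "Suc j" by (rule coloured) simp
            have "\<not> c.silent_esc n k (pattern T (Suc j) n \<zeta>)" if "k < m" for k
              using J'[of "Suc j" k] \<open>J' \<le> j\<close> that unfolding c.silent_esc_def by simp
            then show ?thesis unfolding stuck_def using elim(3) by blast
          qed
          then show ?thesis unfolding Z1_def by blast
        qed
        then show ?thesis unfolding Z_def by blast
      qed
      then show False using elim(2) by blast
    qed
  qed
qed

end

theorem theorem1:
  fixes V :: "'a set" and E :: "'a \<Rightarrow> 'a \<Rightarrow> bool" and r :: 'a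
  assumes "rooted_tree V E r"
    and "infinite V"
    and "uniformly_bounded_degree V E"
    and "\<forall>v\<in>V. card (offspring V E r v) \<ge> 2"
  shows "\<exists>T0::real. 0 < T0 \<and>
           (\<forall>T\<ge>T0. AE \<omega> in stirring_space V E. has_infinite_cycle V (stirring_perm V E \<omega> T))"
proof -
  obtain D where D: "\<And>v. v \<in> V \<Longrightarrow> finite (neighbours V E v) \<and> card (neighbours V E v) \<le> D"
    using assms(3) unfolding uniformly_bounded_degree_def by blast
  interpret bounded_tree V E r D
    by unfold_locales (use assms(1,4) D in auto)
  show ?thesis
  \<comment> \<open>The added 1 secures \<open>esc_time D < T\<close> strictly, as needed because
    \<open>M * p\<close> approaches \<open>T\<close> from below.\<close>
  proof (intro exI[of _ "max 1 (esc_time D + 1)"] conjI allI impI)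
    fix T :: real assume "max 1 (esc_time D + 1) \<le> T"
    then show "AE \<omega> in stirring_space V E. has_infinite_cycle V (stirring_perm V E \<omega> T)"
      by (intro AE_has_infinite_cycle) auto
  qed simp
qed

end
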